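(* Let $G$ be a 2-connected graph on $n$ vertices with $\delta(G)\geq k$, and let $C$ be a longest cycle in $G$, of length $c\in[6,n-1]$. If $e(G)>\max\{f(n,k+1,c),f(n,\lfloor c/2\rfloor-1,c)\}$ and $e(G[V(C)])>h(c+1,\lfloor c/2\rfloor-1)$, then either $G$ is isomorphic to a subgraph of $W_{n,\lfloor c/2\rfloor,c}$, or the $C$-closure $\overline{G}$ of $G$ is isomorphic to $W_{n,k,c}$ or to $Z_{n,k,c}$.
   Context: Graphs are simple and finite. $h(n,k)=\binom{n-k}{2}+k(k-1)$. $f(n,k,c)=\binom{c-k+1}{2}+k(n-c+k-1)$. $W_{n,k,c}$: a clique $K_{c-k+1}$ plus $n-(c-k+1)$ new vertices each joined exactly to the same $k$ vertices of the clique. $Z_{n,k,c}$: union of a clique $K_{c-k+1}$ and $\frac{n-(c-k+1)}{k-1}$ cliques $K_{k+1}$ such that any two of these cliques share exactly the same two vertices. The $m$-closure of a graph is obtained by recursively joining pairs of nonadjacent vertices whose degree sum (in the current graph) is at least $m$ until no such pair remains. For a cycle $C$ of length $c$ in $G$, the $C$-closure $\overline{G}$ is obtained from $G$ by replacing $G[V(C)]$ by its $(c+1)$-closure. *)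

theory Defs
  imports Complex_Main
begin

datatype 'a graph = Graph (verts: "'a set") (edges: "'a set set")

definition simple_graph :: "'a graph \<Rightarrow> bool" where
  "simple_graph G \<longleftrightarrow> finite (verts G) \<and> (\<forall>e\<in>edges G. e \<subseteq> verts G \<and> card e = 2)"

definition degree :: "'a graph \<Rightarrow> 'a \<Rightarrow> nat" where
  "degree G v = card {e \<in> edges G. v \<in> e}"

definition min_degree :: "'a graph \<Rightarrow> nat" where
  "min_degree G = Min (degree G ` verts G)"

definition induced :: "'a graph \<Rightarrow> 'a set \<Rightarrow> 'a graph" where
  "induced G S = Graph (verts G \<inter> S) {e \<in> edges G. e \<subseteq> S}"

definition subgraph :: "'a graph \<Rightarrow> 'a graph \<Rightarrow> bool" where
  "subgraph H G \<longleftrightarrow> simple_graph H \<and> verts H \<subseteq> verts G \<and> edges H \<subseteq> edges G"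

definition graph_iso :: "'a graph \<Rightarrow> 'b graph \<Rightarrow> bool" where
  "graph_iso G H \<longleftrightarrow> (\<exists>\<phi>. bij_betw \<phi> (verts G) (verts H) \<and>
     (\<forall>u\<in>verts G. \<forall>v\<in>verts G. {u, v} \<in> edges G \<longleftrightarrow> {\<phi> u, \<phi> v} \<in> edges H))"

definition connected_graph :: "'a graph \<Rightarrow> bool" where
  "connected_graph G \<longleftrightarrow> verts G \<noteq> {} \<and>
     (\<forall>u\<in>verts G. \<forall>v\<in>verts G. (\<lambda>x y. {x, y} \<in> edges G)\<^sup>*\<^sup>* u v)"

definition two_connected :: "'a graph \<Rightarrow> bool" where
  "two_connected G \<longleftrightarrow> card (verts G) \<ge> 3 \<and> connected_graph G \<and>
     (\<forall>v\<in>verts G. connected_graph (induced G (verts G - {v})))"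

text \<open>A cycle is given by the list of its vertices in cyclic order; its length is the length of
  the list and its vertex set is the set of the list.\<close>

definition is_cycle :: "'a graph \<Rightarrow> 'a list \<Rightarrow> bool" where
  "is_cycle G C \<longleftrightarrow> length C \<ge> 3 \<and> distinct C \<and> set C \<subseteq> verts G \<and>
     (\<forall>i<length C. {C ! i, C ! (Suc i mod length C)} \<in> edges G)"

definition longest_cycle :: "'a graph \<Rightarrow> 'a list \<Rightarrow> bool" where
  "longest_cycle G C \<longleftrightarrow> is_cycle G C \<and> (\<forall>D. is_cycle G D \<longrightarrow> length D \<le> length C)"

definition closure_step :: "nat \<Rightarrow> 'a graph \<Rightarrow> 'a graph \<Rightarrow> bool" where
  "closure_step m G H \<longleftrightarrow> (\<exists>u\<in>verts G. \<exists>v\<in>verts G. u \<noteq> v \<and> {u, v} \<notin> edges G \<and>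
     degree G u + degree G v \<ge> m \<and> H = Graph (verts G) (insert {u, v} (edges G)))"

definition is_m_closure :: "nat \<Rightarrow> 'a graph \<Rightarrow> 'a graph \<Rightarrow> bool" where
  "is_m_closure m G H \<longleftrightarrow> (closure_step m)\<^sup>*\<^sup>* G H \<and> (\<nexists>H'. closure_step m H H')"

text \<open>The result of the closure process does not depend on the order in which edges are added;
  see the lemma \<open>ex1_m_closure\<close> below.\<close>

definition m_closure :: "nat \<Rightarrow> 'a graph \<Rightarrow> 'a graph" where
  "m_closure m G = (THE H. is_m_closure m G H)"

definition C_closure :: "'a graph \<Rightarrow> 'a list \<Rightarrow> 'a graph" where
  "C_closure G C = Graph (verts G)
     ((edges G - edges (induced G (set C))) \<union>
      edges (m_closure (length C + 1) (induced G (set C))))"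

text \<open>The truncated subtractions below are exact whenever \<open>k \<le> n\<close> (for \<open>h_num\<close>), respectively
  \<open>k \<le> c < n\<close> (for \<open>f_num\<close>, \<open>W_graph\<close> and, if \<open>k \<ge> 1\<close>, \<open>Z_graph\<close>).\<close>

definition h_num :: "nat \<Rightarrow> nat \<Rightarrow> nat" where
  "h_num n k = ((n - k) choose 2) + k * (k - 1)"

definition f_num :: "nat \<Rightarrow> nat \<Rightarrow> nat \<Rightarrow> nat" where
  "f_num n k c = ((c - k + 1) choose 2) + k * (n - c + k - 1)"

definition clique_edges :: "'a set \<Rightarrow> 'a set set" where
  "clique_edges S = {{u, v} | u v. u \<in> S \<and> v \<in> S \<and> u \<noteq> v}"

definition W_graph :: "nat \<Rightarrow> nat \<Rightarrow> nat \<Rightarrow> nat graph" where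
  "W_graph n k c = Graph {0..<n}
     (clique_edges {0..<c - k + 1} \<union> {{u, v} | u v. u \<in> {0..<k} \<and> v \<in> {c - k + 1..<n}})"

text \<open>The two common vertices are 0 and 1. The vertex set is the union of the cliques, so it has
  \<open>n\<close> elements only if \<open>k - 1\<close> divides \<open>n - (c - k + 1)\<close>; otherwise no graph on \<open>n\<close> vertices is
  isomorphic to \<open>Z_graph n k c\<close>.\<close>

definition Z_clique :: "nat \<Rightarrow> nat \<Rightarrow> nat \<Rightarrow> nat set" where
  "Z_clique k c i =
     {0, 1} \<union> {c - k + 1 + i * (k - 1)..<c - k + 1 + (i + 1) * (k - 1)}"

definition Z_graph :: "nat \<Rightarrow> nat \<Rightarrow> nat \<Rightarrow> nat graph" where
  "Z_graph n k c = (let t = (n - (c - k + 1)) div (k - 1) in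
     Graph ({0..<c - k + 1} \<union> (\<Union>i<t. Z_clique k c i))
       (clique_edges {0..<c - k + 1} \<union> (\<Union>i<t. clique_edges (Z_clique k c i))))"

lemma simple_graph_finite_edges:
  assumes "simple_graph G"
  shows "finite (edges G)"
proof -
  have "edges G \<subseteq> Pow (verts G)"
    using assms by (auto simp: simple_graph_def)
  with assms show ?thesis
    by (auto simp: simple_graph_def intro: finite_subset)
qed

lemma closure_step_simple_graph:
  assumes "closure_step m G H" "simple_graph G"
  shows "simple_graph H"
  using assms by (fastforce simp: closure_step_def simple_graph_def)

lemma closure_steps_simple_graph:
  assumes "(closure_step m)\<^sup>*\<^sup>* G H" "simple_graph G"
  shows "simple_graph H \<and> verts H = verts G \<and> edges G \<subseteq> edges H"
  using assms
proof (induction rule: rtranclp_induct)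
  case (step H H')
  then have "simple_graph H'"
    using closure_step_simple_graph by blast
  with step show ?case
    by (auto simp: closure_step_def)
qed simp

lemma degree_mono:
  assumes "simple_graph H" "edges G \<subseteq> edges H"
  shows "degree G v \<le> degree H v"
  unfolding degree_def
  using assms simple_graph_finite_edges[of H] by (intro card_mono) auto

lemma closure_steps_le_closure:
  assumes "(closure_step m)\<^sup>*\<^sup>* G H" "is_m_closure m G K" "simple_graph G"
  shows "edges H \<subseteq> edges K"
  using assms(1)
proof (induction rule: rtranclp_induct)
  case base
  show ?case
    using assms closure_steps_simple_graph[of m G K] by (auto simp: is_m_closure_def)
next
  case (step H H')
  from assms have K: "simple_graph K" "verts K = verts G" "\<And>K'. \<not> closure_step m K K'"
    using closure_steps_simple_graph[of m G K] by (auto simp: is_m_closure_def)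
  have H: "verts H = verts G"
    using step.hyps(1) assms(3) closure_steps_simple_graph by blast
  from step.hyps(2) obtain u v where uv: "u \<in> verts H" "v \<in> verts H" "u \<noteq> v"
    "m \<le> degree H u + degree H v" "H' = Graph (verts H) (insert {u, v} (edges H))"
    by (auto simp: closure_step_def)
  have "degree H u \<le> degree K u" "degree H v \<le> degree K v"
    using K(1) step.IH by (auto intro: degree_mono)
  with uv have "m \<le> degree K u + degree K v" by linarith
  with K uv H have "{u, v} \<in> edges K"
    unfolding closure_step_def by metis
  with step.IH uv show ?case by simp
qed

lemma ex_m_closure:
  assumes "simple_graph G"
  shows "\<exists>H. is_m_closure m G H"
  using assms
proof (induction "card (Pow (verts G) - edges G)" arbitrary: G rule: less_induct)
  case less
  show ?case
  proof (cases "\<exists>H. closure_step m G H")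
    case False
    then show ?thesis by (auto simp: is_m_closure_def)
  next
    case True
    then obtain H where H: "closure_step m G H" by blast
    then obtain u v where "{u, v} \<in> Pow (verts G) - edges G"
      "H = Graph (verts G) (insert {u, v} (edges G))"
      by (auto simp: closure_step_def)
    then have "Pow (verts H) - edges H \<subset> Pow (verts G) - edges G"
      by auto
    then have "card (Pow (verts H) - edges H) < card (Pow (verts G) - edges G)"
      using less.prems by (intro psubset_card_mono) (auto simp: simple_graph_def)
    then obtain K where "is_m_closure m H K"
      using less closure_step_simple_graph[OF H] by blast
    with H show ?thesis
      unfolding is_m_closure_def by (meson converse_rtranclp_into_rtranclp)
  qed
qed

lemma ex1_m_closure:
  assumes "simple_graph G"
  shows "\<exists>!H. is_m_closure m G H"
proof -
  have "H = K" if "is_m_closure m G H" "is_m_closure m G K" for H K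
  proof (rule graph.expand)
    have "edges H \<subseteq> edges K" "edges K \<subseteq> edges H"
      using that assms closure_steps_le_closure unfolding is_m_closure_def by blast+
    moreover have "verts H = verts K"
      using that assms closure_steps_simple_graph unfolding is_m_closure_def by metis
    ultimately show "verts H = verts K \<and> edges H = edges K" by blast
  qed
  with ex_m_closure[OF assms] show ?thesis by blast
qed

lemma is_m_closure_m_closure:
  assumes "simple_graph G"
  shows "is_m_closure m G (m_closure m G)"
  unfolding m_closure_def using ex1_m_closure[OF assms] by (rule theI')

end

theory Submission
  imports Defs
begin

text \<open>Following Kopylov, add edges to \<open>G\<close> as long as no cycle longer than \<open>c\<close> appears; in the
  resulting graph \<open>F\<close> any two nonadjacent vertices are joined by a path on more than \<open>c\<close> vertices.
  With \<open>t = \<lfloor>c/2\<rfloor>\<close>, repeated deletion of vertices of degree at most \<open>t\<close> leaves a clique \<open>K\<close>.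

  If \<open>|K| = c + 1 - d\<close> with \<open>d < t\<close>, then already deletion of vertices of degree at most \<open>d\<close> stops
  at \<open>K\<close>, so \<open>e(G) \<le> f(n,d,c)\<close>; convexity of \<open>f\<close> and the edge bound force \<open>d = k \<le> t - 2\<close>. Now the degree
  condition is tight along a longest path from a vertex outside \<open>K\<close> to \<open>K\<close>, and rotations of that path
  show that \<open>F\<close> is \<open>W\<close> or \<open>Z\<close>. Counting edges in \<open>G[V(C)]\<close> shows that the closure recovers all of \<open>K\<close>.

  Otherwise \<open>|K| \<le> c + 1 - t\<close>. In the \<open>(c + 1)\<close>-closure of \<open>F[V(C)]\<close> the vertices of degree more
  than \<open>c - t\<close> are universal by an edge count, there are exactly \<open>t\<close> of them, and the rest is independent, up to
  one edge when \<open>c\<close> is odd: otherwise the closure would be Hamilton-connected and a vertex off \<open>C\<close> would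
  extend \<open>C\<close>. For the same reason the vertices off \<open>C\<close> have all their neighbours among these \<open>t\<close> vertices.\<close>

section \<open>Paths, cycles and 2-connectedness\<close>

text \<open>Tightness comes from an identity. Let \<open>P\<close> be a longest path from a vertex
  \<open>x\<close> off \<open>K\<close> to \<open>K\<close>. All neighbours of \<open>x\<close> lie
  on \<open>P\<close>, and none follows a vertex of \<open>K\<close>, since then a cycle through all
  of \<open>P\<close> would close. So \<open>|P| = |K| + deg x + i\<close>, where \<open>i\<close>
  counts the vertices off \<open>K\<close> whose successor is not adjacent to \<open>x\<close>. As
  \<open>|K| = c + 1 - k\<close> and \<open>deg x \<ge> k\<close>, a path on \<open>c + 1\<close>
  vertices has \<open>i = 0\<close>; on a longer one these positions form one segment, because a
  cycle that skips it has at most \<open>c\<close> vertices. The obstacle is that a rotation can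
  leave the component of \<open>V - K\<close> in which \<open>P\<close> was chosen longest, so
  lengths must be compared between components. The structure is found in \<open>F\<close>, but the
  claim is about the closure of \<open>G\<close>. Vertices off \<open>K\<close> have degree exactly
  \<open>k\<close> in \<open>F\<close>, hence the same neighbours in \<open>G\<close>, and only
  edges inside \<open>K\<close> can be missing. As \<open>F[V(C)]\<close> admits no closure step,
  the closure never leaves \<open>F\<close>. In the sparse case the closure helps because each of
  its paths can be replaced by a path of \<open>F[V(C)]\<close> with the same ends that is at least
  as long.\<close>

definition gpath :: "('a \<Rightarrow> 'a \<Rightarrow> bool) \<Rightarrow> 'a list \<Rightarrow> bool" where
  "gpath E xs \<longleftrightarrow> xs \<noteq> [] \<and> distinct xs \<and> successively E xs"

definition gcyc :: "('a \<Rightarrow> 'a \<Rightarrow> bool) \<Rightarrow> 'a list \<Rightarrow> bool" where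
  "gcyc E xs \<longleftrightarrow> 3 \<le> length xs \<and> gpath E xs \<and> E (last xs) (hd xs)"

lemma gpath_append:
  "gpath E (xs @ ys) \<longleftrightarrow> (if xs = [] then gpath E ys else if ys = [] then gpath E xs else
     gpath E xs \<and> gpath E ys \<and> set xs \<inter> set ys = {} \<and> E (last xs) (hd ys))"
  by (auto simp: gpath_def successively_append_iff)

lemma gpath_Cons:
  "gpath E (x # xs) \<longleftrightarrow> (xs = [] \<or> gpath E xs \<and> x \<notin> set xs \<and> E x (hd xs))"
  by (cases xs) (auto simp: gpath_def)

lemma gpath_Nil [simp]: "\<not> gpath E []"
  by (simp add: gpath_def)

lemma gpath_rev:
  assumes "\<And>u v. E u v \<Longrightarrow> E v u"
  shows "gpath E (rev xs) \<longleftrightarrow> gpath E xs"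
proof -
  have e: "(\<lambda>x y. E y x) = E" using assms by blast
  show ?thesis unfolding gpath_def successively_rev e by simp
qed

lemma gpath_mono: "gpath E xs \<Longrightarrow> (\<And>u v. E u v \<Longrightarrow> F u v) \<Longrightarrow> gpath F xs"
  by (auto simp: gpath_def intro: successively_mono)

lemma rtranclp_imp_gpath:
  assumes "R\<^sup>*\<^sup>* u v"
  shows "\<exists>xs. gpath R xs \<and> hd xs = u \<and> last xs = v"
  using assms
proof (induction rule: rtranclp_induct)
  case base
  show ?case by (rule exI[of _ "[u]"]) (simp add: gpath_def)
next
  case (step y z)
  then obtain xs where xs: "gpath R xs" "hd xs = u" "last xs = y" by blast
  show ?case
  proof (cases "z \<in> set xs")
    case True
    then obtain as bs where "xs = as @ z # bs" by (auto dest: split_list)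
    with xs show ?thesis
      by (intro exI[of _ "as @ [z]"]) (auto simp: gpath_append gpath_Cons hd_append split: if_splits)
  next
    case False
    with xs step show ?thesis
      by (intro exI[of _ "xs @ [z]"]) (auto simp: gpath_append gpath_Cons)
  qed
qed

text \<open>Take a shortest path from \<open>X\<close> to \<open>Y\<close>: a second visit to either
  set would allow it to be cut.\<close>

lemma ex_minimal_gpath:
  assumes "R\<^sup>*\<^sup>* u v" "u \<in> X" "v \<in> Y"
  shows "\<exists>xs. gpath R xs \<and> set xs \<inter> X = {hd xs} \<and> set xs \<inter> Y = {last xs}"
proof -
  define P where "P xs \<longleftrightarrow> gpath R xs \<and> hd xs \<in> X \<and> last xs \<in> Y" for xs
  have "\<exists>xs. P xs" using rtranclp_imp_gpath[OF assms(1)] assms unfolding P_def by blast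
  then obtain xs where xs: "P xs" "\<And>ys. P ys \<Longrightarrow> length xs \<le> length ys"
    by (metis arg_min_nat_lemma)
  have ne: "xs \<noteq> []" using xs(1) by (auto simp: P_def)
  have "z = hd xs" if z: "z \<in> set xs" "z \<in> X" for z
  proof -
    obtain as bs where s: "xs = as @ z # bs" using split_list[OF z(1)] by blast
    have "as = []"
    proof (rule ccontr)
      assume "as \<noteq> []"
      moreover have "P (z # bs)" using xs(1) z s calculation
        by (auto simp: P_def gpath_append)
      ultimately show False using xs(2)[of "z # bs"] s by auto
    qed
    with s show ?thesis by simp
  qed
  moreover have "z = last xs" if z: "z \<in> set xs" "z \<in> Y" for z
  proof -
    obtain as bs where s: "xs = as @ z # bs" using split_list[OF z(1)] by blast
    have "bs = []"
    proof (rule ccontr)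
      assume "bs \<noteq> []"
      moreover have "P (as @ [z])" using xs(1) z s calculation
        by (auto simp: P_def gpath_append gpath_Cons hd_append split: if_splits)
      ultimately show False using xs(2)[of "as @ [z]"] s by auto
    qed
    with s show ?thesis by simp
  qed
  ultimately show ?thesis using xs(1) ne unfolding P_def
    by (intro exI[of _ xs]) auto
qed

text \<open>Several graphs on the same vertices are compared (\<open>G\<close>, its maximal
  extension, closures), so the edges are a relation with which the locale can be instantiated
  repeatedly.\<close>

locale sgraph =
  fixes V :: "'a set" and E :: "'a \<Rightarrow> 'a \<Rightarrow> bool"
  assumes finV: "finite V"
    and E_sym: "E u v \<Longrightarrow> E v u"
    and E_irr: "\<not> E u u"
    and E_V: "E u v \<Longrightarrow> u \<in> V"
begin

lemma E_V': "E u v \<Longrightarrow> v \<in> V"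
  using E_sym E_V by blast

lemma gpath_rev': "gpath E (rev xs) \<longleftrightarrow> gpath E xs"
  using E_sym by (rule gpath_rev)

lemma gpath_set_V:
  assumes "gpath E xs" "hd xs \<in> V"
  shows "set xs \<subseteq> V"
  using assms
proof (induction xs)
  case (Cons x xs)
  then show ?case using E_V'[of x "hd xs"] by (cases "xs = []") (auto simp: gpath_Cons)
qed simp

definition nb :: "'a \<Rightarrow> 'a set" where "nb v = {u. E v u}"

lemma finite_nb [simp]: "finite (nb v)"
  using finite_subset[OF _ finV, of "nb v"] E_V' by (auto simp: nb_def)

end

text \<open>The removed vertex \<open>x\<close> ranges over the whole type; an \<open>x\<close>
  outside \<open>V\<close> gives plain connectedness.\<close>

locale two_conn_graph = sgraph +
  assumes card3: "3 \<le> card V"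
    and tconn: "u \<in> V \<Longrightarrow> v \<in> V \<Longrightarrow> u \<noteq> x \<Longrightarrow> v \<noteq> x \<Longrightarrow>
      (\<lambda>a b. E a b \<and> a \<noteq> x \<and> b \<noteq> x)\<^sup>*\<^sup>* u v"
begin

lemma ex_gpath_avoiding:
  assumes "X \<inter> V - {x} \<noteq> {}" "Y \<inter> V - {x} \<noteq> {}"
  shows "\<exists>xs. gpath E xs \<and> set xs \<inter> X = {hd xs} \<and> set xs \<inter> Y = {last xs} \<and>
     x \<notin> set xs \<and> set xs \<subseteq> V"
proof -
  let ?R = "\<lambda>a b. E a b \<and> a \<noteq> x \<and> b \<noteq> x"
  obtain u v where uv: "u \<in> X" "u \<in> V" "u \<noteq> x" "v \<in> Y" "v \<in> V" "v \<noteq> x"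
    using assms by auto
  have "?R\<^sup>*\<^sup>* u v" using tconn uv by blast
  from ex_minimal_gpath[OF this, of "X \<inter> V - {x}" "Y \<inter> V - {x}"] uv
  obtain xs where xs: "gpath ?R xs" "set xs \<inter> (X \<inter> V - {x}) = {hd xs}"
    "set xs \<inter> (Y \<inter> V - {x}) = {last xs}" by auto
  have p: "gpath E xs" using xs(1) by (rule gpath_mono) auto
  have V: "set xs \<subseteq> V" using gpath_set_V[OF p] xs(2) by auto
  have "hd xs \<noteq> x" using xs(2) by auto
  have "successively ?R ys \<Longrightarrow> hd ys \<noteq> x \<Longrightarrow> x \<notin> set ys" for ys
    by (induction ys) (auto simp: successively_Cons)
  with \<open>hd xs \<noteq> x\<close> xs(1) have "x \<notin> set xs" by (auto simp: gpath_def)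
  with p V xs show ?thesis by (intro exI[of _ xs]) auto
qed

text \<open>The two paths arise from the single path \<open>Q\<close> by one augmentation, which keeps its two
  end vertices as end vertices of the new system.\<close>

lemma two_disjoint_gpaths:
  assumes "gpath E Q" "set Q \<subseteq> V" "X \<subseteq> V" "Y \<subseteq> V" "X \<noteq> {}" "Y \<noteq> {}"
    "X \<inter> Y = {}" "set Q \<inter> X = {}" "set Q \<inter> Y = {}"
  shows "\<exists>R1 R2. gpath E R1 \<and> gpath E R2 \<and> set R1 \<inter> set R2 = {} \<and> hd R1 = hd Q \<and> hd R2 \<in> X \<and>
    (last R1 = last Q \<and> last R2 \<in> Y \<or> last R1 \<in> Y \<and> last R2 = last Q) \<and>
    (set R1 \<union> set R2) \<inter> X = {hd R2} \<and> (set R1 \<union> set R2) \<inter> Y \<subseteq> {last R1, last R2} \<and>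
    set R1 \<subseteq> V \<and> set R2 \<subseteq> V"
  using assms
proof (induction Q arbitrary: X)
  case Nil
  then show ?case by simp
next
  case (Cons x Q)
  show ?case
  proof (cases "Q = []")
    case True
    \<comment> \<open>The single vertex is one path; 2-connectedness supplies the other from
      \<open>X\<close> to \<open>Y\<close> around it.\<close>
    have xX: "X \<inter> V - {x} \<noteq> {}" and xY: "Y \<inter> V - {x} \<noteq> {}"
      using Cons.prems by auto
    obtain Z where Z: "gpath E Z" "set Z \<inter> X = {hd Z}" "set Z \<inter> Y = {last Z}" "x \<notin> set Z"
      "set Z \<subseteq> V"
      using ex_gpath_avoiding[of X x Y, OF xX xY] by blast
    then show ?thesis using True Cons.prems
      by (intro exI[of _ "[x]"] exI[of _ Z]) (auto simp: gpath_def)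
  next
    case False
    have Exq: "E x (hd Q)" "gpath E Q" "x \<notin> set Q" using Cons.prems(1) False
      by (auto simp: gpath_Cons)
    \<comment> \<open>Induct on the tail of the path with \<open>x\<close> moved into the set of
      sources.\<close>
    have "\<exists>R1 R2. gpath E R1 \<and> gpath E R2 \<and> set R1 \<inter> set R2 = {} \<and> hd R1 = hd Q \<and>
      hd R2 \<in> insert x X \<and>
      (last R1 = last Q \<and> last R2 \<in> Y \<or> last R1 \<in> Y \<and> last R2 = last Q) \<and>
      (set R1 \<union> set R2) \<inter> insert x X = {hd R2} \<and> (set R1 \<union> set R2) \<inter> Y \<subseteq> {last R1, last R2} \<and>
      set R1 \<subseteq> V \<and> set R2 \<subseteq> V"
      using Cons.prems Exq by (intro Cons.IH) auto
    then obtain R1 R2 where R: "gpath E R1" "gpath E R2" "set R1 \<inter> set R2 = {}" "hd R1 = hd Q"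
      "hd R2 \<in> insert x X" "last R1 = last Q \<and> last R2 \<in> Y \<or> last R1 \<in> Y \<and> last R2 = last Q"
      "(set R1 \<union> set R2) \<inter> insert x X = {hd R2}" "(set R1 \<union> set R2) \<inter> Y \<subseteq> {last R1, last R2}"
      "set R1 \<subseteq> V" "set R2 \<subseteq> V" by metis
    have ne: "R1 \<noteq> []" "R2 \<noteq> []" using R by auto
    have hl: "hd R1 \<in> set R1" "last R1 \<in> set R1" "hd R2 \<in> set R2" "last R2 \<in> set R2"
      using ne by auto
    have R3: "\<And>w. w \<in> set R1 \<Longrightarrow> w \<notin> set R2" using R(3) by blast
    have R8: "\<And>w. w \<in> set R1 \<Longrightarrow> w \<in> Y \<Longrightarrow> w = last R1"
      "\<And>w. w \<in> set R2 \<Longrightarrow> w \<in> Y \<Longrightarrow> w = last R2"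
    proof -
      fix w assume "w \<in> set R1" "w \<in> Y"
      then have "w = last R1 \<or> w = last R2" "w \<noteq> last R2"
        using R(8) R3 hl(4) by auto
      then show "w = last R1" by simp
    next
      fix w assume "w \<in> set R2" "w \<in> Y"
      then have "w = last R1 \<or> w = last R2" "w \<noteq> last R1"
        using R(8) R3 hl(2) by auto
      then show "w = last R2" by simp
    qed
    have lQ: "last (x # Q) = last Q" "last Q \<notin> Y" "last Q \<notin> X" "x \<notin> Y" "x \<in> V" "x \<notin> X"
      using False Cons.prems by (auto simp: disjoint_iff)
    show ?thesis
    proof (cases "hd R2 = x")
      case False
      have "x \<notin> set R1" "x \<notin> set R2" using R(7) False by auto
      then show ?thesis using R False Exq lQ hl ne
        by (intro exI[of _ "x # R1"] exI[of _ R2]) (auto simp: gpath_Cons)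
    next
      case True
      have x1: "x \<notin> set R1" "x \<in> set R2" using True hl R(3) by auto
      have disX: "(set R1 \<union> set R2) \<inter> X = {}" using R(7)[unfolded True] lQ(6) by (auto simp: set_eq_iff)
      \<comment> \<open>Now \<open>R2\<close> starts at \<open>x\<close> instead of in
        \<open>X\<close>. A path from \<open>X\<close> that avoids \<open>x\<close> is followed up
        to its first contact with the system or with \<open>Y\<close>.\<close>
      let ?W = "(set R1 \<union> set R2 \<union> Y) - {x}"
      have xX: "X \<inter> V - {x} \<noteq> {}" and xW: "?W \<inter> V - {x} \<noteq> {}"
        using Cons.prems lQ by auto
      obtain Z where Z: "gpath E Z" "set Z \<inter> X = {hd Z}" "set Z \<inter> ?W = {last Z}" "x \<notin> set Z"
        "set Z \<subseteq> V"
        using ex_gpath_avoiding[of X x ?W, OF xX xW] by blast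
      have Z3: "\<And>w. w \<in> set Z \<Longrightarrow> w \<in> ?W \<Longrightarrow> w = last Z" "last Z \<in> ?W"
        using Z(3) by (auto simp: set_eq_iff)
      have Zne: "Z \<noteq> []" using Z by auto
      have hZ: "hd Z \<in> set Z" "last Z \<in> set Z" "hd Z \<in> X" using Zne Z by auto
      have R1x: "gpath E (x # R1)" using R x1 Exq by (auto simp: gpath_Cons)
      \<comment> \<open>If \<open>Z\<close> hits \<open>R2\<close>, it takes over the tail of
        \<open>R2\<close>, and \<open>x\<close> is put in front of \<open>R1\<close>. If it hits
        \<open>R1\<close>, then \<open>R2\<close> serves as the path from \<open>x\<close> and
        \<open>Z\<close> takes over the tail of \<open>R1\<close>. If it reaches \<open>Y\<close>
        untouched, it is paired with the path that ends in \<open>last Q\<close>.\<close>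
      consider "last Z \<in> set R2" | "last Z \<in> set R1" | "last Z \<in> Y" "last Z \<notin> set R1 \<union> set R2"
        using Z3 by auto
      then show ?thesis
      proof cases
        case 1
        then obtain A B where s: "R2 = A @ last Z # B" by (blast dest: split_list)
        have dis: "set Z \<inter> set B = {}"
          using Z3 Z(4) R(2) s by (auto simp: gpath_def)
        have A: "A \<noteq> []" using s True hZ(2) Z(4) by (cases A) auto
        have p: "gpath E (Z @ B)" using R(2) Z(1) s dis
          by (cases "B = []") (auto simp: gpath_append gpath_Cons split: if_splits)
        have ZR: "set Z \<inter> set (x # R1) = {}" using Z3 Z(4) R(3) 1 by auto
        have e: "last (Z @ B) = last R2" "hd (Z @ B) = hd Z" "last (x # R1) = last R1"
          using s Zne ne by auto
        have ZY: "w = last R2" if "w \<in> set Z" "w \<in> Y" for w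
          using that Z3(1)[of w] R8(2)[of w] 1 lQ(4) by auto
        show ?thesis
        proof (rule exI[of _ "x # R1"], rule exI[of _ "Z @ B"], unfold e, intro conjI)
          show "set (x # R1) \<inter> set (Z @ B) = {}" using ZR R3 x1 s R(2) A True
            hd_in_set[OF A] by (auto simp: gpath_def disjoint_iff)
          show "(set (x # R1) \<union> set (Z @ B)) \<inter> X = {hd Z}"
            using disX lQ(6) Z(2) s by auto
          show "(set (x # R1) \<union> set (Z @ B)) \<inter> Y \<subseteq> {last R1, last R2}"
            using ZY R8 s lQ(4) by auto
          show "set (x # R1) \<subseteq> V" "set (Z @ B) \<subseteq> V" using R(9,10) lQ(5) Z(5) s by auto
        qed (use R1x p hZ(3) R(6) lQ(1) in auto)
      next
        case 2
        then obtain A B where s: "R1 = A @ last Z # B" by (blast dest: split_list)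
        have dis: "set Z \<inter> set B = {}"
          using Z3 Z(4) R(1) s x1 by (auto simp: gpath_def)
        have p: "gpath E (Z @ B)" using R(1) Z(1) s dis
          by (cases "B = []") (auto simp: gpath_append gpath_Cons split: if_splits)
        have ZR: "set Z \<inter> set R2 = {}" using Z3 Z(4) R(3) 2 by auto
        have e: "last (Z @ B) = last R1" "hd (Z @ B) = hd Z" "hd R2 = x"
          using s Zne ne True by auto
        have ZY: "w = last R1" if "w \<in> set Z" "w \<in> Y" for w
          using that Z3(1)[of w] R8(1)[of w] 2 lQ(4) by auto
        show ?thesis
        proof (rule exI[of _ "R2"], rule exI[of _ "Z @ B"], unfold e, intro conjI)
          show "set R2 \<inter> set (Z @ B) = {}" using ZR R3 s by auto
          show "(set R2 \<union> set (Z @ B)) \<inter> X = {hd Z}"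
            using disX Z(2) s by auto
          show "(set R2 \<union> set (Z @ B)) \<inter> Y \<subseteq> {last R2, last R1}"
            using ZY R8 s by auto
          show "set (Z @ B) \<subseteq> V" using R(9) Z(5) s by auto
        qed (use R(2,6,10) p hZ(3) lQ(1) in auto)
      next
        case 3
        have d: "set Z \<inter> (set R1 \<union> set R2) = {}" using Z3 Z(4) 3 by auto
        have "w = last Z" if "w \<in> set Z" "w \<in> Y" for w using that Z3(1)[of w] lQ(4) by auto
        then have "set Z \<inter> Y \<subseteq> {last Z}" by blast
        then have zY: "set Z \<inter> Y = {last Z}" using 3 hZ by auto
        show ?thesis
        proof (cases "last R2 = last Q")
          case True
          have "set R2 \<inter> Y = {}" using R8 True lQ by auto
          then show ?thesis using R(2,3,10) Z(1,2,5) d zY \<open>hd R2 = x\<close> True 3 disX hZ lQ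
            by (intro exI[of _ R2] exI[of _ Z]) auto
        next
          case False
          then have l: "last R1 = last Q" using R(6) by auto
          have "set R1 \<inter> Y = {}" using R8 l lQ by auto
          then show ?thesis using R(1,3,9) Z(1,2,4,5) d zY R1x l 3 disX hZ lQ ne
            by (intro exI[of _ "x # R1"] exI[of _ Z]) auto
        qed
      qed
    qed
  qed
qed

end

section \<open>Long cycles from long paths\<close>

lemma gpath_join:
  assumes "gpath E xs" "gpath E ys" "last xs = hd ys" "set xs \<inter> set (tl ys) = {}"
  shows "gpath E (xs @ tl ys)" "last (xs @ tl ys) = last ys" "hd (xs @ tl ys) = hd xs"
    "length (xs @ tl ys) = length xs + length ys - 1"
proof -
  obtain y ys' where ys: "ys = y # ys'" using assms(2) by (cases ys) auto
  have xs: "xs \<noteq> []" using assms(1) by auto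
  show "gpath E (xs @ tl ys)" using assms ys xs
    by (cases "ys' = []") (auto simp: gpath_append gpath_Cons)
  show "last (xs @ tl ys) = last ys" "hd (xs @ tl ys) = hd xs"
    "length (xs @ tl ys) = length xs + length ys - 1" using ys xs assms(3) by auto
qed

context sgraph
begin

lemma gcyc_join:
  assumes "gpath E W" "gpath E R" "hd W = hd R" "last W = last R" "hd R \<noteq> last R"
    "set W \<inter> set R \<subseteq> {hd R, last R}" "5 \<le> length W + length R"
  shows "\<exists>Z. gcyc E Z \<and> length Z = length W + length R - 2"
proof -
  obtain a R0 where R0: "R = a # R0" using assms(2) by (cases R) auto
  have "R0 \<noteq> []" using assms(5) R0 by auto
  then obtain R' d where R: "R = a # R' @ [d]" using R0 by (cases R0 rule: rev_cases) auto
  have W: "W \<noteq> []" using assms(1) by auto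
  have pR: "gpath E (d # rev R' @ [a])" using assms(2) gpath_rev'[of R] R by simp
  have dis: "set W \<inter> set R' = {}" using assms(2,6) R by (auto simp: gpath_def)
  have "gpath E (W @ rev R')"
    using assms(1) pR dis W assms(4) R
    by (cases "R' = []") (auto simp: gpath_append gpath_Cons split: if_splits)
  moreover have "E (last (W @ rev R')) (hd (W @ rev R'))"
    using pR assms(3,4) R W
    by (cases "R' = []") (auto simp: gpath_append gpath_Cons hd_append last_rev split: if_splits)
  ultimately have "gcyc E (W @ rev R')" using assms(7) R by (simp add: gcyc_def)
  then show ?thesis using R by (intro exI[of _ "W @ rev R'"]) auto
qed

text \<open>Walk from \<open>x\<close> back to the start, jump to the first member of
  \<open>N\<close> behind \<open>x\<close>, and go on to the end: the vertices skipped contain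
  nothing of \<open>N\<close>.\<close>

lemma ex_gpath_through_start:
  assumes "gpath E L" "N \<subseteq> set L" "\<And>w. w \<in> N \<Longrightarrow> E (hd L) w" "last L \<in> N" "x \<in> set L" "x \<noteq> last L"
  shows "\<exists>F. gpath E F \<and> hd F = x \<and> last F = last L \<and> set F \<subseteq> set L \<and> insert (hd L) N \<subseteq> set F"
proof -
  obtain A B where L: "L = A @ x # B" using assms(5) by (blast dest: split_list)
  have "B \<noteq> []" using assms(6) L by auto
  then have lB: "last L = last B" "last B \<in> set B" using L by auto
  then have "\<exists>w\<in>set B. w \<in> N" using assms(4) by auto
  then obtain B1 b B2 where B: "B = B1 @ b # B2" "b \<in> N" "\<forall>w\<in>set B1. w \<notin> N"
    using split_list_first_prop[of B "\<lambda>w. w \<in> N"] by blast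
  let ?F = "rev (A @ [x]) @ b # B2"
  have "hd L = hd (A @ [x])" using L by (cases A) auto
  then have "last (rev (A @ [x])) = hd L" by (simp add: last_rev)
  moreover have "gpath E (A @ [x])" "gpath E (b # B2)" "set (A @ [x]) \<inter> set (b # B2) = {}"
    using assms(1) L B(1) by (auto simp: gpath_append gpath_Cons split: if_splits)
  ultimately have "gpath E ?F"
    using assms(3)[OF B(2)] gpath_rev'[of "A @ [x]"] by (subst gpath_append) auto
  moreover have "hd L \<in> set (A @ [x])" using L by (cases A) auto
  ultimately show ?thesis using L B lB assms(2)
    by (intro exI[of _ ?F]) (auto simp: hd_append)
qed

text \<open>Two crossing chords: go from \<open>hd P\<close> to \<open>P ! i\<close>, across to
  \<open>last P\<close>, backwards to \<open>P ! j\<close> and home. Only the vertices strictly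
  between \<open>i\<close> and \<open>j\<close> are lost.\<close>

lemma crossing_gcyc:
  assumes "gpath E P" "0 < i" "i < j" "Suc j < length P" "E (last P) (P ! i)" "E (hd P) (P ! j)"
  shows "\<exists>Z. gcyc E Z \<and> length Z = length P - (j - i - 1)"
proof -
  let ?A = "take (Suc i) P" and ?B = "drop j P"
  have P: "P \<noteq> []" "distinct P" using assms by (auto simp: gpath_def)
  have ne: "?A \<noteq> []" "?B \<noteq> []" using assms by auto
  have pA: "gpath E ?A" using assms(1) append_take_drop_id[of "Suc i" P] gpath_append[of E ?A "drop (Suc i) P"] ne
    by (auto split: if_splits)
  have pB: "gpath E ?B" using assms(1) append_take_drop_id[of j P] gpath_append[of E "take j P" ?B] ne
    by (auto split: if_splits)
  have lA: "last ?A = P ! i" using assms by (simp add: take_Suc_conv_app_nth)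
  have lB: "hd ?B = P ! j" "last ?B = last P" using assms by (auto simp: hd_drop_conv_nth)
  have dis: "set ?A \<inter> set ?B = {}" using P(2) assms(3) by (simp add: set_take_disj_set_drop_if_distinct)
  have "gpath E (?A @ rev ?B)"
    using pA pB gpath_rev'[of ?B] dis ne lA lB assms(5) E_sym by (auto simp: gpath_append hd_rev)
  moreover have "last (?A @ rev ?B) = P ! j" "hd (?A @ rev ?B) = hd P"
    using ne lB P by (auto simp: last_rev hd_append)
  ultimately have "gcyc E (?A @ rev ?B)" using assms E_sym by (auto simp: gcyc_def)
  then show ?thesis using assms by (intro exI[of _ "?A @ rev ?B"]) auto
qed

end

context two_conn_graph
begin

text \<open>When the chords at the two ends do not cross, the middle part of \<open>P\<close> is the
  only link between the two fans. Two disjoint paths around it allow a cycle to sweep both fans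
  completely, including the ends of \<open>P\<close>.\<close>

lemma noncrossing_gcyc:
  assumes P: "gpath E P" "set P \<subseteq> V"
    and Nu: "Nu \<subseteq> set P" "\<And>w. w \<in> Nu \<Longrightarrow> E (hd P) w" "Nu \<noteq> {}"
    and Nv: "Nv \<subseteq> set P" "\<And>w. w \<in> Nv \<Longrightarrow> E (last P) w" "Nv \<noteq> {}"
    and nc: "\<And>i j. i < length P \<Longrightarrow> j < length P \<Longrightarrow> P ! i \<in> Nv \<Longrightarrow> P ! j \<in> Nu \<Longrightarrow> j \<le> i"
  shows "\<exists>Z. gcyc E Z \<and> card Nu + card Nv < length Z"
proof -
  have dP: "distinct P" using P by (auto simp: gpath_def)
  define J where "J = {j. j < length P \<and> P ! j \<in> Nu}"
  define I where "I = {i. i < length P \<and> P ! i \<in> Nv}"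
  have fin: "finite J" "finite I" by (auto simp: J_def I_def)
  have ex: "\<exists>j<length P. P ! j \<in> N" if N: "N \<subseteq> set P" "N \<noteq> {}" for N
  proof -
    obtain w where "w \<in> N" using N by blast
    moreover from this have "w \<in> set P" using N by blast
    ultimately show ?thesis by (auto simp: in_set_conv_nth)
  qed
  have neJ: "J \<noteq> {}" using ex[OF Nu(1,3)] by (auto simp: J_def)
  have neI: "I \<noteq> {}" using ex[OF Nv(1,3)] by (auto simp: I_def)
  \<comment> \<open>The last neighbour of \<open>hd P\<close> and the first neighbour of
    \<open>last P\<close> cut \<open>P\<close> into the left fan, the middle \<open>Q\<close> and
    the right fan. The case \<open>g = h\<close>, where \<open>Q\<close> is one vertex, is
    included.\<close>
  define g where "g = Max J"
  define h where "h = Min I"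
  have g: "g \<in> J" "\<And>j. j \<in> J \<Longrightarrow> j \<le> g" using fin neJ by (auto simp: g_def)
  have h: "h \<in> I" "\<And>i. i \<in> I \<Longrightarrow> h \<le> i" using fin neI by (auto simp: h_def)
  have gh: "g \<le> h" "h < length P" "P ! g \<in> Nu" "P ! h \<in> Nv" using g(1) h(1) nc by (auto simp: J_def I_def)
  have "g \<noteq> 0" using Nu(2)[OF gh(3)] E_irr[of "hd P"] gh P(1) hd_conv_nth[of P] by (metis gpath_Nil)
  have "Suc h \<noteq> length P" using Nv(2)[OF gh(4)] E_irr[of "last P"] P(1) last_conv_nth[of P]
    by (metis gpath_Nil diff_Suc_1)
  define L0 where "L0 = take g P"
  define Q where "Q = drop g (take (Suc h) P)"
  define R0 where "R0 = drop (Suc h) P"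
  have "take g P @ drop g (take (Suc h) P) = take (Suc h) P"
    using append_take_drop_id[of g "take (Suc h) P"] gh by (simp add: min_def)
  then have PLQR: "P = L0 @ Q @ R0" unfolding L0_def Q_def R0_def
    by (metis append.assoc append_take_drop_id)
  have ne: "L0 \<noteq> []" "Q \<noteq> []" "R0 \<noteq> []"
    using \<open>g \<noteq> 0\<close> \<open>Suc h \<noteq> length P\<close> gh by (auto simp: L0_def Q_def R0_def)
  have hQ: "hd Q = P ! g" using gh by (simp add: Q_def hd_drop_conv_nth)
  have lQ: "last Q = P ! h" using gh by (simp add: Q_def take_Suc_conv_app_nth last_drop)
  have NuL: "Nu \<subseteq> set (L0 @ [hd Q])"
  proof
    fix w assume w: "w \<in> Nu"
    then obtain j where j: "j < length P" "P ! j = w" using Nu(1) by (meson in_set_conv_nth subsetD)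
    then have "j \<le> g" using g(2) w by (auto simp: J_def)
    then have "w = P ! g \<or> w \<in> set (take g P)" using j
      by (metis in_set_conv_nth le_neq_implies_less length_take min_less_iff_conj nth_take)
    then show "w \<in> set (L0 @ [hd Q])" using hQ L0_def by auto
  qed
  have NvR: "Nv \<subseteq> set (last Q # R0)"
  proof
    fix w assume w: "w \<in> Nv"
    then obtain i where i: "i < length P" "P ! i = w" using Nv(1) by (meson in_set_conv_nth subsetD)
    then have "h \<le> i" using h(2) w by (auto simp: I_def)
    then have "w = drop h P ! (i - h)" "i - h < length (drop h P)" using i by auto
    then have "w \<in> set (drop h P)" using nth_mem by blast
    then show "w \<in> set (last Q # R0)" using lQ gh by (simp add: R0_def Cons_nth_drop_Suc[symmetric])
  qed
  have pp: "gpath E L0" "gpath E Q" "gpath E R0" "set L0 \<inter> set Q = {}" "set L0 \<inter> set R0 = {}"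
    "set Q \<inter> set R0 = {}" "E (last L0) (hd Q)" "E (last Q) (hd R0)"
    using P(1) ne unfolding PLQR by (auto simp: gpath_append)
  have hP: "hd P = hd L0" "last P = last R0" using ne PLQR by auto
  \<comment> \<open>2-connectedness enters here: \<open>R1\<close> starts at the left end of
    \<open>Q\<close>, \<open>R2\<close> somewhere in the left fan, and both reach the right
    side.\<close>
  obtain R1 R2 where R: "gpath E R1" "gpath E R2" "set R1 \<inter> set R2 = {}" "hd R1 = hd Q" "hd R2 \<in> set L0"
    "last R1 = last Q \<and> last R2 \<in> set R0 \<or> last R1 \<in> set R0 \<and> last R2 = last Q"
    "(set R1 \<union> set R2) \<inter> set L0 = {hd R2}" "(set R1 \<union> set R2) \<inter> set R0 \<subseteq> {last R1, last R2}"
    using two_disjoint_gpaths[OF pp(2), of "set L0" "set R0"] pp P(2) ne unfolding PLQR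
    by (auto simp: Int_commute)
  have neR: "R1 \<noteq> []" "R2 \<noteq> []" using R by auto
  have inR: "hd R1 \<in> set R1" "last R1 \<in> set R1" "hd R2 \<in> set R2" "last R2 \<in> set R2" using neR by auto
  have hQin: "hd Q \<in> set Q" "last Q \<in> set Q" using ne by auto
  have hR2Q: "hd R2 \<noteq> hd Q" using R(5) pp(4) hQin by auto
  let ?L = "L0 @ [hd Q]"
  have "gpath E ?L" using pp(1,4,7) ne hQin by (auto simp: gpath_append gpath_Cons)
  moreover have "hd ?L = hd P" using ne hP by simp
  \<comment> \<open>On the left, \<open>hd R2\<close> and \<open>hd Q\<close> are linked by a path
    that collects \<open>hd P\<close> and all of \<open>Nu\<close>.\<close>
  ultimately obtain F where F: "gpath E F" "hd F = hd R2" "last F = hd Q" "set F \<subseteq> set ?L"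
    "insert (hd P) Nu \<subseteq> set F"
    using ex_gpath_through_start[of ?L Nu "hd R2"] NuL Nu(2) gh(3) hQ R(5) hR2Q by auto
  let ?R = "rev (last Q # R0)"
  have "gpath E (last Q # R0)" using pp hQin by (auto simp: gpath_Cons)
  then have pR: "gpath E ?R" using gpath_rev' by blast
  have hR: "hd ?R = last P" "last ?R = last Q" using ne hP by (auto simp: hd_rev)
  \<comment> \<open>The same on the right between the ends of \<open>R1\<close> and
    \<open>R2\<close>; either of them may be the one that ends at \<open>last Q\<close>.\<close>
  have "\<exists>H. gpath E H \<and> hd H = last R1 \<and> last H = last R2 \<and> set H \<subseteq> set (last Q # R0) \<and>
    insert (last P) Nv \<subseteq> set H"
    using R(6)
  proof
    assume a: "last R1 = last Q \<and> last R2 \<in> set R0"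
    then have "last R2 \<noteq> last Q" using pp(6) hQin by auto
    then obtain H where "gpath E H" "hd H = last R2" "last H = last Q" "set H \<subseteq> set ?R"
      "insert (last P) Nv \<subseteq> set H"
      using ex_gpath_through_start[OF pR, of Nv "last R2"] NvR Nv(2) gh(4) lQ a hR by auto
    then show ?thesis using a gpath_rev'[of H]
      by (intro exI[of _ "rev H"]) (auto simp: hd_rev last_rev)
  next
    assume a: "last R1 \<in> set R0 \<and> last R2 = last Q"
    then have "last R1 \<noteq> last Q" using pp(6) hQin by auto
    then obtain H where "gpath E H" "hd H = last R1" "last H = last Q" "set H \<subseteq> set ?R"
      "insert (last P) Nv \<subseteq> set H"
      using ex_gpath_through_start[OF pR, of Nv "last R1"] NvR Nv(2) gh(4) lQ a hR by auto
    then show ?thesis using a by (intro exI[of _ H]) auto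
  qed
  then obtain H where H: "gpath E H" "hd H = last R1" "last H = last R2" "set H \<subseteq> set (last Q # R0)"
    "insert (last P) Nv \<subseteq> set H" by blast
  have R7: "\<And>w. w \<in> set R1 \<Longrightarrow> w \<in> set L0 \<Longrightarrow> False" "\<And>w. w \<in> set R2 \<Longrightarrow> w \<in> set L0 \<Longrightarrow> w = hd R2"
  proof -
    fix w assume "w \<in> set R1" "w \<in> set L0"
    moreover from this have "w = hd R2" using R(7) by (auto simp: set_eq_iff)
    ultimately show False using inR R(3) by auto
  next
    fix w assume "w \<in> set R2" "w \<in> set L0"
    then show "w = hd R2" using R(7) by (auto simp: set_eq_iff)
  qed
  have R8: "w = last R1" if "w \<in> set R1" "w \<in> set R0" for w
  proof -
    have "w \<in> {last R1, last R2}" using R(8) that by blast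
    then show ?thesis using R(3) that inR by auto
  qed
  have R9: "w = last R2" if "w \<in> set R2" "w \<in> set R0" for w
  proof -
    have "w \<in> {last R1, last R2}" using R(8) that by blast
    then show ?thesis using R(3) that inR by auto
  qed
  have hQR: "hd Q \<notin> set R2" using R(3,4) inR by auto
  have lQR: "last Q = last R1 \<or> last Q \<notin> set R1" using R(3,6) inR by auto
  have lQR2: "last Q = last R2 \<or> last Q \<notin> set R2" using R(3,6) inR by auto
  have tlR1: "set (tl R1) = set R1 - {hd Q}"
    using R(1,4) by (cases R1) (auto simp: gpath_def)
  have tlH: "set (tl H) = set H - {last R1}"
    using H(1,2) by (cases H) (auto simp: gpath_def)
  have d1: "set F \<inter> set (tl R1) = {}" using F(4) tlR1 R7(1) by auto
  define W1 where "W1 = F @ tl R1"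
  have W1: "gpath E W1" "last W1 = last R1" "hd W1 = hd R2" "length W1 = length F + length R1 - 1"
    using gpath_join[OF F(1) R(1) _ d1] F R(4) by (auto simp: W1_def)
  have cross: "hd Q \<notin> set (tl H)"
  proof
    assume "hd Q \<in> set (tl H)"
    then have a: "hd Q \<in> set H" "hd Q \<noteq> last R1" using tlH by auto
    then have "hd Q = last Q" using H(4) pp(6) hQin by auto
    then show False using R(3,4,6) a(2) inR by auto
  qed
  have d2: "set W1 \<inter> set (tl H) = {}"
  proof -
    have "set F \<inter> set (tl H) = {}"
    proof (rule ccontr)
      assume "set F \<inter> set (tl H) \<noteq> {}"
      then obtain w where w: "w \<in> set F" "w \<in> set (tl H)" by blast
      then have "w \<in> set L0" "w \<in> set Q \<or> w \<in> set R0" using F(4) H(4) tlH cross hQin by auto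
      then show False using pp(4,5) by auto
    qed
    moreover have "set (tl R1) \<inter> set (tl H) = {}"
      using H(4) tlH tlR1 R8 lQR by (auto simp: disjoint_iff)
    ultimately show ?thesis by (auto simp: W1_def)
  qed
  define W where "W = W1 @ tl H"
  have W: "gpath E W" "last W = last R2" "hd W = hd R2" "length W = length W1 + length H - 1"
    using gpath_join[OF W1(1) H(1) _ d2] W1 H by (auto simp: W_def)
  have "set W \<inter> set R2 \<subseteq> {hd R2, last R2}"
  proof
    fix w assume w: "w \<in> set W \<inter> set R2"
    then have "w \<in> set F \<or> w \<in> set R1 \<or> w \<in> set H"
      unfolding W_def W1_def tlR1 tlH set_append by auto
    then show "w \<in> {hd R2, last R2}"
      using w F(4) H(4) R7(2)[of w] R9[of w] R(3) hQR lQR2 by auto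
  qed
  moreover have hl: "hd R2 \<noteq> last R2"
    using R(5,6) pp(4,5) hQin by auto
  moreover have cF: "card Nu < length F"
  proof -
    have "hd P \<notin> Nu" using Nu(2) E_irr by blast
    moreover have "finite Nu" using Nu(1) finite_subset by blast
    ultimately have "card (insert (hd P) Nu) = Suc (card Nu)" by simp
    moreover have "card (insert (hd P) Nu) \<le> card (set F)" by (rule card_mono) (use F in auto)
    ultimately show ?thesis using card_length[of F] by linarith
  qed
  moreover have cH: "card Nv < length H"
  proof -
    have "last P \<notin> Nv" using Nv(2) E_irr by blast
    moreover have "finite Nv" using Nv(1) finite_subset by blast
    ultimately have "card (insert (last P) Nv) = Suc (card Nv)" by simp
    moreover have "card (insert (last P) Nv) \<le> card (set H)" by (rule card_mono) (use H in auto)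
    ultimately show ?thesis using card_length[of H] by linarith
  qed
  moreover have "2 \<le> length R2" using hl neR by (cases R2; cases "tl R2") auto
  moreover have "1 \<le> length R1" using neR by (cases R1) auto
  moreover have "1 \<le> card Nu" "1 \<le> card Nv"
    using Nu(1,3) Nv(1,3) finite_subset[of _ "set P"] by (simp_all add: Suc_le_eq card_gt_0_iff)
  \<comment> \<open>\<open>F\<close> has at least \<open>|Nu| + 1\<close> vertices, \<open>H\<close>
    at least \<open>|Nv| + 1\<close>, \<open>R1\<close> at least one and \<open>R2\<close> at least
    two; the four junctions are counted twice.\<close>
  ultimately show ?thesis using gcyc_join[OF W(1) R(2) W(3,2)] W(4) W1(4) by fastforce
qed

text \<open>If the chords at the two ends cross, the closest crossing pair loses only vertices that
  neither end sees, so the cycle of \<open>crossing_gcyc\<close> is still long enough. Otherwise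
  \<open>noncrossing_gcyc\<close> applies.\<close>

lemma ends_gcyc:
  assumes P: "gpath E P" "set P \<subseteq> V" "\<not> E (hd P) (last P)"
    and Nu: "Nu \<subseteq> set P" "\<And>w. w \<in> Nu \<Longrightarrow> E (hd P) w" "Nu \<noteq> {}"
    and Nv: "Nv \<subseteq> set P" "\<And>w. w \<in> Nv \<Longrightarrow> E (last P) w" "Nv \<noteq> {}"
  shows "\<exists>Z. gcyc E Z \<and> min (length P) (card Nu + card Nv) \<le> length Z"
proof (cases "\<forall>i<length P. \<forall>j<length P. P ! i \<in> Nv \<longrightarrow> P ! j \<in> Nu \<longrightarrow> j \<le> i")
  case True
  then obtain Z where "gcyc E Z" "card Nu + card Nv < length Z"
    using noncrossing_gcyc[OF P(1,2) Nu Nv] by blast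
  then show ?thesis by (intro exI[of _ Z]) auto
next
  case False
  have dP: "distinct P" "P \<noteq> []" using P by (auto simp: gpath_def)
  define C where "C d \<longleftrightarrow> (\<exists>i j. i < j \<and> j < length P \<and> P ! i \<in> Nv \<and> P ! j \<in> Nu \<and> d = j - i)" for d
  have "\<exists>d. C d" using False unfolding C_def by (metis linorder_not_le)
  then obtain d where d: "C d" "\<And>e. C e \<Longrightarrow> d \<le> e" by (metis exists_least_iff linorder_not_less)
  then obtain i j where ij: "i < j" "j < length P" "P ! i \<in> Nv" "P ! j \<in> Nu" "d = j - i"
    unfolding C_def by blast
  have mn: "j - i \<le> j' - i'" if "i' < j'" "j' < length P" "P ! i' \<in> Nv" "P ! j' \<in> Nu" for i' j'
    using d(2)[of "j' - i'"] that ij(5) unfolding C_def by blast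
  have i0: "0 < i" using Nv(2)[OF ij(3)] P(3) E_sym dP hd_conv_nth[of P] by (cases i) auto
  have jn: "Suc j < length P" using Nu(2)[OF ij(4)] P(3) dP last_conv_nth[of P] ij(2)
    by (metis Suc_lessI diff_Suc_1)
  obtain Z where Z: "gcyc E Z" "length Z = length P - (j - i - 1)"
    using crossing_gcyc[OF P(1) i0 ij(1) jn] Nv(2)[OF ij(3)] Nu(2)[OF ij(4)] by blast
  have "min (length P) (card Nu + card Nv) \<le> length P - (j - i - 1)"
  proof (cases "j = Suc i")
    case False
    \<comment> \<open>\<open>J\<close> holds the predecessors of \<open>Nu\<close>. It is disjoint
      from \<open>I\<close>, since a common position would be a crossing pair at distance 1. By
      minimality both sets miss the positions from \<open>i + 1\<close> to \<open>j - 2\<close>, and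
      both miss the last position.\<close>
    define J where "J = {m. Suc m < length P \<and> P ! Suc m \<in> Nu}"
    define I where "I = {m. m < length P \<and> P ! m \<in> Nv}"
    have cJ: "card Nu \<le> card J"
    proof -
      have "Nu \<subseteq> (\<lambda>m. P ! Suc m) ` J"
      proof
        fix w assume w: "w \<in> Nu"
        then obtain m where m: "m < length P" "P ! m = w" using Nu(1) by (meson in_set_conv_nth subsetD)
        have "m \<noteq> 0" using Nu(2)[OF w] E_irr m dP hd_conv_nth[of P] by metis
        then obtain m' where "m = Suc m'" by (cases m) auto
        then show "w \<in> (\<lambda>m. P ! Suc m) ` J" using m w by (auto simp: J_def)
      qed
      moreover have "finite J" by (rule finite_subset[of _ "{..<length P}"]) (auto simp: J_def)
      ultimately show ?thesis by (meson surj_card_le)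
    qed
    have cI: "card Nv \<le> card I"
    proof -
      have "Nv \<subseteq> (\<lambda>m. P ! m) ` I"
        using Nv(1) by (auto simp: I_def in_set_conv_nth image_iff) (metis in_set_conv_nth subsetD)
      moreover have "finite I" by (auto simp: I_def)
      ultimately show ?thesis by (meson surj_card_le)
    qed
    have "I \<inter> J = {}"
    proof (rule ccontr)
      assume "I \<inter> J \<noteq> {}"
      then obtain m where "m \<in> I" "m \<in> J" by blast
      then show False using mn[of m "Suc m"] False ij by (auto simp: I_def J_def)
    qed
    moreover have "m \<notin> {Suc i..<j - 1}" if "m \<in> I \<union> J" for m
    proof
      assume a: "m \<in> {Suc i..<j - 1}"
      show False using that
      proof
        assume "m \<in> I"
        moreover have "i < m" "m < j" using a by simp_all linarith
        ultimately show False using mn[of m j] ij(2,4) unfolding I_def by fastforce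
      next
        assume "m \<in> J"
        then show False using mn[of i "Suc m"] a ij by (auto simp: J_def)
      qed
    qed
    moreover have "m < length P - 1" if "m \<in> I \<union> J" for m
    proof -
      have "m \<noteq> length P - 1" if "m \<in> I"
        using that Nv(2)[of "P ! m"] E_irr dP last_conv_nth[of P] by (auto simp: I_def)
      then show ?thesis using that by (auto simp: I_def J_def)
    qed
    ultimately have "I \<union> J \<subseteq> {..<length P - 1} - {Suc i..<j - 1}" "I \<inter> J = {}" by auto
    moreover have "finite I" "finite J"
      by (rule finite_subset[of _ "{..<length P}"], auto simp: I_def J_def)+
    moreover have "card ({..<length P - 1} - {Suc i..<j - 1}) = length P - 1 - (j - 1 - Suc i)"
      using jn by (subst card_Diff_subset) auto
    ultimately have "card I + card J \<le> length P - 1 - (j - 1 - Suc i)"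
      by (metis card_Un_disjoint card_mono finite_Diff finite_lessThan)
    then show ?thesis using cI cJ False ij jn by linarith
  qed auto
  then show ?thesis using Z by auto
qed

end

section \<open>Edge-maximal graphs of bounded circumference\<close>

lemma not_successively_split:
  assumes "\<not> successively E xs"
  shows "\<exists>as a b bs. xs = as @ a # b # bs \<and> \<not> E a b"
  using assms
proof (induction xs)
  case (Cons x xs)
  show ?case
  proof (cases "successively E xs")
    case True
    then obtain y ys where "xs = y # ys" "\<not> E x y" using Cons.prems by (cases xs) auto
    then show ?thesis by (intro exI[of _ "[]"]) auto
  next
    case False
    then obtain as a b bs where "xs = as @ a # b # bs" "\<not> E a b" using Cons.IH by blast
    then show ?thesis by (intro exI[of _ "x # as"] exI[of _ a] exI[of _ b] exI[of _ bs]) auto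
  qed
qed simp

text \<open>The edges that may be new join the two ends of \<open>ys\<close>, and in a path on three
  or more vertices the ends are never consecutive.\<close>

lemma gpath_remove_edge:
  assumes "gpath F ys" "3 \<le> length ys" "\<And>p q. F p q \<Longrightarrow> E p q \<or> {p, q} = {hd ys, last ys}"
  shows "gpath E ys"
proof -
  have d: "distinct ys" "ys \<noteq> []" using assms by (auto simp: gpath_def)
  have "E (ys ! i) (ys ! Suc i)" if i: "Suc i < length ys" for i
  proof (rule ccontr)
    assume n: "\<not> ?thesis"
    have "F (ys ! i) (ys ! Suc i)" using assms(1) i by (auto simp: gpath_def successively_conv_nth)
    with n have "{ys ! i, ys ! Suc i} = {ys ! 0, ys ! (length ys - 1)}"
      using assms(3) d by (metis hd_conv_nth last_conv_nth)
    then have "(ys ! i = ys ! 0 \<and> ys ! Suc i = ys ! (length ys - 1)) \<or>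
      (ys ! i = ys ! (length ys - 1) \<and> ys ! Suc i = ys ! 0)" by (simp add: doubleton_eq_iff)
    then have "(i = 0 \<and> Suc i = length ys - 1) \<or> (i = length ys - 1 \<and> Suc i = 0)"
      using d i by (auto simp: nth_eq_iff_index_eq)
    then show False using assms(2) by auto
  qed
  then show ?thesis using d by (auto simp: gpath_def successively_conv_nth)
qed

text \<open>A cycle that uses the new edge is cut open there and becomes a path between
  \<open>u\<close> and \<open>v\<close> on the same vertices.\<close>

lemma gcyc_add_edge:
  assumes "gcyc F xs" "\<And>p q. F p q \<Longrightarrow> E p q \<or> {p, q} = {u, v}"
  shows "gcyc E xs \<or> (\<exists>ys. gpath E ys \<and> length ys = length xs \<and> {hd ys, last ys} = {u, v})"
proof (cases "gpath E xs")
  case True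
  then show ?thesis using assms(1) assms(2)[of "last xs" "hd xs"] by (auto simp: gcyc_def insert_commute)
next
  case False
  have xs: "gpath F xs" "3 \<le> length xs" "F (last xs) (hd xs)" using assms(1) by (auto simp: gcyc_def)
  then have "\<not> successively E xs" using False by (auto simp: gpath_def)
  then obtain as a b bs where s: "xs = as @ a # b # bs" "\<not> E a b" using not_successively_split by blast
  have Fab: "F a b" using xs(1) s by (auto simp: gpath_append gpath_Cons split: if_splits)
  then have ab: "{a, b} = {u, v}" using assms(2) s by blast
  let ?ys = "(b # bs) @ as @ [a]"
  have l: "hd ?ys = b" "last ?ys = a" "length ?ys = length xs" using s by auto
  have "gpath F ?ys"
  proof -
    have "gpath F (as @ [a])" "gpath F (b # bs)" "set (as @ [a]) \<inter> set (b # bs) = {}"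
      using xs(1) s gpath_append[of F "as @ [a]" "b # bs"] by auto
    moreover have "F (last (b # bs)) (hd (as @ [a]))" using xs(3) s by (cases as) auto
    ultimately show ?thesis by (subst gpath_append) auto
  qed
  then have "gpath E ?ys"
  proof (rule gpath_remove_edge)
    show "3 \<le> length ?ys" using l(3) xs(2) by simp
    fix p q assume "F p q"
    moreover have "{hd ?ys, last ?ys} = {u, v}" using ab unfolding l by (simp add: insert_commute)
    ultimately show "E p q \<or> {p, q} = {hd ?ys, last ?ys}" using assms(2) by metis
  qed
  then show ?thesis using l ab by (intro disjI2 exI[of _ ?ys]) (auto simp: insert_commute)
qed

text \<open>The second clause expresses maximality: the additional edge \<open>u v\<close> would
  close a cycle on more than \<open>c\<close> vertices.\<close>

definition circ_maximal :: "'a set \<Rightarrow> ('a \<Rightarrow> 'a \<Rightarrow> bool) \<Rightarrow> nat \<Rightarrow> bool" where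
  "circ_maximal V E c \<longleftrightarrow> (\<forall>xs. gcyc E xs \<longrightarrow> length xs \<le> c) \<and>
     (\<forall>u\<in>V. \<forall>v\<in>V. u \<noteq> v \<longrightarrow> \<not> E u v \<longrightarrow> (\<exists>P. gpath E P \<and> hd P = u \<and> last P = v \<and> c < length P))"

text \<open>Induction on the number of ordered pairs without an edge. If a nonadjacent pair has no
  path on more than \<open>c\<close> vertices, its edge can be added, because a cycle through it
  would open into such a path.\<close>

lemma ex_circ_maximal:
  assumes "sgraph V E" "\<And>xs. gcyc E xs \<Longrightarrow> length xs \<le> c"
  shows "\<exists>F. sgraph V F \<and> (\<forall>u v. E u v \<longrightarrow> F u v) \<and> circ_maximal V F c"
  using assms
proof (induction "card {p \<in> V \<times> V. \<not> E (fst p) (snd p)}" arbitrary: E rule: less_induct)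
  case less
  interpret sgraph V E by fact
  show ?case
  proof (cases "circ_maximal V E c")
    case True
    then show ?thesis using less.prems by blast
  next
    case False
    then obtain u v where uv: "u \<in> V" "v \<in> V" "u \<noteq> v" "\<not> E u v"
      "\<not> (\<exists>P. gpath E P \<and> hd P = u \<and> last P = v \<and> c < length P)"
      using less.prems(2) unfolding circ_maximal_def by blast
    define F where "F p q \<longleftrightarrow> E p q \<or> {p, q} = {u, v}" for p q
    have F: "sgraph V F"
      using uv finV E_sym E_irr E_V by unfold_locales (auto simp: F_def doubleton_eq_iff)
    have c: "length xs \<le> c" if "gcyc F xs" for xs
    proof -
      from gcyc_add_edge[OF that, of E u v] consider "gcyc E xs" |
        ys where "gpath E ys" "length ys = length xs" "{hd ys, last ys} = {u, v}"
        by (auto simp: F_def)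
      then show ?thesis
      proof cases
        case 1
        then show ?thesis using less.prems(2) by blast
      next
        case 2
        have "\<exists>P. gpath E P \<and> hd P = u \<and> last P = v \<and> length P = length ys"
        proof (cases "hd ys = u")
          case True
          then show ?thesis using 2 uv(3) by (intro exI[of _ ys]) (auto simp: doubleton_eq_iff)
        next
          case False
          then show ?thesis using 2 uv(3) gpath_rev'[of ys]
            by (intro exI[of _ "rev ys"]) (auto simp: doubleton_eq_iff hd_rev last_rev)
        qed
        then show ?thesis using uv(5) 2(2) by (metis linorder_not_less)
      qed
    qed
    have "{p \<in> V \<times> V. \<not> F (fst p) (snd p)} \<subset> {p \<in> V \<times> V. \<not> E (fst p) (snd p)}"
    proof
      have "(u, v) \<in> {p \<in> V \<times> V. \<not> E (fst p) (snd p)}" "(u, v) \<notin> {p \<in> V \<times> V. \<not> F (fst p) (snd p)}"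
        using uv by (auto simp: F_def)
      then show "{p \<in> V \<times> V. \<not> F (fst p) (snd p)} \<noteq> {p \<in> V \<times> V. \<not> E (fst p) (snd p)}" by metis
    qed (auto simp: F_def)
    then have "card {p \<in> V \<times> V. \<not> F (fst p) (snd p)} < card {p \<in> V \<times> V. \<not> E (fst p) (snd p)}"
      using finV by (intro psubset_card_mono) auto
    from less.hyps[OF this F c] show ?thesis by (auto simp: F_def)
  qed
qed

section \<open>Edge counts, degeneracy and cores\<close>

context sgraph
begin

definition esz :: "'a set \<Rightarrow> nat" where
  "esz X = card {e. \<exists>u v. e = {u, v} \<and> u \<in> X \<and> v \<in> X \<and> E u v}"

lemma esz_empty [simp]: "esz {} = 0"
  by (simp add: esz_def)

lemma esz_insert:
  assumes "finite X" "v \<notin> X"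
  shows "esz (insert v X) = esz X + card (nb v \<inter> X)"
proof -
  let ?S = "\<lambda>X. {e. \<exists>u v. e = {u, v} \<and> u \<in> X \<and> v \<in> X \<and> E u v}"
  have "?S (insert v X) = ?S X \<union> (\<lambda>u. {v, u}) ` (nb v \<inter> X)"
    using E_irr E_sym by (auto simp: nb_def insert_commute)
  moreover have "?S X \<inter> (\<lambda>u. {v, u}) ` (nb v \<inter> X) = {}"
    using assms(2) by (auto simp: doubleton_eq_iff)
  moreover have "finite (?S X)" by (rule finite_subset[of _ "Pow X"]) (use assms in auto)
  moreover have "finite (nb v \<inter> X)" using assms by auto
  moreover have "card ((\<lambda>u. {v, u}) ` (nb v \<inter> X)) = card (nb v \<inter> X)"
    by (rule card_image) (auto simp: inj_on_def doubleton_eq_iff)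
  ultimately show ?thesis unfolding esz_def by (simp add: card_Un_disjoint)
qed

lemma esz_le_choose: "finite X \<Longrightarrow> esz X \<le> card X choose 2"
proof (induction rule: finite_induct)
  case (insert v X)
  have "card (nb v \<inter> X) \<le> card X" using insert by (intro card_mono) auto
  moreover have "Suc (card X) choose 2 = card X + (card X choose 2)"
    by (simp add: numeral_2_eq_2)
  ultimately show ?case using insert esz_insert by simp
qed simp

text \<open>Delete vertices of inner degree at most \<open>d\<close> one by one, at the cost of at
  most \<open>d\<close> edges each, until \<open>s\<close> vertices remain.\<close>

lemma esz_degenerate:
  assumes "finite X" "s \<le> card X"
    "\<And>Y. Y \<subseteq> X \<Longrightarrow> s < card Y \<Longrightarrow> \<exists>v\<in>Y. card (nb v \<inter> Y) \<le> d"
  shows "esz X \<le> (s choose 2) + d * (card X - s)"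
  using assms
proof (induction "card X" arbitrary: X)
  case 0
  then show ?case by simp
next
  case (Suc m)
  show ?case
  proof (cases "s = card X")
    case True
    then show ?thesis using esz_le_choose[OF Suc.prems(1)] by simp
  next
    case False
    then obtain v where v: "v \<in> X" "card (nb v \<inter> X) \<le> d" using Suc.prems by force
    let ?Y = "X - {v}"
    have c: "card ?Y = m" "finite ?Y" using Suc v by auto
    have "esz ?Y \<le> (s choose 2) + d * (card ?Y - s)"
    proof (rule Suc.hyps(1))
      show "s \<le> card ?Y" using c Suc.prems(2) False Suc.hyps(2) by linarith
      show "\<exists>w\<in>Y. card (nb w \<inter> Y) \<le> d" if "Y \<subseteq> ?Y" "s < card Y" for Y
        using Suc.prems(3)[of Y] that by blast
    qed (use c in simp_all)
    moreover have "esz X = esz ?Y + card (nb v \<inter> ?Y)"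
      using esz_insert[of ?Y v] c v by (simp add: insert_absorb)
    moreover have "nb v \<inter> ?Y = nb v \<inter> X" using E_irr by (auto simp: nb_def)
    moreover have "card X - s = Suc (m - s)" using False Suc.hyps(2) Suc.prems(2) by linarith
    ultimately show ?thesis using v(2) c by simp
  qed
qed

definition dense :: "nat \<Rightarrow> 'a set \<Rightarrow> bool" where
  "dense s X \<longleftrightarrow> X \<subseteq> V \<and> (\<forall>v\<in>X. s < card (nb v \<inter> X))"

text \<open>The \<open>(s + 1)\<close>-core: what remains when vertices of degree at most
  \<open>s\<close> are deleted as long as there are any. As a union of dense sets it does not depend
  on an order of deletion.\<close>

definition core :: "nat \<Rightarrow> 'a set" where "core s = \<Union>{X. dense s X}"

lemma dense_core: "dense s (core s)"
  unfolding dense_def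
proof (intro conjI ballI)
  show "core s \<subseteq> V" by (auto simp: core_def dense_def)
  fix v assume "v \<in> core s"
  then obtain X where X: "v \<in> X" "dense s X" by (auto simp: core_def)
  then have "s < card (nb v \<inter> X)" by (auto simp: dense_def)
  also have "\<dots> \<le> card (nb v \<inter> core s)" using X by (intro card_mono) (auto simp: core_def)
  finally show "s < card (nb v \<inter> core s)" .
qed

lemma dense_le_core: "dense s X \<Longrightarrow> X \<subseteq> core s"
  by (auto simp: core_def)

lemma dense_mono: "dense s X \<Longrightarrow> s' \<le> s \<Longrightarrow> dense s' X"
  by (auto simp: dense_def)

lemma gpath_clique:
  assumes "\<And>u v. u \<in> K \<Longrightarrow> v \<in> K \<Longrightarrow> u \<noteq> v \<Longrightarrow> E u v" "set xs \<subseteq> K" "distinct xs" "xs \<noteq> []"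
  shows "gpath E xs"
  using assms(2-4)
proof (induction xs)
  case (Cons x xs)
  then show ?case using assms(1)[of x "hd xs"]
    by (cases "xs = []") (auto simp: gpath_Cons subset_iff, metis hd_in_set)
qed simp

end

section \<open>Cores of edge-maximal graphs\<close>

locale maximal_graph = two_conn_graph +
  fixes c :: nat
  assumes c3: "3 \<le> c"
    and circ: "gcyc E xs \<Longrightarrow> length xs \<le> c"
    and maxi: "u \<in> V \<Longrightarrow> v \<in> V \<Longrightarrow> u \<noteq> v \<Longrightarrow> \<not> E u v \<Longrightarrow>
      \<exists>P. gpath E P \<and> hd P = u \<and> last P = v \<and> c < length P"
begin

lemma clique_card_le:
  assumes "\<And>u v. u \<in> K \<Longrightarrow> v \<in> K \<Longrightarrow> u \<noteq> v \<Longrightarrow> E u v" "K \<subseteq> V"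
  shows "card K \<le> c"
proof (rule ccontr)
  assume a: "\<not> ?thesis"
  obtain xs where xs: "set xs = K" "distinct xs"
    using finite_distinct_list finite_subset[OF assms(2) finV] by blast
  then have l: "length xs = card K" using distinct_card by fastforce
  then have ne: "xs \<noteq> []" "3 \<le> length xs" using a c3 by auto
  have "last xs \<noteq> hd xs" using ne xs(2) by (cases xs; cases "tl xs") auto
  then have "gcyc E xs" using gpath_clique[of K xs] assms(1) xs ne
    by (auto simp: gcyc_def)
  then show False using circ l a by force
qed

text \<open>Maximality of the graph supplies one such path on more than \<open>c\<close> vertices,
  and lengths are bounded by \<open>|V|\<close>.\<close>

lemma ex_longest_path:
  assumes "u \<in> A" "v \<in> B" "u \<noteq> v" "\<not> E u v" "A \<subseteq> V" "B \<subseteq> V"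
  shows "\<exists>P. gpath E P \<and> hd P \<in> A \<and> last P \<in> B \<and> \<not> E (hd P) (last P) \<and> c < length P \<and>
    set P \<subseteq> V \<and>
    (\<forall>Q. gpath E Q \<longrightarrow> hd Q \<in> A \<longrightarrow> last Q \<in> B \<longrightarrow> \<not> E (hd Q) (last Q) \<longrightarrow> length Q \<le> length P)"
proof -
  define G where "G P \<longleftrightarrow> gpath E P \<and> hd P \<in> A \<and> last P \<in> B \<and> \<not> E (hd P) (last P)" for P
  obtain P0 where P0: "gpath E P0" "hd P0 = u" "last P0 = v" "c < length P0"
    using maxi[of u v] assms by blast
  then have "G P0" using assms by (auto simp: G_def)
  have b: "length P < Suc (card V)" if "G P" for P
  proof -
    have "set P \<subseteq> V" using that gpath_set_V assms(5) by (auto simp: G_def)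
    then show ?thesis using that card_mono[OF finV, of "set P"] distinct_card[of P]
      by (auto simp: G_def gpath_def less_Suc_eq_le)
  qed
  from ex_has_greatest_nat[of G P0 length "Suc (card V)"] \<open>G P0\<close> b
  obtain P where P: "G P" "\<And>Q. G Q \<Longrightarrow> length Q \<le> length P" by (metis less_imp_le)
  have "c < length P" using P(2)[OF \<open>G P0\<close>] P0 by simp
  moreover have "set P \<subseteq> V" using P(1) gpath_set_V assms(5) by (auto simp: G_def)
  ultimately show ?thesis using P by (auto simp: G_def)
qed

text \<open>A longest path between nonadjacent core vertices contains all core neighbours of its
  ends: a further one would close a cycle on more than \<open>c\<close> vertices or give a longer
  path of the same kind. Each end has at least \<open>t + 1\<close> of them, so
  \<open>ends_gcyc\<close> yields a cycle on at least \<open>min |P| (2t + 2) > c\<close>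
  vertices.\<close>

lemma core_clique:
  assumes "c \<le> 2 * t + 1" "u \<in> core t" "v \<in> core t" "u \<noteq> v"
  shows "E u v"
proof (rule ccontr)
  assume a: "\<not> ?thesis"
  have cV: "core t \<subseteq> V" using dense_core[of t] by (auto simp: dense_def)
  obtain P where P: "gpath E P" "hd P \<in> core t" "last P \<in> core t" "\<not> E (hd P) (last P)"
    "c < length P" "set P \<subseteq> V"
    "\<And>Q. gpath E Q \<Longrightarrow> hd Q \<in> core t \<Longrightarrow> last Q \<in> core t \<Longrightarrow> \<not> E (hd Q) (last Q) \<Longrightarrow>
      length Q \<le> length P"
    using ex_longest_path[OF assms(2-4) a cV cV] by blast
  have ne: "P \<noteq> []" using P(1) by auto
  have Nu: "nb (hd P) \<inter> core t \<subseteq> set P"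
  proof (rule ccontr)
    assume "\<not> ?thesis"
    then obtain w where w: "E (hd P) w" "w \<in> core t" "w \<notin> set P" by (auto simp: nb_def)
    have p: "gpath E (w # P)" using w P(1) E_sym by (auto simp: gpath_Cons)
    show False
    proof (cases "E w (last P)")
      case True
      then have "gcyc E (w # P)" using p ne P(5) c3 E_sym by (auto simp: gcyc_def)
      then show False using circ P(5) by force
    next
      case False
      then show False using P(7)[OF p] w P(3) ne by auto
    qed
  qed
  have Nv: "nb (last P) \<inter> core t \<subseteq> set P"
  proof (rule ccontr)
    assume "\<not> ?thesis"
    then obtain w where w: "E (last P) w" "w \<in> core t" "w \<notin> set P" by (auto simp: nb_def)
    have p: "gpath E (P @ [w])" using w P(1) by (auto simp: gpath_append gpath_Cons)
    show False
    proof (cases "E (hd P) w")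
      case True
      then have "gcyc E (P @ [w])" using p ne P(5) c3 E_sym by (auto simp: gcyc_def)
      then show False using circ P(5) by force
    next
      case False
      then show False using P(7)[OF p] w P(2) ne by auto
    qed
  qed
  have d: "t < card (nb (hd P) \<inter> core t)" "t < card (nb (last P) \<inter> core t)"
    using P(2,3) dense_core[of t] by (auto simp: dense_def)
  then have ne2: "nb (hd P) \<inter> core t \<noteq> {}" "nb (last P) \<inter> core t \<noteq> {}" by auto
  obtain Z where "gcyc E Z"
    "min (length P) (card (nb (hd P) \<inter> core t) + card (nb (last P) \<inter> core t)) \<le> length Z"
    using ends_gcyc[OF P(1,6,4) Nu _ ne2(1) Nv _ ne2(2)] by (auto simp: nb_def)
  then show False using circ[of Z] P(5) d assms(1) by linarith
qed

lemma core_card: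
  assumes "core t \<noteq> {}"
  shows "t + 2 \<le> card (core t)"
proof -
  obtain v where v: "v \<in> core t" using assms by blast
  have d: "core t \<subseteq> V" "t < card (nb v \<inter> core t)" using dense_core[of t] v by (auto simp: dense_def)
  have "card (nb v \<inter> core t) < card (core t)"
    using finite_subset[OF d(1) finV] v E_irr by (intro psubset_card_mono) (auto simp: nb_def)
  then show ?thesis using d by linarith
qed

text \<open>A vertex joined to the whole clique could be added to it without destroying
  density.\<close>

lemma core_not_joined:
  assumes t: "c \<le> 2 * t + 1" "core t \<noteq> {}" and x: "x \<in> V - core t"
  shows "\<exists>y\<in>core t. \<not> E x y"
proof (rule ccontr)
  define K where "K = core t"
  have KV: "K \<subseteq> V" using dense_core[of t] by (auto simp: dense_def K_def)
  have finK: "finite K" using finite_subset[OF KV finV] .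
  have cl: "E u v" if "u \<in> K" "v \<in> K" "u \<noteq> v" for u v
    using core_clique[OF t(1)] that by (auto simp: K_def)
  have cK: "t + 2 \<le> card K" using core_card[OF t(2)] by (simp add: K_def)
  assume "\<not> ?thesis"
  then have a: "\<And>y. y \<in> K \<Longrightarrow> E x y" by (auto simp: K_def)
  have xK: "x \<notin> K" using x by (simp add: K_def)
  have "dense t (insert x K)"
    unfolding dense_def
  proof (intro conjI ballI)
    show "insert x K \<subseteq> V" using KV x by auto
    fix v assume v: "v \<in> insert x K"
    have "insert x K - {v} \<subseteq> nb v \<inter> insert x K"
    proof
      fix w assume w: "w \<in> insert x K - {v}"
      then have "E v w" using a[of w] E_sym[OF a[of v]] cl[of v w] v by blast
      then show "w \<in> nb v \<inter> insert x K" using w by (simp add: nb_def)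
    qed
    then have "card (insert x K - {v}) \<le> card (nb v \<inter> insert x K)" by (intro card_mono) auto
    moreover have "card (insert x K - {v}) = card K" using v xK finK by simp
    ultimately show "t < card (nb v \<inter> insert x K)" using cK by linarith
  qed
  then show False using dense_le_core[of t "insert x K"] xK by (auto simp: K_def)
qed

text \<open>Deletion at the smaller threshold \<open>d\<close> stops at the same clique
  \<open>K\<close>. Otherwise take a longest path with nonadjacent ends from
  \<open>core d - K\<close> to \<open>K\<close>: its ends have at least \<open>d + 1\<close> and
  \<open>|K| - 1\<close> neighbours on it, together at least \<open>c + 1\<close>, and
  \<open>ends_gcyc\<close> gives a cycle that is too long.\<close>

lemma dense_le_clique_core:
  assumes t: "c \<le> 2 * t + 1" "core t \<noteq> {}"
    and d: "d = c + 1 - card (core t)" and X: "dense d X"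
  shows "X \<subseteq> core t"
proof (rule ccontr)
  assume n: "\<not> ?thesis"
  define K where "K = core t"
  have KV: "K \<subseteq> V" using dense_core[of t] by (auto simp: dense_def K_def)
  have finK: "finite K" using finite_subset[OF KV finV] .
  have cl: "E u v" if "u \<in> K" "v \<in> K" "u \<noteq> v" for u v
    using core_clique[OF t(1)] that by (auto simp: K_def)
  have cK: "t + 2 \<le> card K" "card K \<le> c" using core_card[OF t(2)] clique_card_le[OF cl KV]
    by (auto simp: K_def)
  have dt: "d \<le> t" "d + card K = c + 1" using cK t d by (auto simp: K_def)
  define D where "D = core d"
  have dD: "dense d D" "X \<subseteq> D" "K \<subseteq> D" using dense_core dense_le_core X dense_mono[OF dense_core dt(1)]
    by (auto simp: D_def K_def)
  have DV: "D \<subseteq> V" using dD by (auto simp: dense_def)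
  obtain x where x: "x \<in> D" "x \<notin> K" using n dD by (auto simp: K_def)
  have "x \<in> V - core t" using x DV by (auto simp: K_def)
  from core_not_joined[OF t this] have "\<exists>y\<in>K. \<not> E x y" by (simp add: K_def)
  then obtain y where y: "y \<in> K" "\<not> E x y" by blast
  obtain P where P: "gpath E P" "hd P \<in> D - K" "last P \<in> K" "\<not> E (hd P) (last P)"
    "c < length P" "set P \<subseteq> V"
    "\<And>Q. gpath E Q \<Longrightarrow> hd Q \<in> D - K \<Longrightarrow> last Q \<in> K \<Longrightarrow> \<not> E (hd Q) (last Q) \<Longrightarrow>
      length Q \<le> length P"
    using ex_longest_path[of x "D - K" y K] x y DV KV by blast
  have ne: "P \<noteq> []" using P(1) by auto
  have Nu: "nb (hd P) \<inter> D \<subseteq> set P"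
  proof (rule ccontr)
    assume "\<not> ?thesis"
    then obtain w where w: "E (hd P) w" "w \<in> D" "w \<notin> set P" by (auto simp: nb_def)
    have p: "gpath E (w # P)" using w P(1) E_sym by (auto simp: gpath_Cons)
    show False
    proof (cases "E w (last P)")
      case True
      then have "gcyc E (w # P)" using p ne P(5) c3 E_sym by (auto simp: gcyc_def)
      then show False using circ P(5) by force
    next
      case False
      then have "w \<notin> K" using cl[of w "last P"] P(3) w ne by (metis last_in_set)
      then show False using P(7)[OF p] w P(3) ne False by auto
    qed
  qed
  have Nv: "K - {last P} \<subseteq> set P"
  proof (rule ccontr)
    assume "\<not> ?thesis"
    then obtain w where w: "w \<in> K" "w \<notin> set P" "w \<noteq> last P" by auto
    have p: "gpath E (P @ [w])" using w P(1,3) cl[of "last P" w] ne by (auto simp: gpath_append gpath_Cons)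
    show False
    proof (cases "E (hd P) w")
      case True
      then have "gcyc E (P @ [w])" using p ne P(5) c3 E_sym by (auto simp: gcyc_def)
      then show False using circ P(5) by force
    next
      case False
      then show False using P(7)[OF p] w P(2) ne by auto
    qed
  qed
  have d1: "d < card (nb (hd P) \<inter> D)" using P(2) dD(1) by (auto simp: dense_def)
  have d2: "card (K - {last P}) = card K - 1" using P(3) finK by simp
  have "0 < card (nb (hd P) \<inter> D)" "0 < card (K - {last P})"
    using d1 d2 cK by simp_all
  then have ne2: "nb (hd P) \<inter> D \<noteq> {}" "K - {last P} \<noteq> {}" by (metis card.empty less_irrefl)+
  obtain Z where "gcyc E Z"
    "min (length P) (card (nb (hd P) \<inter> D) + card (K - {last P})) \<le> length Z"
    using ends_gcyc[OF P(1,6,4) Nu _ ne2(1) Nv _ ne2(2)] cl P(3) by (auto simp: nb_def)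
  then show False using circ[of Z] P(5) d1 d2 dt cK by linarith
qed

end

section \<open>Vertices outside a clique core\<close>

text \<open>The situation once \<open>d = k\<close> is known. The same \<open>k\<close> bounds the
  degrees from below and complements \<open>|K|\<close> to \<open>c + 1\<close>; this coincidence
  makes the later counts tight. The last bound on \<open>k\<close> is
  \<open>k \<le> t - 2\<close>.\<close>

locale clique_core = maximal_graph +
  fixes K :: "'a set" and k :: nat
  assumes KV: "K \<subseteq> V"
    and cl: "u \<in> K \<Longrightarrow> v \<in> K \<Longrightarrow> u \<noteq> v \<Longrightarrow> E u v"
    and cK: "card K + k = c + 1"
    and k2: "2 \<le> k"
    and kc: "2 * k + 4 \<le> c"
    and deg: "v \<in> V \<Longrightarrow> k \<le> card (nb v)"
    and notfull: "v \<in> V - K \<Longrightarrow> \<exists>y\<in>K. \<not> E v y"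
begin

lemma finK: "finite K" using KV finV finite_subset by blast

definition closed :: "'a set \<Rightarrow> bool" where
  "closed D \<longleftrightarrow> D \<subseteq> V - K \<and> (\<forall>a\<in>D. \<forall>b\<in>V - K. E a b \<longrightarrow> b \<in> D)"

text \<open>The ends need no condition of being nonadjacent: an edge between them would close a
  cycle on more than \<open>c\<close> vertices.\<close>

definition cand :: "'a set \<Rightarrow> 'a list \<Rightarrow> bool" where
  "cand D P \<longleftrightarrow> gpath E P \<and> hd P \<in> D \<and> last P \<in> K \<and> c < length P"

text \<open>A set is closed if it is a union of components of \<open>V - K\<close>, so rotations at the start of a candidate
  path keep it a candidate.\<close>

definition dmax :: "'a set \<Rightarrow> 'a list \<Rightarrow> bool" where
  "dmax D P \<longleftrightarrow> closed D \<and> cand D P \<and> (\<forall>Q. cand D Q \<longrightarrow> length Q \<le> length P)"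

lemma dmaxD:
  assumes "dmax D P"
  shows "gpath E P" "P \<noteq> []" "distinct P" "successively E P" "hd P \<in> D" "hd P \<notin> K" "last P \<in> K"
    "c < length P" "set P \<subseteq> V" "closed D"
  using assms gpath_set_V[of P] unfolding dmax_def closed_def cand_def gpath_def by auto

lemma closedD: "closed D \<Longrightarrow> a \<in> D \<Longrightarrow> E a b \<Longrightarrow> b \<notin> K \<Longrightarrow> b \<in> D"
  using E_V' unfolding closed_def by blast

lemma ex_dmax:
  assumes "closed D" "x \<in> D"
  shows "\<exists>P. dmax D P"
proof -
  have x: "x \<in> V - K" using assms by (auto simp: closed_def)
  then obtain y where y: "y \<in> K" "\<not> E x y" using notfull by blast
  obtain P0 where P0: "gpath E P0" "hd P0 = x" "last P0 = y" "c < length P0"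
    using maxi[of x y] x y KV by blast
  then have "cand D P0" using assms y by (auto simp: cand_def)
  moreover have "length P < Suc (card V)" if "cand D P" for P
  proof -
    have "set P \<subseteq> V" using that gpath_set_V[of P] assms(1) unfolding closed_def cand_def by blast
    then show ?thesis using that card_mono[OF finV, of "set P"] distinct_card[of P]
      unfolding cand_def gpath_def by simp
  qed
  ultimately obtain P where "cand D P" "\<forall>Q. cand D Q \<longrightarrow> length Q \<le> length P"
    using ex_has_greatest_nat[of "cand D" P0 length "Suc (card V)"] by blast
  then show ?thesis using assms by (auto simp: dmax_def)
qed

lemma gcyc_le: "gcyc E xs \<Longrightarrow> c < length xs \<Longrightarrow> False"
  using circ[of xs] by simp

lemma dmax_nonadj:
  assumes "dmax D P"
  shows "\<not> E (hd P) (last P)"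
proof
  assume "E (hd P) (last P)"
  then have "gcyc E P" using dmaxD[OF assms] c3 E_sym by (auto simp: gcyc_def)
  then show False using gcyc_le dmaxD[OF assms] by blast
qed

lemma dmax_K_subset:
  assumes "dmax D P"
  shows "K \<subseteq> set P"
proof
  fix w assume w: "w \<in> K"
  show "w \<in> set P"
  proof (rule ccontr)
    assume n: "w \<notin> set P"
    note P = dmaxD[OF assms]
    have "E (last P) w" using cl[of "last P" w] P w n by (metis last_in_set)
    then have "gpath E (P @ [w])" using P n by (auto simp: gpath_append gpath_Cons)
    then have "cand D (P @ [w])" using P w by (auto simp: cand_def)
    then show False using assms by (auto simp: dmax_def)
  qed
qed

text \<open>A missing neighbour is off \<open>K\<close>, hence in the closed set \<open>D\<close>,
  and could be put in front.\<close>

lemma dmax_nb_hd_subset: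
  assumes "dmax D P"
  shows "nb (hd P) \<subseteq> set P"
proof
  fix w assume w: "w \<in> nb (hd P)"
  show "w \<in> set P"
  proof (rule ccontr)
    assume n: "w \<notin> set P"
    note P = dmaxD[OF assms]
    have e: "E (hd P) w" using w by (simp add: nb_def)
    have "w \<notin> K" using n dmax_K_subset[OF assms] by blast
    then have wD: "w \<in> D" using closedD[OF P(10,5) e] by blast
    have "gpath E (w # P)" using P n e E_sym by (auto simp: gpath_Cons)
    then have "cand D (w # P)" using P wD by (auto simp: cand_def)
    then show False using assms by (auto simp: dmax_def)
  qed
qed

text \<open>If the vertex before \<open>hd B\<close> were in \<open>K\<close>, it would be adjacent
  to \<open>last P\<close>; then \<open>A\<close> followed by \<open>B\<close> backwards would close
  through the edge from \<open>hd B\<close> to \<open>hd P\<close>.\<close>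

lemma dmax_pred:
  assumes "dmax D P" "P = A @ B" "A \<noteq> []" "B \<noteq> []" "E (hd P) (hd B)"
  shows "last A \<notin> K"
proof
  assume a: "last A \<in> K"
  note P = dmaxD[OF assms(1)]
  have "last A \<in> set A" "last B \<in> set B" "set A \<inter> set B = {}" using P(3) assms by auto
  then have "last A \<noteq> last B" by auto
  then have "E (last A) (last B)" using cl a P(7) assms by auto
  then have "gpath E (A @ rev B)" using P(1) assms gpath_rev'[of B]
    by (auto simp: gpath_append hd_rev)
  moreover have "E (last (A @ rev B)) (hd (A @ rev B))" using assms E_sym by (auto simp: last_rev)
  ultimately have "gcyc E (A @ rev B)" using P(8) assms c3 by (auto simp: gcyc_def)
  then show False using gcyc_le P(8) assms by fastforce
qed

text \<open>A Posa rotation. The condition on \<open>last A\<close> keeps the new first vertex in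
  the set for which \<open>P\<close> is longest.\<close>

lemma dmax_rotate:
  assumes "dmax D P" "P = A @ B" "A \<noteq> []" "B \<noteq> []" "E (hd P) (hd B)" "last A \<in> D"
  shows "dmax D (rev A @ B)"
proof -
  note P = dmaxD[OF assms(1)]
  have "gpath E (rev A @ B)" using P(1) assms gpath_rev'[of A]
    by (auto simp: gpath_append last_rev)
  moreover have "hd (rev A @ B) = last A" "last (rev A @ B) = last P" "length (rev A @ B) = length P"
    using assms by (auto simp: hd_rev)
  ultimately show ?thesis using assms P unfolding dmax_def cand_def by auto
qed

text \<open>The positions off \<open>K\<close> at which the path cannot be rotated. If the first vertex has degree at least
  \<open>k\<close>, there are at most \<open>length P - (c + 1)\<close> of them.\<close>

definition inactive :: "'a list \<Rightarrow> nat set" where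
  "inactive P = {m. Suc m < length P \<and> P ! m \<notin> K \<and> \<not> E (hd P) (P ! Suc m)}"

lemma finite_inactive [simp]: "finite (inactive P)"
  by (rule finite_subset[of _ "{..<length P}"]) (auto simp: inactive_def)

text \<open>By \<open>dmax_pred\<close> the neighbours of the first vertex correspond to the
  positions off \<open>K\<close> at which the path can be rotated, and all of \<open>K\<close> is on
  \<open>P\<close>. The positions thus split into \<open>K\<close>, these, and the inactive
  ones.\<close>

lemma card_inactive:
  assumes "dmax D P"
  shows "card (inactive P) + card (nb (hd P)) + card K = length P"
proof -
  note P = dmaxD[OF assms]
  let ?n = "length P"
  define Z where "Z = {m. m < ?n \<and> P ! m \<notin> K}"
  define KI where "KI = {m. m < ?n \<and> P ! m \<in> K}"
  define A where "A = {m. Suc m < ?n \<and> P ! m \<notin> K \<and> E (hd P) (P ! Suc m)}"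
  have fin: "finite Z" "finite KI" "finite A"
    by (rule finite_subset[of _ "{..<?n}"], auto simp: Z_def KI_def A_def)+
  have "bij_betw ((!) P) KI K"
    unfolding bij_betw_def
  proof
    show "inj_on ((!) P) KI" using P(3) by (auto simp: inj_on_def KI_def nth_eq_iff_index_eq)
    show "(!) P ` KI = K" using dmax_K_subset[OF assms] by (force simp: KI_def image_iff in_set_conv_nth)
  qed
  then have cKI: "card KI = card K" by (rule bij_betw_same_card)
  have "bij_betw (\<lambda>m. P ! Suc m) A (nb (hd P))"
    unfolding bij_betw_def
  proof
    show "inj_on (\<lambda>m. P ! Suc m) A" using P(3) by (auto simp: inj_on_def A_def nth_eq_iff_index_eq)
    have "w \<in> (\<lambda>m. P ! Suc m) ` A" if w: "w \<in> nb (hd P)" for w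
    proof -
      obtain j where j: "j < ?n" "P ! j = w" using dmax_nb_hd_subset[OF assms] w by (meson in_set_conv_nth subsetD)
      have "w \<noteq> P ! 0" using w E_irr P(2) hd_conv_nth[of P] by (auto simp: nb_def)
      then have "j \<noteq> 0" using j by metis
      then obtain m where m: "j = Suc m" by (cases j) auto
      have "last (take j P) \<notin> K"
        using dmax_pred[OF assms, of "take j P" "drop j P"] j w P(2) \<open>j \<noteq> 0\<close>
        by (auto simp: nb_def hd_drop_conv_nth)
      moreover have "last (take j P) = P ! m" using j m by (simp add: take_Suc_conv_app_nth)
      ultimately show ?thesis using j m w by (auto simp: A_def nb_def)
    qed
    then show "(\<lambda>m. P ! Suc m) ` A = nb (hd P)" by (auto simp: A_def nb_def)
  qed
  then have cA: "card A = card (nb (hd P))" by (rule bij_betw_same_card)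
  have "Z = inactive P \<union> A"
  proof -
    have "Suc m < ?n" if "m < ?n" "P ! m \<notin> K" for m
    proof (rule ccontr)
      assume "\<not> Suc m < ?n"
      then have "m = ?n - 1" using that by auto
      then show False using that P(2,7) last_conv_nth[of P] by auto
    qed
    then show ?thesis by (auto simp: Z_def inactive_def A_def)
  qed
  moreover have "inactive P \<inter> A = {}" by (auto simp: inactive_def A_def)
  ultimately have "card Z = card (inactive P) + card A" using fin by (simp add: card_Un_disjoint)
  moreover have "{..<?n} = Z \<union> KI" "Z \<inter> KI = {}" by (auto simp: Z_def KI_def)
  then have "?n = card Z + card KI" using fin by (metis card_Un_disjoint card_lessThan)
  ultimately show ?thesis using cA cKI by simp
qed

lemma inactive_index:
  assumes "P = A @ z # w # B" "z \<notin> K" "\<not> E (hd P) w"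
  shows "length A \<in> inactive P"
  using assms by (auto simp: inactive_def nth_append)

lemma dmax_length_nonK:
  assumes "dmax D P"
  shows "length (filter (\<lambda>v. v \<notin> K) P) + card K = length P"
proof -
  note P = dmaxD[OF assms]
  have "set (filter (\<lambda>v. v \<in> K) P) = K" using dmax_K_subset[OF assms] by auto
  then have "length (filter (\<lambda>v. v \<in> K) P) = card K" using P(3) distinct_card distinct_filter by metis
  moreover have "length (filter (\<lambda>v. v \<in> K) P) + length (filter (\<lambda>v. v \<notin> K) P) = length P"
    by (rule sum_length_filter_compl)
  ultimately show ?thesis by simp
qed

text \<open>Otherwise no neighbour of \<open>hd P\<close> comes after a vertex of
  \<open>K - {last P}\<close>, all of which are neighbours of \<open>last P\<close>. Then
  \<open>noncrossing_gcyc\<close> gives a cycle on more than \<open>k + |K| - 1 = c\<close>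
  vertices.\<close>

lemma dmax_ex_crossing:
  assumes "dmax D P"
  shows "\<exists>A z w B. P = A @ z # w # B \<and> z \<notin> K \<and> E (hd P) w \<and> set A \<inter> K \<noteq> {}"
proof (rule ccontr)
  assume n: "\<not> ?thesis"
  note P = dmaxD[OF assms]
  let ?Nv = "K - {last P}"
  have x: "hd P \<in> V" using P by auto
  have "nb (hd P) \<noteq> {}" using deg[OF x] k2 by auto
  moreover have "card ?Nv = card K - 1" using P(7) finK by simp
  moreover have "0 < card ?Nv" using calculation(2) cK kc by linarith
  then have "?Nv \<noteq> {}" by (metis card.empty less_irrefl)
  moreover have "j \<le> i" if ij: "i < length P" "j < length P" "P ! i \<in> ?Nv" "P ! j \<in> nb (hd P)" for i j
  proof (rule ccontr)
    assume "\<not> j \<le> i"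
    then obtain m where m: "j = Suc m" "i \<le> m" by (cases j) auto
    have e: "E (hd P) (P ! j)" using ij by (simp add: nb_def)
    have "last (take j P) \<notin> K"
      using dmax_pred[OF assms, of "take j P" "drop j P"] ij e P(2) m
      by (auto simp: hd_drop_conv_nth)
    then have pm: "P ! m \<notin> K" using ij m by (simp add: take_Suc_conv_app_nth)
    have "P = take m P @ P ! m # P ! Suc m # drop (Suc (Suc m)) P"
      using ij m by (simp add: Cons_nth_drop_Suc)
    moreover have "i < m" using m pm ij by (metis DiffD1 le_neq_implies_less)
    then have "P ! i \<in> set (take m P)" using ij m by (auto simp: in_set_conv_nth)
    ultimately show False using n pm e m ij by blast
  qed
  moreover have "?Nv \<subseteq> set P" using dmax_K_subset[OF assms] by blast
  moreover have "\<And>w. w \<in> ?Nv \<Longrightarrow> E (last P) w" using cl P(7) by blast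
  moreover have "\<And>w. w \<in> nb (hd P) \<Longrightarrow> E (hd P) w" by (simp add: nb_def)
  ultimately obtain Z where "gcyc E Z" "card (nb (hd P)) + card ?Nv < length Z"
    using noncrossing_gcyc[OF P(1,9) dmax_nb_hd_subset[OF assms], of ?Nv] by blast
  moreover have "k \<le> card (nb (hd P))" by (rule deg[OF x])
  ultimately show False using circ[of Z] \<open>card ?Nv = card K - 1\<close> \<open>0 < card ?Nv\<close> cK by linarith
qed

text \<open>The pair can be opened: go from \<open>\<kappa>\<close> to \<open>hd F\<close>, from the
  end of \<open>F\<close> back to \<open>\<kappa>'\<close>, along \<open>B\<close> to
  \<open>s\<close>, and home to \<open>hd P\<close>. This cycle contains all of
  \<open>P\<close>.\<close>

lemma dmax_no_K_break:
  assumes "dmax D P" "P = A @ \<kappa> # \<kappa>' # B @ s # F" "\<kappa> \<in> K" "\<kappa>' \<in> K" "E (hd P) s"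
    "F \<noteq> []" "hd F \<in> K"
  shows False
proof -
  note P = dmaxD[OF assms(1)]
  have A: "A \<noteq> []" using P(6) assms(2,3) by auto
  have lF: "last F = last P" "last F \<in> K" using assms(2,6) P(7) by auto
  have e1: "E \<kappa> (hd F)" using cl[of \<kappa> "hd F"] assms P(3) by (cases F) auto
  have "last F \<noteq> \<kappa>'" using assms(2) P(3) last_in_set[OF assms(6)] by auto
  then have e2: "E (last F) \<kappa>'" using cl[of "last F" \<kappa>'] assms(4) lF by blast
  let ?Z = "A @ [\<kappa>] @ F @ \<kappa>' # B @ [s]"
  have "gpath E ?Z" using P(3,4) assms(2,6) e1 e2 A
    by (cases "B = []") (auto simp: gpath_def successively_append_iff successively_Cons)
  moreover have "E (last ?Z) (hd ?Z)" using A assms(2,5) E_sym by auto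
  ultimately have "gcyc E ?Z" using P(8) assms(2) c3 by (simp add: gcyc_def)
  then show False using gcyc_le P(8) assms(2) by fastforce
qed

section \<open>Longest candidates on exactly \<open>c + 1\<close> vertices\<close>

lemma dmax_short_adj_succ:
  assumes "dmax D P" "length P = Suc c" "P = A @ z # w # B" "z \<notin> K"
  shows "E (hd P) w"
proof (rule ccontr)
  assume "\<not> ?thesis"
  then have "length A \<in> inactive P" using inactive_index assms by blast
  then have "card (inactive P) > 0" by (auto simp: card_gt_0_iff)
  moreover have "k \<le> card (nb (hd P))" using deg dmaxD(2,9)[OF assms(1)] by (simp add: subset_iff)
  ultimately show False using card_inactive[OF assms(1)] cK assms(2) by linarith
qed

lemma dmax_short_degree:
  assumes "dmax D P" "length P = Suc c"
  shows "card (nb (hd P)) = k"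
proof -
  have "k \<le> card (nb (hd P))" using deg dmaxD(2,9)[OF assms(1)] by (simp add: subset_iff)
  then show ?thesis using card_inactive[OF assms(1)] cK assms(2) by linarith
qed

text \<open>The last vertex of \<open>B\<close> off \<open>K\<close> is followed by a neighbour
  \<open>s\<close> of \<open>hd P\<close> and then by another vertex of \<open>K\<close>, so
  \<open>dmax_no_K_break\<close> opens the pair.\<close>

lemma dmax_short_K_tail:
  assumes "dmax D P" "length P = Suc c" "P = A @ \<kappa> # \<kappa>' # B" "\<kappa> \<in> K" "\<kappa>' \<in> K"
  shows "set B \<subseteq> K"
proof (rule ccontr)
  note P = dmaxD[OF assms(1)]
  assume "\<not> ?thesis"
  then have "\<exists>z\<in>set B. z \<notin> K" by blast
  then obtain B1 z B2 where B: "B = B1 @ z # B2" "z \<notin> K" "\<forall>v\<in>set B2. v \<in> K"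
    using split_list_last_prop[of B "\<lambda>z. z \<notin> K"] by blast
  have "B2 \<noteq> []" using P(7) assms(3) B by auto
  then obtain s F where sF: "B2 = s # F" by (cases B2) auto
  have xs: "E (hd P) s" by (rule dmax_short_adj_succ[OF assms(1,2), of "A @ \<kappa> # \<kappa>' # B1" z s F]) (use assms(3) B sF in auto)
  have F: "F \<noteq> []" using dmax_nonadj[OF assms(1)] xs assms(3) B sF by (cases F) auto
  then have hF: "hd F \<in> K" using B(3) sF by auto
  show False by (rule dmax_no_K_break[OF assms(1) _ assms(4,5) xs F hF, of A "B1 @ [z]"]) (use assms(3) B sF in auto)
qed

text \<open>Since no position is inactive, \<open>x = hd P\<close> is adjacent to \<open>u'\<close>
  and to \<open>\<kappa>\<close>; it is not adjacent to \<open>u\<close>, which follows a vertex of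
  \<open>K\<close>. A rotation makes \<open>u\<close> the first vertex, and the same facts for the
  rotated path provide the chords of a cycle on \<open>c + 1\<close> vertices.\<close>

lemma dmax_short_no_double:
  assumes "dmax D P" "length P = Suc c" "P = A @ \<kappa> # u # u' # W" "\<kappa> \<in> K" "u \<notin> K" "u' \<notin> K"
  shows False
proof -
  note P = dmaxD[OF assms(1)]
  obtain x A' where A: "A = x # A'" using P(6) assms(3,4) by (cases A) auto
  have x: "hd P = x" using A assms(3) by simp
  have xu': "E x u'" using dmax_short_adj_succ[OF assms(1,2), of "A @ [\<kappa>]" u u' W] assms x by simp
  have xu: "\<not> E x u" using dmax_pred[OF assms(1), of "A @ [\<kappa>]" "u # u' # W"] assms x by auto
  have uu': "E u u'" using P(4) assms(3) by (auto simp: successively_append_iff successively_Cons)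
  have "u' \<in> D" using closedD[OF P(10,5)] xu' x assms(6) by auto
  then have uD: "u \<in> D" using closedD[OF P(10)] E_sym[OF uu'] assms(5) by auto
  \<comment> \<open>Rotation at the edge \<open>x u'\<close>. It stays among the candidates of
    \<open>D\<close> because \<open>x\<close> reaches \<open>u\<close> through \<open>u'\<close> off
    \<open>K\<close>.\<close>
  define P2 where "P2 = rev (A @ [\<kappa>, u]) @ u' # W"
  have d2: "dmax D P2" unfolding P2_def
    by (rule dmax_rotate[OF assms(1)]) (use assms(3) uD xu' x in auto)
  have P2e: "P2 = u # \<kappa> # rev A' @ x # u' # W" by (simp add: P2_def A)
  have l2: "length P2 = Suc c" using assms(2,3) by (simp add: P2_def)
  have h2: "hd P2 = u" by (simp add: P2e)
  \<comment> \<open>If the second vertex of \<open>P\<close> were off \<open>K\<close>, then on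
    \<open>P2\<close> it would be followed by \<open>x\<close>, which forces an edge between
    \<open>u\<close> and \<open>x\<close>.\<close>
  have A'K: "hd (A' @ [\<kappa>]) \<in> K"
  proof (rule ccontr)
    assume n: "hd (A' @ [\<kappa>]) \<notin> K"
    then obtain x' A'' where "A' = x' # A''" "x' \<notin> K" using assms(4) by (cases A') auto
    then have "E u x" using dmax_short_adj_succ[OF d2 l2, of "u # \<kappa> # rev A''" x' x "u' # W"] h2 by (simp add: P2e)
    then show False using xu E_sym by blast
  qed
  have "last A \<notin> K"
  proof
    assume a: "last A \<in> K"
    have "P = butlast A @ last A # \<kappa> # u # u' # W" using assms(3) A by simp
    from dmax_short_K_tail[OF assms(1,2) this a assms(4)] show False using assms(5) by auto
  qed
  moreover have "P = butlast A @ last A # \<kappa> # u # u' # W" using assms(3) A by simp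
  ultimately have xk: "E x \<kappa>" using dmax_short_adj_succ[OF assms(1,2)] x by metis
  have "\<exists>v\<in>set W. v \<in> K" using P(7) assms(3,6) by (metis append_is_Nil_conv last_ConsL last_ConsR last_append last_in_set list.distinct(1))
  then obtain W1 \<kappa>2 W2 where W: "W = W1 @ \<kappa>2 # W2" "\<kappa>2 \<in> K" "\<forall>v\<in>set W1. v \<notin> K"
    using split_list_first_prop[of W "\<lambda>v. v \<in> K"] by blast
  have xK: "x \<notin> K" using P(6) x by simp
  have ul: "E u (last (u' # W1))"
  proof (cases W1 rule: rev_cases)
    case Nil
    then show ?thesis using uu' by simp
  next
    case (snoc W0 v)
    show ?thesis
    proof (cases W0 rule: rev_cases)
      case Nil
      then show ?thesis using dmax_short_adj_succ[OF d2 l2, of "u # \<kappa> # rev A' @ [x]" u' v "\<kappa>2 # W2"] W snoc assms(6) h2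
        by (simp add: P2e)
    next
      case (snoc W00 v')
      then show ?thesis using dmax_short_adj_succ[OF d2 l2, of "u # \<kappa> # rev A' @ x # u' # W00" v' v "\<kappa>2 # W2"] W
          \<open>W1 = W0 @ [v]\<close> h2 by (simp add: P2e)
    qed
  qed
  have uk: "E u \<kappa>2"
  proof (cases W1 rule: rev_cases)
    case Nil
    then show ?thesis using dmax_short_adj_succ[OF d2 l2, of "u # \<kappa> # rev A' @ [x]" u' \<kappa>2 W2] W assms(6) h2
      by (simp add: P2e)
  next
    case (snoc W0 v)
    then show ?thesis using dmax_short_adj_succ[OF d2 l2, of "u # \<kappa> # rev A' @ x # u' # W0" v \<kappa>2 W2] W h2
      by (simp add: P2e)
  qed
  \<comment> \<open>The new chords are \<open>\<kappa> x\<close>, \<open>x u'\<close>, the edge from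
    the end of \<open>u' # W1\<close> to \<open>u\<close>, and \<open>u \<kappa>2\<close>. The cycle
    closes because \<open>last P\<close> and the second vertex of \<open>P\<close> are both in
    \<open>K\<close>.\<close>
  let ?Z = "(A' @ [\<kappa>]) @ x # (u' # W1) @ u # \<kappa>2 # W2"
  have Pe: "P = x # (A' @ [\<kappa>]) @ u # (u' # W1) @ \<kappa>2 # W2" using assms(3) A W by simp
  have sP: "successively E (A' @ [\<kappa>])" "successively E (u' # W1)" "successively E (\<kappa>2 # W2)"
    using P(4) unfolding Pe successively_append_iff successively_Cons by auto
  have dP: "distinct ?Z" using P(3) unfolding Pe by auto
  have "successively E ?Z"
    using sP E_sym[OF xk] xu' ul uk E_sym[OF ul] unfolding successively_append_iff successively_Cons[of E x]
      successively_Cons[of E u] by auto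
  then have "gpath E ?Z" using dP by (simp add: gpath_def)
  moreover have "E (last ?Z) (hd ?Z)"
  proof -
    have l: "last ?Z = last (\<kappa>2 # W2)" "hd ?Z = hd (A' @ [\<kappa>])" by (simp_all add: hd_append)
    have "last (\<kappa>2 # W2) \<in> K" using P(7) unfolding Pe by simp
    moreover have "last (\<kappa>2 # W2) \<in> set (\<kappa>2 # W2)" "hd (A' @ [\<kappa>]) \<in> set (A' @ [\<kappa>])"
      by (rule last_in_set, simp, rule hd_in_set, simp)
    moreover have "set (\<kappa>2 # W2) \<inter> set (A' @ [\<kappa>]) = {}" using dP by auto
    ultimately have "last (\<kappa>2 # W2) \<noteq> hd (A' @ [\<kappa>])" by (metis IntI empty_iff)
    moreover note \<open>last (\<kappa>2 # W2) \<in> K\<close>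
    ultimately show ?thesis using cl A'K l by metis
  qed
  ultimately have "gcyc E ?Z" using assms(2) Pe c3 by (simp add: gcyc_def)
  moreover have "length ?Z = Suc c" using assms(2) unfolding Pe by simp
  ultimately show False using gcyc_le by (metis lessI)
qed

text \<open>A pair \<open>(w, s)\<close> is meant as an excursion on one vertex: \<open>w\<close>
  off \<open>K\<close>, followed by the return to \<open>s\<close> in \<open>K\<close>.\<close>

definition flat :: "('a \<times> 'a) list \<Rightarrow> 'a list" where
  "flat prs = concat (map (\<lambda>(w, s). [w, s]) prs)"

lemma flat_simps [simp]: "flat [] = []" "flat (p # prs) = fst p # snd p # flat prs"
  "flat (prs @ prs') = flat prs @ flat prs'"
  by (auto simp: flat_def split: prod.splits)

lemma set_flat: "set (flat prs) = fst ` set prs \<union> snd ` set prs"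
  by (induction prs) auto

lemma alternating_decomp:
  assumes "xs \<noteq> []" "hd xs \<in> K" "last xs \<in> K"
    "\<And>A u u' B. xs = A @ u # u' # B \<Longrightarrow> u \<notin> K \<Longrightarrow> u' \<notin> K \<Longrightarrow> False"
    "\<And>A u u' B. xs = A @ u # u' # B \<Longrightarrow> u \<in> K \<Longrightarrow> u' \<in> K \<Longrightarrow> set B \<subseteq> K"
  shows "\<exists>s0 prs F. xs = s0 # flat prs @ F \<and> s0 \<in> K \<and> set F \<subseteq> K \<and>
    (\<forall>p\<in>set prs. fst p \<notin> K \<and> snd p \<in> K)"
  using assms
proof (induction "length xs" arbitrary: xs rule: less_induct)
  case less
  obtain s0 ys where xs: "xs = s0 # ys" using less.prems(1) by (cases xs) auto
  show ?case
  proof (cases "ys = [] \<or> hd ys \<in> K")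
    case True
    then have "set ys \<subseteq> K" using less.prems(5)[of "[]" s0 "hd ys" "tl ys"] less.prems(2) xs
      by (cases ys) auto
    then show ?thesis using less.prems(2) xs by (intro exI[of _ s0] exI[of _ "[]"] exI[of _ ys]) auto
  next
    case False
    then obtain w zs where ys: "ys = w # zs" "w \<notin> K" by (cases ys) auto
    have zs: "zs \<noteq> []" using less.prems(3) xs ys by auto
    have hz: "hd zs \<in> K" using less.prems(4)[of "[s0]" w "hd zs" "tl zs"] xs ys zs by auto
    have lz: "last zs \<in> K" using less.prems(3) xs ys zs by auto
    have "\<exists>s1 prs F. zs = s1 # flat prs @ F \<and> s1 \<in> K \<and> set F \<subseteq> K \<and>
      (\<forall>p\<in>set prs. fst p \<notin> K \<and> snd p \<in> K)"
    proof (rule less.hyps[OF _ zs hz lz])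
      show "length zs < length xs" using xs ys by simp
      show False if "zs = A @ u # u' # B" "u \<notin> K" "u' \<notin> K" for A u u' B
        using less.prems(4)[of "s0 # w # A" u u' B] that xs ys by simp
      show "set B \<subseteq> K" if "zs = A @ u # u' # B" "u \<in> K" "u' \<in> K" for A u u' B
        using less.prems(5)[of "s0 # w # A" u u' B] that xs ys by simp
    qed
    then obtain s1 prs F where "zs = s1 # flat prs @ F" "s1 \<in> K" "set F \<subseteq> K"
      "\<forall>p\<in>set prs. fst p \<notin> K \<and> snd p \<in> K" by blast
    then show ?thesis using xs ys less.prems(2)
      by (intro exI[of _ s0] exI[of _ "(w, s1) # prs"] exI[of _ F]) auto
  qed
qed

abbreviation ini :: "'a list \<Rightarrow> 'a list" where "ini P \<equiv> takeWhile (\<lambda>v. v \<notin> K) P"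
abbreviation rst :: "'a list \<Rightarrow> 'a list" where "rst P \<equiv> dropWhile (\<lambda>v. v \<notin> K) P"

lemma dmax_ini_rst:
  assumes "dmax D P"
  shows "P = ini P @ rst P" "ini P \<noteq> []" "rst P \<noteq> []" "hd (ini P) = hd P" "hd (rst P) \<in> K"
    "set (ini P) \<inter> K = {}" "last (rst P) = last P"
proof -
  note P = dmaxD[OF assms]
  show "P = ini P @ rst P" by simp
  show "ini P \<noteq> []" using P(2,6) by (cases P) auto
  then show "hd (ini P) = hd P" using P(2) by (cases P) auto
  show r: "rst P \<noteq> []" using P(2,7) by (auto simp: dropWhile_eq_Nil_conv)
  show "hd (rst P) \<in> K" using hd_dropWhile[OF r] by blast
  show "set (ini P) \<inter> K = {}" by (auto dest: set_takeWhileD)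
  show "last (rst P) = last P" using r by (metis last_append takeWhile_dropWhile_id)
qed

lemma dmax_ini_subset:
  assumes "dmax D P"
  shows "set (ini P) \<subseteq> D"
proof -
  note P = dmaxD[OF assms]
  have "set xs \<subseteq> D" if "successively E xs" "xs \<noteq> []" "hd xs \<in> D" "set xs \<inter> K = {}" for xs
    using that
  proof (induction xs)
    case (Cons x xs)
    show ?case
    proof (cases "xs = []")
      case False
      then have "hd xs \<notin> K" "E x (hd xs)" using Cons.prems by (auto simp: successively_Cons disjoint_iff)
      then have "hd xs \<in> D" using closedD[OF P(10), of x "hd xs"] Cons.prems by simp
      then show ?thesis using Cons False by (simp add: successively_Cons)
    qed (use Cons in simp)
  qed simp
  moreover have "successively E (ini P)"
    using P(4) by (metis successively_append_iff takeWhile_dropWhile_id)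
  ultimately show ?thesis using dmax_ini_rst[OF assms] P(5) by metis
qed

text \<open>After the first visit to \<open>K\<close>, two consecutive vertices off \<open>K\<close>
  are excluded by \<open>dmax_short_no_double\<close>, and two consecutive ones in \<open>K\<close>
  start the tail \<open>F\<close>; so the path alternates until it stays in \<open>K\<close>. As
  \<open>|P| - |K| = k\<close>, exactly \<open>k\<close> of its vertices are off
  \<open>K\<close>.\<close>

lemma dmax_short_decomp:
  assumes "dmax D P" "length P = Suc c"
  shows "\<exists>s0 prs F. rst P = s0 # flat prs @ F \<and> s0 \<in> K \<and> set F \<subseteq> K \<and>
    (\<forall>p\<in>set prs. fst p \<notin> K \<and> snd p \<in> K) \<and> prs \<noteq> [] \<and> length (ini P) + length prs = k \<and>
    nb (hd P) = (set (ini P) - {hd P}) \<union> insert s0 (snd ` set prs)"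
proof -
  note P = dmaxD[OF assms(1)] and I = dmax_ini_rst[OF assms(1)]
  have nd: False if "rst P = A @ u # u' # B" "u \<notin> K" "u' \<notin> K" for A u u' B
  proof -
    have "A \<noteq> []" using that I(5) by auto
    then have "hd (A @ [u]) \<in> K" using I(5) that by auto
    then have "\<exists>v\<in>set A. v \<in> K" using \<open>A \<noteq> []\<close> by (metis hd_append2 hd_in_set)
    then obtain A1 \<kappa> A2 where A: "A = A1 @ \<kappa> # A2" "\<kappa> \<in> K" "\<forall>v\<in>set A2. v \<notin> K"
      using split_list_last_prop[of A "\<lambda>v. v \<in> K"] by blast
    obtain u1 u2 W where U: "A2 @ u # u' # B = u1 # u2 # W" "u1 \<notin> K" "u2 \<notin> K"
    proof (cases A2)
      case Nil
      then show ?thesis using \<open>u \<notin> K\<close> \<open>u' \<notin> K\<close> by (intro that[of u u' B]) auto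
    next
      case (Cons a A3)
      then show ?thesis using A(3) \<open>u \<notin> K\<close> by (cases A3) (auto intro!: that)
    qed
    have "P = (ini P @ A1) @ \<kappa> # u1 # u2 # W" using I(1) that(1) A(1) U(1)
      by (metis append.assoc append_Cons)
    then show False using dmax_short_no_double[OF assms] A(2) U(2,3) by blast
  qed
  have nb: "set B \<subseteq> K" if "rst P = A @ u # u' # B" "u \<in> K" "u' \<in> K" for A u u' B
    using dmax_short_K_tail[OF assms, of "ini P @ A" u u' B] that I(1) by (metis append.assoc)
  obtain s0 prs F where R: "rst P = s0 # flat prs @ F" "s0 \<in> K" "set F \<subseteq> K"
    "\<forall>p\<in>set prs. fst p \<notin> K \<and> snd p \<in> K"
  proof -
    have "\<exists>s0 prs F. rst P = s0 # flat prs @ F \<and> s0 \<in> K \<and> set F \<subseteq> K \<and>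
      (\<forall>p\<in>set prs. fst p \<notin> K \<and> snd p \<in> K)"
    proof (rule alternating_decomp[OF I(3,5)])
      show "last (rst P) \<in> K" using I(7) P(7) by simp
    qed (fact nd, fact nb)
    then show ?thesis using that by blast
  qed
  have Pe: "P = ini P @ s0 # flat prs @ F" using I(1) R(1) by metis
  \<comment> \<open>All these vertices are successors of vertices off \<open>K\<close>. Their number
    is \<open>k\<close>, the degree of the first vertex, so the inclusion is an equality.\<close>
  have sub: "insert s0 (snd ` set prs) \<union> (set (ini P) - {hd P}) \<subseteq> nb (hd P)"
  proof
    fix w assume "w \<in> insert s0 (snd ` set prs) \<union> (set (ini P) - {hd P})"
    then consider "w = s0" | "w \<in> snd ` set prs" | "w \<in> set (ini P)" "w \<noteq> hd P" by blast
    then show "w \<in> nb (hd P)"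
    proof cases
      case 1
      have "P = butlast (ini P) @ last (ini P) # s0 # flat prs @ F" using Pe I(2)
        by (metis append.assoc append_Cons append_Nil append_butlast_last_id)
      moreover have "last (ini P) \<notin> K" using I(2,6) last_in_set by blast
      ultimately have "E (hd P) s0" by (rule dmax_short_adj_succ[OF assms])
      then show ?thesis using 1 by (simp add: nb_def)
    next
      case 2
      then obtain p where p: "p \<in> set prs" "w = snd p" by blast
      then obtain pr1 pr2 where "prs = pr1 @ p # pr2" by (meson split_list)
      then have "P = (ini P @ s0 # flat pr1) @ fst p # w # (flat pr2 @ F)" using Pe p(2)
        by (metis append.assoc append_Cons flat_simps(2,3))
      then have "E (hd P) w" by (rule dmax_short_adj_succ[OF assms]) (use R(4) p(1) in blast)
      then show ?thesis by (simp add: nb_def)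
    next
      case 3
      then obtain I1 I2 where J: "ini P = I1 @ w # I2" by (meson split_list)
      have "I1 \<noteq> []" using J 3 I(4) by auto
      then have "P = butlast I1 @ last I1 # w # (I2 @ s0 # flat prs @ F)" using Pe J
        by (metis append.assoc append_Cons append_Nil append_butlast_last_id)
      moreover have "last I1 \<in> set (ini P)" using J \<open>I1 \<noteq> []\<close> by simp
      then have "last I1 \<notin> K" using I(6) by blast
      ultimately have "E (hd P) w" by (rule dmax_short_adj_succ[OF assms])
      then show ?thesis by (simp add: nb_def)
    qed
  qed
  have dis: "distinct (ini P @ s0 # flat prs @ F)" using P(3) Pe by metis
  have snd_inj: "card (snd ` set prs) = length prs" if "distinct (flat prs)" for prs
    using that by (induction prs) (auto simp: set_flat)
  have cs: "card (insert s0 (snd ` set prs) \<union> (set (ini P) - {hd P})) = length (ini P) + length prs"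
  proof -
    have "card (set (ini P) - {hd P}) = length (ini P) - 1"
      using dis hd_in_set[OF I(2)] I(4) distinct_card[of "ini P"] by (simp add: card_Diff_singleton)
    moreover have "card (insert s0 (snd ` set prs)) = Suc (length prs)"
      using dis snd_inj[of prs] by (auto simp: set_flat)
    moreover have "insert s0 (snd ` set prs) \<inter> (set (ini P) - {hd P}) = {}"
      using I(6) R(2,4) by auto
    moreover have "0 < length (ini P)" using I(2) by simp
    ultimately show ?thesis by (subst card_Un_disjoint) auto
  qed
  have "filter (\<lambda>v. v \<notin> K) (flat prs) = map fst prs" using R(4) by (induction prs) auto
  moreover have "filter (\<lambda>v. v \<notin> K) F = []" using R(3) by (auto simp: filter_empty_conv)
  moreover have "filter (\<lambda>v. v \<notin> K) (ini P) = ini P" using I(6) by (auto simp: filter_id_conv)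
  ultimately have "filter (\<lambda>v. v \<notin> K) (ini P @ s0 # flat prs @ F) = ini P @ map fst prs" using R(2) by simp
  then have "length (filter (\<lambda>v. v \<notin> K) P) = length (ini P) + length prs" using Pe by (metis length_append length_map)
  then have len: "length (ini P) + length prs = k" using dmax_length_nonK[OF assms(1)] assms(2) cK by linarith
  have nbe: "nb (hd P) = (set (ini P) - {hd P}) \<union> insert s0 (snd ` set prs)"
    using card_subset_eq[OF finite_nb sub] cs len dmax_short_degree[OF assms] by (simp add: Un_commute)
  \<comment> \<open>Without an excursion all vertices off \<open>K\<close> would precede those in
    \<open>K\<close>, against \<open>dmax_ex_crossing\<close>.\<close>
  have "prs \<noteq> []"
  proof
    assume e: "prs = []"
    obtain A z w B where c: "P = A @ z # w # B" "z \<notin> K" "set A \<inter> K \<noteq> {}"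
      using dmax_ex_crossing[OF assms(1)] by blast
    have "z \<in> set P" using c(1) by simp
    then have "z \<in> set (ini P @ s0 # F)" using Pe e by (metis append_Nil flat_simps(1))
    then have "z \<in> set (ini P)" using c(2) R(2,3) by auto
    moreover obtain \<kappa> where "\<kappa> \<in> set A" "\<kappa> \<in> K" using c(3) by blast
    then have "ini P = ini A" unfolding c(1) by (intro takeWhile_append1) auto
    ultimately have "z \<in> set A" by (metis set_takeWhileD)
    then show False using P(3) c(1) by auto
  qed
  then show ?thesis using R len nbe by blast
qed

section \<open>Longest candidates on more than \<open>c + 1\<close> vertices\<close>

lemma dmax_block_length:
  assumes "dmax D P" "P = A @ \<kappa> # U @ w # B" "\<kappa> \<in> K" "E (hd P) w"
  shows "length P \<le> c + length U"
proof (rule ccontr)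
  assume n: "\<not> ?thesis"
  note P = dmaxD[OF assms(1)]
  let ?X = "A @ [\<kappa>]" and ?Y = "w # B"
  have lY: "last ?Y = last P" using assms(2) by simp
  have "last ?Y \<in> set ?Y" by (rule last_in_set) simp
  moreover have "\<kappa> \<notin> set ?Y" using P(3) assms(2) by auto
  ultimately have "\<kappa> \<noteq> last ?Y" by metis
  then have e: "E \<kappa> (last ?Y)" using cl assms(3) P(7) lY by metis
  have g: "gpath E ?X" "gpath E ?Y" "set ?X \<inter> set ?Y = {}"
    using P(3,4) assms(2) by (auto simp: gpath_def successively_append_iff successively_Cons)
  have "E (last ?X) (hd (rev ?Y))" unfolding hd_rev using e by simp
  moreover have "gpath E (rev ?Y)" "set ?X \<inter> set (rev ?Y) = {}"
    using g(2,3) gpath_rev'[of ?Y] by auto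
  ultimately have "gpath E (?X @ rev ?Y)" using g(1) by (simp only: gpath_append) simp
  moreover have "last (?X @ rev ?Y) = w" by simp
  moreover have "hd (?X @ rev ?Y) = hd P" using assms(2) by (cases A) auto
  moreover have l: "length (?X @ rev ?Y) + length U = length P" using assms(2) by simp
  \<comment> \<open>This cycle omits exactly \<open>U\<close>: from \<open>\<kappa>\<close> it jumps
    to \<open>last P\<close> and runs backwards to \<open>w\<close>, a neighbour of
    \<open>hd P\<close>.\<close>
  ultimately have "gcyc E (?X @ rev ?Y)" using assms(4) E_sym n c3 by (simp add: gcyc_def)
  then show False using gcyc_le n l by (metis add.commute nat_add_left_cancel_less not_le)
qed

text \<open>Let \<open>U\<close> run from the last vertex of \<open>K\<close> before a crossing to
  the next neighbour of \<open>hd P\<close>. All its positions but the last are inactive, and there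
  are at most \<open>|P| - c - 1\<close> inactive positions. On the other hand
  \<open>|U| \<ge> |P| - c\<close> by \<open>dmax_block_length\<close>. The bounds meet, so equality
  holds everywhere.\<close>

lemma dmax_long_gap:
  assumes "dmax D P" "Suc c < length P"
  shows "\<exists>A \<kappa> U w B. P = A @ \<kappa> # U @ w # B \<and> \<kappa> \<in> K \<and> set U \<inter> K = {} \<and> E (hd P) w \<and>
    length U = length P - c \<and> inactive P = {Suc (length A)..<length A + length U} \<and>
    card (nb (hd P)) = k"
proof -
  note P = dmaxD[OF assms(1)]
  obtain A0 z w0 B0 where c: "P = A0 @ z # w0 # B0" "z \<notin> K" "E (hd P) w0" "set A0 \<inter> K \<noteq> {}"
    using dmax_ex_crossing[OF assms(1)] by blast
  have "\<exists>v\<in>set A0. v \<in> K" using c(4) by blast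
  then obtain A \<kappa> U0 where A: "A0 = A @ \<kappa> # U0" "\<kappa> \<in> K" "\<forall>v\<in>set U0. v \<notin> K"
    using split_list_last_prop[of A0 "\<lambda>v. v \<in> K"] by blast
  define V0 where "V0 = U0 @ [z, w0]"
  have "\<exists>v\<in>set V0. E (hd P) v" using c(3) by (auto simp: V0_def)
  then obtain U w V2 where V: "V0 = U @ w # V2" "E (hd P) w" "\<forall>v\<in>set U. \<not> E (hd P) v"
    using split_list_first_prop[of V0 "\<lambda>v. E (hd P) v"] by blast
  define B where "B = V2 @ B0"
  have Pe: "P = A @ \<kappa> # U @ w # B" using c(1) A(1) V(1) by (simp add: V0_def B_def)
  have Une: "U \<noteq> []" using dmax_pred[OF assms(1), of "A @ [\<kappa>]" "U @ w # B"] Pe V(2) A(2) by auto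
  have "set U \<subseteq> set (butlast V0)" unfolding V(1) by (simp add: butlast_append)
  then have UK: "set U \<inter> K = {}" using A(3) c(2) by (auto simp: V0_def butlast_append)
  have lU: "length P \<le> c + length U" using dmax_block_length[OF assms(1) Pe A(2) V(2)] .
  have sub: "{Suc (length A)..<length A + length U} \<subseteq> inactive P"
  proof
    fix m assume m: "m \<in> {Suc (length A)..<length A + length U}"
    then obtain i where i: "m = length A + Suc i" "Suc i < length U"
      by (metis add_Suc_right add_less_cancel_left atLeastLessThan_iff le_Suc_ex plus_nat.simps(2))
    have "P ! m = U ! i" "P ! Suc m = U ! Suc i" unfolding Pe i(1) using i(2) by (auto simp: nth_append)
    moreover have "U ! i \<in> set U" "U ! Suc i \<in> set U" using i(2) by auto
    moreover have "Suc m < length P" unfolding Pe i(1) using i(2) by simp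
    ultimately show "m \<in> inactive P" using UK V(3) by (auto simp: inactive_def)
  qed
  have kn: "k \<le> card (nb (hd P))" using deg P(2,9) by (simp add: subset_iff)
  have ci: "card (inactive P) + card (nb (hd P)) + card K = length P" by (rule card_inactive[OF assms(1)])
  have "length U - 1 \<le> card (inactive P)" using card_mono[OF finite_inactive sub] by simp
  moreover have "0 < length U" using Une by simp
  ultimately have "length U + c = length P" using lU kn ci cK by linarith
  moreover have "card (nb (hd P)) = k" using calculation lU kn ci cK
      \<open>length U - 1 \<le> card (inactive P)\<close> \<open>0 < length U\<close> by linarith
  ultimately have eqs: "card (inactive P) = length U - 1" "length U = length P - c" "card (nb (hd P)) = k"
    using ci cK by linarith+
  have "inactive P = {Suc (length A)..<length A + length U}"
    using card_subset_eq[OF finite_inactive sub] eqs(1) by simp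
  then show ?thesis using Pe A(2) UK V(2) eqs by blast
qed

text \<open>A vertex off \<open>K\<close> right after a vertex of \<open>K\<close> occupies an
  inactive position, and these all lie in \<open>U\<close>. So the path leaves \<open>K\<close> only
  once, at the front of \<open>U\<close>, which fixes the rest of its shape.\<close>

lemma dmax_long_split:
  assumes "dmax D P" "Suc c < length P"
  shows "\<exists>I \<kappa> U W s F. P = I @ \<kappa> # U @ W @ s # F \<and> I \<noteq> [] \<and> set I \<inter> K = {} \<and> set U \<inter> K = {} \<and>
    set W \<inter> K = {} \<and> \<kappa> \<in> K \<and> s \<in> K \<and> set F \<subseteq> K \<and> F \<noteq> [] \<and> E (hd P) (hd (W @ [s])) \<and>
    length U = length P - c \<and> inactive P = {Suc (length I)..<length I + length U} \<and>
    card (nb (hd P)) = k"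
proof -
  note P = dmaxD[OF assms(1)]
  obtain A \<kappa> U w B where S: "P = A @ \<kappa> # U @ w # B" "\<kappa> \<in> K" "set U \<inter> K = {}" "E (hd P) w"
    "length U = length P - c" "inactive P = {Suc (length A)..<length A + length U}" "card (nb (hd P)) = k"
    using dmax_long_gap[OF assms] by blast
  have Une: "U \<noteq> []" using S(5) assms(2) by auto
  \<comment> \<open>If \<open>w'\<close> were adjacent to \<open>hd P\<close>, then
    \<open>dmax_block_length\<close> with the block \<open>[u]\<close> would give
    \<open>|P| \<le> c + 1\<close>.\<close>
  have uniq: "length A' = length A" if e: "P = A' @ \<kappa>' # u # B'" "\<kappa>' \<in> K" "u \<notin> K" for A' \<kappa>' u B'
  proof -
    have "B' \<noteq> []" using e P(7) by auto
    then obtain w' B'' where B': "B' = w' # B''" by (cases B') auto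
    have "\<not> E (hd P) w'"
    proof
      assume "E (hd P) w'"
      then have "length P \<le> c + length [u]"
        using dmax_block_length[OF assms(1), of A' \<kappa>' "[u]" w' B''] e B' by simp
      then show False using assms(2) by simp
    qed
    then have "length (A' @ [\<kappa>']) \<in> inactive P" using inactive_index[of P "A' @ [\<kappa>']" u w' B''] e B' by simp
    then have l: "length A \<le> length A'" "length A' < length A + length U - 1" using S(6) by auto
    show ?thesis
    proof (rule ccontr)
      assume "length A' \<noteq> length A"
      then obtain i where i: "length A' = length A + Suc i" using l(1)
        by (metis add_Suc_right le_neq_implies_less less_iff_Suc_add)
      have iU: "i < length U" using l(2) i by linarith
      have "P ! length A' = \<kappa>'" using e(1) by simp
      moreover have "P ! length A' = U ! i" unfolding S(1) i using iU by (simp add: nth_append)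
      moreover have "U ! i \<in> set U" using iU by simp
      ultimately show False using S(3) e(2) by auto
    qed
  qed
  have allK: "set Y \<subseteq> K" if e: "P = X @ Y @ Z" "Y \<noteq> []" "hd Y \<in> K" "length A < length X \<or> length X + length Y \<le> length A"
    for X Y Z
  proof (rule ccontr)
    assume "\<not> ?thesis"
    then have "\<exists>z\<in>set Y. z \<notin> K" by blast
    then obtain Y1 z Y2 where Y: "Y = Y1 @ z # Y2" "z \<notin> K" "\<forall>v\<in>set Y1. v \<in> K"
      using split_list_first_prop[of Y "\<lambda>z. z \<notin> K"] by auto
    have "Y1 \<noteq> []" using Y e(3) by auto
    then obtain Y0 y where Y1: "Y1 = Y0 @ [y]" by (cases Y1 rule: rev_cases) auto
    have "length (X @ Y0) = length A" using uniq[of "X @ Y0" y z "Y2 @ Z"] e(1) Y Y1 by simp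
    then show False using e(4) Y(1) Y1 by auto
  qed
  define W where "W = ini (w # B)"
  have "last (w # B) \<in> K" using P(7) S(1) by simp
  moreover have "last (w # B) \<in> set (w # B)" by (rule last_in_set) simp
  ultimately have "rst (w # B) \<noteq> []" by (metis dropWhile_eq_Nil_conv)
  then obtain s F where sF: "rst (w # B) = s # F" by (cases "rst (w # B)") auto
  have sK: "s \<in> K" using hd_dropWhile[of "\<lambda>v. v \<notin> K" "w # B"] sF by auto
  have wB: "w # B = W @ s # F" using sF W_def by (metis takeWhile_dropWhile_id)
  have WK: "set W \<inter> K = {}" unfolding W_def using set_takeWhileD[of _ "\<lambda>v. v \<notin> K" "w # B"] by blast
  have Pe: "P = A @ \<kappa> # U @ W @ s # F" using S(1) wB by simp
  have FK: "set (s # F) \<subseteq> K" using allK[of "A @ \<kappa> # U @ W" "s # F" "[]"] Pe sK by simp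
  \<comment> \<open>The vertex before \<open>s\<close> is the last of \<open>U\<close> or comes
    after \<open>U\<close>, so its position is not inactive.\<close>
  have es: "E (hd P) s"
  proof (rule ccontr)
    assume n: "\<not> ?thesis"
    obtain V v where V: "U @ W = V @ [v]" using Une by (cases "U @ W" rule: rev_cases) auto
    have "v \<in> set (U @ W)" using V by simp
    then have "v \<notin> K" using S(3) WK by auto
    moreover have "P = (A @ \<kappa> # V) @ v # s # F" using Pe V by (metis append.assoc append_Cons append_Nil)
    ultimately have "length (A @ \<kappa> # V) \<in> inactive P" using inactive_index n by blast
    moreover have "length (U @ W) = Suc (length V)" using V by simp
    ultimately show False using S(6) by auto
  qed
  have F: "F \<noteq> []" using dmax_nonadj[OF assms(1)] es Pe by auto
  have AK: "set A \<inter> K = {}"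
  proof (rule ccontr)
    assume "set A \<inter> K \<noteq> {}"
    then have "\<exists>v\<in>set A. v \<in> K" by blast
    then obtain A1 a A2 where A: "A = A1 @ a # A2" "a \<in> K"
      using split_list_first_prop[of A "\<lambda>v. v \<in> K"] by blast
    have "set (a # A2) \<subseteq> K" using allK[of A1 "a # A2" "\<kappa> # U @ W @ s # F"] Pe A by simp
    then have "last (a # A2) \<in> K" using last_in_set[of "a # A2"] by blast
    moreover have "A = A1 @ butlast (a # A2) @ [last (a # A2)]" using A(1) append_butlast_last_id[of "a # A2"] by simp
    then have "P = (A1 @ butlast (a # A2)) @ last (a # A2) # \<kappa> # (U @ W) @ s # F" using Pe
      by (metis append.assoc append_Cons append_Nil)
    moreover have "hd F \<in> K" using F FK by auto
    ultimately show False using dmax_no_K_break[OF assms(1)] S(2) es F by blast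
  qed
  have "A \<noteq> []" using Pe P(6) S(2) by auto
  moreover have "E (hd P) (hd (W @ [s]))" using S(4) wB by (cases W) auto
  moreover have "set F \<subseteq> K" using FK by simp
  ultimately show ?thesis using Pe AK S(2,3,5,6,7) WK sK F by blast
qed

lemma split_unique:
  assumes "I @ \<kappa> # Y = I' @ \<kappa>' # Y'" "set I \<inter> K = {}" "set I' \<inter> K = {}" "\<kappa> \<in> K" "\<kappa>' \<in> K"
  shows "I = I'" "\<kappa> = \<kappa>'" "Y = Y'"
proof -
  have "ini (I @ \<kappa> # Y) = I" "ini (I' @ \<kappa>' # Y') = I'" using assms by (subst takeWhile_append2; auto)+
  then show "I = I'" using assms(1) by simp
  then show "\<kappa> = \<kappa>'" "Y = Y'" using assms(1) by auto
qed

text \<open>It remains to exclude \<open>W \<noteq> []\<close>. In that case a rotation at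
  \<open>hd W\<close> turns \<open>U\<close> into the initial segment, and the split of the rotated
  path supplies the chords of a cycle on more than \<open>c\<close> vertices.\<close>

lemma dmax_long_decomp:
  assumes "dmax D P" "Suc c < length P"
  shows "\<exists>I \<kappa> U s F. P = I @ \<kappa> # U @ s # F \<and> I \<noteq> [] \<and> U \<noteq> [] \<and> set I \<inter> K = {} \<and> set U \<inter> K = {} \<and>
    \<kappa> \<in> K \<and> s \<in> K \<and> length I = k - 1 \<and> inactive P = {Suc (length I)..<length I + length U} \<and>
    card (nb (hd P)) = k"
proof -
  note P = dmaxD[OF assms(1)]
  obtain I \<kappa> U W s F where S: "P = I @ \<kappa> # U @ W @ s # F" "I \<noteq> []" "set I \<inter> K = {}" "set U \<inter> K = {}"
    "set W \<inter> K = {}" "\<kappa> \<in> K" "s \<in> K" "set F \<subseteq> K" "F \<noteq> []" "E (hd P) (hd (W @ [s]))"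
    "length U = length P - c" "inactive P = {Suc (length I)..<length I + length U}"
    "card (nb (hd P)) = k"
    using dmax_long_split[OF assms] by blast
  have Ke: "K = set (\<kappa> # s # F)" using dmax_K_subset[OF assms(1)] S(1,3-8) by auto
  have dK: "distinct (\<kappa> # s # F)" using P(3) S(1) by auto
  have cardK: "card K = length F + 2" using distinct_card[OF dK] Ke by simp
  have Une: "U \<noteq> []" using S(11) assms(2) by auto
  \<comment> \<open>Here \<open>|P| = c + |U|\<close>, and \<open>K\<close> consists of
    \<open>\<kappa>\<close>, \<open>s\<close> and \<open>F\<close>.\<close>
  have lens: "length I + length W = k - 1"
    using S(1,11) cardK cK assms(2) by simp
  have lF: "last F = last P" "last F \<in> set F" using S(1,9) by auto
  have kF: "E (last F) \<kappa>" using cl[of "last F" \<kappa>] lF S(6,8) dK by auto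
  have sub: "successively E I" "successively E (U @ W)" "successively E (s # F)" "successively E U" "successively E W"
    "E (last I) \<kappa>" "E \<kappa> (hd U)" "W = [] \<or> E (last U) (hd W)"
    using P(4) S(1,2) Une by (cases "W = []"; auto simp: successively_append_iff successively_Cons)+
  have "W = []"
  proof (rule ccontr)
    assume W: "W \<noteq> []"
    have xw: "E (hd P) (hd W)" using S(10) W by simp
    have "hd W \<notin> K" using S(5) W by (metis IntI empty_iff hd_in_set)
    then have "hd W \<in> D" using closedD[OF P(10,5) xw] by blast
    moreover have "last U \<notin> K" using S(4) Une by (metis IntI empty_iff last_in_set)
    ultimately have uD: "last U \<in> D" using closedD[OF P(10)] E_sym[of "last U" "hd W"] sub(8) W by blast
    define P2 where "P2 = rev (I @ \<kappa> # U) @ W @ s # F"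
    have d2: "dmax D P2" unfolding P2_def
      by (rule dmax_rotate[OF assms(1)]) (use S(1) uD xw W Une in auto)
    have P2e: "P2 = rev U @ \<kappa> # (rev I @ W) @ s # F" by (simp add: P2_def)
    have l2: "length P2 = length P" using S(1) by (simp add: P2_def)
    have h2: "hd P2 = last U" using Une by (simp add: P2e hd_rev)
    obtain I2 \<kappa>2 U2 W2 s2 F2 where T: "P2 = I2 @ \<kappa>2 # U2 @ W2 @ s2 # F2" "I2 \<noteq> []" "set I2 \<inter> K = {}" "set U2 \<inter> K = {}"
      "set W2 \<inter> K = {}" "\<kappa>2 \<in> K" "s2 \<in> K"
      "length U2 = length P2 - c" "inactive P2 = {Suc (length I2)..<length I2 + length U2}"
      using dmax_long_split[OF d2] assms(2) l2 by metis
    have q: "rev U @ \<kappa> # ((rev I @ W) @ s # F) = I2 @ \<kappa>2 # ((U2 @ W2) @ s2 # F2)"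
      using T(1) P2e by simp
    have "set (rev U) \<inter> K = {}" using S(4) by simp
    note e = split_unique[OF q this T(3) S(6) T(6)]
    have "set (rev I @ W) \<inter> K = {}" "set (U2 @ W2) \<inter> K = {}" using S(3,5) T(4,5) by auto
    note e2 = split_unique[OF e(3) this S(7) T(7)]
    have lV: "length (U2 @ W2) = k - 1" using e2(1) lens by (metis length_append length_rev)
    have lU: "length U2 = length U" using T(8) S(11) l2 by simp
    have cyc: False if g: "gpath E Z" "hd Z = \<kappa>" "last Z = last F" "length Z \<ge> card K + k" for Z
    proof -
      have "c < length Z" using g(4) cK by simp
      moreover from this have "gcyc E Z" using g c3 kF by (simp add: gcyc_def)
      ultimately show False using gcyc_le by blast
    qed
    show False
    proof (cases "W2 = []")
      case True
      \<comment> \<open>Together with a nonempty \<open>W\<close> this makes an excursion from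
        \<open>\<kappa>\<close> to \<open>s\<close> over at least \<open>k\<close> vertices,
        followed by the rest of \<open>K\<close>.\<close>
      then have "length U = k - 1" using lU lV by simp
      moreover have "1 \<le> length W" using W by (cases W) auto
      ultimately have "k \<le> length U + length W" using k2 by simp
      moreover have "gpath E (\<kappa> # (U @ W) @ s # F)"
        using P(3,4) S(1) by (auto simp: gpath_def successively_append_iff)
      ultimately show False using cyc[of "\<kappa> # (U @ W) @ s # F"] S(9) cardK by simp
    next
      case False
      \<comment> \<open>As \<open>W2\<close> is nonempty, the last two vertices of
        \<open>U2 @ W2\<close> are not at inactive positions. So \<open>last U\<close>, the first
        vertex of \<open>P2\<close>, is adjacent to their successors \<open>l\<close> and
        \<open>s\<close>.\<close>
      have "2 \<le> length (U2 @ W2)" using False lU Une by (cases W2; cases U2) auto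
      then obtain V0 l where V0: "U2 @ W2 = V0 @ [l]" by (cases "U2 @ W2" rule: rev_cases) auto
      then have "V0 \<noteq> []" using \<open>2 \<le> _\<close> by (metis One_nat_def Suc_n_not_le_n append_Nil length_Cons list.size(3) numeral_2_eq_2)
      then obtain V v where V: "U2 @ W2 = V @ [v, l]" using V0 by (cases V0 rule: rev_cases) auto
      have ll: "l = last W" using V0 e2(1) W by (metis last_appendR last_snoc)
      have "v \<in> set (U2 @ W2)" "l \<in> set (U2 @ W2)" using V by simp_all
      then have vK: "v \<notin> K" "l \<notin> K" using T(4,5) by auto
      have lenV: "length U2 < length V + 2"
      proof -
        have "length (U2 @ W2) = length V + 2" using V by simp
        moreover have "0 < length W2" using False by simp
        ultimately show ?thesis by (simp only: length_append)
      qed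
      have x2l: "E (last U) l"
      proof (rule ccontr)
        assume "\<not> ?thesis"
        moreover have "P2 = (I2 @ \<kappa> # V) @ v # l # (s # F)" using T(1) e V e2
          by (metis append.assoc append_Cons append_Nil)
        ultimately have "length (I2 @ \<kappa> # V) \<in> inactive P2" using inactive_index vK(1) h2 by metis
        then show False using T(9) lenV by simp
      qed
      have x2s: "E (last U) s"
      proof (rule ccontr)
        assume "\<not> ?thesis"
        moreover have "P2 = (I2 @ \<kappa> # V @ [v]) @ l # s # F" using T(1) e V e2
          by (metis append.assoc append_Cons append_Nil)
        ultimately have "length (I2 @ \<kappa> # V @ [v]) \<in> inactive P2" using inactive_index vK(2) h2 by metis
        then show False using T(9) lenV by simp
      qed
      \<comment> \<open>It covers \<open>I\<close>, \<open>W\<close>, one vertex of \<open>U\<close>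
        and all of \<open>K\<close>, hence \<open>(k - 1) + 1 + |K| = c + 1\<close>
        vertices.\<close>
      let ?Z = "[\<kappa>] @ rev I @ W @ [last U] @ (s # F)"
      have ub: "U = butlast U @ [last U]" using Une by simp
      have dZ: "distinct ?Z"
      proof -
        have "distinct (I @ \<kappa> # (butlast U @ [last U]) @ W @ s # F)" using P(3) S(1) ub by metis
        then show ?thesis by auto
      qed
      have sr: "successively E (rev I)" using gpath_rev'[of I] sub(1) P(3) S(1,2) by (auto simp: gpath_def)
      have hI: "hd I = hd P" using S(1,2) by simp
      have "successively E ?Z"
        unfolding successively_append_iff using sr sub(5,3,6) S(2) W E_sym x2l x2s xw ll hI
        by (auto simp: hd_rev last_rev)
      then have "gpath E ?Z" using dZ by (simp add: gpath_def)
      then show False using cyc[of ?Z] S(9) cardK lens k2 by simp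
    qed
  qed
  then have "P = I @ \<kappa> # U @ s # F" "length I = k - 1" using S(1) lens by simp_all
  then show ?thesis using S(2-4,6,7,12,13) Une by blast
qed

text \<open>The vertex of \<open>K\<close> at which the initial segment ends, and the one at which
  the path returns from its first excursion; in \<open>Z\<close> they are the two common
  vertices.\<close>

definition attach :: "'a list \<Rightarrow> 'a set" where
  "attach P = {hd (rst P), hd (rst (tl (rst P)))}"

lemma dmax_long_ini:
  assumes "dmax D P" "Suc c < length P"
  shows "length (ini P) = k - 1"
proof -
  obtain I \<kappa> U s F where S: "P = I @ \<kappa> # U @ s # F" "set I \<inter> K = {}" "\<kappa> \<in> K" "length I = k - 1"
    using dmax_long_decomp[OF assms] by blast
  have "ini P = I" using S by (subst S(1), subst takeWhile_append2) auto
  then show ?thesis using S(4) by simp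
qed

text \<open>A long candidate has a single excursion \<open>U\<close>, and a short one with
  \<open>k - 1\<close> initial vertices has exactly one pair. Either way the positions in
  \<open>ini P\<close> and the last position of the excursion are active, which already gives
  \<open>k\<close> neighbours.\<close>

lemma nb_hd_Z:
  assumes "dmax D P" "length (ini P) = k - 1"
  shows "nb (hd P) = (set (ini P) - {hd P}) \<union> attach P \<and> attach P \<subseteq> K \<and> card (attach P) = 2"
proof (cases "Suc c < length P")
  case True
  note P = dmaxD[OF assms(1)]
  obtain I \<kappa> U s F where S: "P = I @ \<kappa> # U @ s # F" "I \<noteq> []" "set I \<inter> K = {}" "set U \<inter> K = {}"
    "\<kappa> \<in> K" "s \<in> K" "length I = k - 1" "inactive P = {Suc (length I)..<length I + length U}"
    "card (nb (hd P)) = k" "U \<noteq> []"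
    using dmax_long_decomp[OF assms(1) True] by blast
  have iP: "ini P = I" using S by (subst S(1), subst takeWhile_append2) auto
  have rP: "rst P = \<kappa> # U @ s # F" using S by (subst S(1), subst dropWhile_append2) auto
  have "rst (U @ s # F) = s # F" using S by (subst dropWhile_append2) auto
  then have attach: "attach P = {\<kappa>, s}" using rP by (simp add: attach_def)
  have ks: "\<kappa> \<noteq> s" using P(3) S(1) by auto
  have act: "E (hd P) w" if "P = A @ z # w # B" "z \<notin> K" "length A \<notin> inactive P" for A z w B
    using inactive_index that by blast
  have sub: "(set I - {hd P}) \<union> {\<kappa>, s} \<subseteq> nb (hd P)"
  proof
    fix w assume "w \<in> (set I - {hd P}) \<union> {\<kappa>, s}"
    then consider "w \<in> set I" "w \<noteq> hd P" | "w = \<kappa>" | "w = s" by blast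
    then have "E (hd P) w"
    proof cases
      case 1
      then obtain I1 I2 where J: "I = I1 @ w # I2" by (meson split_list)
      have "I1 \<noteq> []" using J 1 S(1) by auto
      then obtain I0 z where I0: "I1 = I0 @ [z]" by (cases I1 rule: rev_cases) auto
      show ?thesis using act[of I0 z w "I2 @ \<kappa> # U @ s # F"] S(1,3,8) J I0 by auto
    next
      case 2
      obtain I0 z where I0: "I = I0 @ [z]" using S(2) by (cases I rule: rev_cases) auto
      show ?thesis using act[of I0 z \<kappa> "U @ s # F"] S(1,3,8) I0 2 by auto
    next
      case 3
      obtain U0 z where "U = U0 @ [z]" using S(10) by (cases U rule: rev_cases) auto
      then show ?thesis using act[of "I @ \<kappa> # U0" z s F] S(1,4,8) 3 by auto
    qed
    then show "w \<in> nb (hd P)" by (simp add: nb_def)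
  qed
  have "card ((set I - {hd P}) \<union> {\<kappa>, s}) = k"
  proof -
    have "distinct I" "hd P \<in> set I" using P(3) S(1,2) by auto
    then have "card (set I - {hd P}) = k - 2" using distinct_card[of I] S(7) by simp
    moreover have "(set I - {hd P}) \<inter> {\<kappa>, s} = {}" using S(3,5,6) by auto
    ultimately show ?thesis using ks k2 by (subst card_Un_disjoint) auto
  qed
  then have "nb (hd P) = (set I - {hd P}) \<union> {\<kappa>, s}"
    using card_subset_eq[OF finite_nb sub] S(9) by simp
  then show ?thesis using attach iP S(5,6) ks by auto
next
  case False
  then have l: "length P = Suc c" using dmaxD(8)[OF assms(1)] by simp
  obtain s0 prs F where S: "rst P = s0 # flat prs @ F" "s0 \<in> K" "set F \<subseteq> K"
    "\<forall>p\<in>set prs. fst p \<notin> K \<and> snd p \<in> K" "prs \<noteq> []" "length (ini P) + length prs = k"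
    "nb (hd P) = (set (ini P) - {hd P}) \<union> insert s0 (snd ` set prs)"
    using dmax_short_decomp[OF assms(1) l] by blast
  have "length prs = 1" using S(6) assms(2) k2 by simp
  then obtain p where p: "prs = [p]" by (cases prs) auto
  have rP: "rst P = s0 # fst p # snd p # F" using S(1) p by simp
  have "attach P = {s0, snd p}" using rP S(4) p by (simp add: attach_def)
  moreover have "s0 \<noteq> snd p"
    using dmaxD(3)[OF assms(1)] dmax_ini_rst(1)[OF assms(1)] rP distinct_append[of "ini P" "rst P"] by auto
  ultimately show ?thesis using S(7,2,4) p by auto
qed

text \<open>Each vertex of the initial segment becomes the first one by a rotation that only
  reorders this segment, so \<open>nb_hd_Z\<close> applies to all of them.\<close>

lemma nb_ini_Z:
  assumes "dmax D P" "length (ini P) = k - 1" "p \<in> set (ini P)"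
  shows "nb p = (set (ini P) - {p}) \<union> attach P"
proof (cases "p = hd P")
  case True
  then show ?thesis using nb_hd_Z[OF assms(1,2)] by simp
next
  case False
  note I = dmax_ini_rst[OF assms(1)]
  obtain I1 I2 where J: "ini P = I1 @ p # I2" using assms(3) by (meson split_list)
  define A where "A = I1 @ [p]"
  define B where "B = I2 @ rst P"
  have PAB: "P = A @ B" using I(1) J by (simp add: A_def B_def)
  have Bne: "B \<noteq> []" using I(3) by (simp add: B_def)
  have iK: "set (I1 @ p # I2) \<inter> K = {}" using I(6) J by simp
  have hB: "hd B \<in> (set (ini P) - {hd P}) \<union> attach P"
  proof (cases I2)
    case Nil
    then show ?thesis by (simp add: B_def attach_def)
  next
    case (Cons q I3)
    moreover have "q \<noteq> hd P"
    proof -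
      have "distinct (ini P)" using dmaxD(3)[OF assms(1)] by (rule distinct_takeWhile)
      then have "distinct (I1 @ p # q # I3)" using J Cons by simp
      moreover have "hd P = hd (I1 @ [p])" using I(4) J by (cases I1) auto
      then have "hd P \<in> set (I1 @ [p])" using hd_in_set[of "I1 @ [p]"] by simp
      ultimately show ?thesis by auto
    qed
    ultimately show ?thesis using J by (simp add: B_def)
  qed
  then have "E (hd P) (hd B)" using nb_hd_Z[OF assms(1,2)] by (auto simp: nb_def)
  moreover have "p \<in> D" using dmax_ini_subset[OF assms(1)] assms(3) by blast
  ultimately have d: "dmax D (rev A @ B)" using dmax_rotate[OF assms(1) PAB] Bne by (simp add: A_def)
  have hr: "rst P = hd (rst P) # tl (rst P)" using I(3) by simp
  have "rev A @ B = (rev A @ I2) @ rst P" by (simp add: B_def)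
  moreover have "set (rev A @ I2) \<inter> K = {}" using iK by (auto simp: A_def)
  moreover have "ini (xs @ rst P) = xs" "rst (xs @ rst P) = rst P" if "set xs \<inter> K = {}" for xs
  proof -
    have "ini (rst P) = []" using I(5) by (subst hr) simp
    moreover have "rst (rst P) = rst P" using I(5) by (subst hr, subst (3) hr) simp
    moreover have "\<And>v. v \<in> set xs \<Longrightarrow> v \<notin> K" using that by blast
    ultimately show "ini (xs @ rst P) = xs" "rst (xs @ rst P) = rst P"
      by (simp_all add: takeWhile_append2 dropWhile_append2)
  qed
  ultimately have i2: "ini (rev A @ B) = rev A @ I2" "rst (rev A @ B) = rst P" by metis+
  have "nb (hd (rev A @ B)) = (set (rev A @ I2) - {hd (rev A @ B)}) \<union> attach (rev A @ B)"
  proof -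
    have "length (rev A @ I2) = k - 1" using assms(2) J by (simp add: A_def)
    then show ?thesis using nb_hd_Z[OF d] unfolding i2(1) by blast
  qed
  moreover have "hd (rev A @ B) = p" by (simp add: A_def)
  moreover have "attach (rev A @ B) = attach P" using i2(2) by (simp add: attach_def)
  ultimately show ?thesis using J by (auto simp: A_def)
qed

section \<open>Components off \<open>K\<close> and the two local patterns\<close>

definition comp :: "'a \<Rightarrow> 'a set" where
  "comp v = {w. (\<lambda>a b. E a b \<and> a \<notin> K \<and> b \<notin> K)\<^sup>*\<^sup>* v w}"

lemma comp_refl: "v \<in> comp v"
  by (simp add: comp_def)

lemma closed_comp:
  assumes "v \<in> V - K"
  shows "closed (comp v)"
proof -
  have "w \<in> V - K" if "w \<in> comp v" for w
    using that unfolding comp_def mem_Collect_eq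
    by (induction rule: rtranclp_induct) (use assms E_V' in auto)
  moreover have "b \<in> comp v" if "a \<in> comp v" "b \<in> V - K" "E a b" for a b
  proof -
    have "a \<notin> K" using calculation[OF that(1)] by blast
    then show ?thesis using that unfolding comp_def
      by (metis (mono_tags, lifting) DiffD2 mem_Collect_eq rtranclp.rtrancl_into_rtrancl)
  qed
  ultimately show ?thesis unfolding closed_def by blast
qed

text \<open>\<open>Q\<close> is closed under edges off \<open>K\<close>, so it contains the
  component of each of its members. This puts \<open>v\<close> itself into a pattern found at the
  start of a path from its component.\<close>

lemma comp_absorb:
  assumes "x \<in> comp v" "x \<in> Q" "\<And>q. q \<in> Q \<Longrightarrow> nb q \<subseteq> Q \<union> K"
  shows "v \<in> Q"
proof -
  let ?R = "\<lambda>a b. E a b \<and> a \<notin> K \<and> b \<notin> K"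
  have "?R\<^sup>*\<^sup>* v x" using assms(1) by (simp add: comp_def)
  then have "?R\<^sup>*\<^sup>* x v"
  proof (induction rule: rtranclp_induct)
    case (step y z)
    then have "?R z y" using E_sym by blast
    then show ?case using step.IH by (rule converse_rtranclp_into_rtranclp)
  qed simp
  then show ?thesis using assms(2)
    by (induction rule: rtranclp_induct) (use assms(3) in \<open>auto simp: nb_def\<close>)
qed

text \<open>\<open>Q \<union> {a, b}\<close> is one of the small cliques \<open>K_{k+1}\<close> of
  \<open>Z\<close>.\<close>

definition isZ :: "'a \<Rightarrow> 'a set \<Rightarrow> 'a \<Rightarrow> 'a \<Rightarrow> bool" where
  "isZ v Q a b \<longleftrightarrow> v \<in> Q \<and> Q \<subseteq> V - K \<and> card Q = k - 1 \<and> a \<in> K \<and> b \<in> K \<and> a \<noteq> b \<and>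
     (\<forall>q\<in>Q. nb q = (Q - {q}) \<union> {a, b})"

lemma dmax_isZ:
  assumes "v \<in> V - K" "dmax (comp v) P" "length (ini P) = k - 1"
  shows "\<exists>a b. isZ v (set (ini P)) a b"
proof -
  note P = dmaxD[OF assms(2)] and I = dmax_ini_rst[OF assms(2)]
  have Z: "attach P \<subseteq> K" "card (attach P) = 2" using nb_hd_Z[OF assms(2,3)] by auto
  obtain a b where ab: "attach P = {a, b}" "a \<noteq> b" using Z(2) by (meson card_2_iff)
  have nbq: "nb q = (set (ini P) - {q}) \<union> {a, b}" if "q \<in> set (ini P)" for q
    using nb_ini_Z[OF assms(2,3) that] ab by simp
  have "v \<in> set (ini P)"
  proof (rule comp_absorb[of "hd P"])
    show "hd P \<in> comp v" using P(5) .
    show "hd P \<in> set (ini P)" using I(2,4) hd_in_set by metis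
    show "nb q \<subseteq> set (ini P) \<union> K" if "q \<in> set (ini P)" for q using nbq[OF that] ab Z(1) by auto
  qed
  moreover have "set (ini P) \<subseteq> V - K" using dmax_ini_subset[OF assms(2)] P(10) by (auto simp: closed_def)
  moreover have "card (set (ini P)) = k - 1" using assms(3) P(3) distinct_card distinct_takeWhile by metis
  ultimately show ?thesis using nbq ab Z(1) by (intro exI[of _ a] exI[of _ b]) (auto simp: isZ_def)
qed

text \<open>The new path starts at \<open>w\<close>, possibly in another component, so its
  maximality is a new claim. A path on more than \<open>c + 1\<close> vertices from there would put
  \<open>w\<close> into a block \<open>Q\<close> as in \<open>isZ\<close>, attached at
  \<open>p\<close> and \<open>s\<close>; replacing \<open>w\<close> by all of \<open>Q\<close> would
  lengthen \<open>P\<close>, where \<open>3 \<le> k\<close> ensures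
  \<open>|Q| \<ge> 2\<close>.\<close>

lemma dmax_swap:
  assumes "dmax D P" "length P = Suc c" "P = A @ p # w # s # B" "p \<in> K" "w \<notin> K" "s \<in> K" "3 \<le> k"
  shows "dmax (comp w) (rev (A @ [p, w]) @ s # B)"
proof -
  note P = dmaxD[OF assms(1)] and I = dmax_ini_rst[OF assms(1)]
  define X where "X = A @ [p, w]"
  have PX: "P = X @ s # B" using assms(3) by (simp add: X_def)
  have hX: "hd X = hd P" "X \<noteq> []" "last X = w" using assms(3) by (cases A, auto simp: X_def)
  have xs: "E (hd P) s" using dmax_short_adj_succ[OF assms(1,2), of "A @ [p]" w s B] assms(3,5) by simp
  have gX: "gpath E X" "gpath E (s # B)" "set X \<inter> set (s # B) = {}"
    using P(1) hX(2) unfolding PX by (auto simp: gpath_append split: if_splits)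
  have "gpath E (rev X @ s # B)"
    using gX gpath_rev'[of X] xs hX by (simp add: gpath_append last_rev)
  moreover have "hd (rev X @ s # B) = w" using hX by (simp add: hd_rev)
  moreover have "last (rev X @ s # B) \<in> K" using P(7) PX by simp
  moreover have l3: "length (rev X @ s # B) = Suc c" using assms(2) PX by simp
  ultimately have c3: "cand (comp w) (rev X @ s # B)" using comp_refl by (simp add: cand_def)
  have wV: "w \<in> V - K" using P(9) assms(3,5) by auto
  obtain P' where P': "dmax (comp w) P'" using ex_dmax[OF closed_comp[OF wV] comp_refl] by blast
  have "length P' \<le> Suc c"
  proof (rule ccontr)
    assume n: "\<not> ?thesis"
    then have li: "length (ini P') = k - 1" using dmax_long_ini[OF P'] by simp
    obtain a b where Z: "isZ w (set (ini P')) a b" using dmax_isZ[OF wV P' li] by blast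
    define Q where "Q = set (ini P')"
    have Q: "w \<in> Q" "Q \<subseteq> V - K" "card Q = k - 1" "a \<in> K" "b \<in> K" "a \<noteq> b"
      and nbQ: "\<And>q. q \<in> Q \<Longrightarrow> nb q = (Q - {q}) \<union> {a, b}"
      using Z unfolding isZ_def Q_def by blast+
    have wp: "E w p" "E w s"
      using P(4) assms(3) E_sym by (auto simp: successively_append_iff successively_Cons)
    have ps: "p \<noteq> s" using P(3) assms(3) by auto
    have nK: "u \<in> {a, b}" if "q \<in> Q" "E q u" "u \<in> K" for q u
    proof -
      have "u \<in> (Q - {q}) \<union> {a, b}" using nbQ[OF that(1)] that(2) by (auto simp: nb_def)
      then show ?thesis using Q(2) that(3) by auto
    qed
    have ab: "{a, b} = {p, s}" using nK[OF Q(1) wp(1) assms(4)] nK[OF Q(1) wp(2) assms(6)] ps by auto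
    \<comment> \<open>A second vertex of \<open>Q\<close> on the initial segment of \<open>P\<close>
      would put \<open>hd P'\<close> into \<open>D\<close>, and \<open>P'\<close> would be a longer
      candidate than \<open>P\<close>. Later on \<open>P\<close> it would stand between
      \<open>p\<close> and \<open>s\<close> just as \<open>w\<close> does, but \<open>p\<close> and
      \<open>s\<close> occur only once.\<close>
    have disj: "q = w" if q: "q \<in> Q" "q \<in> set P" for q
    proof (rule ccontr)
      assume qw: "q \<noteq> w"
      have qK: "q \<notin> K" using q(1) Q(2) by blast
      show False
      proof (cases "q \<in> set (ini P)")
        case True
        then have qD: "q \<in> D" using dmax_ini_subset[OF assms(1)] by blast
        have hP': "hd P' \<in> Q" unfolding Q_def using dmax_ini_rst(2,4)[OF P'] hd_in_set by metis
        have "hd P' \<in> D"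
        proof (cases "hd P' = q")
          case False
          then have "E q (hd P')" using nbQ[OF q(1)] hP' by (auto simp: nb_def)
          then show ?thesis using closedD[OF P(10) qD] hP' Q(2) by blast
        qed (use qD in simp)
        then have "cand D P'" using dmaxD[OF P'] by (simp add: cand_def)
        then show False using assms(1,2) n unfolding dmax_def by auto
      next
        case False
        obtain s0 prs F where S: "rst P = s0 # flat prs @ F" "s0 \<in> K" "set F \<subseteq> K"
          "\<forall>p\<in>set prs. fst p \<notin> K \<and> snd p \<in> K"
          using dmax_short_decomp[OF assms(1,2)] by metis
        have "q \<in> set (rst P)" using False q(2) I(1) by (metis Un_iff set_append)
        then have "q \<in> fst ` set prs" using S qK by (auto simp: set_flat)
        then obtain r where r: "r \<in> set prs" "q = fst r" by blast
        then obtain pr1 pr2 where pr: "prs = pr1 @ r # pr2" by (meson split_list)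
        define Y where "Y = ini P @ butlast (s0 # flat pr1)"
        define \<kappa>q where "\<kappa>q = last (s0 # flat pr1)"
        have lK: "\<kappa>q \<in> K"
        proof (cases pr1 rule: rev_cases)
          case (snoc pr r')
          then show ?thesis using S(4) pr by (auto simp: \<kappa>q_def)
        qed (use S(2) in \<open>simp add: \<kappa>q_def\<close>)
        have "s0 # flat pr1 = butlast (s0 # flat pr1) @ [\<kappa>q]" unfolding \<kappa>q_def by simp
        moreover have "P = ini P @ (s0 # flat pr1) @ q # snd r # flat pr2 @ F"
          using I(1) S(1) pr r(2) by simp
        ultimately have Pq: "P = Y @ \<kappa>q # q # snd r # flat pr2 @ F"
          unfolding Y_def by (metis append.assoc append_Cons append_Nil)
        have sr: "snd r \<in> K" using S(4) r(1) by blast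
        have "E q \<kappa>q" "E q (snd r)"
          using P(4) E_sym unfolding Pq by (auto simp: successively_append_iff successively_Cons)
        then have "\<kappa>q \<in> {p, s}" "snd r \<in> {p, s}" using nK[OF q(1)] lK sr ab by auto
        moreover have "\<kappa>q \<noteq> snd r" using P(3) unfolding Pq by auto
        ultimately consider "\<kappa>q = p" "snd r = s" | "\<kappa>q = s" "snd r = p" by auto
        then show False
        proof cases
          case 1
          have "length Y = length A"
          proof -
            have "P ! length Y = p" unfolding Pq using 1 by simp
            moreover have "P ! length A = p" unfolding assms(3) by simp
            moreover have "length Y < length P" "length A < length P" using Pq assms(3) by (metis length_append length_Cons less_add_Suc1 add_Suc_right)+
            ultimately show ?thesis using P(3) by (metis nth_eq_iff_index_eq)
          qed
          moreover have "P ! Suc (length Y) = q" unfolding Pq by (simp add: nth_append)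
          moreover have "P ! Suc (length A) = w" unfolding assms(3) by (simp add: nth_append)
          ultimately show False using qw by simp
        next
          case 2
          have "length Y = Suc (Suc (length A))"
          proof -
            have "P ! length Y = s" unfolding Pq using 2 by simp
            moreover have "P ! Suc (Suc (length A)) = s" unfolding assms(3) by (simp add: nth_append)
            moreover have "length Y < length P" by (subst Pq) simp
            moreover have "Suc (Suc (length A)) < length P" by (subst assms(3)) simp
            ultimately show ?thesis using P(3) by (metis nth_eq_iff_index_eq)
          qed
          moreover have "Suc (Suc (length Y)) = length A"
          proof -
            have "P ! Suc (Suc (length Y)) = p" unfolding Pq using 2 by (simp add: nth_append)
            moreover have "P ! length A = p" unfolding assms(3) by simp
            moreover have "Suc (Suc (length Y)) < length P" by (subst Pq) simp
            moreover have "length A < length P" by (subst assms(3)) simp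
            ultimately show ?thesis using P(3) by (metis nth_eq_iff_index_eq)
          qed
          ultimately show False by simp
        qed
      qed
    qed
    have finQ: "finite Q" by (simp add: Q_def)
    obtain qs where qs: "set qs = Q" "distinct qs" using finite_distinct_list[OF finQ] by blast
    have lq: "length qs = k - 1" using Q(3) qs distinct_card by metis
    have qne: "qs \<noteq> []" using lq assms(7) by auto
    have gq: "gpath E qs"
    proof (rule gpath_clique[of Q])
      show "E u v" if "u \<in> Q" "v \<in> Q" "u \<noteq> v" for u v using nbQ[OF that(1)] that(2,3) by (auto simp: nb_def)
    qed (use qs qne in auto)
    have qE: "E q p" "E q s" if "q \<in> Q" for q using nbQ[OF that] ab by (auto simp: nb_def)
    have hq: "hd qs \<in> Q" "last qs \<in> Q" using qne qs by auto
    define P4 where "P4 = (A @ [p]) @ qs @ s # B"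
    have "gpath E (A @ [p])" "gpath E (s # B)" "set (A @ [p]) \<inter> set (s # B) = {}" "w \<notin> set (A @ [p])" "w \<notin> set (s # B)"
      using P(3,4) assms(3) by (auto simp: gpath_def successively_append_iff successively_Cons)
    moreover have "set qs \<inter> set (A @ [p]) = {}" "set qs \<inter> set (s # B) = {}"
      using disj calculation(4,5) assms(3) qs(1) by auto
    ultimately have "gpath E P4" unfolding P4_def gpath_append using gq qne qE[OF hq(1)] qE[OF hq(2)] E_sym by auto
    moreover have "hd P4 = hd P" using assms(3) by (cases A) (auto simp: P4_def)
    moreover have "last P4 = last P" using assms(3) by (simp add: P4_def)
    moreover have lP4: "length P4 > length P" using lq assms(3,7) by (simp add: P4_def)
    ultimately have "cand D P4" using P(5,7,8) by (simp add: cand_def)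
    then show False using assms(1) lP4 by (auto simp: dmax_def)
  qed
  then show ?thesis using P' c3 l3 closed_comp[OF wV] unfolding dmax_def X_def[symmetric] by (metis le_trans)
qed

text \<open>A fragment of \<open>W\<close>: the \<open>k - 1\<close> vertices of \<open>Ws\<close>
  are just enough for a path that alternates through all of \<open>S\<close>.\<close>

definition isW :: "'a \<Rightarrow> 'a set \<Rightarrow> 'a set \<Rightarrow> bool" where
  "isW v S Ws \<longleftrightarrow> S \<subseteq> K \<and> card S = k \<and> Ws \<subseteq> V - K \<and> card Ws = k - 1 \<and> v \<notin> Ws \<and> nb v = S \<and>
     (\<forall>w\<in>Ws. nb w = S)"

text \<open>If a longest candidate from the component of \<open>v\<close> does not have
  \<open>k - 1\<close> initial vertices, it has exactly \<open>c + 1\<close> vertices and at least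
  two excursions. Swaps then show that it starts with \<open>v\<close> alone and that each excursion
  vertex has the neighbourhood of \<open>v\<close>.\<close>

lemma isZ_or_isW:
  assumes v: "v \<in> V - K"
  shows "(\<exists>Q a b. isZ v Q a b) \<or> (3 \<le> k \<and> (\<exists>S Ws. isW v S Ws))"
proof -
  obtain P where P: "dmax (comp v) P" using ex_dmax[OF closed_comp[OF v] comp_refl] by blast
  note PD = dmaxD[OF P] and I = dmax_ini_rst[OF P]
  show ?thesis
  proof (cases "length (ini P) = k - 1")
    case True
    then show ?thesis using dmax_isZ[OF v P] by blast
  next
    case False
    then have l: "length P = Suc c" using dmax_long_ini[OF P] PD(8) by fastforce
    obtain s0 prs F where S: "rst P = s0 # flat prs @ F" "s0 \<in> K" "set F \<subseteq> K"
      "\<forall>p\<in>set prs. fst p \<notin> K \<and> snd p \<in> K" "prs \<noteq> []" "length (ini P) + length prs = k"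
      "nb (hd P) = (set (ini P) - {hd P}) \<union> insert s0 (snd ` set prs)"
      using dmax_short_decomp[OF P l] by blast
    have Pe: "P = ini P @ s0 # flat prs @ F" using I(1) S(1) by metis
    have i1: "1 \<le> length (ini P)" using I(2) by (cases "ini P") auto
    have lp: "2 \<le> length prs" using False S(5,6) by (cases prs; cases "tl prs") auto
    have k3: "3 \<le> k" using i1 lp S(6) by linarith
    have swap: "dmax (comp (fst r)) (rev ((ini P @ s0 # flat pr1) @ [fst r]) @ snd r # flat pr2 @ F)"
      if pr: "prs = pr1 @ r # pr2" for pr1 r pr2
    proof -
      define A where "A = ini P @ butlast (s0 # flat pr1)"
      define p where "p = last (s0 # flat pr1)"
      have "s0 # flat pr1 = butlast (s0 # flat pr1) @ [p]" unfolding p_def by simp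
      then have A: "ini P @ s0 # flat pr1 = A @ [p]" unfolding A_def by (metis append.assoc)
      have pK: "p \<in> K"
      proof (cases pr1 rule: rev_cases)
        case (snoc pr r')
        then show ?thesis using S(4) pr by (auto simp: p_def)
      qed (use S(2) in \<open>simp add: p_def\<close>)
      have "P = (ini P @ s0 # flat pr1) @ fst r # snd r # flat pr2 @ F" using Pe pr by simp
      then have e: "P = A @ p # fst r # snd r # flat pr2 @ F" unfolding A by simp
      have "fst r \<notin> K" "snd r \<in> K" using S(4) pr by auto
      from dmax_swap[OF P l e pK this k3] show ?thesis unfolding A by simp
    qed
    \<comment> \<open>With two initial vertices, the swap at the first excursion would put both
      consecutively behind \<open>s0\<close> in \<open>K\<close>, against
      \<open>dmax_short_no_double\<close>.\<close>
    have "length (ini P) = 1"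
    proof (rule ccontr)
      assume "\<not> ?thesis"
      then have "2 \<le> length (rev (ini P))" using i1 by simp
      then obtain u u' W where u: "rev (ini P) = u # u' # W"
        by (metis (no_types, lifting) Suc_le_length_iff numeral_2_eq_2)
      obtain r pr2 where pr: "prs = [] @ r # pr2" using S(5) by (cases prs) auto
      have "u \<in> set (ini P)" "u' \<in> set (ini P)" using u by (metis list.set_intros set_rev)+
      then have uK: "u \<notin> K" "u' \<notin> K" using I(6) by auto
      have "rev ((ini P @ s0 # flat []) @ [fst r]) @ snd r # flat pr2 @ F =
        [fst r] @ s0 # u # u' # (W @ snd r # flat pr2 @ F)" using u by simp
      with swap[OF pr] have d: "dmax (comp (fst r)) ([fst r] @ s0 # u # u' # (W @ snd r # flat pr2 @ F))"
        by simp
      have "length ([fst r] @ s0 # u # u' # (W @ snd r # flat pr2 @ F)) = Suc c"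
      proof -
        have "length (rev (ini P)) = Suc (Suc (length W))" using u by simp
        moreover have "length P = length (ini P) + 1 + (2 + length (flat pr2)) + length F" by (subst Pe) (simp add: pr)
        ultimately show ?thesis using l by simp
      qed
      from dmax_short_no_double[OF d this refl S(2) uK] show False .
    qed
    then obtain x where x: "ini P = [x]" by (auto simp: length_Suc_conv)
    have hx: "hd P = x" using I(4) x by simp
    define SS where "SS = insert s0 (snd ` set prs)"
    have nx: "nb x = SS" using S(7) x hx by (simp add: SS_def)
    have SK: "SS \<subseteq> K" using S(2,4) by (auto simp: SS_def)
    \<comment> \<open>All neighbours of \<open>x\<close> are in \<open>K\<close>, so
      \<open>{x}\<close> is its component off \<open>K\<close>.\<close>
    have "v \<in> {x}" by (rule comp_absorb[of x]) (use PD(5) hx nx SK in auto)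
    then have vx: "v = x" by simp
    have cS: "card SS = k" using dmax_short_degree[OF P l] hx nx by simp
    have KF: "K = SS \<union> set F"
    proof
      show "K \<subseteq> SS \<union> set F"
      proof
        fix u assume u: "u \<in> K"
        then have "u \<in> set (ini P @ s0 # flat prs @ F)" using dmax_K_subset[OF P] Pe by (metis subsetD)
        then show "u \<in> SS \<union> set F" using u S(4) I(6) by (auto simp: SS_def set_flat)
      qed
    qed (use SK S(3) in auto)
    have dP: "distinct (ini P @ s0 # flat prs @ F)" using PD(3) Pe by metis
    have nw: "nb (fst r) = SS" if r: "r \<in> set prs" for r
    proof -
      obtain pr1 pr2 where pr: "prs = pr1 @ r # pr2" using r by (meson split_list)
      define P3 where "P3 = rev ((ini P @ s0 # flat pr1) @ [fst r]) @ snd r # flat pr2 @ F"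
      have d3: "dmax (comp (fst r)) P3" using swap[OF pr] by (simp add: P3_def)
      have "length P = length (ini P @ s0 # flat (pr1 @ r # pr2) @ F)" using Pe pr by metis
      then have l3: "length P3 = Suc c" using l by (simp add: P3_def)
      have h3: "hd P3 = fst r" by (simp add: P3_def)
      have rK: "fst r \<notin> K" "snd r \<in> K" using S(4) r by auto
      have i3: "ini P3 = [fst r]"
      proof -
        have "last (s0 # flat pr1) \<in> K"
        proof (cases pr1 rule: rev_cases)
          case (snoc pr r')
          then show ?thesis using S(4) pr by auto
        qed (use S(2) in simp)
        moreover have "rev (s0 # flat pr1) = last (s0 # flat pr1) # rev (butlast (s0 # flat pr1))"
          by (metis append_butlast_last_id list.distinct(1) rev_eq_Cons_iff rev_rev_ident)
        then have "P3 = fst r # last (s0 # flat pr1) # rev (butlast (s0 # flat pr1)) @ rev (ini P) @ snd r # flat pr2 @ F"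
          unfolding P3_def by simp
        ultimately show ?thesis using rK(1) by simp
      qed
      have nK: "nb (fst r) \<subseteq> K"
      proof -
        obtain s0' prs' F' where "s0' \<in> K" "\<forall>p\<in>set prs'. fst p \<notin> K \<and> snd p \<in> K"
          "nb (hd P3) = (set (ini P3) - {hd P3}) \<union> insert s0' (snd ` set prs')"
          using dmax_short_decomp[OF d3 l3] by blast
        then show ?thesis using i3 h3 by auto
      qed
      \<comment> \<open>A vertex of \<open>F\<close> follows a vertex of \<open>K\<close> on
        \<open>P3\<close>, so by \<open>dmax_pred\<close> it is not adjacent to the first
        vertex.\<close>
      have "u \<notin> set F" if u: "u \<in> nb (fst r)" for u
      proof
        assume "u \<in> set F"
        then obtain F1 F2 where F: "F = F1 @ u # F2" by (meson split_list)
        define Y where "Y = snd r # flat pr2 @ F1"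
        have "P3 = (rev ((ini P @ s0 # flat pr1) @ [fst r]) @ Y) @ u # F2"
          by (simp add: P3_def F Y_def)
        moreover have "E (hd P3) (hd (u # F2))" using u h3 by (simp add: nb_def)
        ultimately have "last (rev ((ini P @ s0 # flat pr1) @ [fst r]) @ Y) \<notin> K"
          using dmax_pred[OF d3] by blast
        then have "last Y \<notin> K" by (simp add: Y_def)
        moreover have "last Y \<in> K"
        proof (cases F1 rule: rev_cases)
          case Nil
          show ?thesis
          proof (cases pr2 rule: rev_cases)
            case Nil
            then show ?thesis using \<open>F1 = []\<close> rK(2) by (simp add: Y_def)
          next
            case (snoc pr r')
            then show ?thesis using \<open>F1 = []\<close> S(4) pr by (auto simp: Y_def)
          qed
        next
          case (snoc F0 f)
          then show ?thesis using F S(3) by (auto simp: Y_def)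
        qed
        ultimately show False by simp
      qed
      then have "nb (fst r) \<subseteq> SS" using nK KF by blast
      moreover have "card (nb (fst r)) = k" using dmax_short_degree[OF d3 l3] h3 by simp
      moreover have "finite SS" by (simp add: SS_def)
      ultimately show ?thesis using cS card_subset_eq by metis
    qed
    have fst_card: "card (fst ` set prs) = length prs" if "distinct (flat prs)" for prs
      using that by (induction prs) (auto simp: set_flat)
    have "isW v SS (fst ` set prs)"
      unfolding isW_def
    proof (intro conjI)
      show "fst ` set prs \<subseteq> V - K"
      proof -
        have "set (ini P @ s0 # flat prs @ F) \<subseteq> V" using PD(9) Pe by metis
        then show ?thesis using S(4) by (auto simp: set_flat)
      qed
      have "distinct (flat prs)" using dP by simp
      then show "card (fst ` set prs) = k - 1" using fst_card S(6) \<open>length (ini P) = 1\<close> by simp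
      show "v \<notin> fst ` set prs"
      proof -
        have "x \<notin> set (flat prs)" using dP x by auto
        then show ?thesis using vx by (auto simp: set_flat)
      qed
    qed (use SK cS nx vx nw in auto)
    then show ?thesis using k3 by blast
  qed
qed

section \<open>Cycles through two patterns at once\<close>

fun alt :: "'b list \<Rightarrow> 'b list \<Rightarrow> 'b list" where
  "alt ss [] = ss"
| "alt [] (w # ws) = []"
| "alt (s # ss) (w # ws) = s # w # alt ss ws"

lemma alt_props:
  assumes "length ws < length ss" "distinct ss" "distinct ws" "set ss \<inter> set ws = {}"
    "set ss \<subseteq> K" "\<And>w s. w \<in> set ws \<Longrightarrow> s \<in> set ss \<Longrightarrow> E w s"
  shows "gpath E (alt ss ws)" "set (alt ss ws) = set ss \<union> set ws" "hd (alt ss ws) = hd ss"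
    "last (alt ss ws) = last ss" "length (alt ss ws) = length ss + length ws"
proof -
  have "gpath E (alt ss ws) \<and> set (alt ss ws) = set ss \<union> set ws \<and> hd (alt ss ws) = hd ss \<and>
    last (alt ss ws) = last ss \<and> length (alt ss ws) = length ss + length ws"
    using assms
  proof (induction ss ws rule: alt.induct)
    case (1 ss)
    then show ?case using gpath_clique[of K ss] cl by auto
  next
    case (3 s ss w ws)
    have ih: "gpath E (alt ss ws) \<and> set (alt ss ws) = set ss \<union> set ws \<and> hd (alt ss ws) = hd ss \<and>
      last (alt ss ws) = last ss \<and> length (alt ss ws) = length ss + length ws"
      by (rule 3(1)) (use 3 in auto)
    have ne: "ss \<noteq> []" using 3(2) by auto
    then have "hd ss \<in> set ss" by simp
    then have "E w (hd ss)" "E s w" using 3(7)[of w] E_sym by auto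
    moreover have "alt ss ws \<noteq> []" using ih ne by (metis gpath_Nil)
    ultimately show ?case using ih ne 3(3-5) by (auto simp: gpath_Cons)
  qed auto
  then show "gpath E (alt ss ws)" "set (alt ss ws) = set ss \<union> set ws" "hd (alt ss ws) = hd ss"
    "last (alt ss ws) = last ss" "length (alt ss ws) = length ss + length ws" by blast+
qed

text \<open>Leave \<open>K\<close> at \<open>a\<close>, traverse \<open>qs\<close> and
  \<open>\<tau>\<close>, and collect the rest of the clique \<open>K\<close> on the way back to
  \<open>a\<close>. The claim bounds the length of this cycle by \<open>c\<close>.\<close>

lemma excursion:
  assumes "gpath E qs" "set qs \<inter> K = {}" "a \<in> K" "E a (hd qs)" "gpath E \<tau>" "last \<tau> \<in> K"
    "E (last qs) (hd \<tau>)" "a \<notin> set \<tau>" "set \<tau> \<inter> set qs = {}"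
  shows "length qs + length \<tau> + card (K - set \<tau>) \<le> c"
proof -
  have "finite (K - set \<tau> - {a})" using finK by simp
  from finite_distinct_list[OF this]
  obtain R where R: "set R = K - set \<tau> - {a}" "distinct R" by blast
  have lR: "length R + 1 = card (K - set \<tau>)"
  proof -
    have "a \<in> K - set \<tau>" using assms by simp
    then have "card (K - set \<tau>) = Suc (card (K - set \<tau> - {a}))" using finK by (metis card.remove finite_Diff)
    then show ?thesis using R distinct_card by fastforce
  qed
  have ne: "qs \<noteq> []" "\<tau> \<noteq> []" using assms by auto
  have lt: "last \<tau> \<in> set \<tau>" using ne by simp
  have aq: "a \<notin> set qs" using assms by auto
  have 1: "gpath E (a # qs @ \<tau>)" using assms ne aq by (auto simp: gpath_Cons gpath_append)
  show ?thesis
  proof (cases "R = []")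
    case True
    have "E (last \<tau>) a" using cl[of "last \<tau>" a] assms lt by auto
    then have "gcyc E (a # qs @ \<tau>)" using 1 ne by (cases qs; cases \<tau>) (auto simp: gcyc_def)
    from circ[OF this] show ?thesis using True lR by simp
  next
    case False
    have hR: "hd R \<in> set R" "last R \<in> set R" using False by auto
    have "gpath E R" using gpath_clique[of K R] cl R False by auto
    moreover have "hd R \<in> K" "hd R \<notin> set \<tau>" using hR(1) R(1) by auto
    then have "E (last \<tau>) (hd R)" using cl[of "last \<tau>" "hd R"] assms(6) lt by metis
    moreover have "set (a # qs @ \<tau>) \<inter> set R = {}" using R assms(2) by auto
    ultimately have "gpath E ((a # qs @ \<tau>) @ R)" using 1 ne False by (subst gpath_append) auto
    moreover have "E (last R) a" using cl[of "last R" a] hR R assms by auto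
    ultimately have "gcyc E ((a # qs @ \<tau>) @ R)" using False ne by (cases qs; cases \<tau>) (auto simp: gcyc_def)
    from circ[OF this] show ?thesis using lR by simp
  qed
qed

lemma isW_excursion:
  assumes W: "isW v S Ws" and q: "gpath E qs" "set qs \<subseteq> V - K" "set qs \<inter> Ws = {}"
    and ab: "a \<in> K" "b \<in> K" "a \<noteq> b" "E a (hd qs)" "E (last qs) b"
    and c: "a \<notin> S \<or> 2 \<le> length qs \<and> a \<in> S \<and> b \<in> S"
  shows False
proof -
  have S: "S \<subseteq> K" "card S = k" "Ws \<subseteq> V - K" "card Ws = k - 1" "\<And>w. w \<in> Ws \<Longrightarrow> nb w = S"
    using W by (auto simp: isW_def)
  have fin: "finite S" "finite Ws" using S finK finV finite_subset by (blast, meson finite_Diff finite_subset)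
  have EW: "E w s" if "w \<in> Ws" "s \<in> S" for w s using S(5) that by (auto simp: nb_def)
  obtain ws where ws: "set ws = Ws" "distinct ws" using finite_distinct_list[OF fin(2)] by blast
  have lw: "length ws = k - 1" using ws S(4) distinct_card by metis
  have qne: "qs \<noteq> []" using q(1) by auto
  have lq: "1 \<le> length qs" using qne by (cases qs) auto
  obtain ss where ss: "set ss = S - {b} - {a}" "distinct ss"
    using finite_distinct_list[of "S - {b} - {a}"] fin by blast
  have ls: "length ss = card (S - {b} - {a})" using ss distinct_card by metis
  show False
  proof (cases "a \<in> S")
    case False
    show False
    proof (cases "b \<in> S")
      case True
      have lss: "length ss = k - 1" using ls False True S(2) fin by simp
      have sS: "set (b # ss) = S" using ss True False by auto
      have d: "distinct (b # ss)" "set (b # ss) \<subseteq> K" "set (b # ss) \<inter> set ws = {}"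
        using ss(2) sS S(1,3) ws(1) ss(1) by auto
      have e: "\<And>w s. w \<in> set ws \<Longrightarrow> s \<in> set (b # ss) \<Longrightarrow> E w s" using sS ws(1) EW by blast
      have l: "length ws < length (b # ss)" using lw lss by simp
      note p = alt_props[OF l d(1) ws(2) d(3) d(2) e]
      have "last (b # ss) \<in> set (b # ss)" by (rule last_in_set) simp
      then have lK: "last (alt (b # ss) ws) \<in> K" using d(2) p(4) by auto
      have na: "a \<notin> set (alt (b # ss) ws)" using p(2) sS ws(1) S(3) ab(1) False by auto
      have dq: "set (alt (b # ss) ws) \<inter> set qs = {}" using p(2) sS ws(1) q(2,3) S(1) by auto
      have qK: "set qs \<inter> K = {}" using q(2) by auto
      have le: "length qs + length (alt (b # ss) ws) + card (K - set (alt (b # ss) ws)) \<le> c"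
        using excursion[OF q(1) qK ab(1,4) p(1) lK _ na dq] p(3) ab(5) by simp
      have "K - set (alt (b # ss) ws) = K - S" using p(2) sS ws S by auto
      then have "card (K - set (alt (b # ss) ws)) = card K - k" using S(1,2) finK by (simp add: card_Diff_subset fin)
      then show False using le p(5) lw lss lq cK kc k2 by simp
    next
      case b: False
      have sS: "set ss = S" using ss b False by auto
      have lss: "length ss = k" using ls S(2) sS ss by metis
      have d: "set ss \<subseteq> K" "set ss \<inter> set ws = {}" using sS S(1,3) ws(1) by auto
      have e: "\<And>w s. w \<in> set ws \<Longrightarrow> s \<in> set ss \<Longrightarrow> E w s" using sS ws(1) EW by blast
      have l: "length ws < length ss" using lw lss k2 by simp
      note p = alt_props[OF l ss(2) ws(2) d(2,1) e]
      have ne: "ss \<noteq> []" "alt ss ws \<noteq> []" using lss k2 p(1) by auto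
      have hl: "hd ss \<in> S" "last ss \<in> S" using ne(1) sS by auto
      have "b \<notin> set (alt ss ws)" using p(2) sS b ws S(3) ab(2) by auto
      moreover have "E b (hd ss)" using cl[of b "hd ss"] hl S(1) b ab(2) by auto
      ultimately have p2: "gpath E (b # alt ss ws)" using p ne by (simp add: gpath_Cons)
      have lK: "last (b # alt ss ws) \<in> K" using p(4) hl(2) S(1) ne by auto
      have na: "a \<notin> set (b # alt ss ws)" using p(2) sS ws(1) S(3) ab(1,3) False by auto
      have dq: "set (b # alt ss ws) \<inter> set qs = {}" using p(2) sS ws(1) q(2,3) S(1) ab(2) by auto
      have qK: "set qs \<inter> K = {}" using q(2) by auto
      have le: "length qs + length (b # alt ss ws) + card (K - set (b # alt ss ws)) \<le> c"
        using excursion[OF q(1) qK ab(1,4) p2 lK _ na dq] ab(5) by simp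
      have "K - set (b # alt ss ws) = K - insert b S" using p(2) sS ws S by auto
      moreover have "card (K - insert b S) = card K - card (insert b S)"
        using S(1,2) fin ab(2) by (intro card_Diff_subset) auto
      ultimately have "card (K - set (b # alt ss ws)) = card K - Suc k" using b fin S(2) by simp
      then show False using le p(5) lw lss lq cK kc k2 by simp
    qed
  next
    case True
    then have q2: "2 \<le> length qs" "b \<in> S" using c by auto
    have lss: "length ss = k - 2" using ls True q2(2) S(2) fin ab(3) by simp
    \<comment> \<open>Only \<open>k - 1\<close> vertices of \<open>S\<close> remain, so the
      alternating path has room for \<open>k - 2\<close> of \<open>Ws\<close>.\<close>
    define ws' where "ws' = take (k - 2) ws"
    have ws': "length ws' = k - 2" "set ws' \<subseteq> Ws" "distinct ws'"
      using lw ws by (auto simp: ws'_def dest: in_set_takeD)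
    have sS: "set (b # ss) = S - {a}" using ss q2 ab(3) by auto
    have p: "gpath E (alt (b # ss) ws')" "set (alt (b # ss) ws') = set (b # ss) \<union> set ws'"
      "hd (alt (b # ss) ws') = b" "last (alt (b # ss) ws') = last (b # ss)"
      "length (alt (b # ss) ws') = length (b # ss) + length ws'"
    proof -
      have d: "distinct (b # ss)" "set (b # ss) \<subseteq> K" "set (b # ss) \<inter> set ws' = {}"
        using ss sS S ws' by auto
      have e: "\<And>w s. w \<in> set ws' \<Longrightarrow> s \<in> set (b # ss) \<Longrightarrow> E w s" using sS ws'(2) EW by blast
      have l: "length ws' < length (b # ss)" using ws'(1) lss by simp
      note alt_props[OF l d(1) ws'(3) d(3) d(2) e]
      then show "gpath E (alt (b # ss) ws')" "set (alt (b # ss) ws') = set (b # ss) \<union> set ws'"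
        "hd (alt (b # ss) ws') = b" "last (alt (b # ss) ws') = last (b # ss)"
        "length (alt (b # ss) ws') = length (b # ss) + length ws'" by auto
    qed
    have "last (b # ss) \<in> set (b # ss)" by (rule last_in_set) simp
    then have "last (b # ss) \<in> S" unfolding sS by blast
    then have lK: "last (alt (b # ss) ws') \<in> K" using S p by auto
    have na: "a \<notin> set (alt (b # ss) ws')" using p(2) sS ws'(2) S(3) ab(1) by auto
    have dq: "set (alt (b # ss) ws') \<inter> set qs = {}" using p(2) sS ws'(2) q(2,3) S(1) by auto
    have qK: "set qs \<inter> K = {}" using q(2) by auto
    have le: "length qs + length (alt (b # ss) ws') + card (K - set (alt (b # ss) ws')) \<le> c"
      using excursion[OF q(1) qK ab(1,4) p(1) lK _ na dq] p(3) ab(5) by simp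
    have "K - set (alt (b # ss) ws') = K - (S - {a})" using p(2) sS ws' S by auto
    moreover have "card (K - (S - {a})) = card K - card (S - {a})" using S(1) fin by (intro card_Diff_subset) auto
    ultimately have "card (K - set (alt (b # ss) ws')) = card K - (k - 1)" using True fin S(2) by simp
    then show False using le p(5) ws'(1) lss q2(1) cK kc k2 by simp
  qed
qed

lemma isZ_path:
  assumes "isZ v Q a b"
  shows "\<exists>qs. gpath E qs \<and> set qs = Q \<and> length qs = k - 1 \<and> E a (hd qs) \<and> E (last qs) b \<and>
    E b (hd qs) \<and> E (last qs) a"
proof -
  have Q: "v \<in> Q" "Q \<subseteq> V - K" "card Q = k - 1" "\<And>q. q \<in> Q \<Longrightarrow> nb q = (Q - {q}) \<union> {a, b}"
    using assms by (auto simp: isZ_def)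
  have "finite Q" using Q(2) finV by (meson finite_Diff finite_subset)
  then obtain qs where qs: "set qs = Q" "distinct qs" using finite_distinct_list by blast
  have ne: "qs \<noteq> []" using qs Q(1) by auto
  have "gpath E qs"
  proof (rule gpath_clique[of Q])
    show "E u w" if "u \<in> Q" "w \<in> Q" "u \<noteq> w" for u w using Q(4)[OF that(1)] that(2,3) by (auto simp: nb_def)
  qed (use qs ne in auto)
  moreover have "E q a" "E q b" if "q \<in> Q" for q using Q(4)[OF that] by (auto simp: nb_def)
  moreover have "hd qs \<in> Q" "last qs \<in> Q" using qs ne by auto
  moreover have "length qs = k - 1" using qs Q(3) distinct_card by metis
  ultimately show ?thesis using qs E_sym by (intro exI[of _ qs]) auto
qed

lemma isZ_sym: "isZ v Q a b \<Longrightarrow> isZ v Q b a"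
  unfolding isZ_def by (auto simp: insert_commute)

text \<open>One cycle can traverse both blocks and all of \<open>K\<close>, hence
  \<open>|K| + 2(k - 1) > c\<close> vertices. The case \<open>a' = b\<close>, where the second block
  directly follows the first, is treated separately.\<close>

lemma isZ_excursion:
  assumes Z: "isZ v Q a b" "isZ v' Q' a' b'" and n: "b' \<noteq> a" "b' \<noteq> b" "a' \<noteq> a"
  shows False
proof -
  have q: "Q \<subseteq> V - K" "a \<in> K" "b \<in> K" "a \<noteq> b" "\<And>q. q \<in> Q \<Longrightarrow> nb q = (Q - {q}) \<union> {a, b}"
    using Z(1) by (auto simp: isZ_def)
  have q': "Q' \<subseteq> V - K" "a' \<in> K" "b' \<in> K" "a' \<noteq> b'" "\<And>q. q \<in> Q' \<Longrightarrow> nb q = (Q' - {q}) \<union> {a', b'}"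
    using Z(2) by (auto simp: isZ_def)
  obtain qs where qs: "gpath E qs" "set qs = Q" "length qs = k - 1" "E a (hd qs)" "E (last qs) b"
    using isZ_path[OF Z(1)] by blast
  obtain qs' where qs': "gpath E qs'" "set qs' = Q'" "length qs' = k - 1" "E a' (hd qs')" "E (last qs') b'"
    using isZ_path[OF Z(2)] by blast
  have dis: "Q \<inter> Q' = {}"
  proof (rule ccontr)
    assume "Q \<inter> Q' \<noteq> {}"
    then obtain r where "r \<in> Q" "r \<in> Q'" by blast
    then have "b' \<in> (Q - {r}) \<union> {a, b}" using q(5) q'(5) by blast
    then show False using n q(1) q'(3) by auto
  qed
  have ne: "qs' \<noteq> []" using qs' by auto
  have p1: "gpath E (a' # qs' @ [b'])"
    using qs' ne q' by (auto simp: gpath_Cons gpath_append)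
  have qK: "set qs \<inter> K = {}" using qs q by auto
  show False
  proof (cases "a' = b")
    case True
    let ?t = "a' # qs' @ [b']"
    have "length qs + length ?t + card (K - set ?t) \<le> c"
      by (rule excursion[OF qs(1) qK q(2) qs(4) p1]) (use True qs(2,5) q' n q dis qs'(2) in auto)
    moreover have "K - set ?t = K - {a', b'}" using qs' q' by auto
    moreover have "card (K - {a', b'}) = card K - 2" using q' by (subst card_Diff_subset) auto
    ultimately show False using qs(3) qs'(3) cK kc k2 by simp
  next
    case False
    let ?t = "b # a' # qs' @ [b']"
    have p2: "gpath E ?t" using p1 False cl[of b a'] q q' n qs'(2) by (auto simp: gpath_Cons)
    have "length qs + length ?t + card (K - set ?t) \<le> c"
      by (rule excursion[OF qs(1) qK q(2) qs(4) p2]) (use qs(2,5) q' n q dis qs'(2) in auto)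
    moreover have "K - set ?t = K - {b, a', b'}" using qs' q' by auto
    moreover have "card (K - {b, a', b'}) = card K - 3" using q q' n False by (subst card_Diff_subset) auto
    ultimately show False using qs(3) qs'(3) cK kc k2 by simp
  qed
qed

lemma isZ_same:
  assumes Z: "isZ v Q a b" "isZ v' Q' a' b'"
  shows "{a', b'} = {a, b}"
proof (rule ccontr)
  assume "\<not> ?thesis"
  moreover have "a \<noteq> b" "a' \<noteq> b'" using Z by (auto simp: isZ_def)
  ultimately have "a' \<notin> {a, b} \<or> b' \<notin> {a, b}" by auto
  then show False
    using isZ_excursion[OF Z] isZ_excursion[OF isZ_sym[OF Z(1)] Z(2)]
      isZ_excursion[OF Z(1) isZ_sym[OF Z(2)]] isZ_excursion[OF isZ_sym[OF Z(1)] isZ_sym[OF Z(2)]]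
      \<open>a \<noteq> b\<close> \<open>a' \<noteq> b'\<close> by auto
qed

text \<open>If one vertex has the pattern \<open>isW\<close> with \<open>k \<ge> 3\<close>, any
  other neighbourhood of either type supplies an excursion that \<open>isW_excursion\<close>
  forbids. Otherwise every vertex is in a block, and by \<open>isZ_same\<close> all blocks have the
  same attachments.\<close>

theorem clique_structure:
  "(\<exists>S. S \<subseteq> K \<and> card S = k \<and> (\<forall>v\<in>V - K. nb v = S)) \<or>
   (\<exists>a b. a \<in> K \<and> b \<in> K \<and> a \<noteq> b \<and>
     (\<forall>v\<in>V - K. \<exists>Q. v \<in> Q \<and> Q \<subseteq> V - K \<and> card Q = k - 1 \<and> (\<forall>q\<in>Q. nb q = (Q - {q}) \<union> {a, b})))"
proof (cases "\<exists>v\<in>V - K. 3 \<le> k \<and> (\<exists>S Ws. isW v S Ws)")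
  case True
  then obtain v S Ws where v: "v \<in> V - K" "3 \<le> k" "isW v S Ws" by blast
  have S: "S \<subseteq> K" "card S = k" "\<And>w. w \<in> Ws \<Longrightarrow> nb w = S" using v(3) by (auto simp: isW_def)
  have finS: "finite S" using S(1) finK finite_subset by blast
  have "nb u = S" if u: "u \<in> V - K" for u
  proof -
    consider Q a b where "isZ u Q a b" | S' Ws' where "isW u S' Ws'" using isZ_or_isW[OF u] by blast
    then show ?thesis
    proof cases
      case 1
      obtain qs where qs: "gpath E qs" "set qs = Q" "length qs = k - 1" "E a (hd qs)" "E (last qs) b"
        "E b (hd qs)" "E (last qs) a"
        using isZ_path[OF 1] by blast
      have Q: "Q \<subseteq> V - K" "a \<in> K" "b \<in> K" "a \<noteq> b" "\<And>q. q \<in> Q \<Longrightarrow> nb q = (Q - {q}) \<union> {a, b}" "card Q = k - 1"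
        using 1 by (auto simp: isZ_def)
      have "Q \<inter> Ws = {}"
      proof (rule ccontr)
        assume "Q \<inter> Ws \<noteq> {}"
        then obtain q where q: "q \<in> Q" "q \<in> Ws" by blast
        then have "Q - {q} \<subseteq> K" using Q(5) S(1,3) by blast
        then have "Q = {q}" using Q(1) q by auto
        then show False using Q(6) v(2) by simp
      qed
      then have dis: "set qs \<inter> Ws = {}" "set qs \<subseteq> V - K" using qs(2) Q(1) by auto
      have "2 \<le> length qs" using qs(3) v(2) by simp
      then show ?thesis
        using isW_excursion[OF v(3) qs(1) dis(2,1) Q(2,3,4) qs(4,5)]
          isW_excursion[OF v(3) qs(1) dis(2,1) Q(3,2) _ qs(6,7)] Q(4) by auto
    next
      case 2
      have S': "S' \<subseteq> K" "card S' = k" "nb u = S'" using 2 by (auto simp: isW_def)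
      show ?thesis
      proof (rule ccontr)
        assume n: "nb u \<noteq> S"
        have "\<not> S' \<subseteq> S" using card_subset_eq[OF finS, of S'] S S' n by auto
        then obtain a where a: "a \<in> S'" "a \<notin> S" by blast
        have "\<not> S' \<subseteq> {a}" using card_mono[of "{a}" S'] S'(2) k2 by auto
        then obtain b where b: "b \<in> S'" "b \<noteq> a" by blast
        have "E u a" "E u b" using a b S'(3) by (auto simp: nb_def)
        moreover have "u \<notin> Ws" using n S(3) by blast
        ultimately show False
          using isW_excursion[OF v(3), of "[u]" a b] a b S'(1) u E_sym by (auto simp: gpath_def)
      qed
    qed
  qed
  then show ?thesis using S by blast
next
  case False
  then have Z: "\<exists>Q a b. isZ v Q a b" if "v \<in> V - K" for v using isZ_or_isW that by blast
  show ?thesis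
  proof (cases "V - K = {}")
    case True
    obtain a where "a \<in> K" using cK kc by fastforce
    obtain S where "S \<subseteq> K" "card S = k" using obtain_subset_with_card_n[of k K] cK kc by auto
    then show ?thesis using True by blast
  next
    case ne: False
    then obtain v0 Q0 a b where v0: "isZ v0 Q0 a b" using Z by blast
    have "\<exists>Q. v \<in> Q \<and> Q \<subseteq> V - K \<and> card Q = k - 1 \<and> (\<forall>q\<in>Q. nb q = (Q - {q}) \<union> {a, b})"
      if v: "v \<in> V - K" for v
    proof -
      obtain Q a' b' where Q: "isZ v Q a' b'" using Z[OF v] by blast
      have "{a', b'} = {a, b}" using isZ_same[OF v0 Q] .
      then show ?thesis using Q by (auto simp: isZ_def)
    qed
    moreover have "a \<in> K" "b \<in> K" "a \<noteq> b" using v0 by (auto simp: isZ_def)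
    ultimately show ?thesis by blast
  qed
qed

end

section \<open>Hamilton-connected graphs\<close>

lemma two_choose: "2 * (n choose 2) = n * (n - 1)"
  by (induction n) (auto simp: numeral_2_eq_2 algebra_simps)

text \<open>The elements of \<open>us\<close> serve as connectors between the paths; those left over
  form the end.\<close>

fun weave :: "'a list list \<Rightarrow> 'a list \<Rightarrow> 'a list" where
  "weave [] us = us"
| "weave (p # ps) [] = []"
| "weave (p # ps) (u # us) = p @ u # weave ps us"

context sgraph
begin

lemma weave_props:
  assumes "length ps \<le> length us" "us \<noteq> []" "distinct (concat ps)" "distinct us"
    "set us \<inter> set (concat ps) = {}" "\<And>p. p \<in> set ps \<Longrightarrow> gpath E p"
    "\<And>u v. u \<in> set us \<Longrightarrow> v \<in> set us \<Longrightarrow> u \<noteq> v \<Longrightarrow> E u v"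
    "\<And>u v. u \<in> set us \<Longrightarrow> v \<in> set (concat ps) \<Longrightarrow> E u v"
  shows "gpath E (weave ps us) \<and> set (weave ps us) = set us \<union> set (concat ps) \<and>
    last (weave ps us) = last us \<and> hd (weave ps us) = (if ps = [] then hd us else hd (hd ps))"
  using assms
proof (induction ps us rule: weave.induct)
  case (1 us)
  then show ?case using gpath_clique[of "set us" us] by auto
next
  case (3 p ps u us)
  have gp: "gpath E p" "p \<noteq> []" using 3(7)[of p] by auto
  have pu: "E (last p) u" using 3(9)[of u "last p"] gp(2) E_sym by auto
  show ?case
  proof (cases "us = []")
    case True
    then have "ps = []" using 3(2) by simp
    then show ?thesis using True gp pu 3(6) by (auto simp: gpath_append gpath_Cons)
  next
    case False
    have ih: "gpath E (weave ps us) \<and> set (weave ps us) = set us \<union> set (concat ps) \<and>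
      last (weave ps us) = last us \<and> hd (weave ps us) = (if ps = [] then hd us else hd (hd ps))"
    proof (rule 3(1))
      show "length ps \<le> length us" "us \<noteq> []" using 3(2) False by auto
      show "distinct (concat ps)" "distinct us" "set us \<inter> set (concat ps) = {}" using 3(4-6) by auto
      show "gpath E q" if "q \<in> set ps" for q using 3(7) that by simp
      show "E v w" if "v \<in> set us" "w \<in> set us" "v \<noteq> w" for v w using 3(8) that by simp
      show "E v w" if "v \<in> set us" "w \<in> set (concat ps)" for v w using 3(9)[of v w] that by simp
    qed
    have ne: "weave ps us \<noteq> []" using ih by (metis gpath_Nil)
    have "hd (weave ps us) \<in> set (weave ps us)" using ne by simp
    then have h: "hd (weave ps us) \<in> set us \<union> set (concat ps)" "hd (weave ps us) \<noteq> u"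
      using ih 3(5,6) by auto
    then have uh: "E u (hd (weave ps us))" using 3(8)[of u] 3(9)[of u] by auto
    have "gpath E (u # weave ps us)" using ih uh 3(5,6) by (auto simp: gpath_Cons)
    moreover have "set p \<inter> set (u # weave ps us) = {}" using ih 3(4,6) by auto
    ultimately have "gpath E (p @ u # weave ps us)" using gp pu by (simp add: gpath_append)
    then show ?thesis using ih ne False gp(2) by auto
  qed
qed simp

text \<open>Cutting the piece of \<open>x\<close> in front of \<open>x\<close> creates at most one
  additional piece, so \<open>rest\<close> is no longer than \<open>ps\<close>.\<close>

lemma pieces_start:
  assumes "\<And>p. p \<in> set ps \<Longrightarrow> gpath E p" "distinct (concat ps)" "x \<in> set (concat ps)"
  shows "\<exists>px rest. gpath E px \<and> hd px = x \<and> (\<forall>p\<in>set rest. gpath E p) \<and> distinct (concat (px # rest)) \<and>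
    set (concat (px # rest)) = set (concat ps) \<and> length rest \<le> length ps"
proof -
  obtain p where p: "p \<in> set ps" "x \<in> set p" using assms(3) by auto
  obtain ps1 ps2 where ps: "ps = ps1 @ p # ps2" using p(1) by (meson split_list)
  obtain A B where pA: "p = A @ x # B" using p(2) by (meson split_list)
  have gp: "gpath E (A @ x # B)" using assms(1) p(1) pA by simp
  then have gx: "gpath E (x # B)" by (auto simp: gpath_append split: if_splits)
  show ?thesis
  proof (cases "A = []")
    case True
    then show ?thesis using assms ps pA gx
      by (intro exI[of _ "x # B"] exI[of _ "ps1 @ ps2"]) auto
  next
    case False
    then have gA: "gpath E A" using gp by (auto simp: gpath_append)
    show ?thesis using assms ps pA gx gA
      by (intro exI[of _ "x # B"] exI[of _ "A # ps1 @ ps2"]) auto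
  qed
qed

text \<open>The vertices of \<open>A\<close> are adjacent to everything and connect consecutive
  pieces. With both ends in \<open>Y\<close> there are up to \<open>|ps| + 2\<close> pieces after
  cutting at the ends, which takes \<open>|ps| + 1\<close> connectors; the other cases fit the same
  bound.\<close>

lemma hamilton_connected_pieces:
  assumes "finite A" "finite Y" "A \<inter> Y = {}"
    and cl: "\<And>u v. u \<in> A \<Longrightarrow> v \<in> A \<Longrightarrow> u \<noteq> v \<Longrightarrow> E u v"
    and jn: "\<And>u v. u \<in> A \<Longrightarrow> v \<in> Y \<Longrightarrow> E u v"
    and ps: "\<And>p. p \<in> set ps \<Longrightarrow> gpath E p" "distinct (concat ps)" "set (concat ps) = Y"
    and r: "length ps + 1 \<le> card A" and xy: "x \<in> A \<union> Y" "y \<in> A \<union> Y" "x \<noteq> y"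
  shows "\<exists>P. gpath E P \<and> hd P = x \<and> last P = y \<and> set P = A \<union> Y"
proof -
  have list: "\<exists>us. set us = A - X \<and> distinct us \<and> length us = card (A - X)" for X
    using finite_distinct_list[of "A - X"] assms(1) distinct_card by (metis finite_Diff)
  have AY: "\<exists>P. gpath E P \<and> hd P = x \<and> last P = y \<and> set P = A \<union> Y" if x: "x \<in> Y" and y: "y \<in> A" for x y
  proof -
    obtain px rest where px: "gpath E px" "hd px = x" "\<forall>p\<in>set rest. gpath E p" "distinct (concat (px # rest))"
      "set (concat (px # rest)) = Y" "length rest \<le> length ps"
    proof -
      have "x \<in> set (concat ps)" using x ps(3) by simp
      from pieces_start[OF ps(1,2) this] show ?thesis using that unfolding ps(3) by blast
    qed
    obtain us where us: "set us = A - {y}" "distinct us" "length us = card (A - {y})" using list by blast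
    have "length us + 1 = card A" using us(3) y assms(1) by (simp add: card_Diff_singleton r)
      (metis One_nat_def Suc_pred card_gt_0_iff empty_iff)
    let ?P = "weave (px # rest) (us @ [y])"
    have "gpath E ?P \<and> set ?P = set (us @ [y]) \<union> set (concat (px # rest)) \<and>
      last ?P = last (us @ [y]) \<and> hd ?P = (if px # rest = [] then hd (us @ [y]) else hd (hd (px # rest)))"
    proof (rule weave_props)
      show "length (px # rest) \<le> length (us @ [y])" using px(6) r \<open>length us + 1 = card A\<close> by simp
      show "set (us @ [y]) \<inter> set (concat (px # rest)) = {}" using px(5) us(1) y assms(3) by auto
      show "E v w" if "v \<in> set (us @ [y])" "w \<in> set (us @ [y])" "v \<noteq> w" for v w using cl that us(1) y by auto
      show "E v w" if "v \<in> set (us @ [y])" "w \<in> set (concat (px # rest))" for v w using jn that us(1) y px(5) by auto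
    qed (use px us in auto)
    then show ?thesis using px(2,5) us(1) y by (intro exI[of _ ?P]) auto
  qed
  consider "x \<in> A" "y \<in> A" | "x \<in> Y" "y \<in> A" | "x \<in> A" "y \<in> Y" | "x \<in> Y" "y \<in> Y" using xy by blast
  then show ?thesis
  proof cases
    case 1
    obtain us where us: "set us = A - {x, y}" "distinct us" "length us = card (A - {x, y})" using list by blast
    have lu: "length us + 2 = card A"
    proof -
      have "card {x, y} \<le> card A" using 1 assms(1) by (intro card_mono) auto
      then show ?thesis using us(3) 1 xy(3) assms(1) by (simp add: card_Diff_subset)
    qed
    let ?P = "weave ps (us @ [y])"
    have P: "gpath E ?P \<and> set ?P = set (us @ [y]) \<union> set (concat ps) \<and>
      last ?P = last (us @ [y]) \<and> hd ?P = (if ps = [] then hd (us @ [y]) else hd (hd ps))"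
    proof (rule weave_props)
      show "length ps \<le> length (us @ [y])" using r lu by simp
      show "set (us @ [y]) \<inter> set (concat ps) = {}" using ps(3) us(1) 1 assms(3) by auto
      show "E v w" if "v \<in> set (us @ [y])" "w \<in> set (us @ [y])" "v \<noteq> w" for v w using cl that us(1) 1 by auto
      show "E v w" if "v \<in> set (us @ [y])" "w \<in> set (concat ps)" for v w using jn that us(1) 1 ps(3) by auto
    qed (use ps us in auto)
    have ne: "?P \<noteq> []" using P by (metis gpath_Nil)
    have sP: "set ?P = insert y (A - {x, y}) \<union> Y" using P us(1) ps(3) by simp
    have "hd ?P \<in> set ?P" using ne by simp
    then have "hd ?P \<in> insert y (A - {x, y}) \<union> Y" unfolding sP .
    moreover have "insert y (A - {x, y}) \<subseteq> A - {x}" using 1 xy(3) by auto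
    ultimately have "hd ?P \<in> (A - {x}) \<union> Y" by (meson UnE UnI1 UnI2 subsetD)
    then have "E x (hd ?P)" using cl[of x "hd ?P"] jn[of x "hd ?P"] 1 by blast
    moreover have "x \<notin> set ?P" using P us(1) ps(3) 1 xy(3) assms(3) by auto
    ultimately have "gpath E (x # ?P)" using P by (simp add: gpath_Cons)
    then show ?thesis using P us(1) ps(3) 1 ne by (intro exI[of _ "x # ?P"]) auto
  next
    case 2
    then show ?thesis using AY by blast
  next
    case 3
    obtain P where "gpath E P" "hd P = y" "last P = x" "set P = A \<union> Y" using AY[OF 3(2,1)] by blast
    then show ?thesis using gpath_rev'[of P] by (intro exI[of _ "rev P"]) (auto simp: hd_rev last_rev)
  next
    case 4
    obtain px rest where px: "gpath E px" "hd px = x" "\<forall>p\<in>set rest. gpath E p" "distinct (concat (px # rest))"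
      "set (concat (px # rest)) = Y" "length rest \<le> length ps"
    proof -
      have "x \<in> set (concat ps)" using 4 ps(3) by simp
      from pieces_start[OF ps(1,2) this] show ?thesis using that unfolding ps(3) by blast
    qed
    \<comment> \<open>Cut a second time, so that one piece starts at \<open>x\<close> and another
      ends at \<open>y\<close>. If \<open>y\<close> is on the piece of \<open>x\<close>, the part
      from \<open>y\<close> on is reversed.\<close>
    have "\<exists>qx rest' py. gpath E qx \<and> hd qx = x \<and> (\<forall>p\<in>set rest'. gpath E p) \<and> gpath E py \<and> last py = y \<and>
      distinct (concat (qx # rest' @ [py])) \<and> set (concat (qx # rest' @ [py])) = Y \<and> length rest' \<le> length ps"
    proof (cases "y \<in> set px")
      case True
      then obtain A0 B0 where pA: "px = A0 @ y # B0" by (meson split_list)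
      have "A0 \<noteq> []" using pA px(2) xy(3) by auto
      then have g: "gpath E A0" "gpath E (y # B0)" "hd A0 = x" using px(1,2) pA by (auto simp: gpath_append)
      have "gpath E (rev (y # B0))" using g(2) gpath_rev' by blast
      then show ?thesis using g px pA
        by (intro exI[of _ A0] exI[of _ rest] exI[of _ "rev (y # B0)"]) auto
    next
      case False
      then have yr: "y \<in> set (concat rest)" using 4 px(5) by auto
      have dr: "distinct (concat rest)" using px(4) by simp
      have gr: "\<And>p. p \<in> set rest \<Longrightarrow> gpath E p" using px(3) by blast
      obtain py rest' where py: "gpath E py" "hd py = y" "\<forall>p\<in>set rest'. gpath E p" "distinct (concat (py # rest'))"
        "set (concat (py # rest')) = set (concat rest)" "length rest' \<le> length rest"
        using pieces_start[OF gr dr yr] by blast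
      have "gpath E (rev py)" using py(1) gpath_rev' by blast
      moreover have "last (rev py) = y" using py(1,2) by (simp add: last_rev)
      moreover have "distinct (concat (px # rest' @ [rev py]))" using px(4) py(4,5) by auto
      moreover have "set (concat (px # rest' @ [rev py])) = Y" using px(5) py(5) by auto
      ultimately show ?thesis using px(1,2,6) py(3,6)
        by (intro exI[of _ px] exI[of _ rest'] exI[of _ "rev py"]) auto
    qed
    then obtain qx rest' py where q: "gpath E qx" "hd qx = x" "\<forall>p\<in>set rest'. gpath E p" "gpath E py" "last py = y"
      "distinct (concat (qx # rest' @ [py]))" "set (concat (qx # rest' @ [py])) = Y" "length rest' \<le> length ps"
      by blast
    obtain us where us: "set us = A - {}" "distinct us" "length us = card (A - {})" using list by blast
    let ?P = "weave (qx # rest') us"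
    have une: "us \<noteq> []" using us(3) r by auto
    have P: "gpath E ?P \<and> set ?P = set us \<union> set (concat (qx # rest')) \<and>
      last ?P = last us \<and> hd ?P = (if qx # rest' = [] then hd us else hd (hd (qx # rest')))"
    proof (rule weave_props)
      show "length (qx # rest') \<le> length us" using r us q(8) by simp
      show "set us \<inter> set (concat (qx # rest')) = {}" using q(7) us(1) assms(3) by auto
      show "E v w" if "v \<in> set us" "w \<in> set us" "v \<noteq> w" for v w using cl that us(1) by auto
      show "E v w" if "v \<in> set us" "w \<in> set (concat (qx # rest'))" for v w using jn that us(1) q(7) by auto
    qed (use q us une in auto)
    have ne: "?P \<noteq> []" "py \<noteq> []" using P q(4) by (metis gpath_Nil)+
    have "last us \<in> A" using une us(1) last_in_set by blast
    moreover have "hd py \<in> Y" using ne(2) q(7) by auto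
    ultimately have "E (last ?P) (hd py)" using jn P by simp
    moreover have "set ?P \<inter> set py = {}" using P q(6,7) us(1) assms(3) by auto
    ultimately have "gpath E (?P @ py)" using P q(4) ne by (simp add: gpath_append)
    moreover have "set (?P @ py) = A \<union> Y" using P us(1) q(7) by auto
    ultimately show ?thesis using P ne q(2,5) by (intro exI[of _ "?P @ py"]) auto
  qed
qed

text \<open>Vertices of \<open>Y\<close> off \<open>qs\<close> count as pieces of one vertex, so
  there are \<open>|qs| + |Y| - |concat qs|\<close> pieces.\<close>

lemma hamilton_connected:
  assumes "finite A" "finite Y" "A \<inter> Y = {}"
    and cl: "\<And>u v. u \<in> A \<Longrightarrow> v \<in> A \<Longrightarrow> u \<noteq> v \<Longrightarrow> E u v"
    and jn: "\<And>u v. u \<in> A \<Longrightarrow> v \<in> Y \<Longrightarrow> E u v"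
    and qs: "\<And>p. p \<in> set qs \<Longrightarrow> gpath E p" "distinct (concat qs)" "set (concat qs) \<subseteq> Y"
    and r: "length qs + card Y + 1 \<le> card A + length (concat qs)"
    and xy: "x \<in> A \<union> Y" "y \<in> A \<union> Y" "x \<noteq> y"
  shows "\<exists>P. gpath E P \<and> hd P = x \<and> last P = y \<and> set P = A \<union> Y"
proof -
  have "finite (Y - set (concat qs))" using assms(2) by simp
  from finite_distinct_list[OF this] obtain zs where zs: "set zs = Y - set (concat qs)" "distinct zs" by blast
  let ?ps = "qs @ map (\<lambda>z. [z]) zs"
  have cz: "concat (map (\<lambda>z. [z]) zs) = zs" by (induction zs) auto
  show ?thesis
  proof (rule hamilton_connected_pieces[OF assms(1,2,3) cl jn _ _ _ _ xy, of ?ps])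
    show "gpath E p" if "p \<in> set ?ps" for p using that qs(1) by (auto simp: gpath_def)
    show "distinct (concat ?ps)" using qs(2) zs by (auto simp: cz)
    show "set (concat ?ps) = Y" using zs qs(3) by (auto simp: cz)
    have "length zs = card (Y - set (concat qs))" using zs distinct_card by metis
    also have "\<dots> = card Y - length (concat qs)"
      using qs(2,3) assms(2) by (simp only: card_Diff_subset[OF finite_set qs(3)] distinct_card)
    finally have "length zs = card Y - length (concat qs)" .
    moreover have "length (concat qs) \<le> card Y" using qs(2,3) assms(2) by (metis card_mono distinct_card)
    ultimately show "length ?ps + 1 \<le> card A" using r by simp
  qed
qed

section \<open>Double counting and matchings\<close>

lemma sum_card_nb_swap:
  assumes "finite X" "finite Y"
  shows "(\<Sum>v\<in>X. card (nb v \<inter> Y)) = (\<Sum>v\<in>Y. card (nb v \<inter> X))"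
proof -
  have c: "card (nb v \<inter> Z) = (\<Sum>u\<in>Z. if E v u then 1 else 0)" if "finite Z" for v Z
  proof -
    have "(\<Sum>u\<in>Z. if E v u then 1 else (0::nat)) = card (Z \<inter> {u. E v u})"
      using that by (simp add: sum.If_cases)
    then show ?thesis by (simp add: nb_def Int_commute)
  qed
  have "(\<Sum>v\<in>X. card (nb v \<inter> Y)) = (\<Sum>v\<in>X. \<Sum>u\<in>Y. if E v u then 1 else 0)" using c[OF assms(2)] by simp
  also have "\<dots> = (\<Sum>u\<in>Y. \<Sum>v\<in>X. if E v u then 1 else 0)" by (rule sum.swap)
  also have "\<dots> = (\<Sum>u\<in>Y. \<Sum>v\<in>X. if E u v then 1 else 0)"
    by (intro sum.cong refl if_cong) (use E_sym in auto)
  also have "\<dots> = (\<Sum>u\<in>Y. card (nb u \<inter> X))" using c[OF assms(1)] by simp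
  finally show ?thesis .
qed

lemma handshake: "finite X \<Longrightarrow> (\<Sum>v\<in>X. card (nb v \<inter> X)) = 2 * esz X"
proof (induction rule: finite_induct)
  case (insert x X)
  have x: "nb x \<inter> insert x X = nb x \<inter> X" using E_irr by (auto simp: nb_def)
  have v: "card (nb v \<inter> insert x X) = card (nb v \<inter> X) + card (nb v \<inter> {x})" for v
  proof -
    have "nb v \<inter> insert x X = (nb v \<inter> X) \<union> (nb v \<inter> {x})" by auto
    moreover have "(nb v \<inter> X) \<inter> (nb v \<inter> {x}) = {}" using insert by auto
    ultimately show ?thesis by (simp add: card_Un_disjoint)
  qed
  have "(\<Sum>v\<in>X. card (nb v \<inter> {x})) = card (nb x \<inter> X)"
    using sum_card_nb_swap[of X "{x}"] insert by simp
  then have "(\<Sum>v\<in>X. card (nb v \<inter> insert x X)) = 2 * esz X + card (nb x \<inter> X)"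
    using insert.IH by (simp add: v sum.distrib)
  then show ?case using insert x esz_insert by simp
qed simp

lemma nb_V: "nb v \<inter> V = nb v"
  using E_V' by (auto simp: nb_def)

lemma esz_Un_le:
  assumes "finite D" "finite X"
  shows "esz (X \<union> D) \<le> esz X + (\<Sum>v\<in>D. card (nb v))"
  using assms(1)
proof (induction rule: finite_induct)
  case (insert d D)
  show ?case
  proof (cases "d \<in> X")
    case True
    then have "X \<union> insert d D = X \<union> D" by auto
    then show ?thesis using insert by simp
  next
    case False
    have "esz (insert d (X \<union> D)) = esz (X \<union> D) + card (nb d \<inter> (X \<union> D))"
      using False insert assms by (intro esz_insert) auto
    moreover have "card (nb d \<inter> (X \<union> D)) \<le> card (nb d)" by (rule card_mono) auto
    ultimately show ?thesis using insert by simp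
  qed
qed simp

lemma esz_le_sum:
  assumes "L \<subseteq> V"
  shows "esz V \<le> (card L choose 2) + (\<Sum>v\<in>V - L. card (nb v))"
proof -
  have fin: "finite L" "finite (V - L)" using assms finV finite_subset by auto
  have "L \<union> (V - L) = V" using assms by auto
  then show ?thesis using esz_Un_le[OF fin(2,1)] esz_le_choose[OF fin(1)] by simp
qed

lemma esz_universal:
  assumes "finite A" "finite B" "A \<inter> B = {}" "\<And>u v. u \<in> A \<Longrightarrow> v \<in> A \<union> B \<Longrightarrow> u \<noteq> v \<Longrightarrow> E u v"
  shows "esz (A \<union> B) = (card A choose 2) + card A * card B + esz B"
  using assms
proof (induction rule: finite_induct)
  case (insert a A)
  have IH: "esz (A \<union> B) = (card A choose 2) + card A * card B + esz B" using insert by auto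
  have "nb a \<inter> (A \<union> B) = A \<union> B" using insert by (auto simp: nb_def)
  then have "card (nb a \<inter> (A \<union> B)) = card A + card B" using insert by (simp add: card_Un_disjoint)
  moreover have "esz (insert a (A \<union> B)) = esz (A \<union> B) + card (nb a \<inter> (A \<union> B))"
    using insert by (intro esz_insert) auto
  moreover have "Suc (card A) choose 2 = card A + (card A choose 2)" by (simp add: numeral_2_eq_2)
  ultimately show ?case using IH insert by (simp add: algebra_simps)
qed simp

lemma esz_pos:
  assumes "0 < esz X"
  shows "\<exists>u v. u \<in> X \<and> v \<in> X \<and> E u v"
proof (rule ccontr)
  assume "\<not> ?thesis"
  then have "{e. \<exists>u v. e = {u, v} \<and> u \<in> X \<and> v \<in> X \<and> E u v} = {}" by blast
  then show False using assms unfolding esz_def by (metis card.empty less_irrefl)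
qed

text \<open>With inner degrees at most 1, removing both ends of an edge destroys only that
  edge.\<close>

lemma matching_pieces:
  assumes "finite X" "\<And>v. v \<in> X \<Longrightarrow> card (nb v \<inter> X) \<le> 1" "j \<le> esz X"
  shows "\<exists>qs. (\<forall>p\<in>set qs. gpath E p) \<and> distinct (concat qs) \<and> set (concat qs) \<subseteq> X \<and>
    length qs = j \<and> length (concat qs) = 2 * j"
  using assms
proof (induction j arbitrary: X)
  case 0
  then show ?case by (intro exI[of _ "[]"]) auto
next
  case (Suc j)
  then obtain u v where uv: "u \<in> X" "v \<in> X" "E u v" using esz_pos[of X] by auto
  have ne: "u \<noteq> v" using uv E_irr by auto
  define X' where "X' = X - {u, v}"
  have 1: "esz X = esz (X - {u}) + card (nb u \<inter> (X - {u}))"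
    using esz_insert[of "X - {u}" u] Suc.prems(1) uv by (simp add: insert_absorb)
  have 2: "esz (X - {u}) = esz X' + card (nb v \<inter> X')"
  proof -
    have "insert v X' = X - {u}" using uv ne by (auto simp: X'_def)
    then show ?thesis using esz_insert[of X' v] Suc.prems(1) by (simp add: X'_def)
  qed
  have "card (nb u \<inter> (X - {u})) \<le> card (nb u \<inter> X)" using Suc.prems(1) by (intro card_mono) auto
  moreover have "nb v \<inter> X' = {}"
  proof (rule ccontr)
    assume "nb v \<inter> X' \<noteq> {}"
    then obtain z where "z \<in> nb v" "z \<in> X" "z \<noteq> u" by (auto simp: X'_def)
    then have "{u, z} \<subseteq> nb v \<inter> X" using uv E_sym by (auto simp: nb_def)
    then have "card {u, z} \<le> card (nb v \<inter> X)" using Suc.prems(1) by (intro card_mono) auto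
    then show False using Suc.prems(2)[OF uv(2)] \<open>z \<noteq> u\<close> by simp
  qed
  ultimately have "j \<le> esz X'" using 1 2 Suc.prems(2)[OF uv(1)] Suc.prems(3) by simp
  moreover have "card (nb w \<inter> X') \<le> 1" if "w \<in> X'" for w
  proof -
    have "card (nb w \<inter> X') \<le> card (nb w \<inter> X)" using Suc.prems(1) by (intro card_mono) (auto simp: X'_def)
    then show ?thesis using Suc.prems(2)[of w] that by (simp add: X'_def)
  qed
  moreover have "finite X'" using Suc.prems(1) by (simp add: X'_def)
  ultimately obtain qs where qs: "\<forall>p\<in>set qs. gpath E p" "distinct (concat qs)" "set (concat qs) \<subseteq> X'"
    "length qs = j" "length (concat qs) = 2 * j" using Suc.IH[of X'] by blast
  have "gpath E [u, v]" using uv ne by (simp add: gpath_def)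
  moreover have "distinct (concat ([u, v] # qs))" "set (concat ([u, v] # qs)) \<subseteq> X"
    using qs(2,3) ne uv by (auto simp: X'_def)
  moreover have "length (concat ([u, v] # qs)) = 2 * Suc j" using qs(5) by simp
  ultimately show ?case using qs(1,4) by (intro exI[of _ "[u, v] # qs"]) (auto simp del: concat.simps)
qed

end

section \<open>Graphs closed under the degree-sum condition\<close>

text \<open>Here \<open>a\<close> stands for \<open>|A|\<close>, \<open>l\<close> for
  \<open>|L - A|\<close> and \<open>w\<close> for the total slack in the degree estimates. The lower
  bounds on \<open>2 * e\<close> are \<open>2h(c + 1, t - 1) + 2\<close>, written out for even and
  odd \<open>c\<close>.\<close>

lemma size_bounds:
  fixes c t a e w l :: nat
  assumes b: "2 * e + w \<le> a * (a - 1) + (c - a) * (t + a) + l"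
    and ev: "c = 2 * t \<Longrightarrow> l = 0 \<and> 3 * (t * t) + 8 \<le> 2 * e + 3 * t"
    and od: "c = 2 * t + 1 \<Longrightarrow> l + a \<le> t + 2 \<and> 3 * (t * t) + 12 \<le> 2 * e + t"
    and c: "c = 2 * t \<or> c = 2 * t + 1" and t: "3 \<le> t"
  shows "a = t \<Longrightarrow> w + 8 \<le> 2 * t" "a + 1 = t \<Longrightarrow> w + 7 \<le> t" "t \<le> a + 1"
proof -
  obtain s where s: "t = 3 + s" using le_Suc_ex[OF t] by blast
  show "w + 8 \<le> 2 * t" if "a = t" using c
  proof
    assume c: "c = 2 * t"
    show ?thesis using b ev[OF c] unfolding that c s by (simp add: algebra_simps)
  next
    assume c: "c = 2 * t + 1"
    show ?thesis using b od[OF c] unfolding that c s by (simp add: algebra_simps)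
  qed
  show "w + 7 \<le> t" if "a + 1 = t"
  proof -
    have a: "a = 2 + s" using that s by simp
    show ?thesis using c
    proof
      assume c: "c = 2 * t"
      show ?thesis using b ev[OF c] unfolding c s a by (simp add: algebra_simps)
    next
      assume c: "c = 2 * t + 1"
      show ?thesis using b od[OF c] unfolding c s a by (simp add: algebra_simps)
    qed
  qed
  show "t \<le> a + 1"
  proof (rule ccontr)
    assume "\<not> ?thesis"
    then obtain d where d: "t = a + 2 + d" using le_Suc_ex[of "a + 2" t] by auto
    have aa: "a * (a - 1) + a = a * a" by (cases a) auto
    show False using c
    proof
      assume c: "c = 2 * t"
      have ca: "c - a = a + 4 + 2 * d" using c d by simp
      show False using b ev[OF c] aa unfolding ca unfolding d by (simp add: algebra_simps)
    next
      assume c: "c = 2 * t + 1"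
      have ca: "c - a = a + 5 + 2 * d" using c d by simp
      show False using b od[OF c] aa unfolding ca unfolding d by (simp add: algebra_simps)
    qed
  qed
qed

lemma size_bounds_choose:
  fixes c t e :: nat
  assumes "2 * e \<le> (c + 1 - t) * (c - t) + 2 * ((t - 1) * (t - 1))"
    and ev: "c = 2 * t \<Longrightarrow> 3 * (t * t) + 8 \<le> 2 * e + 3 * t"
    and od: "c = 2 * t + 1 \<Longrightarrow> 3 * (t * t) + 12 \<le> 2 * e + t"
    and c: "c = 2 * t \<or> c = 2 * t + 1" and t: "3 \<le> t"
  shows False
proof -
  obtain s where s: "t = 3 + s" using le_Suc_ex[OF t] by blast
  show False using c
  proof
    assume c: "c = 2 * t"
    show False using assms(1) ev[OF c] unfolding c s by (simp add: algebra_simps)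
  next
    assume c: "c = 2 * t + 1"
    show False using assms(1) od[OF c] unfolding c s by (simp add: algebra_simps)
  qed
qed

text \<open>Used for \<open>|A| = t - 1 = s + 2\<close>, where \<open>b\<close> is the number of
  edges outside \<open>A\<close>.\<close>

lemma size_bounds_rest:
  fixes c t s e b :: nat
  assumes "2 * e = (s + 2) * (s + 1) + 2 * ((s + 2) * (c - (s + 2))) + 2 * b"
    and ev: "c = 2 * t \<Longrightarrow> 3 * (t * t) + 8 \<le> 2 * e + 3 * t"
    and od: "c = 2 * t + 1 \<Longrightarrow> 3 * (t * t) + 12 \<le> 2 * e + t"
    and s: "t = s + 3"
  shows "c = 2 * t \<Longrightarrow> 4 \<le> b" "c = 2 * t + 1 \<Longrightarrow> 7 \<le> b"
proof -
  show "4 \<le> b" if c: "c = 2 * t" using assms(1) ev[OF c] unfolding c s by (simp add: algebra_simps)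
  show "7 \<le> b" if c: "c = 2 * t + 1" using assms(1) od[OF c] unfolding c s by (simp add: algebra_simps)
qed

locale closed_graph = sgraph +
  fixes c t :: nat
  assumes cV: "card V = c" and c6: "6 \<le> c" and t_def: "t = c div 2"
    and clo: "u \<in> V \<Longrightarrow> v \<in> V \<Longrightarrow> u \<noteq> v \<Longrightarrow> \<not> E u v \<Longrightarrow> card (nb u) + card (nb v) \<le> c"
begin

lemma ct: "c = 2 * t \<or> c = 2 * t + 1" "3 \<le> t"
  using t_def c6 by presburger+

definition L :: "'a set" where "L = {v \<in> V. t < card (nb v)}"

lemma L_V: "L \<subseteq> V" by (auto simp: L_def)

lemma finL: "finite L" using L_V finV finite_subset by blast

text \<open>Two such degrees sum to at least \<open>2t + 2 > c\<close>.\<close>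

lemma L_clique: "u \<in> L \<Longrightarrow> v \<in> L \<Longrightarrow> u \<noteq> v \<Longrightarrow> E u v"
proof (rule ccontr)
  assume a: "u \<in> L" "v \<in> L" "u \<noteq> v" "\<not> E u v"
  then have "card (nb u) + card (nb v) \<le> c" "t < card (nb u)" "t < card (nb v)"
    using clo[of u v] unfolding L_def by auto
  then show False using ct(1) by linarith
qed

lemma L_deg:
  assumes "v \<in> L"
  shows "card L \<le> card (nb v) + 1"
proof -
  have "L - {v} \<subseteq> nb v" using L_clique assms by (auto simp: nb_def)
  then have "card (L - {v}) \<le> card (nb v)" by (intro card_mono) auto
  then show ?thesis using assms finL by simp
qed

lemma card_L_le: "card L \<le> c"
  using card_mono[OF finV L_V] cV by simp

text \<open>As \<open>v\<close> has degree at most \<open>t < |L|\<close>, it misses some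
  \<open>w\<close> in the clique \<open>L\<close>, whose degree is at least \<open>|L| - 1\<close>;
  closedness bounds the sum of the two degrees by \<open>c\<close>.\<close>

lemma low_deg:
  assumes "c + 2 \<le> card L + t" "v \<in> V - L"
  shows "card (nb v) + card L \<le> c + 1"
proof -
  have lv: "card (nb v) \<le> t" using assms by (auto simp: L_def)
  have "\<not> L \<subseteq> nb v"
  proof
    assume "L \<subseteq> nb v"
    then have "card L \<le> card (nb v)" by (intro card_mono) auto
    then show False using lv assms(1) ct by linarith
  qed
  then obtain w where w: "w \<in> L" "\<not> E v w" by (auto simp: nb_def)
  then have "card (nb v) + card (nb w) \<le> c" using clo[of v w] assms w L_V by auto
  then show ?thesis using L_deg[OF w(1)] by linarith
qed

text \<open>With \<open>d = c + 1 - |L|\<close>, there are \<open>d - 1\<close> vertices outside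
  \<open>L\<close>, each of degree at most \<open>d\<close>.\<close>

lemma esz_big:
  assumes "c + 2 \<le> card L + t"
  shows "esz V \<le> h_num (c + 1) (c + 1 - card L)"
proof -
  let ?d = "c + 1 - card L"
  have "esz V \<le> (card L choose 2) + (\<Sum>v\<in>V - L. card (nb v))" by (rule esz_le_sum[OF L_V])
  also have "(\<Sum>v\<in>V - L. card (nb v)) \<le> (\<Sum>v\<in>V - L. ?d)"
    using low_deg[OF assms] by (intro sum_mono) (simp add: le_diff_conv2 card_L_le le_SucI)
  also have "(\<Sum>v\<in>V - L. ?d) = (c - card L) * ?d" using cV finL L_V by (simp add: card_Diff_subset)
  finally have "esz V \<le> (card L choose 2) + (c - card L) * ?d" by simp
  moreover have "c + 1 - ?d = card L" "?d - 1 = c - card L" using card_L_le by auto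
  ultimately show ?thesis by (simp add: h_num_def mult.commute)
qed

text \<open>The threshold complements \<open>t\<close>: by closedness a vertex of \<open>A\<close>
  is adjacent to every other vertex of degree at least \<open>t\<close>. For even \<open>c\<close>
  this set is \<open>L\<close>.\<close>

definition A :: "'a set" where "A = {v \<in> V. c < card (nb v) + t}"

lemma A_V: "A \<subseteq> V" by (auto simp: A_def)

lemma finA: "finite A" using A_V finV finite_subset by blast

lemma A_L: "A \<subseteq> L" using ct by (auto simp: A_def L_def)

lemma A_adj: "v \<in> V \<Longrightarrow> t \<le> card (nb v) \<Longrightarrow> a \<in> A \<Longrightarrow> v \<noteq> a \<Longrightarrow> E a v"
  using clo[of a v] by (auto simp: A_def)

lemma notA_deg: "v \<in> V - A \<Longrightarrow> card (nb v) \<le> c - t"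
  by (auto simp: A_def)

lemma card_notA: "card (V - A) = c - card A"
  using cV finA A_V by (simp add: card_Diff_subset)

text \<open>In the sum of all degrees, those of \<open>A\<close> are counted at the other ends of
  their edges. This leaves the edges inside \<open>A\<close> and one term for each vertex
  outside.\<close>

lemma double_esz:
  "2 * esz V \<le> card A * (card A - 1) + (\<Sum>v\<in>V - A. card (nb v) + card (nb v \<inter> A))"
proof -
  have "2 * esz V = (\<Sum>v\<in>V. card (nb v))" using handshake[OF finV] by (simp add: nb_V)
  also have "\<dots> = (\<Sum>v\<in>A. card (nb v)) + (\<Sum>v\<in>V - A. card (nb v))"
    using A_V finV by (metis add.commute sum.subset_diff)
  also have "(\<Sum>v\<in>A. card (nb v)) = (\<Sum>v\<in>A. card (nb v \<inter> V))" by (simp add: nb_V)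
  also have "\<dots> = (\<Sum>v\<in>V. card (nb v \<inter> A))" by (rule sum_card_nb_swap[OF finA finV])
  also have "\<dots> = (\<Sum>v\<in>A. card (nb v \<inter> A)) + (\<Sum>v\<in>V - A. card (nb v \<inter> A))"
    using A_V finV by (metis add.commute sum.subset_diff)
  also have "(\<Sum>v\<in>A. card (nb v \<inter> A)) \<le> (\<Sum>v\<in>A. card A - 1)"
  proof (rule sum_mono)
    fix v assume v: "v \<in> A"
    have "card (nb v \<inter> A) \<le> card (A - {v})" using finA E_irr by (intro card_mono) (auto simp: nb_def)
    then show "card (nb v \<inter> A) \<le> card A - 1" using v finA by simp
  qed
  also have "(\<Sum>v\<in>A. card A - 1) = card A * (card A - 1)" by simp
  finally show ?thesis by (simp add: sum.distrib)
qed

end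

locale closed_graph_small = closed_graph +
  assumes Ls: "card L + t \<le> c + 1" and He: "h_num (c + 1) (t - 1) < esz V"
begin

lemma He_num:
  "c = 2 * t \<Longrightarrow> 3 * (t * t) + 8 \<le> 2 * esz V + 3 * t"
  "c = 2 * t + 1 \<Longrightarrow> 3 * (t * t) + 12 \<le> 2 * esz V + t"
proof -
  obtain s where s: "t = s + 3" using ct(2) by (metis add.commute le_Suc_ex)
  have h: "2 * h_num (c + 1) (t - 1) + 2 \<le> 2 * esz V" using He by simp
  show "3 * (t * t) + 8 \<le> 2 * esz V + 3 * t" if c: "c = 2 * t"
  proof -
    have "2 * h_num (c + 1) (t - 1) = (s + 5) * (s + 4) + 2 * ((s + 2) * (s + 1))"
      unfolding h_num_def c s using two_choose[of "s + 5"] by (simp add: algebra_simps)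
    then show ?thesis using h unfolding s by (simp add: algebra_simps)
  qed
  show "3 * (t * t) + 12 \<le> 2 * esz V + t" if c: "c = 2 * t + 1"
  proof -
    have "2 * h_num (c + 1) (t - 1) = (s + 6) * (s + 5) + 2 * ((s + 2) * (s + 1))"
      unfolding h_num_def c s using two_choose[of "s + 6"] by (simp add: algebra_simps)
    then show ?thesis using h unfolding s by (simp add: algebra_simps)
  qed
qed

text \<open>If \<open>|A| > t\<close>, a vertex of degree \<open>t\<close> would be adjacent to all
  of \<open>A\<close>; so degrees outside \<open>L\<close> are at most \<open>t - 1\<close>. Fill
  \<open>L\<close> up to \<open>c + 1 - t\<close> vertices; the other \<open>t - 1\<close> vertices
  then add at most \<open>(t - 1)^2\<close> edges, which is too few.\<close>

lemma A_le: "card A \<le> t"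
proof (rule ccontr)
  assume n: "\<not> ?thesis"
  have low: "card (nb v) \<le> t - 1" if v: "v \<in> V - L" for v
  proof (rule ccontr)
    assume "\<not> ?thesis"
    moreover have "card (nb v) \<le> t" using v by (auto simp: L_def)
    ultimately have e: "card (nb v) = t" by simp
    have "A \<subseteq> nb v"
    proof
      fix a assume a: "a \<in> A"
      then have "v \<noteq> a" using v A_L by blast
      then have "E a v" using A_adj[of v a] v e a by simp
      then show "a \<in> nb v" using E_sym by (simp add: nb_def)
    qed
    then have "card A \<le> card (nb v)" by (intro card_mono) auto
    then show False using n e by simp
  qed
  have "\<exists>L'. L \<subseteq> L' \<and> L' \<subseteq> V \<and> card L' = c + 1 - t"
  proof (rule exists_subset_between)
    show "card L \<le> c + 1 - t" using Ls by simp
    show "c + 1 - t \<le> card V" using cV ct by linarith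
  qed (use L_V finV in auto)
  then obtain L' where L': "L \<subseteq> L'" "L' \<subseteq> V" "card L' = c + 1 - t" by blast
  have "esz V \<le> (card L' choose 2) + (\<Sum>v\<in>V - L'. card (nb v))" by (rule esz_le_sum[OF L'(2)])
  also have "(\<Sum>v\<in>V - L'. card (nb v)) \<le> (\<Sum>v\<in>V - L'. t - 1)" using low L'(1) by (intro sum_mono) auto
  also have "\<dots> = (t - 1) * (t - 1)"
  proof -
    have "c - (c + 1 - t) = t - 1" using ct by linarith
    then have "card (V - L') = t - 1" using L'(2,3) cV finV by (simp add: card_Diff_subset finite_subset)
    then show ?thesis by simp
  qed
  finally have "2 * esz V \<le> 2 * ((c + 1 - t) choose 2) + 2 * ((t - 1) * (t - 1))" using L'(3) by simp
  then have "2 * esz V \<le> (c + 1 - t) * (c - t) + 2 * ((t - 1) * (t - 1))" using two_choose[of "c + 1 - t"] by simp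
  from size_bounds_choose[OF this He_num ct] show False .
qed

text \<open>Outside \<open>A\<close> the largest possible value of
  \<open>deg v + |nb v \<inter> A|\<close> is \<open>t + |A|\<close>, plus 1 on \<open>L\<close>;
  \<open>w\<close> records how far a vertex stays below it.\<close>

lemma sum_bound:
  assumes "\<And>v. v \<in> V - A \<Longrightarrow> card (nb v) + card (nb v \<inter> A) + w v \<le> t + card A + (if v \<in> L then 1 else 0)"
  shows "2 * esz V + (\<Sum>v\<in>V - A. w v) \<le> card A * (card A - 1) + (c - card A) * (t + card A) + card (L - A)"
proof -
  have "(\<Sum>v\<in>V - A. card (nb v) + card (nb v \<inter> A)) + (\<Sum>v\<in>V - A. w v) =
    (\<Sum>v\<in>V - A. card (nb v) + card (nb v \<inter> A) + w v)" by (simp add: sum.distrib)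
  also have "\<dots> \<le> (\<Sum>v\<in>V - A. t + card A + (if v \<in> L then 1 else 0))" by (intro sum_mono assms)
  also have "\<dots> = (c - card A) * (t + card A) + (\<Sum>v\<in>V - A. if v \<in> L then 1 else 0)"
    using card_notA by (simp add: sum.distrib)
  also have "(\<Sum>v\<in>V - A. if v \<in> L then 1 else (0::nat)) = card (L - A)"
  proof -
    have "(V - A) \<inter> {v. v \<in> L} = L - A" using L_V by auto
    then show ?thesis using finV by (simp add: sum.If_cases)
  qed
  finally show ?thesis using double_esz by linarith
qed

lemma da_le: "card (nb v \<inter> A) \<le> card A" "card (nb v \<inter> A) \<le> card (nb v)"
  using finA by (auto intro: card_mono)

lemma base_bound:
  assumes "v \<in> V - A"
  shows "card (nb v) \<le> t + (if v \<in> L then 1 else 0)"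
proof -
  have "card (nb v) \<le> c - t" using notA_deg[OF assms] .
  then show ?thesis using ct(1) assms by (auto simp: L_def)
qed

lemma LA_card: "c = 2 * t \<Longrightarrow> card (L - A) = 0" "c = 2 * t + 1 \<Longrightarrow> card (L - A) + card A \<le> t + 2"
proof -
  show "card (L - A) = 0" if c: "c = 2 * t"
  proof -
    have "v \<in> A" if "v \<in> L" for v using that c unfolding L_def A_def mem_Collect_eq by linarith
    then have "L - A = {}" by blast
    then show ?thesis by (metis card.empty)
  qed
  show "card (L - A) + card A \<le> t + 2" if c: "c = 2 * t + 1"
  proof -
    have "card (L - A) + card A = card L" using A_L finL by (simp add: card_Diff_subset finA card_mono)
    then show ?thesis using Ls c by linarith
  qed
qed

lemma A_ge: "t \<le> card A + 1"
proof (rule ccontr)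
  assume n: "\<not> ?thesis"
  have b: "2 * esz V + (\<Sum>v\<in>V - A. 0) \<le> card A * (card A - 1) + (c - card A) * (t + card A) + card (L - A)"
  proof (rule sum_bound)
    fix v assume v: "v \<in> V - A"
    show "card (nb v) + card (nb v \<inter> A) + 0 \<le> t + card A + (if v \<in> L then 1 else 0)"
      using base_bound[OF v] da_le(1)[of v] by linarith
  qed
  then have b: "2 * esz V + 0 \<le> card A * (card A - 1) + (c - card A) * (t + card A) + card (L - A)" by simp
  have "t \<le> card A + 1"
    by (rule size_bounds(3)[OF b _ _ ct]) (use LA_card He_num in auto)
  then show False using n by simp
qed

definition B0 :: "'a set" where "B0 = {v \<in> V. card (nb v) < t}"

lemma B0_sub: "B0 \<subseteq> V - A" "finite B0"
  using A_L finV by (auto simp: B0_def L_def A_def)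

text \<open>Such a \<open>b\<close> misses some \<open>a\<close> in \<open>A\<close>, and
  \<open>a\<close> is adjacent to everything outside \<open>B0\<close>, so its degree is at least
  \<open>c - |B0| - 1\<close>.\<close>

lemma B0_deg:
  assumes "b \<in> B0" "card (nb b \<inter> A) < card A"
  shows "card (nb b) \<le> card B0 + 1"
proof -
  have "\<not> A \<subseteq> nb b" using assms(2) by (metis Int_absorb1 Int_commute less_irrefl)
  then obtain a where a: "a \<in> A" "\<not> E b a" by (auto simp: nb_def)
  have ab: "a \<noteq> b" using a(1) assms(1) B0_sub by auto
  have "V - B0 - {a} \<subseteq> nb a"
  proof
    fix w assume w: "w \<in> V - B0 - {a}"
    then have "t \<le> card (nb w)" by (auto simp: B0_def not_less)
    then have "E a w" using A_adj[of w a] a(1) w by blast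
    then show "w \<in> nb a" by (simp add: nb_def)
  qed
  then have "card (V - B0 - {a}) \<le> card (nb a)" by (intro card_mono) auto
  moreover have "card (V - B0 - {a}) = c - card B0 - 1"
  proof -
    have "a \<in> V - B0" "B0 \<subseteq> V" using a(1) A_V B0_sub by auto
    then show ?thesis using B0_sub(2) cV finV card_Diff_subset[of B0 V] by simp
  qed
  moreover have "card (nb b) + card (nb a) \<le> c" using clo[of b a] assms(1) a ab A_V B0_sub by auto
  moreover have "card B0 + 1 \<le> c"
  proof -
    have "insert a B0 \<subseteq> V" "a \<notin> B0" using a(1) A_V B0_sub by auto
    then have "card (insert a B0) \<le> c" "card (insert a B0) = Suc (card B0)"
      using card_mono[OF finV, of "insert a B0"] cV B0_sub(2) by simp_all
    then show ?thesis by simp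
  qed
  ultimately show ?thesis by linarith
qed

text \<open>Every vertex of \<open>B0\<close> costs slack, so \<open>B0\<close> is small. But a
  vertex that is not adjacent to all of \<open>A\<close> has degree at most \<open>|B0| + 1\<close>,
  and then it costs more slack than the edge count leaves.\<close>

lemma A_universal:
  assumes "a \<in> A" "v \<in> V" "v \<noteq> a"
  shows "E a v"
proof (rule ccontr)
  assume nE: "\<not> ?thesis"
  have "card (nb v) < t" using A_adj[OF assms(2) _ assms(1,3)] nE not_le by blast
  then have vB: "v \<in> B0" using assms(2) by (simp add: B0_def)
  have dv: "card (nb v \<inter> A) < card A"
  proof (rule psubset_card_mono[OF finA])
    show "nb v \<inter> A \<subset> A" using nE assms(1) E_sym by (auto simp: nb_def)
  qed
  define m where "m = card B0"
  have m1: "1 \<le> m" using vB B0_sub(2) by (auto simp: m_def Suc_le_eq card_gt_0_iff)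
  have sumB0: "(\<Sum>v\<in>V - A. if v \<in> B0 then X else 0) = m * X" for X :: nat
  proof -
    have "(V - A) \<inter> {v. v \<in> B0} = B0" using B0_sub by auto
    then show ?thesis using finV by (simp add: sum.If_cases m_def)
  qed
  have B0L: "u \<notin> L" if "u \<in> B0" for u using that by (auto simp: B0_def L_def)
  consider "card A = t" | "card A + 1 = t" using A_le A_ge by linarith
  then show False
  proof cases
    case 1
    have mX: "m * X + 8 \<le> 2 * t" if X: "\<And>u. u \<in> B0 \<Longrightarrow> card (nb u) + card (nb u \<inter> A) + X \<le> 2 * t" for X
    proof -
      have b: "2 * esz V + (\<Sum>v\<in>V - A. if v \<in> B0 then X else 0) \<le> card A * (card A - 1) + (c - card A) * (t + card A) + card (L - A)"
      proof (rule sum_bound)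
        fix u assume u: "u \<in> V - A"
        show "card (nb u) + card (nb u \<inter> A) + (if u \<in> B0 then X else 0) \<le> t + card A + (if u \<in> L then 1 else 0)"
        proof (cases "u \<in> B0")
          case True
          then show ?thesis using X[OF True] 1 by simp
        next
          case False
          then show ?thesis using base_bound[OF u] da_le(1)[of u] by simp
        qed
      qed
      have "2 * esz V + m * X \<le> card A * (card A - 1) + (c - card A) * (t + card A) + card (L - A)"
        using b unfolding sumB0 .
      then show ?thesis by (rule size_bounds(1)[OF _ _ _ ct 1]) (use LA_card He_num in auto)
    qed
    have B0d: "card (nb u) < t" "card (nb u \<inter> A) < t" "card (nb u) \<le> m + 1" "card (nb u \<inter> A) \<le> m + 1"
      if "u \<in> B0" for u
    proof -
      show d: "card (nb u) < t" using that by (simp add: B0_def)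
      then show d2: "card (nb u \<inter> A) < t" using da_le(2)[of u] by simp
      show "card (nb u) \<le> m + 1" using B0_deg[OF that] d2 1 by (simp add: m_def)
      then show "card (nb u \<inter> A) \<le> m + 1" using da_le(2)[of u] by simp
    qed
    \<comment> \<open>First estimate: as \<open>|A| = t\<close>, each vertex of \<open>B0\<close>
      loses at least 1 in its degree and 1 in its neighbours in \<open>A\<close>.\<close>
    have "m * 2 + 8 \<le> 2 * t"
    proof (rule mX)
      fix u assume "u \<in> B0"
      from B0d(1,2)[OF this] show "card (nb u) + card (nb u \<inter> A) + 2 \<le> 2 * t" by linarith
    qed
    then have "m + 4 \<le> t" by linarith
    then obtain s where s: "t = m + 4 + s" using le_Suc_ex by blast
    \<comment> \<open>Second estimate, now that degrees in \<open>B0\<close> are at most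
      \<open>m + 1\<close>: the loss per vertex is \<open>2t - 2(m + 1)\<close>.\<close>
    have "m * (2 * (3 + s)) + 8 \<le> 2 * t"
    proof (rule mX)
      fix u assume "u \<in> B0"
      have "2 * t = (m + 1) + (m + 1) + 2 * (3 + s)" using s by simp
      then show "card (nb u) + card (nb u \<inter> A) + 2 * (3 + s) \<le> 2 * t"
        using add_mono[OF B0d(3,4)[OF \<open>u \<in> B0\<close>]] by linarith
    qed
    then have "3 * m + m * s \<le> m + s" using s by (simp add: algebra_simps)
    moreover have "s \<le> m * s" using m1 by simp
    ultimately show False using m1 by linarith
  next
    case 2
    \<comment> \<open>With \<open>|A| = t - 1\<close>, a vertex of \<open>B0\<close> may be adjacent
      to all of \<open>A\<close> and is only sure to lose 1; the additional loss \<open>Y\<close> is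
      that of \<open>v\<close> alone.\<close>
    have mY: "m + Y + 7 \<le> t" if Y: "card (nb v) + card (nb v \<inter> A) + 1 + Y \<le> t + card A" for Y
    proof -
      have b: "2 * esz V + (\<Sum>u\<in>V - A. (if u \<in> B0 then 1 else 0) + (if u = v then Y else 0)) \<le> card A * (card A - 1) + (c - card A) * (t + card A) + card (L - A)"
      proof (rule sum_bound)
        fix u assume u: "u \<in> V - A"
        show "card (nb u) + card (nb u \<inter> A) + ((if u \<in> B0 then 1 else 0) + (if u = v then Y else 0)) \<le> t + card A + (if u \<in> L then 1 else 0)"
        proof (cases "u \<in> B0")
          case True
          then have "card (nb u) + 1 \<le> t" by (simp add: B0_def)
          then show ?thesis using True Y da_le(1)[of u] by auto
        next
          case False
          then show ?thesis using base_bound[OF u] da_le(1)[of u] vB by auto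
        qed
      qed
      have "(\<Sum>u\<in>V - A. (if u \<in> B0 then 1 else 0) + (if u = v then Y else 0)) = m + Y"
        using sumB0[of 1] vB B0_sub finV by (simp add: sum.distrib sum.delta subset_iff)
      then have b': "2 * esz V + (m + Y) \<le> card A * (card A - 1) + (c - card A) * (t + card A) + card (L - A)"
        using b by simp
      show ?thesis by (rule size_bounds(2)[OF b' _ _ ct 2]) (use LA_card He_num in auto)
    qed
    have "card (nb v) + 1 \<le> t" using vB by (simp add: B0_def)
    then have "card (nb v) + card (nb v \<inter> A) + 1 + 0 \<le> t + card A" using da_le(1)[of v] by simp
    from mY[OF this] have m7: "m + 7 \<le> t" by simp
    have "card (nb v) \<le> m + 1" using B0_deg[OF vB dv] by (simp add: m_def)
    \<comment> \<open>The value of \<open>Y\<close> solves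
      \<open>2(m + 1) + 1 + Y = t + |A| = 2t - 1\<close>.\<close>
    then have "card (nb v) + card (nb v \<inter> A) + 1 + (2 * t - 2 * m - 4) \<le> t + card A"
      using da_le(2)[of v] 2 m7 by linarith
    from mY[OF this] show False using m7 by linarith
  qed
qed

lemma esz_split: "esz V = (card A choose 2) + card A * (c - card A) + esz (V - A)"
proof -
  have "A \<union> (V - A) = V" using A_V by auto
  moreover have "esz (A \<union> (V - A)) = (card A choose 2) + card A * card (V - A) + esz (V - A)"
    using A_universal finA finV A_V by (intro esz_universal) auto
  ultimately show ?thesis using card_notA by simp
qed

lemma ham_connected_B:
  assumes "\<And>p. p \<in> set qs \<Longrightarrow> gpath E p" "distinct (concat qs)" "set (concat qs) \<subseteq> V - A"
    "length qs + (c - card A) + 1 \<le> card A + length (concat qs)" "x \<in> V" "y \<in> V" "x \<noteq> y"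
  shows "\<exists>P. gpath E P \<and> hd P = x \<and> last P = y \<and> set P = V"
proof -
  have e: "A \<union> (V - A) = V" using A_V by auto
  have "\<exists>P. gpath E P \<and> hd P = x \<and> last P = y \<and> set P = A \<union> (V - A)"
    by (rule hamilton_connected[where qs = qs])
      (use finA finV A_universal A_V assms card_notA e in auto)
  then show ?thesis using e by simp
qed

lemma deg_B:
  assumes "v \<in> V - A"
  shows "card (nb v) = card A + card (nb v \<inter> (V - A))"
proof -
  have "nb v = A \<union> (nb v \<inter> (V - A))" using A_universal[of _ v] assms E_sym E_V' by (auto simp: nb_def)
  moreover have "A \<inter> (nb v \<inter> (V - A)) = {}" by auto
  ultimately show ?thesis using finA finV by (metis card_Un_disjoint finite_Diff finite_Int)
qed

lemma esz_supp:
  assumes "finite Y" "\<And>u v. u \<in> X \<Longrightarrow> v \<in> X \<Longrightarrow> E u v \<Longrightarrow> u \<in> Y"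
  shows "esz X \<le> esz Y"
  unfolding esz_def
proof (rule card_mono)
  show "finite {e. \<exists>u v. e = {u, v} \<and> u \<in> Y \<and> v \<in> Y \<and> E u v}"
    by (rule finite_subset[of _ "Pow Y"]) (use assms(1) in auto)
  show "{e. \<exists>u v. e = {u, v} \<and> u \<in> X \<and> v \<in> X \<and> E u v} \<subseteq> {e. \<exists>u v. e = {u, v} \<and> u \<in> Y \<and> v \<in> Y \<and> E u v}"
    using assms(2) E_sym by blast
qed

text \<open>Edges outside \<open>A\<close> merge vertices into fewer pieces, and with
  \<open>|A| - 1\<close> pieces \<open>hamilton_connected\<close> applies. If
  \<open>|A| = t - 1\<close>, the edge count forces 3 disjoint edges outside \<open>A\<close> for
  even \<open>c\<close> and 4 for odd \<open>c\<close>, which suffices. If \<open>|A| = t\<close>,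
  one edge suffices for even \<open>c\<close> and two for odd \<open>c\<close>.\<close>

theorem near_extremal:
  assumes xy: "x \<in> V" "y \<in> V" "x \<noteq> y" and NH: "\<not> (\<exists>P. gpath E P \<and> hd P = x \<and> last P = y \<and> set P = V)"
  shows "card A = t" "c = 2 * t \<Longrightarrow> u \<in> V - A \<Longrightarrow> v \<in> V - A \<Longrightarrow> \<not> E u v"
    "c = 2 * t + 1 \<Longrightarrow> u \<in> V - A \<Longrightarrow> v \<in> V - A \<Longrightarrow> u' \<in> V - A \<Longrightarrow> v' \<in> V - A \<Longrightarrow> E u v \<Longrightarrow> E u' v' \<Longrightarrow>
      {u, v} = {u', v'}"
proof -
  define B where "B = V - A"
  have finB: "finite B" using finV by (simp add: B_def)
  have noq: False if "\<And>p. p \<in> set qs \<Longrightarrow> gpath E p" "distinct (concat qs)" "set (concat qs) \<subseteq> B"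
    "length qs + (c - card A) + 1 \<le> card A + length (concat qs)" for qs
    using ham_connected_B[OF that(1,2) _ that(4) xy] that(3) NH unfolding B_def by blast
  obtain s where s: "t = s + 3" using ct(2) by (metis add.commute le_Suc_ex)
  show At: "card A = t"
  proof (rule ccontr)
    assume "card A \<noteq> t"
    then have a: "card A = s + 2" using A_le A_ge s by linarith
    have spl: "2 * esz V = (s + 2) * (s + 1) + 2 * ((s + 2) * (c - (s + 2))) + 2 * esz B"
      using esz_split two_choose[of "s + 2"] unfolding a B_def[symmetric] by simp
    have Bnum: "c = 2 * t \<Longrightarrow> 4 \<le> esz B" "c = 2 * t + 1 \<Longrightarrow> 7 \<le> esz B"
      using size_bounds_rest[OF spl _ _ s] He_num by blast+
    have non: "card (nb u \<inter> B) + card (nb v \<inter> B) + 2 * (s + 2) \<le> c" if "u \<in> B" "v \<in> B" "u \<noteq> v" "\<not> E u v" for u v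
      using clo[of u v] deg_B[of u] deg_B[of v] that a by (auto simp: B_def)
    \<comment> \<open>A vertex of larger degree inside \<open>B\<close> is adjacent to all
      non-isolated vertices of \<open>B\<close>, so that the edges of \<open>B\<close> lie within 3
      or 4 vertices and are too few; or it is adjacent to everything and would belong to
      \<open>A\<close>.\<close>
    have bnd: "card (nb v \<inter> B) + 2 * t \<le> c + 1" if v: "v \<in> B" for v
    proof (rule ccontr)
      assume n: "\<not> ?thesis"
      define N0 where "N0 = {w \<in> B. 1 \<le> card (nb w \<inter> B)}"
      have "E v w" if "w \<in> N0" "w \<noteq> v" for w using non[OF v, of w] that n s by (auto simp: N0_def)
      then have N0: "N0 \<subseteq> insert v (nb v \<inter> B)" by (auto simp: N0_def nb_def)
      have bv: "card (nb v \<inter> B) + 2 * t = c + 2"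
      proof (rule ccontr)
        assume n2: "\<not> ?thesis"
        have "E v w" if "w \<in> B" "w \<noteq> v" for w using non[OF v, of w] that n n2 s by auto
        then have "V - {v} \<subseteq> nb v" using A_universal[of _ v] v E_sym by (auto simp: B_def nb_def)
        then have "card (V - {v}) \<le> card (nb v)" by (intro card_mono) auto
        then have "c - 1 \<le> card (nb v)" using v cV finV by (simp add: B_def)
        then have "v \<in> A" using v ct c6 by (auto simp: A_def B_def)
        then show False using v by (simp add: B_def)
      qed
      have "esz B \<le> esz N0"
      proof (rule esz_supp)
        show "finite N0" using finB by (simp add: N0_def)
        show "p \<in> N0" if "p \<in> B" "q \<in> B" "E p q" for p q
        proof -
          have "nb p \<inter> B \<noteq> {}" using that by (auto simp: nb_def)
          then show ?thesis using that finB by (simp add: N0_def Suc_le_eq card_gt_0_iff)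
        qed
      qed
      also have "\<dots> \<le> card N0 choose 2" using finB by (intro esz_le_choose) (simp add: N0_def)
      finally have e1: "2 * esz B \<le> card N0 * (card N0 - 1)" using two_choose[of "card N0"] by simp
      have "card N0 \<le> card (insert v (nb v \<inter> B))" using N0 finB by (intro card_mono) auto
      also have "\<dots> \<le> Suc (card (nb v \<inter> B))" by (simp add: card_insert_if)
      finally have cN: "card N0 \<le> Suc (card (nb v \<inter> B))" .
      show False using ct(1)
      proof
        assume c: "c = 2 * t"
        then have "card N0 \<le> 3" using cN bv by simp
        then have "card N0 * (card N0 - 1) \<le> 3 * 2" by (intro mult_le_mono) auto
        then show False using e1 Bnum(1)[OF c] by linarith
      next
        assume c: "c = 2 * t + 1"
        then have "card N0 \<le> 4" using cN bv by simp
        then have "card N0 * (card N0 - 1) \<le> 4 * 3" by (intro mult_le_mono) auto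
        then show False using e1 Bnum(2)[OF c] by linarith
      qed
    qed
    show False using ct(1)
    proof
      assume c: "c = 2 * t"
      \<comment> \<open>Three disjoint edges join the \<open>t + 1\<close> vertices of
        \<open>B\<close> into \<open>t - 2 = |A| - 1\<close> pieces.\<close>
      have "3 \<le> esz B" using Bnum(1)[OF c] by simp
      moreover have "card (nb v \<inter> B) \<le> 1" if "v \<in> B" for v using bnd[OF that] c by simp
      ultimately obtain qs where "\<forall>p\<in>set qs. gpath E p" "distinct (concat qs)" "set (concat qs) \<subseteq> B"
        "length qs = 3" "length (concat qs) = 2 * 3" using matching_pieces[OF finB, of 3] by blast
      then show False using noq[of qs] a c s by auto
    next
      assume c: "c = 2 * t + 1"
      have e7: "7 \<le> esz B" by (rule Bnum(2)[OF c])
      have b2: "card (nb v \<inter> B) \<le> 2" if "v \<in> B" for v using bnd[OF that] c by simp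
      show False
      proof (cases "\<exists>q\<in>B. card (nb q \<inter> B) = 2")
        case False
        then have "card (nb v \<inter> B) \<le> 1" if "v \<in> B" for v using b2[OF that] that by fastforce
        then obtain qs where "\<forall>p\<in>set qs. gpath E p" "distinct (concat qs)" "set (concat qs) \<subseteq> B"
          "length qs = 4" "length (concat qs) = 2 * 4" using matching_pieces[OF finB, of 4] e7 by auto
        then show False using noq[of qs] a c s by auto
      next
        case True
        then obtain q where q: "q \<in> B" "card (nb q \<inter> B) = 2" by blast
        then obtain f g where fg: "nb q \<inter> B = {f, g}" "f \<noteq> g" by (meson card_2_iff)
        have qf: "E q f" "E q g" "f \<in> B" "g \<in> B" "q \<noteq> f" "q \<noteq> g" using fg E_irr by (auto simp: nb_def)
        \<comment> \<open>Removing \<open>q\<close> and its two neighbours destroys at most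
          \<open>2 + 1 + 1\<close> of at least seven edges. Three disjoint edges in \<open>X\<close>
          together with \<open>q f\<close> make four.\<close>
        define X where "X = B - {q, f, g}"
        have "card (nb v \<inter> X) \<le> 1" if v: "v \<in> X" for v
        proof -
          have "\<not> E q v" using v fg by (auto simp: X_def nb_def)
          then have "card (nb v \<inter> B) \<le> 1" using non[OF q(1), of v] v q c s by (auto simp: X_def)
          moreover have "card (nb v \<inter> X) \<le> card (nb v \<inter> B)" using finB by (intro card_mono) (auto simp: X_def)
          ultimately show ?thesis by simp
        qed
        moreover have "3 \<le> esz X"
        proof -
          have 1: "esz B = esz (B - {q}) + card (nb q \<inter> (B - {q}))"
            using esz_insert[of "B - {q}" q] finB q by (simp add: insert_absorb)
          have "insert f (B - {q, f}) = B - {q}" using qf by auto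
          then have 2: "esz (B - {q}) = esz (B - {q, f}) + card (nb f \<inter> (B - {q, f}))"
            using esz_insert[of "B - {q, f}" f] finB by simp
          have "insert g X = B - {q, f}" using qf fg(2) by (auto simp: X_def)
          then have 3: "esz (B - {q, f}) = esz X + card (nb g \<inter> X)"
            using esz_insert[of X g] finB by (simp add: X_def)
          have "card (nb q \<inter> (B - {q})) \<le> card (nb q \<inter> B)" using finB by (intro card_mono) auto
          moreover have less: "card (nb w \<inter> Y) < card (nb w \<inter> B)" if "E q w" "Y \<subseteq> B - {q}" for w Y
          proof (rule psubset_card_mono)
            show "nb w \<inter> Y \<subset> nb w \<inter> B" using that q(1) E_sym by (auto simp: nb_def)
          qed (use finB in simp)
          have "card (nb f \<inter> (B - {q, f})) < card (nb f \<inter> B)" by (rule less) (use qf in auto)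
          moreover have "card (nb g \<inter> X) < card (nb g \<inter> B)" by (rule less) (use qf in \<open>auto simp: X_def\<close>)
          ultimately show ?thesis using 1 2 3 e7 q(2) b2[OF qf(3)] b2[OF qf(4)] by linarith
        qed
        moreover have "finite X" using finB by (simp add: X_def)
        ultimately obtain qs where qs: "\<forall>p\<in>set qs. gpath E p" "distinct (concat qs)" "set (concat qs) \<subseteq> X"
          "length qs = 3" "length (concat qs) = 2 * 3" using matching_pieces[of X 3] by blast
        have "gpath E [q, f]" using qf by (simp add: gpath_def)
        moreover have "distinct (concat ([q, f] # qs))" "set (concat ([q, f] # qs)) \<subseteq> B"
          using qs(2,3) qf q(1) by (auto simp: X_def)
        moreover have "length (concat ([q, f] # qs)) = 8" "length ([q, f] # qs) = 4" using qs(4,5) by simp_all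
        ultimately show False using noq[of "[q, f] # qs"] a c s qs(1) by (auto simp del: concat.simps)
      qed
    qed
  qed
  show "\<not> E u v" if "c = 2 * t" "u \<in> V - A" "v \<in> V - A"
  proof
    assume e: "E u v"
    then have "gpath E [u, v]" "u \<noteq> v" using E_irr by (auto simp: gpath_def)
    then show False using noq[of "[[u, v]]"] that At by (auto simp: B_def)
  qed
  show "{u, v} = {u', v'}" if c: "c = 2 * t + 1" and w: "u \<in> V - A" "v \<in> V - A" "u' \<in> V - A" "v' \<in> V - A" "E u v" "E u' v'"
  proof (rule ccontr)
    assume n: "{u, v} \<noteq> {u', v'}"
    \<comment> \<open>A piece on three vertices saves as much as two disjoint edges.\<close>
    have three: False if "p \<in> B" "q \<in> B" "r \<in> B" "E p q" "E q r" "p \<noteq> r" for p q r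
    proof -
      have "gpath E [p, q, r]" using that E_irr by (auto simp: gpath_def)
      then show False using noq[of "[[p, q, r]]"] that At c by (auto simp: gpath_def)
    qed
    have ne: "u \<noteq> v" "u' \<noteq> v'" using w E_irr by auto
    have uB: "u \<in> B" "v \<in> B" "u' \<in> B" "v' \<in> B" using w by (auto simp: B_def)
    show False
    proof (cases "{u, v} \<inter> {u', v'} = {}")
      case True
      have "gpath E [u, v]" "gpath E [u', v']" using w ne by (auto simp: gpath_def)
      then show False using noq[of "[[u, v], [u', v']]"] True uB ne At c by auto
    next
      case False
      then consider "u = u'" | "u = v'" | "v = u'" | "v = v'" by auto
      then show False
        by cases (use n three w uB ne E_sym in \<open>metis insert_commute\<close>)+
    qed
  qed
qed

end

section \<open>Graphs and their closures\<close>

definition adj :: "'a graph \<Rightarrow> 'a \<Rightarrow> 'a \<Rightarrow> bool" where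
  "adj G u v \<longleftrightarrow> {u, v} \<in> edges G"

lemma sgraph_adj:
  assumes "simple_graph G"
  shows "sgraph (verts G) (adj G)"
proof
  show "finite (verts G)" using assms by (simp add: simple_graph_def)
  show "adj G v u" if "adj G u v" for u v using that by (simp add: adj_def insert_commute)
  show "\<not> adj G u u" for u using assms by (force simp: adj_def simple_graph_def)
  show "u \<in> verts G" if "adj G u v" for u v using that assms by (force simp: adj_def simple_graph_def)
qed

lemma simple_edge_cases:
  assumes "simple_graph G" "e \<in> edges G"
  shows "\<exists>u v. e = {u, v} \<and> u \<noteq> v \<and> u \<in> verts G \<and> v \<in> verts G"
proof -
  have "card e = 2" "e \<subseteq> verts G" using assms by (auto simp: simple_graph_def)
  then obtain u v where "e = {u, v}" "u \<noteq> v" by (meson card_2_iff)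
  then show ?thesis using \<open>e \<subseteq> verts G\<close> by auto
qed

lemma degree_adj:
  assumes "simple_graph G"
  shows "degree G v = card (sgraph.nb (adj G) v)"
proof -
  interpret sgraph "verts G" "adj G" using sgraph_adj[OF assms] .
  have "{e \<in> edges G. v \<in> e} = (\<lambda>u. {v, u}) ` nb v"
  proof (intro equalityI subsetI)
    fix e assume e: "e \<in> {e \<in> edges G. v \<in> e}"
    then obtain x y where "e = {x, y}" "x \<noteq> y" using simple_edge_cases[OF assms] by blast
    then show "e \<in> (\<lambda>u. {v, u}) ` nb v" using e by (auto simp: nb_def adj_def insert_commute)
  qed (auto simp: nb_def adj_def)
  moreover have "card ((\<lambda>u. {v, u}) ` nb v) = card (nb v)"
    by (rule card_image) (auto simp: inj_on_def doubleton_eq_iff)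
  ultimately show ?thesis by (simp add: degree_def)
qed

lemma card_edges_esz:
  assumes "simple_graph G"
  shows "card (edges G) = sgraph.esz (adj G) (verts G)"
proof -
  interpret sgraph "verts G" "adj G" using sgraph_adj[OF assms] .
  have "edges G = {e. \<exists>u v. e = {u, v} \<and> u \<in> verts G \<and> v \<in> verts G \<and> adj G u v}"
    using simple_edge_cases[OF assms] by (fastforce simp: adj_def)
  then show ?thesis unfolding esz_def by simp
qed

lemma is_cycle_gcyc:
  assumes "simple_graph G"
  shows "is_cycle G C \<longleftrightarrow> gcyc (adj G) C"
proof -
  interpret sgraph "verts G" "adj G" using sgraph_adj[OF assms] .
  show ?thesis
  proof
    assume c: "is_cycle G C"
    then have l: "3 \<le> length C" and d: "distinct C" and e: "\<And>i. i < length C \<Longrightarrow> adj G (C ! i) (C ! (Suc i mod length C))"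
      by (auto simp: is_cycle_def adj_def)
    have "successively (adj G) C" unfolding successively_conv_nth
    proof (intro allI impI)
      fix i assume "Suc i < length C"
      then show "adj G (C ! i) (C ! Suc i)" using e[of i] by simp
    qed
    moreover have "adj G (last C) (hd C)"
    proof -
      have "Suc (length C - 1) = length C" using l by simp
      then have "Suc (length C - 1) mod length C = 0" by (simp only: mod_self)
      moreover have "C \<noteq> []" using l by auto
      ultimately show ?thesis using e[of "length C - 1"] l by (simp add: last_conv_nth hd_conv_nth)
    qed
    ultimately show "gcyc (adj G) C" using l d by (auto simp: gcyc_def gpath_def)
  next
    assume c: "gcyc (adj G) C"
    then have l: "3 \<le> length C" and d: "distinct C" and s: "successively (adj G) C" and e: "adj G (last C) (hd C)"
      by (auto simp: gcyc_def gpath_def)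
    have ne: "C \<noteq> []" using l by auto
    have "set C \<subseteq> verts G" using c E_V' e by (intro gpath_set_V) (auto simp: gcyc_def)
    moreover have "{C ! i, C ! (Suc i mod length C)} \<in> edges G" if i: "i < length C" for i
    proof (cases "Suc i < length C")
      case True
      then show ?thesis using s by (simp add: successively_conv_nth adj_def)
    next
      case False
      then have e1: "Suc i = length C" using i by simp
      then have "i = length C - 1" "Suc i mod length C = 0" by (simp_all only: mod_self diff_Suc_1 flip: e1)
      then show ?thesis using e ne by (simp add: last_conv_nth hd_conv_nth adj_def)
    qed
    ultimately show "is_cycle G C" using l d by (simp add: is_cycle_def)
  qed
qed

lemma gcyc_nth:
  assumes "gcyc E C" "i < length C"
  shows "E (C ! i) (C ! (Suc i mod length C))"
proof (cases "Suc i < length C")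
  case True
  then show ?thesis using assms(1) by (simp add: gcyc_def gpath_def successively_conv_nth)
next
  case False
  then have e1: "Suc i = length C" using assms(2) by simp
  then have "i = length C - 1" "Suc i mod length C = 0" by (simp_all only: mod_self diff_Suc_1 flip: e1)
  then show ?thesis using assms by (auto simp: gcyc_def gpath_def last_conv_nth hd_conv_nth)
qed

lemma two_conn_graph_adj:
  assumes "simple_graph G" "two_connected G"
  shows "two_conn_graph (verts G) (adj G)"
proof -
  interpret sgraph "verts G" "adj G" using sgraph_adj[OF assms(1)] .
  show ?thesis
  proof
    show "3 \<le> card (verts G)" using assms(2) by (simp add: two_connected_def)
    fix u v x assume uv: "u \<in> verts G" "v \<in> verts G" "u \<noteq> x" "v \<noteq> x"
    show "(\<lambda>a b. adj G a b \<and> a \<noteq> x \<and> b \<noteq> x)\<^sup>*\<^sup>* u v"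
    proof (cases "x \<in> verts G")
      case True
      let ?H = "induced G (verts G - {x})"
      have "connected_graph ?H" using assms(2) True by (simp add: two_connected_def)
      moreover have "u \<in> verts ?H" "v \<in> verts ?H" using uv by (auto simp: induced_def)
      ultimately have "(\<lambda>a b. {a, b} \<in> edges ?H)\<^sup>*\<^sup>* u v" by (simp add: connected_graph_def)
      then show ?thesis
        by (rule rtranclp_mono[THEN predicate2D, rotated]) (auto simp: induced_def adj_def)
    next
      case False
      have "(\<lambda>a b. {a, b} \<in> edges G)\<^sup>*\<^sup>* u v" using assms(2) uv by (simp add: two_connected_def connected_graph_def)
      then show ?thesis
      proof (rule rtranclp_mono[THEN predicate2D, rotated])
        show "(\<lambda>a b. {a, b} \<in> edges G) \<le> (\<lambda>a b. adj G a b \<and> a \<noteq> x \<and> b \<noteq> x)"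
          using False E_V E_V' by (auto simp: adj_def[symmetric])
      qed
    qed
  qed
qed

lemma two_conn_graph_mono:
  assumes "two_conn_graph V E" "sgraph V F" "\<And>u v. E u v \<Longrightarrow> F u v"
  shows "two_conn_graph V F"
proof -
  interpret E: two_conn_graph V E by fact
  interpret F: sgraph V F by fact
  show ?thesis
  proof
    show "3 \<le> card V" by (rule E.card3)
    fix u v x assume "u \<in> V" "v \<in> V" "u \<noteq> x" "v \<noteq> x"
    then have "(\<lambda>a b. E a b \<and> a \<noteq> x \<and> b \<noteq> x)\<^sup>*\<^sup>* u v" by (rule E.tconn)
    then show "(\<lambda>a b. F a b \<and> a \<noteq> x \<and> b \<noteq> x)\<^sup>*\<^sup>* u v"
      by (rule rtranclp_mono[THEN predicate2D, rotated]) (use assms(3) in auto)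
  qed
qed

lemma two_conn_graph_degree_ge_2:
  assumes "two_conn_graph V E" "v \<in> V"
  shows "2 \<le> card (sgraph.nb E v)"
proof -
  interpret two_conn_graph V E by fact
  have one: "\<exists>w. w \<noteq> x \<and> E v w" if x: "x \<noteq> v" for x
  proof -
    have "\<not> V \<subseteq> {v, x}"
    proof
      assume "V \<subseteq> {v, x}"
      then have "card V \<le> card {v, x}" by (intro card_mono) auto
      also have "\<dots> \<le> 2" by (simp add: card_insert_if)
      finally show False using card3 by simp
    qed
    then obtain u where u: "u \<in> V" "u \<noteq> v" "u \<noteq> x" by blast
    have "(\<lambda>a b. E a b \<and> a \<noteq> x \<and> b \<noteq> x)\<^sup>*\<^sup>* v u" using tconn[OF assms(2) u(1) x[symmetric] u(3)] .
    then show ?thesis by (cases rule: converse_rtranclpE) (use u(2) in auto)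
  qed
  have "\<exists>x. x \<noteq> v"
  proof (rule ccontr)
    assume "\<not> ?thesis"
    then have "V \<subseteq> {v}" by auto
    then have "card V \<le> card {v}" by (intro card_mono) auto
    then show False using card3 by simp
  qed
  then obtain w where w: "E v w" using one by blast
  then have "w \<noteq> v" using E_irr by auto
  then obtain w' where "w' \<noteq> w" "E v w'" using one by blast
  then have "{w, w'} \<subseteq> nb v" "card {w, w'} = 2" using w by (auto simp: nb_def)
  then show ?thesis using card_mono[of "nb v" "{w, w'}"] by simp
qed

text \<open>The new edge is bypassed through a common neighbour off the path or, failing that, by the
  crossing argument of Bondy and Chvatal; both keep the ends of the path.\<close>

lemma closure_step_gpath:
  assumes "simple_graph G" "closure_step (c + 1) G H" "card (verts G) = c" "gpath (adj H) P" "hd P \<in> verts G"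
  shows "\<exists>P'. gpath (adj G) P' \<and> hd P' = hd P \<and> last P' = last P \<and> length P \<le> length P'"
proof (cases "gpath (adj G) P")
  case True
  then show ?thesis by blast
next
  case False
  interpret G: sgraph "verts G" "adj G" using sgraph_adj[OF assms(1)] .
  obtain u0 v0 where uv0: "u0 \<in> verts G" "v0 \<in> verts G" "u0 \<noteq> v0" "{u0, v0} \<notin> edges G"
    "c + 1 \<le> degree G u0 + degree G v0" "H = Graph (verts G) (insert {u0, v0} (edges G))"
    using assms(2) by (auto simp: closure_step_def)
  have H: "simple_graph H" "verts H = verts G" using closure_step_simple_graph[OF assms(2,1)] uv0(6) by auto
  interpret H: sgraph "verts G" "adj H" using sgraph_adj[OF H(1)] H(2) by simp
  have adjH: "adj H p q \<longleftrightarrow> adj G p q \<or> {p, q} = {u0, v0}" for p q by (auto simp: adj_def uv0(6))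
  have P: "distinct P" "P \<noteq> []" "successively (adj H) P" using assms(4) by (auto simp: gpath_def)
  have PV: "set P \<subseteq> verts G" using H.gpath_set_V[OF assms(4,5)] .
  have "\<not> successively (adj G) P" using False P by (auto simp: gpath_def)
  then obtain A u v B where s: "P = A @ u # v # B" "\<not> adj G u v" using not_successively_split by blast
  have "adj H u v" using P(3) s(1) by (auto simp: successively_append_iff successively_Cons)
  then have uvs: "{u, v} = {u0, v0}" using adjH s(2) by blast
  have uv: "u \<noteq> v" "c + 1 \<le> card (G.nb u) + card (G.nb v)" "u \<in> verts G" "v \<in> verts G"
    using uvs uv0 degree_adj[OF assms(1)] by (auto simp: doubleton_eq_iff)
  have gA: "successively (adj G) (A @ [u])" and gB: "successively (adj G) (v # B)"
  proof -
    have a: "successively (adj G) xs" if "successively (adj H) xs" "u \<notin> set xs \<or> v \<notin> set xs" for xs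
      using that(1)
    proof (rule successively_mono)
      fix p q assume pq: "p \<in> set xs" "q \<in> set xs" "adj H p q"
      then show "adj G p q" using adjH[of p q] uvs that(2) by (auto simp: doubleton_eq_iff)
    qed
    have "successively (adj H) (A @ [u])" "successively (adj H) (v # B)" "v \<notin> set (A @ [u])" "u \<notin> set (v # B)"
      using P s(1) by (auto simp: successively_append_iff successively_Cons)
    then show "successively (adj G) (A @ [u])" "successively (adj G) (v # B)" using a by blast+
  qed
  let ?n = "length P" and ?i = "length A"
  show ?thesis
  proof (cases "\<exists>w. w \<notin> set P \<and> adj G u w \<and> adj G v w")
    case True
    then obtain w where w: "w \<notin> set P" "adj G u w" "adj G w v" using G.E_sym by blast
    have "gpath (adj G) (A @ [u] @ w # v # B)" using gA gB w P(1) s(1)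
      by (auto simp: gpath_def successively_append_iff successively_Cons)
    then show ?thesis using s(1) by (intro exI[of _ "A @ [u] @ w # v # B"]) (auto simp: hd_append)
  next
    case noW: False
    \<comment> \<open>A position \<open>j\<close> in both sets means that \<open>u\<close> sees
      \<open>P ! j\<close> and \<open>v\<close> sees its successor, which permits a detour. Neither
      set contains \<open>?i\<close>, so if they are disjoint they are too small for the degree
      sum.\<close>
    define Ju where "Ju = {j. Suc j < ?n \<and> adj G u (P ! j)}"
    define Jv where "Jv = {j. Suc j < ?n \<and> adj G v (P ! Suc j)}"
    have fin: "finite Ju" "finite Jv" by (rule finite_subset[of _ "{..<?n}"], auto simp: Ju_def Jv_def)+
    have Pi: "P ! ?i = u" "P ! Suc ?i = v" unfolding s(1) by (auto simp: nth_append)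
    have ni: "?i \<notin> Ju" "?i \<notin> Jv" using Pi G.E_irr by (auto simp: Ju_def Jv_def)
    show ?thesis
    proof (cases "Ju \<inter> Jv = {}")
      case True
      have "Ju \<union> Jv \<subseteq> {..<?n - 1} - {?i}" using ni by (auto simp: Ju_def Jv_def)
      moreover have "?i < ?n - 1" using s(1) by simp
      then have "card ({..<?n - 1} - {?i}) = ?n - 2" by simp
      ultimately have c1: "card Ju + card Jv \<le> ?n - 2" using fin True
        by (metis card_Un_disjoint card_mono finite_Diff finite_lessThan)
      have "G.nb u \<inter> set P \<subseteq> insert (last P) ((!) P ` Ju)"
      proof
        fix w assume w: "w \<in> G.nb u \<inter> set P"
        then obtain j where j: "j < ?n" "P ! j = w" by (auto simp: in_set_conv_nth)
        show "w \<in> insert (last P) ((!) P ` Ju)"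
        proof (cases "Suc j < ?n")
          case True
          then show ?thesis using j w by (auto simp: Ju_def G.nb_def)
        next
          case False
          then have "j = ?n - 1" using j by simp
          then show ?thesis using j P(2) by (simp add: last_conv_nth)
        qed
      qed
      then have "card (G.nb u \<inter> set P) \<le> card (insert (last P) ((!) P ` Ju))" using fin by (intro card_mono) auto
      also have "\<dots> \<le> Suc (card Ju)" using card_image_le[OF fin(1), of "(!) P"] fin by (simp add: card_insert_if)
      finally have cu: "card (G.nb u \<inter> set P) \<le> Suc (card Ju)" .
      have "G.nb v \<inter> set P \<subseteq> insert (hd P) ((\<lambda>j. P ! Suc j) ` Jv)"
      proof
        fix w assume w: "w \<in> G.nb v \<inter> set P"
        then obtain j where j: "j < ?n" "P ! j = w" by (auto simp: in_set_conv_nth)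
        show "w \<in> insert (hd P) ((\<lambda>j. P ! Suc j) ` Jv)"
          using j w P(2) by (cases j) (auto simp: Jv_def G.nb_def hd_conv_nth)
      qed
      then have "card (G.nb v \<inter> set P) \<le> card (insert (hd P) ((\<lambda>j. P ! Suc j) ` Jv))" using fin by (intro card_mono) auto
      also have "\<dots> \<le> Suc (card Jv)" using card_image_le[OF fin(2), of "\<lambda>j. P ! Suc j"] fin by (simp add: card_insert_if)
      finally have cv: "card (G.nb v \<inter> set P) \<le> Suc (card Jv)" .
      have split: "card (G.nb w) = card (G.nb w \<inter> set P) + card (G.nb w - set P)" for w
        by (metis G.finite_nb add.commute card_Diff_subset_Int card_Int_Diff finite_Int)
      have "(G.nb u - set P) \<inter> (G.nb v - set P) = {}" using noW by (auto simp: G.nb_def)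
      then have "card (G.nb u - set P) + card (G.nb v - set P) = card ((G.nb u - set P) \<union> (G.nb v - set P))"
        by (simp add: card_Un_disjoint)
      also have "\<dots> \<le> card (verts G - set P)" using G.finV G.E_V' by (intro card_mono) (auto simp: G.nb_def)
      also have "\<dots> = c - ?n" using PV P(1) assms(3) G.finV by (simp add: card_Diff_subset distinct_card)
      finally have co: "card (G.nb u - set P) + card (G.nb v - set P) \<le> c - ?n" .
      have "?n \<le> c" using PV P(1) assms(3) card_mono[OF G.finV PV] by (simp add: distinct_card)
      moreover have "2 \<le> ?n" using s(1) by simp
      \<comment> \<open>On \<open>P\<close> the degrees of \<open>u\<close> and \<open>v\<close> sum
        to at most \<open>(?n - 2) + 2\<close>, off \<open>P\<close> to at most
        \<open>c - ?n\<close>: altogether at most \<open>c\<close>.\<close>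
      ultimately show ?thesis using c1 cu cv co split[of u] split[of v] uv(2) by linarith
    next
      case False
      then obtain j where j: "Suc j < ?n" "adj G u (P ! j)" "adj G v (P ! Suc j)"
        by (auto simp: Ju_def Jv_def)
      have ji: "j \<noteq> ?i" using j ni by (auto simp: Ju_def)
      have dP: "distinct (A @ u # v # B)" using P(1) s(1) by simp
      show ?thesis
      proof (cases "j < ?i")
        case True
        define p q where "p = P ! j" and "q = P ! Suc j"
        define X Y where "X = take (Suc j) A" and "Y = drop (Suc j) A"
        have AXY: "A = X @ Y" by (simp add: X_def Y_def)
        have X: "X \<noteq> []" "last X = p" using True by (auto simp: X_def p_def s(1) nth_append take_Suc_conv_app_nth)
        have q: "hd (Y @ [u]) = q"
        proof (cases "Suc j < ?i")
          case True
          then show ?thesis by (simp add: Y_def q_def s(1) nth_append hd_append hd_drop_conv_nth)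
        next
          case False
          then have "Suc j = ?i" using True by simp
          then show ?thesis by (simp add: Y_def q_def s(1) nth_append)
        qed
        \<comment> \<open>Reverse the stretch from the successor of \<open>P ! j\<close> to
          \<open>u\<close>, so that \<open>P ! j\<close> is followed by \<open>u\<close> and that
          successor by \<open>v\<close>.\<close>
        let ?P = "X @ rev (Y @ [u]) @ v # B"
        have sY: "successively (adj G) X" "successively (adj G) (Y @ [u])"
          using gA unfolding AXY by (auto simp: successively_append_iff)
        have sr: "successively (adj G) (rev (Y @ [u]))" using sY(2) dP G.gpath_rev'[of "Y @ [u]"] AXY by (auto simp: gpath_def)
        have "hd (rev (Y @ [u])) = u" by simp
        moreover have "last (rev (Y @ [u])) = q" using q by (simp add: last_rev del: rev_append)
        ultimately have "successively (adj G) ?P"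
          unfolding successively_append_iff using sY(1) sr gB X j G.E_sym by (auto simp: p_def q_def)
        then have "gpath (adj G) ?P" using dP AXY by (auto simp: gpath_def)
        then show ?thesis using s(1) AXY X by (intro exI[of _ ?P]) auto
      next
        case False
        then have ij: "Suc ?i \<le> j" using ji by simp
        define p q where "p = P ! j" and "q = P ! Suc j"
        define k where "k = j - Suc ?i"
        define X Y where "X = take (Suc k) (v # B)" and "Y = drop (Suc k) (v # B)"
        have BXY: "v # B = X @ Y" by (simp add: X_def Y_def)
        have jk: "j = Suc ?i + k" "Suc k < length (v # B)" using ij j(1) s(1) by (auto simp: k_def)
        have "P ! j = (v # B) ! k" "P ! Suc j = (v # B) ! Suc k" unfolding s(1) jk(1) by (auto simp: nth_append)
        moreover have "X = take k (v # B) @ [(v # B) ! k]" unfolding X_def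
          by (rule take_Suc_conv_app_nth) (use jk(2) in simp)
        moreover have "Y = (v # B) ! Suc k # drop (Suc (Suc k)) (v # B)" unfolding Y_def
          by (rule Cons_nth_drop_Suc[symmetric]) (rule jk(2))
        moreover have "X \<noteq> []" "hd X = v" by (simp_all add: X_def)
        ultimately have X: "X \<noteq> []" "last X = p" "Y \<noteq> []" "hd Y = q" "hd X = v"
          by (simp_all add: p_def q_def)
        \<comment> \<open>The mirror image: reverse the stretch from \<open>v\<close> to
          \<open>P ! j\<close>.\<close>
        let ?P = "(A @ [u]) @ rev X @ Y"
        have sX: "successively (adj G) X" "successively (adj G) Y" using gB unfolding BXY by (auto simp: successively_append_iff)
        have dX: "distinct (A @ u # (X @ Y))" using dP BXY by simp
        have sr: "successively (adj G) (rev X)" using sX(1) dX G.gpath_rev'[of X] X(1) by (auto simp: gpath_def)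
        have "successively (adj G) ?P"
          unfolding successively_append_iff[of _ "A @ [u]"] successively_append_iff[of _ "rev X"]
          using gA sr sX X j by (auto simp: hd_rev last_rev p_def q_def)
        then have "gpath (adj G) ?P" using dX by (auto simp: gpath_def)
        moreover have "P = A @ u # X @ Y" using s(1) BXY by simp
        ultimately show ?thesis using X by (intro exI[of _ ?P]) (auto simp: hd_append)
      qed
    qed
  qed
qed

lemma closure_gpath:
  assumes "simple_graph G" "(closure_step (c + 1))\<^sup>*\<^sup>* G H" "card (verts G) = c" "gpath (adj H) P" "hd P \<in> verts G"
  shows "\<exists>P'. gpath (adj G) P' \<and> hd P' = hd P \<and> last P' = last P \<and> length P \<le> length P'"
  using assms(2,4,5)
proof (induction arbitrary: P rule: rtranclp_induct)
  case base
  then show ?case by blast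
next
  case (step H H')
  have H: "simple_graph H" "verts H = verts G" using closure_steps_simple_graph[OF step.hyps(1) assms(1)] by auto
  obtain P1 where P1: "gpath (adj H) P1" "hd P1 = hd P" "last P1 = last P" "length P \<le> length P1"
    using closure_step_gpath[OF H(1) step.hyps(2) _ step.prems(1)] H assms(3) step.prems(2) by auto
  moreover obtain P2 where "gpath (adj G) P2" "hd P2 = hd P1" "last P2 = last P1" "length P1 \<le> length P2"
    using step.IH[OF P1(1)] P1(2) step.prems(2) by auto
  ultimately show ?case by (intro exI[of _ P2]) auto
qed

text \<open>Degrees grow with the graph, so every closure step stays inside a supergraph that admits
  none. This confines the closure of \<open>G[V(C)]\<close> to \<open>F[V(C)]\<close>.\<close>

lemma closure_mono:
  assumes "(closure_step m)\<^sup>*\<^sup>* G H" "simple_graph G" "simple_graph K" "verts K = verts G"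
    "edges G \<subseteq> edges K" "\<nexists>K'. closure_step m K K'"
  shows "edges H \<subseteq> edges K"
  using assms(1)
proof (induction rule: rtranclp_induct)
  case base
  show ?case by (rule assms(5))
next
  case (step H H')
  have H: "verts H = verts G" using step.hyps(1) assms(2) closure_steps_simple_graph by blast
  from step.hyps(2) obtain u v where uv: "u \<in> verts H" "v \<in> verts H" "u \<noteq> v"
    "m \<le> degree H u + degree H v" "H' = Graph (verts H) (insert {u, v} (edges H))"
    by (auto simp: closure_step_def)
  have "degree H u \<le> degree K u" "degree H v \<le> degree K v" using assms(3) step.IH by (auto intro: degree_mono)
  with uv have "m \<le> degree K u + degree K v" by linarith
  with assms(4,6) uv H have "{u, v} \<in> edges K" unfolding closure_step_def by metis
  with step.IH uv show ?case by simp
qed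

lemma m_closed_closed_graph:
  assumes "simple_graph H" "\<nexists>H'. closure_step (c + 1) H H'" "card (verts H) = c" "6 \<le> c"
  shows "closed_graph (verts H) (adj H) c (c div 2)"
proof -
  interpret sgraph "verts H" "adj H" using sgraph_adj[OF assms(1)] .
  show ?thesis
  proof
    fix u v assume "u \<in> verts H" "v \<in> verts H" "u \<noteq> v" "\<not> adj H u v"
    then have "\<not> c + 1 \<le> degree H u + degree H v" using assms(2) unfolding closure_step_def adj_def by blast
    then show "card (nb u) + card (nb v) \<le> c" using degree_adj[OF assms(1)] by simp
  qed (use assms in auto)
qed

text \<open>For \<open>k \<le> c\<close>, twice \<open>f_num n k c\<close> is a quadratic polynomial
  in \<open>k\<close> with leading coefficient 3.\<close>

lemma f_num_convex:
  assumes "c < n" "p \<le> j" "j \<le> q" "q \<le> c"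
  shows "f_num n j c \<le> max (f_num n p c) (f_num n q c)"
proof -
  define b where "b = 2 * (int n - int c - 1) - 2 * int c - 1"
  have g: "2 * int (f_num n i c) = 3 * int i * int i + b * int i + int c * int c + int c" if i: "i \<le> c" for i
  proof -
    have "2 * f_num n i c = (c - i + 1) * (c - i) + 2 * (i * (n - c + i - 1))"
      using two_choose[of "c - i + 1"] by (simp add: f_num_def)
    then have "2 * int (f_num n i c) = (int (c - i) + 1) * int (c - i) + 2 * (int i * int (n - c + i - 1))"
      by (metis (no_types, lifting) of_nat_1 of_nat_add of_nat_mult of_nat_numeral)
    moreover have "int (c - i) = int c - int i" "int (n - c + i - 1) = int n - int c + int i - 1"
      using i assms(1) by auto
    ultimately show ?thesis by (simp add: b_def algebra_simps)
  qed
  show ?thesis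
  proof (rule ccontr)
    assume n: "\<not> ?thesis"
    have pc: "p \<le> c" "j \<le> c" using assms by auto
    have 1: "int (f_num n p c) < int (f_num n j c)" "int (f_num n q c) < int (f_num n j c)" using n by auto
    have "(int j - int p) * (3 * (int j + int p) + b) > 0"
      using 1(1) g[OF pc(1)] g[OF pc(2)] by (simp add: algebra_simps)
    then have a: "3 * (int j + int p) + b > 0" using assms(2) by (simp add: zero_less_mult_iff)
    have "(int q - int j) * (3 * (int q + int j) + b) < 0"
      using 1(2) g[OF assms(4)] g[OF pc(2)] by (simp add: algebra_simps)
    then have "3 * (int q + int j) + b < 0" using assms(3) by (simp add: mult_less_0_iff)
    moreover have "3 * (int j + int p) \<le> 3 * (int q + int j)" using assms(2,3) by simp
    ultimately show False using a by linarith
  qed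
qed

text \<open>The upper bound describes \<open>c + 1 - t\<close> unrestricted vertices,
  \<open>t - d\<close> vertices that add at most \<open>t\<close> edges each, and
  \<open>d - 1\<close> vertices that add at most \<open>d\<close> each. It arises in both cases of
  the proof.\<close>

lemma size_contradiction:
  fixes c t d e :: nat
  assumes "c = 2 * t \<or> c = 2 * t + 1" "2 \<le> d" "d + 1 \<le> t" "h_num (c + 1) (t - 1) < e"
    "e \<le> ((c + 1 - t) choose 2) + t * (t - d) + d * (d - 1)"
  shows False
proof -
  obtain s where s: "t = d + 1 + s" using le_Suc_ex[OF assms(3)] by blast
  obtain r where r: "d = 2 + r" using le_Suc_ex[OF assms(2)] by blast
  have "2 * h_num (c + 1) (t - 1) = (c + 2 - t) * (c + 1 - t) + 2 * ((t - 1) * (t - 2))"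
  proof -
    have "c + 1 - (t - 1) = c + 2 - t" using s by simp
    then show ?thesis using two_choose[of "c + 2 - t"] assms(1) by (auto simp: h_num_def)
  qed
  then have 1: "(c + 2 - t) * (c + 1 - t) + 2 * ((t - 1) * (t - 2)) + 2 \<le>
    (c + 1 - t) * (c - t) + 2 * (t * (t - d)) + 2 * (d * (d - 1))"
    using assms(4,5) two_choose[of "c + 1 - t"] by simp
  show False using assms(1)
  proof
    assume c: "c = 2 * t"
    show False using 1 unfolding c s r by (simp add: algebra_simps)
  next
    assume c: "c = 2 * t + 1"
    show False using 1 unfolding c s r by (simp add: algebra_simps)
  qed
qed

section \<open>Vertices outside the longest cycle\<close>

text \<open>\<open>F\<close> is the maximal graph, \<open>C\<close> the vertex set of its cycle and
  \<open>H\<close> the closure of \<open>F[C]\<close>. Assumption \<open>tr\<close> brings paths of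
  \<open>H\<close> back to \<open>F\<close>, where the circumference is bounded.\<close>

locale outer = F: two_conn_graph V F + H: closed_graph C H c t
  for V :: "'a set" and F :: "'a \<Rightarrow> 'a \<Rightarrow> bool" and C :: "'a set" and H :: "'a \<Rightarrow> 'a \<Rightarrow> bool" and c t :: nat +
  assumes CV: "C \<subset> V"
    and circ: "gcyc F xs \<Longrightarrow> length xs \<le> c"
    and tr: "gpath H P \<Longrightarrow> hd P \<in> C \<Longrightarrow> \<exists>P'. gpath F P' \<and> set P' \<subseteq> C \<and> hd P' = hd P \<and>
      last P' = last P \<and> length P \<le> length P'"
    and FH: "u \<in> C \<Longrightarrow> v \<in> C \<Longrightarrow> F u v \<Longrightarrow> H u v"
    and ham: "\<exists>xs. gcyc H xs \<and> set xs = C"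
begin

text \<open>Transfer \<open>P\<close> to \<open>F\<close> and close it through \<open>Q\<close>. So
  an excursion off \<open>C\<close> is bounded by the longest path of \<open>H\<close> between its
  ends.\<close>

lemma excursion_length:
  assumes "gpath F Q" "set Q \<inter> C = {}" "x \<in> C" "x \<noteq> y" "F x (hd Q)" "F (last Q) y"
    "gpath H P" "hd P = x" "last P = y"
  shows "length P + length Q \<le> c"
proof -
  obtain P' where P': "gpath F P'" "set P' \<subseteq> C" "hd P' = x" "last P' = y" "length P \<le> length P'"
    using tr[OF assms(7)] assms(3,8,9) by auto
  have ne: "P' \<noteq> []" "Q \<noteq> []" using P' assms(1) by auto
  have "gpath F (rev Q)" using assms(1) F.gpath_rev' by blast
  moreover have "set P' \<inter> set (rev Q) = {}" using P'(2) assms(2) by auto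
  moreover have "F (last P') (hd (rev Q))" using P'(4) assms(6) F.E_sym by (simp add: hd_rev)
  ultimately have "gpath F (P' @ rev Q)" using P'(1) ne by (simp add: gpath_append)
  moreover have "F (last (P' @ rev Q)) (hd (P' @ rev Q))" using ne P'(3) assms(5) F.E_sym by (simp add: last_rev)
  moreover have "2 \<le> length P'" using P'(3,4) assms(4) ne by (cases P'; cases "tl P'") auto
  moreover have "1 \<le> length Q" using ne by (cases Q) auto
  ultimately have "gcyc F (P' @ rev Q)" by (simp add: gcyc_def)
  from circ[OF this] show ?thesis using P'(5) by simp
qed

lemma path_to_C:
  assumes "v \<in> V - C" "v \<noteq> w"
  shows "\<exists>Q y. gpath F Q \<and> set Q \<inter> C = {} \<and> hd Q = v \<and> y \<in> C \<and> y \<noteq> w \<and> w \<notin> set Q \<and> F (last Q) y"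
proof -
  have "\<not> C \<subseteq> {w}"
  proof
    assume "C \<subseteq> {w}"
    then have "card C \<le> card {w}" by (intro card_mono) auto
    then show False using H.cV H.c6 by simp
  qed
  then have "{v} \<inter> V - {w} \<noteq> {}" "C \<inter> V - {w} \<noteq> {}" using assms CV by auto
  from F.ex_gpath_avoiding[OF this] obtain xs where xs: "gpath F xs" "set xs \<inter> {v} = {hd xs}" "set xs \<inter> C = {last xs}"
    "w \<notin> set xs" by blast
  have hv: "hd xs = v" using xs(2) by auto
  have ly: "last xs \<in> C" "last xs \<in> set xs" using xs(3) by auto
  obtain Q y where Q: "xs = Q @ [y]" using xs(1) by (cases xs rule: rev_cases) auto
  have y: "y \<in> C" "y \<noteq> w" using ly xs(4) Q by auto
  have Qne: "Q \<noteq> []" using hv Q y assms(1) by (cases Q) auto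
  have g: "gpath F Q" "y \<notin> set Q" "F (last Q) y" using xs(1) Q Qne by (auto simp: gpath_append gpath_Cons)
  have "z \<notin> C" if "z \<in> set Q" for z
  proof
    assume "z \<in> C"
    then have "z \<in> set xs \<inter> C" using that Q by simp
    then have "z = y" unfolding xs(3) using Q by simp
    then show False using g(2) that by simp
  qed
  then show ?thesis using g y hv Q Qne xs(4) by (intro exI[of _ Q] exI[of _ y]) auto
qed

lemma ex_attached: "\<exists>v\<in>V - C. \<exists>\<kappa>\<in>C. F v \<kappa>"
proof -
  obtain v where v: "v \<in> V - C" using CV by blast
  obtain w where w: "w \<in> C" using H.cV H.c6 by fastforce
  obtain Q y where Q: "gpath F Q" "set Q \<inter> C = {}" "hd Q = v" "y \<in> C" "F (last Q) y"
    using path_to_C[OF v, of w] v w by blast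
  then have "last Q \<in> set Q" by (metis gpath_Nil last_in_set)
  then have "last Q \<in> V - C" using Q(2,5) F.E_V by blast
  then show ?thesis using Q(4,5) by blast
qed

lemma ham_length: "gpath H P \<Longrightarrow> set P = C \<Longrightarrow> length P = c"
  using H.cV distinct_card[of P] by (simp add: gpath_def)

lemma attached_no_ham:
  assumes "v \<in> V - C" "\<kappa> \<in> C" "F v \<kappa>"
  shows "\<exists>y\<in>C. y \<noteq> \<kappa> \<and> \<not> (\<exists>P. gpath H P \<and> hd P = \<kappa> \<and> last P = y \<and> set P = C)"
proof -
  obtain Q y where Q: "gpath F Q" "set Q \<inter> C = {}" "hd Q = v" "y \<in> C" "y \<noteq> \<kappa>" "F (last Q) y"
    using path_to_C[OF assms(1), of \<kappa>] assms by blast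
  have "\<not> (\<exists>P. gpath H P \<and> hd P = \<kappa> \<and> last P = y \<and> set P = C)"
  proof
    assume "\<exists>P. gpath H P \<and> hd P = \<kappa> \<and> last P = y \<and> set P = C"
    then obtain P where P: "gpath H P" "hd P = \<kappa>" "last P = y" "set P = C" by blast
    have "length P + length Q \<le> c"
      by (rule excursion_length[OF Q(1,2) assms(2) _ _ Q(6) P(1-3)]) (use Q assms F.E_sym in auto)
    moreover have "length P = c" using ham_length[OF P(1,4)] .
    moreover have "Q \<noteq> []" using Q(1) by auto
    ultimately show False by simp
  qed
  then show ?thesis using Q by blast
qed

text \<open>A complete \<open>H\<close> would have Hamilton paths between all pairs. The lemma later
  ensures that the clique \<open>L\<close> is not all of \<open>C\<close>.\<close>

lemma not_complete: "\<exists>u\<in>C. \<exists>v\<in>C. u \<noteq> v \<and> \<not> H u v"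
proof (rule ccontr)
  assume "\<not> ?thesis"
  then have cl: "\<And>u v. u \<in> C \<Longrightarrow> v \<in> C \<Longrightarrow> u \<noteq> v \<Longrightarrow> H u v" by blast
  obtain v \<kappa> where v: "v \<in> V - C" "\<kappa> \<in> C" "F v \<kappa>" using ex_attached by blast
  obtain y where y: "y \<in> C" "y \<noteq> \<kappa>" "\<not> (\<exists>P. gpath H P \<and> hd P = \<kappa> \<and> last P = y \<and> set P = C)"
    using attached_no_ham[OF v] by blast
  have "finite (C - {\<kappa>, y})" using H.finV by simp
  from finite_distinct_list[OF this] obtain zs where zs: "set zs = C - {\<kappa>, y}" "distinct zs" by blast
  have "gpath H (\<kappa> # zs @ [y])" by (rule H.gpath_clique[of C]) (use cl zs v y in auto)
  moreover have "set (\<kappa> # zs @ [y]) = C" using zs v y by auto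
  ultimately show False using y(3) by (metis last.simps last_snoc list.sel(1) snoc_eq_iff_butlast)
qed

end

locale outer_small = outer + closed_graph_small C H c t
begin

lemma A_facts:
  "card H.A = t" "c = 2 * t \<Longrightarrow> u \<in> C - H.A \<Longrightarrow> v \<in> C - H.A \<Longrightarrow> \<not> H u v"
  "c = 2 * t + 1 \<Longrightarrow> u \<in> C - H.A \<Longrightarrow> v \<in> C - H.A \<Longrightarrow> u' \<in> C - H.A \<Longrightarrow> v' \<in> C - H.A \<Longrightarrow> H u v \<Longrightarrow> H u' v' \<Longrightarrow>
      {u, v} = {u', v'}"
proof -
  obtain w \<kappa> where v: "w \<in> V - C" "\<kappa> \<in> C" "F w \<kappa>" using ex_attached by blast
  obtain y where y: "y \<in> C" "y \<noteq> \<kappa>" "\<not> (\<exists>P. gpath H P \<and> hd P = \<kappa> \<and> last P = y \<and> set P = C)"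
    using attached_no_ham[OF v] by blast
  show "card H.A = t" "c = 2 * t \<Longrightarrow> u \<in> C - H.A \<Longrightarrow> v \<in> C - H.A \<Longrightarrow> \<not> H u v"
    "c = 2 * t + 1 \<Longrightarrow> u \<in> C - H.A \<Longrightarrow> v \<in> C - H.A \<Longrightarrow> u' \<in> C - H.A \<Longrightarrow> v' \<in> C - H.A \<Longrightarrow> H u v \<Longrightarrow> H u' v' \<Longrightarrow>
      {u, v} = {u', v'}"
    using near_extremal[OF v(2) y(1) y(2)[symmetric] y(3)] by blast+
qed

definition B :: "'a set" where "B = C - H.A"

lemma B_facts: "finite B" "B \<subseteq> C" "card B = c - t" "B \<inter> H.A = {}" "H.A \<union> B = C" "H.A \<subseteq> C"
  using H.finV H.A_V H.card_notA A_facts(1) by (auto simp: B_def)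

lemma ham_A:
  assumes "Y \<subseteq> B" "x \<in> H.A \<union> Y" "y \<in> H.A \<union> Y" "x \<noteq> y" "\<And>p. p \<in> set qs \<Longrightarrow> gpath H p" "distinct (concat qs)"
    "set (concat qs) \<subseteq> Y" "length qs + card Y + 1 \<le> t + length (concat qs)"
  shows "\<exists>P. gpath H P \<and> hd P = x \<and> last P = y \<and> set P = H.A \<union> Y"
proof (rule H.hamilton_connected[OF H.finA _ _ _ _ assms(5,6,7) _ assms(2-4)])
  show "finite Y" using assms(1) B_facts(1) finite_subset by blast
  show "H.A \<inter> Y = {}" using assms(1) B_facts(4) by blast
  show "H u v" if "u \<in> H.A" "v \<in> H.A" "u \<noteq> v" for u v using A_universal that B_facts(6) by blast
  show "H u v" if "u \<in> H.A" "v \<in> Y" for u v using A_universal[of u v] that B_facts(2,4) assms(1) by blast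
  show "length qs + card Y + 1 \<le> card H.A + length (concat qs)" using assms(8) A_facts(1) by simp
qed

lemma ex_A_other: "\<exists>a\<in>H.A. a \<noteq> y"
proof (rule ccontr)
  assume "\<not> ?thesis"
  then have "H.A \<subseteq> {y}" by auto
  then have "card H.A \<le> card {y}" by (intro card_mono) auto
  then show False using A_facts(1) H.ct(2) by simp
qed

text \<open>As \<open>|B| = t + 1 > |A|\<close>, the successors of the vertices of \<open>B\<close>
  on a Hamilton cycle cannot all lie in \<open>A\<close>.\<close>

lemma odd_edge:
  assumes "c = 2 * t + 1"
  shows "\<exists>p\<in>B. \<exists>q\<in>B. H p q"
proof (rule ccontr)
  assume n: "\<not> ?thesis"
  obtain xs where xs: "gcyc H xs" "set xs = C" using ham by blast
  have d: "distinct xs" using xs(1) by (simp add: gcyc_def gpath_def)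
  then have l: "length xs = c" using xs(2) H.cV distinct_card by metis
  define I where "I = {i. i < c \<and> xs ! i \<in> B}"
  have finI: "finite I" by (simp add: I_def)
  have "(!) xs ` I = B" using xs(2) l B_facts(2) by (auto simp: I_def in_set_conv_nth image_iff) (metis in_set_conv_nth subsetD)
  moreover have "inj_on ((!) xs) I" using d l by (auto simp: inj_on_def I_def nth_eq_iff_index_eq)
  ultimately have cI: "card I = card B" by (metis card_image)
  have "(\<lambda>i. xs ! (Suc i mod c)) ` I \<subseteq> H.A"
  proof
    fix z assume "z \<in> (\<lambda>i. xs ! (Suc i mod c)) ` I"
    then obtain i where i: "i < c" "xs ! i \<in> B" "z = xs ! (Suc i mod c)" by (auto simp: I_def)
    have "H (xs ! i) z" using gcyc_nth[OF xs(1), of i] i l by simp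
    moreover from this have "z \<in> C" using H.E_V' by blast
    ultimately show "z \<in> H.A" using n i(2) B_facts(5) by blast
  qed
  moreover have "inj_on (\<lambda>i. xs ! (Suc i mod c)) I"
  proof (rule inj_onI)
    fix i j assume ij: "i \<in> I" "j \<in> I" "xs ! (Suc i mod c) = xs ! (Suc j mod c)"
    then have lt: "i < c" "j < c" by (auto simp: I_def)
    then have "Suc i mod c < length xs" "Suc j mod c < length xs" using l by simp_all
    then have "Suc i mod c = Suc j mod c" using ij(3) d by (simp add: nth_eq_iff_index_eq)
    then show "i = j" using lt by (auto simp: mod_Suc split: if_splits)
  qed
  ultimately have "card I \<le> card H.A" using H.finA by (metis card_image card_mono)
  then show False using cI B_facts(3) A_facts(1) assms by simp
qed

text \<open>Once \<open>x\<close> is used as an end, the rest of \<open>B\<close> has to form at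
  most \<open>t - 1\<close> pieces. For even \<open>c\<close> it has only \<open>t - 1\<close>
  vertices; for odd \<open>c\<close> the edge inside \<open>B\<close> saves one piece. If
  \<open>x\<close> is an end of that edge, the other end \<open>z\<close> is placed next to
  \<open>x\<close>, or at the end when \<open>y = z\<close>.\<close>

lemma ham_from_B:
  assumes x: "x \<in> B" and y: "y \<in> C" "y \<noteq> x"
  shows "\<exists>P. gpath H P \<and> hd P = x \<and> last P = y \<and> set P = C"
proof -
  have xA: "H a x" "H x a" if "a \<in> H.A" for a
    using A_universal[of a x] that x B_facts H.E_sym by blast+
  have Bx: "card (B - {x}) = c - t - 1" using x B_facts(1,3) by simp
  obtain a0 where a0: "a0 \<in> H.A" "a0 \<noteq> y" using ex_A_other by blast
  have cons: ?thesis if P': "gpath H P'" "hd P' = a0" "last P' = y" "set P' = H.A \<union> (B - {x})" for P'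
  proof -
    have "P' \<noteq> []" using P'(1) by auto
    moreover have "x \<notin> set P'" using P'(4) x B_facts(4) by auto
    ultimately have "gpath H (x # P')" using P' xA(2)[OF a0(1)] by (simp add: gpath_Cons)
    moreover have "set (x # P') = C" using P'(4) x B_facts(5) by auto
    ultimately show ?thesis using P'(3) \<open>P' \<noteq> []\<close> by (intro exI[of _ "x # P'"]) auto
  qed
  have yY: "y \<in> H.A \<union> (B - {x})" using y B_facts(5) by blast
  show ?thesis using H.ct(1)
  proof
    assume c: "c = 2 * t"
    have "\<exists>P. gpath H P \<and> hd P = a0 \<and> last P = y \<and> set P = H.A \<union> (B - {x})"
      by (rule ham_A[where qs = "[]"]) (use a0 yY Bx c H.ct(2) in auto)
    then show ?thesis using cons by blast
  next
    assume c: "c = 2 * t + 1"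
    obtain p q where pq: "p \<in> B" "q \<in> B" "H p q" using odd_edge[OF c] by blast
    have pqn: "p \<noteq> q" using pq H.E_irr by auto
    show ?thesis
    proof (cases "x \<in> {p, q}")
      case False
      have "\<exists>P. gpath H P \<and> hd P = a0 \<and> last P = y \<and> set P = H.A \<union> (B - {x})"
        by (rule ham_A[where qs = "[[p, q]]"]) (use a0 yY Bx c H.ct(2) pq pqn False in \<open>auto simp: gpath_def\<close>)
      then show ?thesis using cons by blast
    next
      case True
      then obtain z where z: "z \<in> B" "H x z" "z \<noteq> x" "{p, q} = {x, z}" using pq pqn H.E_sym by auto
      let ?Y = "B - {x, z}"
      have cY: "card ?Y = c - t - 2" using x z B_facts(1,3) by (simp add: card_Diff_subset)
      have zA: "H z a" "H a z" if "a \<in> H.A" for a using A_universal[of a z] that z(1) B_facts H.E_sym by blast+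
      show ?thesis
      proof (cases "y = z")
        case False
        then have yY: "y \<in> H.A \<union> ?Y" using y B_facts(5) by blast
        obtain P' where P': "gpath H P'" "hd P' = a0" "last P' = y" "set P' = H.A \<union> ?Y"
        proof -
          have "\<exists>P. gpath H P \<and> hd P = a0 \<and> last P = y \<and> set P = H.A \<union> ?Y"
            by (rule ham_A[where qs = "[]"]) (use a0 yY cY c H.ct(2) in auto)
          then show ?thesis using that by blast
        qed
        have ne: "P' \<noteq> []" using P'(1) by auto
        have "x \<notin> set P'" "z \<notin> set P'" using P'(4) x z B_facts(4) by auto
        then have "gpath H (x # z # P')" using P' ne zA(1)[OF a0(1)] z by (simp add: gpath_Cons)
        moreover have "set (x # z # P') = C" using P'(4) x z B_facts(5) by auto
        ultimately show ?thesis using P'(3) ne by (intro exI[of _ "x # z # P'"]) auto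
      next
        case True
        obtain a1 where a1: "a1 \<in> H.A" "a1 \<noteq> a0" using ex_A_other by blast
        obtain P' where P': "gpath H P'" "hd P' = a0" "last P' = a1" "set P' = H.A \<union> ?Y"
        proof -
          have "\<exists>P. gpath H P \<and> hd P = a0 \<and> last P = a1 \<and> set P = H.A \<union> ?Y"
            by (rule ham_A[where qs = "[]"]) (use a0 a1 cY c H.ct(2) in auto)
          then show ?thesis using that by blast
        qed
        have ne: "P' \<noteq> []" using P'(1) by auto
        have "x \<notin> set P'" "z \<notin> set P'" using P'(4) x z B_facts(4) by auto
        then have "gpath H (x # P' @ [z])"
          using P' ne zA(2)[OF a1(1)] xA(2)[OF a0(1)] z by (simp add: gpath_Cons gpath_append)
        moreover have "set (x # P' @ [z]) = C" using P'(4) x z B_facts(5) by auto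
        ultimately show ?thesis using True by (intro exI[of _ "x # P' @ [z]"]) auto
      qed
    qed
  qed
qed

text \<open>Leaving out one vertex of \<open>B\<close> makes \<open>t - 1\<close> pieces, for odd
  \<open>c\<close> with the help of the edge inside \<open>B\<close>.\<close>

lemma almost_ham:
  assumes "x \<in> H.A" "y \<in> H.A" "x \<noteq> y"
  shows "\<exists>P. gpath H P \<and> hd P = x \<and> last P = y \<and> length P = c - 1"
proof -
  have len: "length P = c - 1" if "gpath H P" "set P = H.A \<union> (B - {b})" "b \<in> B" for P b
  proof -
    have "H.A \<union> (B - {b}) = C - {b}" using B_facts(4,5) that(3) by auto
    moreover have "card (C - {b}) = c - 1" using that(3) B_facts(2) H.cV by (metis card_Diff_singleton subsetD)
    ultimately have "card (set P) = c - 1" using that(2) by simp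
    then show ?thesis using that(1) distinct_card[of P] by (simp add: gpath_def)
  qed
  show ?thesis using H.ct(1)
  proof
    assume c: "c = 2 * t"
    have "B \<noteq> {}" using B_facts(3) c H.ct(2) by auto
    then obtain b where b: "b \<in> B" by blast
    have cb: "card (B - {b}) = t - 1" using b B_facts(1,3) c by simp
    have "\<exists>P. gpath H P \<and> hd P = x \<and> last P = y \<and> set P = H.A \<union> (B - {b})"
      by (rule ham_A[where qs = "[]"]) (use assms cb H.ct(2) in auto)
    then show ?thesis using len b by blast
  next
    assume c: "c = 2 * t + 1"
    obtain p q where pq: "p \<in> B" "q \<in> B" "H p q" using odd_edge[OF c] by blast
    have pqn: "p \<noteq> q" using pq H.E_irr by auto
    have "\<not> B \<subseteq> {p, q}"
    proof
      assume "B \<subseteq> {p, q}"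
      then have "card B \<le> card {p, q}" by (intro card_mono) auto
      then show False using B_facts(3) c H.ct(2) by (simp add: card_insert_if split: if_splits)
    qed
    then obtain b where b: "b \<in> B" "b \<noteq> p" "b \<noteq> q" by blast
    have cb: "card (B - {b}) = t" using b B_facts(1,3) c by simp
    have "\<exists>P. gpath H P \<and> hd P = x \<and> last P = y \<and> set P = H.A \<union> (B - {b})"
      by (rule ham_A[where qs = "[[p, q]]"]) (use assms cb pq pqn b in \<open>auto simp: gpath_def\<close>)
    then show ?thesis using len b by blast
  qed
qed

text \<open>A Hamilton path of \<open>H\<close> between \<open>x\<close> and \<open>y\<close> would
  make the cycle too long, so by \<open>ham_from_B\<close> neither is in \<open>B\<close>. The path
  on \<open>c - 1\<close> vertices between them then leaves room for one vertex.\<close>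

lemma excursion_short:
  assumes "gpath F Q" "set Q \<inter> C = {}" "x \<in> C" "y \<in> C" "x \<noteq> y" "F x (hd Q)" "F (last Q) y"
  shows "x \<in> H.A" "y \<in> H.A" "length Q = 1"
proof -
  have ne: "Q \<noteq> []" using assms(1) by auto
  have noham: "\<not> (\<exists>P. gpath H P \<and> hd P = x \<and> last P = y \<and> set P = C)"
    using excursion_length[OF assms(1-3,5-7)] ham_length ne by fastforce
  show x: "x \<in> H.A"
  proof (rule ccontr)
    assume "x \<notin> H.A"
    then have "x \<in> B" using assms(3) by (simp add: B_def)
    then show False using ham_from_B[of x y] noham assms(4,5) by blast
  qed
  show y: "y \<in> H.A"
  proof (rule ccontr)
    assume "y \<notin> H.A"
    then have "y \<in> B" using assms(4) by (simp add: B_def)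
    then obtain P where P: "gpath H P" "hd P = y" "last P = x" "set P = C" using ham_from_B[of y x] assms(3,5) by blast
    then have "gpath H (rev P)" "hd (rev P) = x" "last (rev P) = y" "set (rev P) = C"
      using H.gpath_rev'[of P] by (auto simp: hd_rev last_rev)
    then show False using noham by blast
  qed
  obtain P where P: "gpath H P" "hd P = x" "last P = y" "length P = c - 1" using almost_ham[OF x y assms(5)] by blast
  have "length P + length Q \<le> c" by (rule excursion_length[OF assms(1-3,5-7) P(1-3)])
  moreover have "0 < length Q" using ne by simp
  ultimately show "length Q = 1" using P(4) H.c6 by linarith
qed

lemma attached_two:
  assumes "v \<in> V - C" "\<kappa> \<in> C" "F v \<kappa>"
  shows "\<kappa> \<in> H.A \<and> (\<exists>y\<in>C. y \<noteq> \<kappa> \<and> F v y)"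
proof -
  obtain Q y where Q: "gpath F Q" "set Q \<inter> C = {}" "hd Q = v" "y \<in> C" "y \<noteq> \<kappa>" "F (last Q) y"
    using path_to_C[OF assms(1), of \<kappa>] assms by blast
  have 1: "\<kappa> \<in> H.A" "length Q = 1"
    using excursion_short[OF Q(1,2) assms(2) Q(4)] Q assms(3) F.E_sym by auto
  then have "last Q = v" using Q(3) by (cases Q) auto
  then show ?thesis using 1 Q by auto
qed

text \<open>From \<open>w\<close> some path off \<open>C\<close> that avoids \<open>v\<close> leads
  to a vertex \<open>y\<close> in \<open>C\<close>. As \<open>v\<close> has two neighbours in
  \<open>C\<close>, one differs from \<open>y\<close>, and prefixing \<open>v\<close> gives an
  excursion on at least two vertices.\<close>

lemma no_outer_edge:
  assumes "v \<in> V - C" "w \<in> V - C" "F v w" "\<kappa> \<in> C" "F v \<kappa>"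
  shows False
proof -
  obtain \<kappa>2 where k2: "\<kappa>2 \<in> C" "\<kappa>2 \<noteq> \<kappa>" "F v \<kappa>2" using attached_two[OF assms(1,4,5)] by blast
  have vw: "w \<noteq> v" using assms(3) F.E_irr by auto
  obtain Q y where Q: "gpath F Q" "set Q \<inter> C = {}" "hd Q = w" "y \<in> C" "v \<notin> set Q" "F (last Q) y"
    using path_to_C[OF assms(2) vw] by blast
  obtain x where x: "x \<in> C" "x \<noteq> y" "F v x" using k2 assms(4,5) by metis
  have ne: "Q \<noteq> []" using Q(1) by auto
  have "gpath F (v # Q)" using Q ne assms(3) by (simp add: gpath_Cons)
  moreover have "set (v # Q) \<inter> C = {}" using Q(2) assms(1) by auto
  ultimately have "length (v # Q) = 1"
    using excursion_short(3)[of "v # Q" x y] x Q(4,6) ne F.E_sym by auto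
  then show False using ne by simp
qed

lemma outer_nb:
  assumes "v \<in> V - C"
  shows "F.nb v \<subseteq> H.A"
proof -
  obtain w where w: "w \<in> C" using H.cV H.c6 by fastforce
  obtain Q y where Q: "gpath F Q" "set Q \<inter> C = {}" "hd Q = v" "y \<in> C" "F (last Q) y"
    using path_to_C[OF assms, of w] assms w by blast
  have QV: "set Q \<subseteq> V" using F.gpath_set_V[OF Q(1)] Q(3) assms by simp
  \<comment> \<open>Otherwise the last two vertices of \<open>Q\<close> form an edge off
    \<open>C\<close> with an end attached to \<open>C\<close>.\<close>
  have att: "\<exists>\<kappa>\<in>C. F v \<kappa>"
  proof (cases Q rule: rev_cases)
    case Nil
    then show ?thesis using Q(1) by simp
  next
    case (snoc Q0 z)
    show ?thesis
    proof (cases "Q0 = []")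
      case True
      then show ?thesis using snoc Q(3,4,5) by auto
    next
      case False
      then have "F (last Q0) z" "last Q0 \<in> set Q" "z \<in> set Q" using Q(1) snoc by (auto simp: gpath_append)
      then have "F z (last Q0)" "last Q0 \<in> V - C" "z \<in> V - C" using Q(2) QV F.E_sym by blast+
      then show ?thesis using no_outer_edge[of z "last Q0" y] Q(4,5) snoc by auto
    qed
  qed
  show ?thesis
  proof
    fix u assume "u \<in> F.nb v"
    then have u: "F v u" by (simp add: F.nb_def)
    show "u \<in> H.A"
    proof (cases "u \<in> C")
      case True
      then show ?thesis using attached_two[OF assms True u] by blast
    next
      case False
      then have "u \<in> V - C" using u F.E_V' by blast
      then show ?thesis using no_outer_edge[OF assms _ u] att by blast
    qed
  qed
qed

theorem outer_structure:
  "\<exists>A \<subseteq> C. card A = t \<and> (\<forall>v\<in>V - C. F.nb v \<subseteq> A) \<and> (c = 2 * t \<longrightarrow> (\<forall>u\<in>C - A. \<forall>v\<in>C - A. \<not> F u v)) \<and>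
    (c = 2 * t + 1 \<longrightarrow> (\<exists>p\<in>C - A. \<exists>q\<in>C - A. p \<noteq> q \<and> (\<forall>u\<in>C - A. \<forall>v\<in>C - A. F u v \<longrightarrow> {u, v} = {p, q})))"
proof (intro exI[of _ H.A] conjI impI ballI)
  show "H.A \<subseteq> C" "card H.A = t" using B_facts(6) A_facts(1) by auto
  show "F.nb v \<subseteq> H.A" if "v \<in> V - C" for v using outer_nb[OF that] .
  show "\<not> F u v" if "c = 2 * t" "u \<in> C - H.A" "v \<in> C - H.A" for u v
    using A_facts(2)[OF that] FH that by blast
  show "\<exists>p\<in>C - H.A. \<exists>q\<in>C - H.A. p \<noteq> q \<and> (\<forall>u\<in>C - H.A. \<forall>v\<in>C - H.A. F u v \<longrightarrow> {u, v} = {p, q})"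
    if c: "c = 2 * t + 1"
  proof -
    obtain p q where pq: "p \<in> C - H.A" "q \<in> C - H.A" "H p q" using odd_edge[OF c] by (auto simp: B_def)
    have "p \<noteq> q" using pq(3) H.E_irr by auto
    moreover have "{u, v} = {p, q}" if "u \<in> C - H.A" "v \<in> C - H.A" "F u v" for u v
      using A_facts(3)[OF c that(1,2) pq(1,2) _ pq(3)] FH that by blast
    ultimately show ?thesis using pq by blast
  qed
qed

end

section \<open>The extremal graphs\<close>

lemma cyclic_all:
  fixes c j :: nat
  assumes "R j" "j < c" "\<And>i. i < c \<Longrightarrow> R i \<Longrightarrow> R (Suc i mod c)" "i < c"
  shows "R i"
proof -
  have "R ((j + m) mod c)" for m
  proof (induction m)
    case 0
    then show ?case using assms(1,2) by simp
  next
    case (Suc m)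
    have "R (Suc ((j + m) mod c) mod c)" using assms(2) assms(3)[of "(j + m) mod c"] Suc by simp
    then show ?case by (simp add: mod_Suc_eq)
  qed
  from this[of "i + c - j"] show ?thesis using assms(2,4) by simp
qed

context clique_core
begin

text \<open>The common shape of the two outcomes: \<open>q = 1\<close> is the graph \<open>W\<close>, \<open>q = k - 1\<close> the graph \<open>Z\<close>.\<close>

definition layered :: "'a set \<Rightarrow> nat \<Rightarrow> bool" where
  "layered S q \<longleftrightarrow> S \<subseteq> K \<and> (q = 1 \<and> card S = k \<or> q = k - 1 \<and> card S = 2) \<and>
     (\<forall>v\<in>V - K. \<exists>Q. v \<in> Q \<and> Q \<subseteq> V - K \<and> card Q = q \<and> (\<forall>u\<in>Q. nb u = (Q - {u}) \<union> S))"

lemma ex_layered: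
  "(\<exists>S. layered S 1 \<and> card S = k) \<or> (\<exists>S. layered S (k - 1) \<and> card S = 2)"
  using clique_structure
proof
  assume "\<exists>S\<subseteq>K. card S = k \<and> (\<forall>v\<in>V - K. nb v = S)"
  then obtain S where S: "S \<subseteq> K" "card S = k" "\<And>v. v \<in> V - K \<Longrightarrow> nb v = S" by blast
  have "\<exists>Q. v \<in> Q \<and> Q \<subseteq> V - K \<and> card Q = 1 \<and> (\<forall>u\<in>Q. nb u = (Q - {u}) \<union> S)" if "v \<in> V - K" for v
    using that S(3) by (intro exI[of _ "{v}"]) auto
  then show ?thesis using S by (auto simp: layered_def)
next
  assume "\<exists>a b. a \<in> K \<and> b \<in> K \<and> a \<noteq> b \<and>
     (\<forall>v\<in>V - K. \<exists>Q. v \<in> Q \<and> Q \<subseteq> V - K \<and> card Q = k - 1 \<and> (\<forall>q\<in>Q. nb q = (Q - {q}) \<union> {a, b}))"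
  then obtain a b where "a \<in> K" "b \<in> K" "a \<noteq> b"
    "\<forall>v\<in>V - K. \<exists>Q. v \<in> Q \<and> Q \<subseteq> V - K \<and> card Q = k - 1 \<and> (\<forall>q\<in>Q. nb q = (Q - {q}) \<union> {a, b})" by blast
  then have "layered {a, b} (k - 1)" "card {a, b} = 2" by (auto simp: layered_def)
  then show ?thesis by blast
qed

text \<open>The block of \<open>v\<close>, recovered from the graph without a choice.\<close>

definition layer :: "'a \<Rightarrow> 'a set" where "layer v = insert v (nb v - K)"

lemma layeredD:
  assumes "layered S q"
  shows "S \<subseteq> K" "finite S" "(q + 1) * card S = 2 * k" "1 \<le> q" "q < k"
    "v \<in> V - K \<Longrightarrow> layer v \<subseteq> V - K \<and> card (layer v) = q \<and> nb v = (layer v - {v}) \<union> S \<and> card (nb v) = k"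
    "v \<in> V - K \<Longrightarrow> u \<in> layer v \<Longrightarrow> layer u = layer v"
proof -
  show S: "S \<subseteq> K" using assms by (simp add: layered_def)
  then show finS: "finite S" using finK finite_subset by blast
  have q: "q = 1 \<and> card S = k \<or> q = k - 1 \<and> card S = 2" using assms by (simp add: layered_def)
  then show "(q + 1) * card S = 2 * k" "1 \<le> q" "q < k" using k2 by auto
  have LQ: "\<exists>Q. v \<in> Q \<and> Q \<subseteq> V - K \<and> card Q = q \<and> (\<forall>u\<in>Q. nb u = (Q - {u}) \<union> S)" if "v \<in> V - K" for v
    using assms that unfolding layered_def by blast
  have ex: "layer v = Q \<and> Q \<subseteq> V - K \<and> card Q = q" if "v \<in> Q" "Q \<subseteq> V - K" "card Q = q" "\<forall>u\<in>Q. nb u = (Q - {u}) \<union> S" for v Q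
    using that S by (auto simp: layer_def)
  show "layer v \<subseteq> V - K \<and> card (layer v) = q \<and> nb v = (layer v - {v}) \<union> S \<and> card (nb v) = k" if v: "v \<in> V - K" for v
  proof -
    obtain Q where Q: "v \<in> Q" "Q \<subseteq> V - K" "card Q = q" "\<forall>u\<in>Q. nb u = (Q - {u}) \<union> S"
      using LQ[OF v] by blast
    have finQ: "finite Q" using Q(2) finV by (meson finite_Diff finite_subset)
    have "(Q - {v}) \<inter> S = {}" using Q(2) S by auto
    then have "card (nb v) = (q - 1) + card S" using Q finS finQ by (simp add: card_Un_disjoint)
    then have "card (nb v) = k" using q k2 by auto
    then show ?thesis using ex[OF Q] Q by simp
  qed
  show "layer u = layer v" if v: "v \<in> V - K" "u \<in> layer v" for u v
  proof -
    obtain Q where Q: "v \<in> Q" "Q \<subseteq> V - K" "card Q = q" "\<forall>u\<in>Q. nb u = (Q - {u}) \<union> S"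
      using LQ[OF v(1)] by blast
    have "layer v = Q" using ex[OF Q] by simp
    then show ?thesis using ex[of u Q] Q v(2) by simp
  qed
qed

text \<open>The missing vertex \<open>k0\<close> is adjacent to both and could be inserted between
  them.\<close>

lemma no_consecutive_K:
  assumes xs: "gcyc E xs" "length xs = c" and k0: "k0 \<in> K - set xs" and i: "i < c"
  shows "\<not> (xs ! i \<in> K \<and> xs ! (Suc i mod c) \<in> K)"
proof
  assume a: "xs ! i \<in> K \<and> xs ! (Suc i mod c) \<in> K"
  have d: "distinct xs" "successively E xs" "E (last xs) (hd xs)" "xs \<noteq> []" using xs by (auto simp: gcyc_def gpath_def)
  have kk: "E u k0" "E k0 u" if "u \<in> K" "u \<in> set xs" for u using cl[of u k0] cl[of k0 u] that k0 by auto
  show False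
  proof (cases "Suc i < c")
    case True
    then have s: "xs = take i xs @ xs ! i # xs ! Suc i # drop (Suc (Suc i)) xs" using xs(2)
      by (simp add: Cons_nth_drop_Suc)
    have aK: "xs ! i \<in> K" "xs ! Suc i \<in> K" using a True by auto
    define A u v B where "A = take i xs" and "u = xs ! i" and "v = xs ! Suc i" and "B = drop (Suc (Suc i)) xs"
    have e: "xs = A @ u # v # B" using s by (simp add: A_def u_def v_def B_def)
    have "xs ! i \<in> set xs" "xs ! Suc i \<in> set xs" using True xs(2) by auto
    then have uk: "E u k0" "E k0 v" using kk aK unfolding u_def v_def by blast+
    have "successively E (A @ u # k0 # v # B)" using d(2) uk unfolding e
      by (auto simp: successively_append_iff successively_Cons)
    then have "gpath E (A @ u # k0 # v # B)" using d(1) k0 unfolding e by (auto simp: gpath_def)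
    moreover have "last (A @ u # k0 # v # B) = last xs" "hd (A @ u # k0 # v # B) = hd xs"
      unfolding e by (auto simp: hd_append)
    ultimately have "gcyc E (A @ u # k0 # v # B)" using d(3) by (simp add: gcyc_def)
    moreover have "length (A @ u # k0 # v # B) = Suc (length xs)" unfolding e by simp
    ultimately show False using circ[of "A @ u # k0 # v # B"] xs(2) by simp
  next
    case False
    then have e1: "Suc i = c" using i by simp
    then have "Suc i mod c = 0" by simp
    then have aK: "last xs \<in> K" "hd xs \<in> K" using a e1 d(4) xs(2) by (auto simp: last_conv_nth hd_conv_nth)
    have uk: "E (last xs) k0" "E k0 (hd xs)" using kk aK d(4) by auto
    have "gpath E (xs @ [k0])" using d uk k0 by (auto simp: gpath_def successively_append_iff)
    then have "gcyc E (xs @ [k0])" using uk d(4) xs by (auto simp: gcyc_def)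
    then show False using circ[of "xs @ [k0]"] xs(2) by simp
  qed
qed

text \<open>If a vertex of \<open>K\<close> is missed, no two vertices of \<open>K\<close> are
  consecutive on the cycle, so those on it belong to \<open>S\<close>. Each block that it meets is
  left at some point, into a vertex of \<open>S\<close>. Hence
  \<open>c \<le> |S| + q|S| = 2k\<close>, against \<open>2k + 4 \<le> c\<close>.\<close>

lemma K_on_cycle:
  assumes L: "layered S q" and xs: "gcyc E xs" "length xs = c"
  shows "K \<subseteq> set xs"
proof (rule ccontr)
  assume "\<not> ?thesis"
  then obtain k0 where k0: "k0 \<in> K - set xs" by blast
  note LD = layeredD[OF L]
  define C where "C = set xs"
  have d: "distinct xs" using xs by (auto simp: gcyc_def gpath_def)
  have finC: "finite C" by (simp add: C_def)
  have cC: "card C = c" using d xs(2) distinct_card by (simp add: C_def distinct_card)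
  have CV: "C \<subseteq> V"
  proof -
    have "hd xs \<in> V" using xs(1) E_V' by (auto simp: gcyc_def)
    then show ?thesis using gpath_set_V xs(1) by (auto simp: gcyc_def C_def)
  qed
  have c0: "0 < c" using c3 by simp
  have stp: "E (xs ! i) (xs ! (Suc i mod c))" if "i < c" for i using gcyc_nth[OF xs(1)] that xs(2) by simp
  have inC: "xs ! i \<in> C" if "i < c" for i using that xs(2) by (simp add: C_def)
  have "C \<inter> K \<subseteq> S"
  proof
    fix z assume z: "z \<in> C \<inter> K"
    then obtain i where i: "i < c" "z = xs ! i" using xs(2) by (auto simp: C_def in_set_conv_nth)
    define y where "y = xs ! (Suc i mod c)"
    have "y \<notin> K" using no_consecutive_K[OF xs k0 i(1)] z i by (simp add: y_def)
    moreover have "E z y" using stp[OF i(1)] i(2) by (simp add: y_def)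
    ultimately have "y \<in> V - K" "z \<in> nb y" using E_V' E_sym by (auto simp: nb_def)
    then have "z \<in> (layer y - {y}) \<union> S" "layer y \<subseteq> V - K" using LD(6)[of y] by auto
    then show "z \<in> S" using z by auto
  qed
  then have c1: "card (C \<inter> K) \<le> card S" using LD(2) by (rule card_mono[rotated])
  define T where "T = layer ` (C - K)"
  have finT: "finite T" using finC by (simp add: T_def)
  have Tq: "card Q = q" "Q \<subseteq> V - K" if "Q \<in> T" for Q using that LD(6) CV by (auto simp: T_def)
  have ex: "\<exists>i<c. xs ! i \<in> Q \<and> xs ! (Suc i mod c) \<notin> Q" if Q: "Q \<in> T" for Q
  proof (rule ccontr)
    assume n: "\<not> ?thesis"
    obtain v where v: "v \<in> C - K" "Q = layer v" using Q by (auto simp: T_def)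
    obtain j where j: "j < c" "xs ! j = v" using v(1) xs(2) by (auto simp: C_def in_set_conv_nth)
    have jQ: "xs ! j \<in> Q" using j v(2) by (simp add: layer_def)
    have "xs ! i \<in> Q" if i: "i < c" for i
      by (rule cyclic_all[of "\<lambda>i. xs ! i \<in> Q" j c i, OF jQ j(1) _ i]) (use n in blast)
    then have "C \<subseteq> Q" using xs(2) by (auto simp: C_def in_set_conv_nth)
    then have "card C \<le> q" using Tq[OF Q] finV by (metis card_mono finite_Diff finite_subset)
    then show False using cC LD(5) kc by linarith
  qed
  \<comment> \<open>\<open>f Q\<close> selects one exit from \<open>Q\<close>. The vertex after it
    determines the exit and thereby the block, so there are at most \<open>|S|\<close> blocks on the
    cycle.\<close>
  define f where "f Q = (SOME i. i < c \<and> xs ! i \<in> Q \<and> xs ! (Suc i mod c) \<notin> Q)" for Q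
  have f: "f Q < c" "xs ! f Q \<in> Q" "xs ! (Suc (f Q) mod c) \<notin> Q" if "Q \<in> T" for Q
    using someI_ex[OF ex[OF that, unfolded Bex_def]] unfolding f_def by auto
  have clsT: "layer u = Q" if Q: "Q \<in> T" "u \<in> Q" for Q u
  proof -
    obtain v where v: "v \<in> C - K" "Q = layer v" using Q(1) by (auto simp: T_def)
    then show ?thesis using LD(7)[of v u] Q(2) CV by auto
  qed
  have "inj_on (\<lambda>Q. xs ! (Suc (f Q) mod c)) T"
  proof (rule inj_onI)
    fix Q Q' assume a: "Q \<in> T" "Q' \<in> T" "xs ! (Suc (f Q) mod c) = xs ! (Suc (f Q') mod c)"
    have "Suc (f Q) mod c < length xs" "Suc (f Q') mod c < length xs" using c0 xs(2) by simp_all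
    then have "Suc (f Q) mod c = Suc (f Q') mod c" using a(3) d by (simp add: nth_eq_iff_index_eq)
    then have "f Q = f Q'" using f(1)[OF a(1)] f(1)[OF a(2)] by (auto simp: mod_Suc split: if_splits)
    then show "Q = Q'" using f(2)[OF a(1)] f(2)[OF a(2)] clsT a(1,2) by metis
  qed
  moreover have "(\<lambda>Q. xs ! (Suc (f Q) mod c)) ` T \<subseteq> S"
  proof
    fix z assume "z \<in> (\<lambda>Q. xs ! (Suc (f Q) mod c)) ` T"
    then obtain Q where Q: "Q \<in> T" "z = xs ! (Suc (f Q) mod c)" by blast
    define u where "u = xs ! f Q"
    have u: "u \<in> Q" "u \<in> V - K" "layer u = Q" using f(2)[OF Q(1)] Tq[OF Q(1)] clsT[OF Q(1)] by (auto simp: u_def)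
    have "E u z" using stp[OF f(1)[OF Q(1)]] Q(2) by (simp add: u_def)
    then have "z \<in> (layer u - {u}) \<union> S" using LD(6)[OF u(2)] by (auto simp: nb_def)
    then show "z \<in> S" using f(3)[OF Q(1)] Q(2) u(3) by auto
  qed
  ultimately have cT: "card T \<le> card S" using LD(2) by (metis card_image card_mono)
  have "C - K \<subseteq> \<Union>T" by (auto simp: T_def layer_def)
  moreover have "finite (\<Union>T)" using finT Tq finV by (meson Union_least finite_Diff finite_subset)
  ultimately have "card (C - K) \<le> card (\<Union>T)" by (rule card_mono[rotated])
  also have "\<dots> \<le> (\<Sum>Q\<in>T. card Q)" by (rule card_Union_le_sum_card)
  also have "\<dots> = card T * q" using Tq by simp
  also have "\<dots> \<le> card S * q" using cT by simp
  finally have c2: "card (C - K) \<le> card S * q" .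
  have "c = card (C \<inter> K) + card (C - K)" using cC finC by (metis card_Int_Diff)
  also have "\<dots> \<le> card S + card S * q" using c1 c2 by simp
  also have "\<dots> = (q + 1) * card S" by simp
  finally show False using LD(3) kc by linarith
qed

end

section \<open>Isomorphisms with the explicit graphs\<close>

lemma ex_bij_nested:
  assumes "finite V" "K \<subseteq> V" "S \<subseteq> K"
  shows "\<exists>f::'a \<Rightarrow> nat. bij_betw f V {0..<card V} \<and> f ` S = {0..<card S} \<and> f ` K = {0..<card K}"
proof -
  have fin: "finite S" "finite (K - S)" "finite (V - K)" using assms finite_subset by (auto intro: finite_subset)
  obtain xs where xs: "set xs = S" "distinct xs" using finite_distinct_list[OF fin(1)] by blast
  obtain ys where ys: "set ys = K - S" "distinct ys" using finite_distinct_list[OF fin(2)] by blast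
  obtain zs where zs: "set zs = V - K" "distinct zs" using finite_distinct_list[OF fin(3)] by blast
  define ws where "ws = xs @ ys @ zs"
  have d: "distinct ws" "set ws = V" using xs ys zs assms by (auto simp: ws_def)
  have dxy: "distinct (xs @ ys)" "set (xs @ ys) = K" using xs ys assms by auto
  have l: "length ws = card V" "length xs = card S" "length (xs @ ys) = card K"
    using distinct_card[OF d(1)] distinct_card[OF xs(2)] distinct_card[OF dxy(1)] d(2) xs(1) dxy(2) by auto
  have b: "bij_betw ((!) ws) {..<card V} V" using bij_betw_nth[OF d(1)] d(2) l(1) by auto
  have i: "inj_on ((!) ws) {..<card V}" using b by (simp add: bij_betw_def)
  have img: "(!) ws ` {..<length us} = set us" if "ws = us @ vs" for us vs
    using that by (auto simp: nth_append in_set_conv_nth image_iff) 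
  have S: "(!) ws ` {..<card S} = S" using img[of xs "ys @ zs"] xs(1) l(2) by (simp add: ws_def)
  have K: "(!) ws ` {..<card K} = K" using img[of "xs @ ys" zs] dxy(2) l(3) by (simp add: ws_def)
  let ?f = "inv_into {..<card V} ((!) ws)"
  have "bij_betw ?f V {..<card V}" using bij_betw_inv_into[OF b] .
  moreover have le: "card S \<le> card V" "card K \<le> card V" using assms by (auto intro: card_mono order_trans)
  have "?f ` S = {..<card S}"
    using inv_into_image_cancel[OF i, of "{..<card S}"] S le(1) by auto
  moreover have "?f ` K = {..<card K}"
    using inv_into_image_cancel[OF i, of "{..<card K}"] K le(2) by auto
  ultimately show ?thesis by (intro exI[of _ ?f]) (simp add: atLeast0LessThan)
qed

lemma bij_image_mem:
  assumes "bij_betw f V X" "A \<subseteq> V" "f ` A = B" "v \<in> V"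
  shows "f v \<in> B \<longleftrightarrow> v \<in> A"
  using assms by (metis bij_betw_def image_eqI inj_on_image_mem_iff)

lemma mem_clique_edges: "{x, y} \<in> clique_edges S \<longleftrightarrow> x \<in> S \<and> y \<in> S \<and> x \<noteq> y"
  by (auto simp: clique_edges_def doubleton_eq_iff)

lemma embed_subgraph:
  fixes f :: "'a \<Rightarrow> nat"
  assumes G: "simple_graph G" and f: "bij_betw f (verts G) {0..<n}"
    and W: "verts W = {0..<n}" and e: "\<And>u v. adj G u v \<Longrightarrow> {f u, f v} \<in> edges W"
  shows "\<exists>H. subgraph H W \<and> graph_iso G H"
proof -
  define H where "H = Graph {0..<n} {{f u, f v} | u v. adj G u v}"
  interpret sgraph "verts G" "adj G" using sgraph_adj[OF G] .
  have inj: "inj_on f (verts G)" using f by (simp add: bij_betw_def)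
  have "subgraph H W"
    unfolding subgraph_def
  proof (intro conjI)
    show "simple_graph H" unfolding simple_graph_def
    proof (intro conjI ballI)
      show "finite (verts H)" by (simp add: H_def)
      fix x assume "x \<in> edges H"
      then obtain u v where uv: "x = {f u, f v}" "adj G u v" by (auto simp: H_def)
      have V: "u \<in> verts G" "v \<in> verts G" "u \<noteq> v" using uv(2) E_V E_V' E_irr by auto
      show "x \<subseteq> verts H" using uv(1) V f by (auto simp: H_def bij_betw_def)
      have "f u \<noteq> f v" using inj V by (auto simp: inj_on_def)
      then show "card x = 2" using uv(1) by simp
    qed
    show "verts H \<subseteq> verts W" "edges H \<subseteq> edges W" using W e by (auto simp: H_def)
  qed
  moreover have "graph_iso G H"
    unfolding graph_iso_def
  proof (intro exI[of _ f] conjI ballI)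
    show "bij_betw f (verts G) (verts H)" using f by (simp add: H_def)
    fix u v assume V: "u \<in> verts G" "v \<in> verts G"
    show "({u, v} \<in> edges G) = ({f u, f v} \<in> edges H)"
    proof
      assume "{u, v} \<in> edges G"
      then show "{f u, f v} \<in> edges H" by (auto simp: H_def adj_def)
    next
      assume "{f u, f v} \<in> edges H"
      then obtain u' v' where e: "{f u, f v} = {f u', f v'}" "adj G u' v'" by (auto simp: H_def)
      have V': "u' \<in> verts G" "v' \<in> verts G" using e(2) E_V E_V' by auto
      have "{u, v} = {u', v'}" using e(1) inj V V' by (auto simp: doubleton_eq_iff inj_on_eq_iff)
      then show "{u, v} \<in> edges G" using e(2) by (simp add: adj_def)
    qed
  qed
  ultimately show ?thesis by blast
qed

lemma W_edge_iff:
  assumes "k \<le> m" "m \<le> n" "m = c - k + 1" "x < n" "y < n"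
  shows "{x, y} \<in> edges (W_graph n k c) \<longleftrightarrow>
    x < m \<and> y < m \<and> x \<noteq> y \<or> x < k \<and> m \<le> y \<or> y < k \<and> m \<le> x"
  using assms by (auto simp: W_graph_def mem_clique_edges doubleton_eq_iff)

lemma graph_iso_W:
  assumes "finite V" "S \<subseteq> K" "K \<subseteq> V" "card S = k" "card K = c - k + 1" "verts G = V"
    "\<And>u v. u \<in> V \<Longrightarrow> v \<in> V \<Longrightarrow> {u, v} \<in> edges G \<longleftrightarrow>
      u \<in> K \<and> v \<in> K \<and> u \<noteq> v \<or> u \<in> S \<and> v \<notin> K \<or> v \<in> S \<and> u \<notin> K"
  shows "graph_iso G (W_graph (card V) k c)"
proof -
  obtain f :: "'a \<Rightarrow> nat" where f: "bij_betw f V {0..<card V}" "f ` S = {0..<card S}" "f ` K = {0..<card K}"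
    using ex_bij_nested[OF assms(1,3,2)] by blast
  have SV: "S \<subseteq> V" using assms(2,3) by blast
  have fS: "f v < k \<longleftrightarrow> v \<in> S" if "v \<in> V" for v using bij_image_mem[OF f(1) SV f(2) that] assms(4) by simp
  have fK: "f v < card K \<longleftrightarrow> v \<in> K" if "v \<in> V" for v using bij_image_mem[OF f(1) assms(3) f(3) that] by simp
  have fV: "f v < card V" if "v \<in> V" for v using f(1) that by (auto simp: bij_betw_def)
  have le: "k \<le> card K" "card K \<le> card V" using assms finite_subset card_mono by (metis, metis)
  show ?thesis
    unfolding graph_iso_def
  proof (intro exI[of _ f] conjI ballI)
    show "bij_betw f (verts G) (verts (W_graph (card V) k c))" using f(1) assms(6) by (simp add: W_graph_def)
    fix u v assume "u \<in> verts G" "v \<in> verts G"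
    then have uv: "u \<in> V" "v \<in> V" using assms(6) by auto
    have "f u \<noteq> f v \<longleftrightarrow> u \<noteq> v" using f(1) uv by (auto simp: bij_betw_def inj_on_def)
    then show "({u, v} \<in> edges G) = ({f u, f v} \<in> edges (W_graph (card V) k c))"
      using W_edge_iff[OF le assms(5) fV[OF uv(1)] fV[OF uv(2)]] assms(7)[OF uv] fS fK uv
      by (auto simp: not_less[symmetric])
  qed
qed

text \<open>Number \<open>K\<close> first, with \<open>S\<close> at 0 and 1, and then one block
  after another.\<close>

lemma graph_iso_Z:
  fixes V :: "'a set" and layer :: "'a \<Rightarrow> 'a set"
  assumes fin: "finite V" and S: "S \<subseteq> K" "card S = 2" and KV: "K \<subseteq> V" "card K = c - k + 1" and k: "2 \<le> k"
    and layer: "\<And>v. v \<in> V - K \<Longrightarrow> v \<in> layer v \<and> layer v \<subseteq> V - K \<and> card (layer v) = k - 1"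
    and cls_eq: "\<And>u v. v \<in> V - K \<Longrightarrow> u \<in> layer v \<Longrightarrow> layer u = layer v" and vG: "verts G = V"
    and edg: "\<And>u v. u \<in> V \<Longrightarrow> v \<in> V \<Longrightarrow> {u, v} \<in> edges G \<longleftrightarrow> u \<noteq> v \<and>
      (u \<in> K \<and> v \<in> K \<or> u \<in> S \<and> v \<notin> K \<or> v \<in> S \<and> u \<notin> K \<or> u \<notin> K \<and> v \<in> layer u)"
  shows "graph_iso G (Z_graph (card V) k c)"
proof -
  define R where "R = V - K"
  define T where "T = layer ` R"
  define l where "l = k - 1"
  define m where "m = card K"
  have l1: "1 \<le> l" using k by (simp add: l_def)
  have finR: "finite R" "finite T" using fin by (auto simp: R_def T_def)
  have finK: "finite K" using KV fin finite_subset by blast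
  have TQ: "finite Q" "card Q = l" "Q \<subseteq> R" if "Q \<in> T" for Q
  proof -
    show "Q \<subseteq> R" "card Q = l" using that layer by (auto simp: T_def R_def l_def)
    then show "finite Q" using finR finite_subset by blast
  qed
  have clsT: "layer v = Q" if "Q \<in> T" "v \<in> Q" for Q v
    using that cls_eq by (auto simp: T_def R_def)
  have clsR: "layer v \<in> T" "v \<in> layer v" if "v \<in> R" for v using that layer by (auto simp: T_def R_def)
  \<comment> \<open>The blocks partition \<open>V - K\<close>, so the division in
    \<open>Z_graph\<close> is exact.\<close>
  have "card R = card T * l"
  proof -
    have "\<Union>T = R" using TQ(3) clsR by blast
    moreover have "card (\<Union>T) = (\<Sum>Q\<in>T. card Q)"
    proof (rule card_Union_disjoint)
      show "pairwise disjnt T" unfolding pairwise_def disjnt_def using clsT by blast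
    qed (use TQ in blast)
    ultimately show ?thesis using TQ(2) by simp
  qed
  moreover have cV: "card V = m + card R"
  proof -
    have "V = K \<union> R" "K \<inter> R = {}" using KV by (auto simp: R_def)
    then show ?thesis using finK finR(1) by (simp add: m_def card_Un_disjoint)
  qed
  ultimately have tt: "(card V - m) div l = card T" using l1 by simp
  obtain \<psi> :: "'a \<Rightarrow> nat" where psi: "bij_betw \<psi> K {0..<card K}" "\<psi> ` S = {0..<2}"
    using ex_bij_nested[OF finK subset_refl S(1)] S(2) by auto
  obtain \<beta> :: "'a set \<Rightarrow> nat" where beta: "bij_betw \<beta> T {0..<card T}" using ex_bij_betw_finite_nat[OF finR(2)] by blast
  have "\<forall>Q\<in>T. \<exists>g. bij_betw g Q {0..<l}" using ex_bij_betw_finite_nat TQ(1,2) by metis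
  then obtain \<gamma> where gamma: "\<And>Q. Q \<in> T \<Longrightarrow> bij_betw (\<gamma> Q) Q {0..<l}" by metis
  \<comment> \<open>\<open>\<beta>\<close> orders the blocks and \<open>\<gamma>\<close> the
    vertices of a block; both are read off again by division with remainder by the block size
    \<open>l\<close>.\<close>
  define \<phi> where "\<phi> v = (if v \<in> K then \<psi> v else m + (\<beta> (layer v) * l + \<gamma> (layer v) v))" for v
  have phiK: "\<phi> v < m" if "v \<in> K" for v using that psi(1) by (auto simp: \<phi>_def m_def bij_betw_def)
  have gl: "\<gamma> (layer v) v < l" "\<beta> (layer v) < card T" if "v \<in> R" for v
    using gamma[OF clsR(1)[OF that]] clsR[OF that] beta by (auto simp: bij_betw_def)
  have phiR: "\<phi> v = m + (\<beta> (layer v) * l + \<gamma> (layer v) v)" if "v \<in> R" for v using that by (simp add: \<phi>_def R_def)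
  have blk: "\<phi> v \<in> {m + i * l..<m + (i + 1) * l} \<longleftrightarrow> \<beta> (layer v) = i" if v: "v \<in> R" for v i
  proof
    assume "\<beta> (layer v) = i"
    then show "\<phi> v \<in> {m + i * l..<m + (i + 1) * l}" using phiR[OF v] gl(1)[OF v] by simp
  next
    assume "\<phi> v \<in> {m + i * l..<m + (i + 1) * l}"
    then have "i * l \<le> \<beta> (layer v) * l + \<gamma> (layer v) v" "\<beta> (layer v) * l + \<gamma> (layer v) v < (i + 1) * l"
      using phiR[OF v] by auto
    then have "(\<beta> (layer v) * l + \<gamma> (layer v) v) div l = i"
      using l1 by (intro div_nat_eqI) (auto simp: mult.commute)
    then show "\<beta> (layer v) = i" using gl(1)[OF v] l1 by simp
  qed
  have VKR: "V = K \<union> R" "K \<inter> R = {}" using KV by (auto simp: R_def)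
  have imK: "\<phi> ` K = {0..<m}" using psi(1) by (auto simp: \<phi>_def m_def bij_betw_def)
  have imR: "\<phi> ` R = (\<Union>i<card T. {m + i * l..<m + (i + 1) * l})"
  proof (intro equalityI subsetI)
    fix z assume "z \<in> \<phi> ` R"
    then show "z \<in> (\<Union>i<card T. {m + i * l..<m + (i + 1) * l})" using blk gl(2) by (auto simp del: mult_Suc)
  next
    fix z assume "z \<in> (\<Union>i<card T. {m + i * l..<m + (i + 1) * l})"
    then obtain i where i: "i < card T" "m + i * l \<le> z" "z < m + (i + 1) * l" by auto
    then obtain j where j: "z = m + (i * l + j)" using le_Suc_ex by (metis add.assoc)
    have jl: "j < l" using i(3) j by simp
    obtain Q where Q: "Q \<in> T" "\<beta> Q = i" using beta i(1) by (metis atLeastLessThan_iff bij_betw_def imageE zero_le)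
    obtain v where v: "v \<in> Q" "\<gamma> Q v = j" using gamma[OF Q(1)] jl by (metis atLeastLessThan_iff bij_betw_def imageE zero_le)
    have "v \<in> R" "layer v = Q" using TQ(3)[OF Q(1)] clsT[OF Q(1)] v(1) by auto
    then have "\<phi> v = z" using phiR Q(2) v(2) j by simp
    then show "z \<in> \<phi> ` R" using \<open>v \<in> R\<close> by blast
  qed
  have inj: "inj_on \<phi> V"
  proof (rule inj_onI)
    fix u v assume uv: "u \<in> V" "v \<in> V" "\<phi> u = \<phi> v"
    have side: "w \<in> K \<longleftrightarrow> \<phi> w < m" if "w \<in> V" for w
      using that phiK[of w] by (cases "w \<in> K") (simp_all add: phiR R_def)
    show "u = v"
    proof (cases "u \<in> K")
      case True
      then have "v \<in> K" using side uv by metis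
      then show ?thesis using True uv(3) psi(1) by (auto simp: \<phi>_def bij_betw_def inj_on_def)
    next
      case False
      then have R: "u \<in> R" "v \<in> R" using side uv by (auto simp: R_def)
      have b: "\<beta> (layer u) = \<beta> (layer v)" using blk[OF R(1)] blk[OF R(2)] uv(3) by metis
      then have c: "layer u = layer v" using beta clsR(1) R by (auto simp: bij_betw_def inj_on_def)
      then have "\<gamma> (layer u) u = \<gamma> (layer u) v" using uv(3) phiR R b by simp
      moreover have "u \<in> layer u" "v \<in> layer u" using clsR(2) R c by auto
      ultimately show ?thesis using gamma[OF clsR(1)[OF R(1)]] by (auto simp: bij_betw_def inj_on_def)
    qed
  qed
  have ck: "c - k + 1 = m" using KV(2) by (simp add: m_def)
  have Zc: "Z_clique k c i = {0, 1} \<union> {m + i * l..<m + (i + 1) * l}" for i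
    by (simp only: Z_clique_def ck l_def)
  have m2: "2 \<le> m" using S finK card_mono by (metis m_def)
  have vZ: "verts (Z_graph (card V) k c) = {0..<m} \<union> (\<Union>i<card T. {m + i * l..<m + (i + 1) * l})"
  proof -
    have "verts (Z_graph (card V) k c) = {0..<m} \<union> (\<Union>i<(card V - m) div l. Z_clique k c i)"
      by (simp only: Z_graph_def Let_def ck l_def graph.sel)
    moreover have "{0, 1} \<subseteq> {0..<m}" using m2 by auto
    ultimately show ?thesis unfolding tt Zc by blast
  qed
  have eZ: "edges (Z_graph (card V) k c) = clique_edges {0..<m} \<union> (\<Union>i<card T. clique_edges (Z_clique k c i))"
    by (simp only: Z_graph_def Let_def ck graph.sel tt[unfolded l_def])
  have phiS: "\<phi> v \<in> {0, 1} \<longleftrightarrow> v \<in> S" if "v \<in> V" for v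
  proof (cases "v \<in> K")
    case True
    have "{0, 1} = {0..<2::nat}" by auto
    then show ?thesis using bij_image_mem[OF psi(1) S(1) psi(2) True] True by (simp add: \<phi>_def)
  next
    case False
    then show ?thesis using phiR[of v] that m2 S(1) by (auto simp: R_def)
  qed
  have phiQ: "\<phi> v \<in> Z_clique k c i \<longleftrightarrow> v \<in> S \<or> v \<in> R \<and> \<beta> (layer v) = i" if v: "v \<in> V" for v i
  proof (cases "v \<in> K")
    case True
    then have "\<phi> v < m" "v \<notin> R" using phiK by (auto simp: R_def)
    then show ?thesis using phiS[OF v] unfolding Zc by auto
  next
    case False
    then have "v \<in> R" using v by (simp add: R_def)
    then show ?thesis using phiS[OF v] blk[of v i] unfolding Zc by blast
  qed
  have phiKm: "\<phi> v < m \<longleftrightarrow> v \<in> K" if "v \<in> V" for v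
    using that phiK[of v] by (cases "v \<in> K") (simp_all add: phiR R_def)
  show ?thesis
    unfolding graph_iso_def
  proof (intro exI[of _ \<phi>] conjI ballI)
    show "bij_betw \<phi> (verts G) (verts (Z_graph (card V) k c))"
      unfolding bij_betw_def vG vZ using inj imK imR VKR(1) by (simp add: image_Un)
    fix u v assume "u \<in> verts G" "v \<in> verts G"
    then have uv: "u \<in> V" "v \<in> V" using vG by auto
    have ne: "\<phi> u \<noteq> \<phi> v \<longleftrightarrow> u \<noteq> v" using inj uv by (auto simp: inj_on_def)
    have "{\<phi> u, \<phi> v} \<in> edges (Z_graph (card V) k c) \<longleftrightarrow> u \<noteq> v \<and> (u \<in> K \<and> v \<in> K \<or>
      (\<exists>i<card T. (u \<in> S \<or> u \<in> R \<and> \<beta> (layer u) = i) \<and> (v \<in> S \<or> v \<in> R \<and> \<beta> (layer v) = i)))"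
      unfolding eZ using ne phiQ uv phiKm by (auto simp: mem_clique_edges)
    also have "\<dots> \<longleftrightarrow> u \<noteq> v \<and> (u \<in> K \<and> v \<in> K \<or> u \<in> S \<and> v \<notin> K \<or> v \<in> S \<and> u \<notin> K \<or> u \<notin> K \<and> v \<in> layer u)"
    proof -
      have 1: "(u \<in> R \<and> v \<in> R \<and> \<beta> (layer u) = \<beta> (layer v)) \<longleftrightarrow> u \<notin> K \<and> v \<in> layer u"
      proof
        assume a: "u \<in> R \<and> v \<in> R \<and> \<beta> (layer u) = \<beta> (layer v)"
        then have "layer u = layer v" using beta clsR(1) by (auto simp: bij_betw_def inj_on_def)
        then show "u \<notin> K \<and> v \<in> layer u" using a clsR(2)[of v] by (auto simp: R_def)
      next
        assume a: "u \<notin> K \<and> v \<in> layer u"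
        then have u: "u \<in> R" using uv by (simp add: R_def)
        then show "u \<in> R \<and> v \<in> R \<and> \<beta> (layer u) = \<beta> (layer v)"
          using a clsT[OF clsR(1)[OF u]] TQ(3)[OF clsR(1)[OF u]] by auto
      qed
      have 2: "w \<in> R \<longleftrightarrow> w \<notin> K" if "w \<in> V" for w using that by (auto simp: R_def)
      have 3: "(\<exists>i<card T. (u \<in> S \<or> u \<in> R \<and> \<beta> (layer u) = i) \<and> (v \<in> S \<or> v \<in> R \<and> \<beta> (layer v) = i)) \<longleftrightarrow>
        u \<in> S \<and> v \<in> S \<and> 0 < card T \<or> u \<in> S \<and> v \<in> R \<or> u \<in> R \<and> v \<in> S \<or> (u \<in> R \<and> v \<in> R \<and> \<beta> (layer u) = \<beta> (layer v))"
        using gl(2)[of u] gl(2)[of v] by (cases "u \<in> S"; cases "v \<in> S"; cases "u \<in> R"; cases "v \<in> R") auto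
      show ?thesis unfolding 3 1 using 2[OF uv(1)] 2[OF uv(2)] S(1) by blast
    qed
    also have "\<dots> \<longleftrightarrow> {u, v} \<in> edges G" using edg[OF uv] by simp
    finally show "({u, v} \<in> edges G) = ({\<phi> u, \<phi> v} \<in> edges (Z_graph (card V) k c))" by simp
  qed
qed

section \<open>The two cases\<close>

text \<open>Leads from relations back to the type \<open>graph\<close>, on which closures are
  defined.\<close>

definition rel_graph :: "'a set \<Rightarrow> ('a \<Rightarrow> 'a \<Rightarrow> bool) \<Rightarrow> 'a graph" where
  "rel_graph C F = Graph C {{u, v} | u v. u \<in> C \<and> v \<in> C \<and> F u v}"

lemma rel_graph:
  assumes "sgraph V F" "C \<subseteq> V"
  shows "simple_graph (rel_graph C F)" "verts (rel_graph C F) = C"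
    "adj (rel_graph C F) u v \<longleftrightarrow> u \<in> C \<and> v \<in> C \<and> F u v"
proof -
  interpret sgraph V F by fact
  have "finite C" using assms(2) finV finite_subset by blast
  moreover have "card {u, v} = 2" if "F u v" for u v using that E_irr by (cases "u = v") auto
  ultimately show "simple_graph (rel_graph C F)" by (auto simp: simple_graph_def rel_graph_def)
  show "verts (rel_graph C F) = C" by (simp add: rel_graph_def)
  show "adj (rel_graph C F) u v \<longleftrightarrow> u \<in> C \<and> v \<in> C \<and> F u v"
    using E_sym by (auto simp: adj_def rel_graph_def doubleton_eq_iff)
qed

lemma induced_facts:
  assumes "simple_graph G" "C \<subseteq> verts G"
  shows "simple_graph (induced G C)" "verts (induced G C) = C"
    "adj (induced G C) u v \<longleftrightarrow> u \<in> C \<and> v \<in> C \<and> adj G u v"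
  using assms by (auto simp: simple_graph_def induced_def adj_def intro: finite_subset)

lemma edges_mono_adj:
  assumes "simple_graph G" "\<And>u v. adj G u v \<Longrightarrow> adj H u v"
  shows "edges G \<subseteq> edges H"
  using simple_edge_cases[OF assms(1)] assms(2) by (fastforce simp: adj_def)

text \<open>In the extremal graph, \<open>h(c + 1, d)\<close> edges lie on \<open>c\<close>
  vertices, and each of the other \<open>n - c\<close> vertices adds \<open>d\<close>.\<close>

lemma f_num_h_num:
  assumes "1 \<le> d" "d \<le> c" "c < n"
  shows "f_num n d c = h_num (c + 1) d + d * (n - c)"
proof -
  have "n - c + d - 1 = (n - c) + (d - 1)" "c + 1 - d = c - d + 1" using assms by auto
  then have "f_num n d c = ((c + 1 - d) choose 2) + d * ((n - c) + (d - 1))" by (simp add: f_num_def)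
  also have "\<dots> = h_num (c + 1) d + d * (n - c)" unfolding h_num_def distrib_left by simp
  finally show ?thesis .
qed

lemma cycle_closure:
  assumes "simple_graph G" "gcyc (adj G) xs" "set xs = verts G" "length xs = c" "6 \<le> c" "is_m_closure (c + 1) G H"
  shows "simple_graph H" "verts H = verts G" "edges G \<subseteq> edges H" "closed_graph (verts G) (adj H) c (c div 2)"
    "gpath (adj H) P \<Longrightarrow> hd P \<in> verts G \<Longrightarrow> \<exists>P'. gpath (adj G) P' \<and> hd P' = hd P \<and> last P' = last P \<and> length P \<le> length P'"
proof -
  have st: "(closure_step (c + 1))\<^sup>*\<^sup>* G H" "\<nexists>H'. closure_step (c + 1) H H'" using assms(6) by (auto simp: is_m_closure_def)
  show H: "simple_graph H" "verts H = verts G" "edges G \<subseteq> edges H" using closure_steps_simple_graph[OF st(1) assms(1)] by auto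
  have cV: "card (verts G) = c" using assms(2-4) distinct_card[of xs] by (auto simp: gcyc_def gpath_def)
  then show "closed_graph (verts G) (adj H) c (c div 2)" using m_closed_closed_graph[OF H(1) st(2) _ assms(5)] H(2) by simp
  show "\<exists>P'. gpath (adj G) P' \<and> hd P' = hd P \<and> last P' = last P \<and> length P \<le> length P'"
    if "gpath (adj H) P" "hd P \<in> verts G"
    using closure_gpath[OF assms(1) st(1) cV that] .
qed

text \<open>The hypothesis on the core of \<open>F\<close> has to be turned into a bound on
  \<open>L\<close>, which lives in the closure of \<open>F[C]\<close>; then
  \<open>outer_structure\<close> applies.\<close>

lemma sparse_core_case:
  assumes mg: "maximal_graph V F c" and c: "6 \<le> c" "c < card V" and t: "t = c div 2"
    and sm: "card (sgraph.core V F t) + t \<le> c + 1"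
    and xs: "gcyc F xs" "length xs = c"
    and e: "h_num (c + 1) (t - 1) < card (edges (rel_graph (set xs) F))"
  shows "\<exists>A \<subseteq> set xs. card A = t \<and> (\<forall>v\<in>V - set xs. sgraph.nb F v \<subseteq> A) \<and>
    (c = 2 * t \<longrightarrow> (\<forall>u\<in>set xs - A. \<forall>v\<in>set xs - A. \<not> F u v)) \<and>
    (c = 2 * t + 1 \<longrightarrow> (\<exists>p\<in>set xs - A. \<exists>q\<in>set xs - A. p \<noteq> q \<and>
      (\<forall>u\<in>set xs - A. \<forall>v\<in>set xs - A. F u v \<longrightarrow> {u, v} = {p, q})))"
proof -
  interpret F: maximal_graph V F c by fact
  define C where "C = set xs"
  have dx: "distinct xs" using xs(1) by (simp add: gcyc_def gpath_def)
  have "hd xs \<in> V" using xs(1) F.E_V' by (auto simp: gcyc_def)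
  then have CV: "C \<subseteq> V" using F.gpath_set_V xs(1) by (auto simp: gcyc_def C_def)
  have cC: "card C = c" using dx xs(2) by (simp add: C_def distinct_card)
  have CVn: "C \<subset> V" using CV cC c(2) by auto
  define G where "G = rel_graph C F"
  note G = rel_graph[OF F.sgraph_axioms CV, folded G_def]
  obtain H where H: "is_m_closure (c + 1) G H" using ex_m_closure[OF G(1)] by blast
  have gG: "gcyc (adj G) xs"
  proof -
    have "successively (adj G) xs" using xs(1) unfolding gcyc_def gpath_def
      by (auto intro!: successively_mono[of F xs "adj G"] simp: G(3) C_def)
    moreover have "adj G (last xs) (hd xs)" using xs(1) unfolding gcyc_def gpath_def by (auto simp: G(3) C_def)
    ultimately show ?thesis using xs(1) by (auto simp: gcyc_def gpath_def)
  qed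
  have sxs: "set xs = verts G" using G(2) by (simp add: C_def)
  note cl = cycle_closure[OF G(1) gG sxs xs(2) c(1) H, unfolded G(2)]
  have hg: "closed_graph C (adj H) c t" using cl(4) t by simp
  have GH: "adj H u v" if "adj G u v" for u v using that cl(3) by (auto simp: adj_def)
  interpret O: outer V F C "adj H" c t
  proof -
    interpret h: closed_graph C "adj H" c t by (rule hg)
    show "outer V F C (adj H) c t"
    proof
      show "C \<subset> V" by (rule CVn)
      show "length ys \<le> c" if "gcyc F ys" for ys using F.circ[OF that] .
      show "\<exists>P'. gpath F P' \<and> set P' \<subseteq> C \<and> hd P' = hd P \<and> last P' = last P \<and> length P \<le> length P'"
        if P: "gpath (adj H) P" "hd P \<in> C" for P
      proof -
        obtain P' where P': "gpath (adj G) P'" "hd P' = hd P" "last P' = last P" "length P \<le> length P'"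
          using cl(5)[OF P] by blast
        interpret g: sgraph C "adj G" using sgraph_adj[OF G(1)] G(2) by simp
        have "set P' \<subseteq> C" using g.gpath_set_V[OF P'(1)] P'(2) P(2) by simp
        moreover have "gpath F P'" using P'(1) by (rule gpath_mono) (simp add: G(3))
        ultimately show ?thesis using P' by blast
      qed
      show "adj H u v" if "u \<in> C" "v \<in> C" "F u v" for u v using GH that by (simp add: G(3))
      have "gcyc (adj H) xs" using gG GH gpath_mono[of "adj G" xs "adj H"] by (auto simp: gcyc_def)
      then show "\<exists>ys. gcyc (adj H) ys \<and> set ys = C" by (auto simp: C_def)
    qed
  qed
  have eGH: "card (edges G) \<le> card (edges H)" using cl(3) simple_graph_finite_edges[OF cl(1)] by (rule card_mono[rotated])
  have eH: "card (edges H) = O.H.esz C" using card_edges_esz[OF cl(1)] cl(2) by simp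
  have He: "h_num (c + 1) (t - 1) < O.H.esz C" using e eGH eH by (simp add: G_def C_def)
  \<comment> \<open>For a large \<open>L\<close> the edges of \<open>F[C]\<close> rather than those
    of the closure are counted. Inside \<open>L\<close> they are few by degeneracy, since more than
    \<open>c + 1 - t\<close> vertices with inner degrees above \<open>t\<close> would lie in the
    core of \<open>F\<close>; outside \<open>L\<close>, \<open>low_deg\<close> bounds the
    degrees.\<close>
  have Ls: "card O.H.L + t \<le> c + 1"
  proof (rule ccontr)
    assume n: "\<not> ?thesis"
    then have n': "c + 2 \<le> card O.H.L + t" by simp
    define d where "d = c + 1 - card O.H.L"
    have "O.H.L \<noteq> C" using O.not_complete O.H.L_clique by blast
    then have "card O.H.L < c" using O.H.L_V O.H.finV cC by (metis psubsetI psubset_card_mono)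
    then have d: "2 \<le> d" "d + 1 \<le> t" "card O.H.L + d = c + 1" using n' by (auto simp: d_def)
    interpret g: sgraph C "adj G" using sgraph_adj[OF G(1)] G(2) by simp
    have eG: "card (edges G) = g.esz C" using card_edges_esz[OF G(1)] G(2) by simp
    have nbs: "g.nb v \<subseteq> O.H.nb v" for v using GH by (auto simp: g.nb_def O.H.nb_def)
    have "O.H.L \<union> (C - O.H.L) = C" using O.H.L_V by auto
    then have 1: "g.esz C \<le> g.esz O.H.L + (\<Sum>v\<in>C - O.H.L. card (g.nb v))"
      using g.esz_Un_le[of "C - O.H.L" O.H.L] O.H.finL O.H.finV by simp
    have "(\<Sum>v\<in>C - O.H.L. card (g.nb v)) \<le> (\<Sum>v\<in>C - O.H.L. d)"
    proof (rule sum_mono)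
      fix v assume v: "v \<in> C - O.H.L"
      have "card (g.nb v) \<le> card (O.H.nb v)" using nbs by (intro card_mono) auto
      then show "card (g.nb v) \<le> d" using O.H.low_deg[OF n' v] d(3) by linarith
    qed
    also have "\<dots> = (d - 1) * d"
    proof -
      have "card (C - O.H.L) = d - 1" using O.H.L_V O.H.finL cC d(3) by (simp add: card_Diff_subset)
      then show ?thesis by simp
    qed
    finally have 2: "(\<Sum>v\<in>C - O.H.L. card (g.nb v)) \<le> (d - 1) * d" .
    have 3: "g.esz O.H.L \<le> ((c + 1 - t) choose 2) + t * (card O.H.L - (c + 1 - t))"
    proof (rule g.esz_degenerate[OF O.H.finL])
      show "c + 1 - t \<le> card O.H.L" using n' by simp
      fix Y assume Y: "Y \<subseteq> O.H.L" "c + 1 - t < card Y"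
      show "\<exists>v\<in>Y. card (g.nb v \<inter> Y) \<le> t"
      proof (rule ccontr)
        assume n: "\<not> ?thesis"
        have YC: "Y \<subseteq> C" using Y(1) O.H.L_V by blast
        have "F.dense t Y" unfolding F.dense_def
        proof (intro conjI ballI)
          show "Y \<subseteq> V" using YC CV by blast
          fix v assume v: "v \<in> Y"
          then have "t < card (g.nb v \<inter> Y)" using n by auto
          also have "\<dots> \<le> card (F.nb v \<inter> Y)"
          proof (rule card_mono)
            show "finite (F.nb v \<inter> Y)" by simp
            show "g.nb v \<inter> Y \<subseteq> F.nb v \<inter> Y" by (auto simp: g.nb_def F.nb_def G(3))
          qed
          finally show "t < card (F.nb v \<inter> Y)" .
        qed
        then have "Y \<subseteq> F.core t" by (rule F.dense_le_core)
        moreover have "finite (F.core t)" using F.dense_core[of t] F.finV finite_subset by (auto simp: F.dense_def)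
        ultimately have "card Y \<le> card (F.core t)" by (metis card_mono)
        then show False using Y(2) sm by linarith
      qed
    qed
    have "card O.H.L - (c + 1 - t) = t - d" using d O.H.ct by linarith
    then have "card (edges G) \<le> ((c + 1 - t) choose 2) + t * (t - d) + d * (d - 1)"
      using 1 2 3 eG by (simp add: mult.commute)
    moreover have "c = 2 * t \<or> c = 2 * t + 1" using O.H.ct(1) .
    ultimately show False using size_contradiction[OF _ d(1,2)] e by (auto simp: G_def C_def)
  qed
  interpret S: outer_small V F C "adj H" c t
    by unfold_locales (use Ls He in auto)
  show ?thesis using S.outer_structure unfolding C_def by blast
qed

text \<open>\<open>A\<close> takes the first \<open>t\<close> places of the clique in
  \<open>W\<close>. The clique has \<open>c - t + 1\<close> vertices, so one place remains for even
  \<open>c\<close> and two for odd \<open>c\<close>; in the odd case these hold the ends of the one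
  possible edge outside \<open>A\<close>.\<close>

lemma sparse_core_embed:
  assumes G: "simple_graph G" and V: "card (verts G) = n" and F: "sgraph (verts G) F" "\<And>u v. adj G u v \<Longrightarrow> F u v"
    and C: "C \<subseteq> verts G" "card C = c" and t: "t = c div 2" "6 \<le> c"
    and A: "A \<subseteq> C" "card A = t" "\<forall>v\<in>verts G - C. sgraph.nb F v \<subseteq> A"
      "c = 2 * t \<longrightarrow> (\<forall>u\<in>C - A. \<forall>v\<in>C - A. \<not> F u v)"
      "c = 2 * t + 1 \<longrightarrow> (\<exists>p\<in>C - A. \<exists>q\<in>C - A. p \<noteq> q \<and> (\<forall>u\<in>C - A. \<forall>v\<in>C - A. F u v \<longrightarrow> {u, v} = {p, q}))"
  shows "\<exists>H. subgraph H (W_graph n t c) \<and> graph_iso G H"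
proof -
  interpret F: sgraph "verts G" F by fact
  have finC: "finite C" using C(1) F.finV finite_subset by blast
  have finA: "finite A" using A(1) finC finite_subset by blast
  have ct: "c = 2 * t \<or> c = 2 * t + 1" "3 \<le> t" using t by presburger+
  have "\<exists>X. X \<subseteq> C - A \<and> card X = c - t + 1 - t \<and> (\<forall>u\<in>C - A. \<forall>v\<in>C - A. F u v \<longrightarrow> u \<in> X \<and> v \<in> X)"
    using ct(1)
  proof
    assume c: "c = 2 * t"
    have "card (C - A) = t" using A(1,2) C(2) finA c by (simp add: card_Diff_subset)
    then have "C - A \<noteq> {}" using ct(2) by (metis card.empty not_numeral_le_zero)
    then obtain u where "u \<in> C - A" by blast
    then show ?thesis using A(4) c by (intro exI[of _ "{u}"]) auto
  next
    assume c: "c = 2 * t + 1"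
    then obtain p q where pq: "p \<in> C - A" "q \<in> C - A" "p \<noteq> q" "\<forall>u\<in>C - A. \<forall>v\<in>C - A. F u v \<longrightarrow> {u, v} = {p, q}"
      using A(5) by blast
    have "card {p, q} = c - t + 1 - t" using pq(3) c by simp
    moreover have "u \<in> {p, q} \<and> v \<in> {p, q}" if "u \<in> C - A" "v \<in> C - A" "F u v" for u v
      using pq(4) that by blast
    ultimately show ?thesis using pq(1,2) by (intro exI[of _ "{p, q}"]) auto
  qed
  then obtain X where X: "X \<subseteq> C - A" "card X = c - t + 1 - t" "\<And>u v. u \<in> C - A \<Longrightarrow> v \<in> C - A \<Longrightarrow> F u v \<Longrightarrow> u \<in> X \<and> v \<in> X"
    by blast
  define K where "K = A \<union> X"
  have KC: "K \<subseteq> verts G" "A \<subseteq> K" using X(1) A(1) C(1) by (auto simp: K_def)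
  have "finite X" "A \<inter> X = {}" using X(1) finC finite_subset by auto
  then have cK: "card K = c - t + 1" using X(2) A(2) finA ct(1) card_Un_disjoint[of A X] unfolding K_def by linarith
  obtain f :: "'a \<Rightarrow> nat" where f: "bij_betw f (verts G) {0..<n}" "f ` A = {0..<t}" "f ` K = {0..<card K}"
    using ex_bij_nested[OF F.finV KC] V A(2) by auto
  have AV: "A \<subseteq> verts G" using A(1) C(1) by blast
  have fA: "f v < t \<longleftrightarrow> v \<in> A" if "v \<in> verts G" for v using bij_image_mem[OF f(1) AV f(2) that] by simp
  have fK: "f v < card K \<longleftrightarrow> v \<in> K" if "v \<in> verts G" for v using bij_image_mem[OF f(1) KC(1) f(3) that] by simp
  have fV: "f v < n" if "v \<in> verts G" for v using f(1) that by (auto simp: bij_betw_def)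
  have le: "t \<le> card K" "card K \<le> n" using cK ct card_mono[OF F.finV KC(1)] V by linarith+
  show ?thesis
  proof (rule embed_subgraph[OF G f(1)])
    show "verts (W_graph n t c) = {0..<n}" by (simp add: W_graph_def)
    fix u v assume "adj G u v"
    then have uv: "F u v" "u \<in> verts G" "v \<in> verts G" "u \<noteq> v" using F(2) F.E_V F.E_V' F.E_irr by blast+
    have ne: "f u \<noteq> f v" using f(1) uv by (auto simp: bij_betw_def inj_on_def)
    have half: "y \<in> A" if "F x y" "x \<in> verts G" "x \<notin> K" for x y
    proof (cases "x \<in> C")
      case False
      then show ?thesis using A(3) that by (auto simp: F.nb_def)
    next
      case True
      show ?thesis
      proof (rule ccontr)
        assume yA: "y \<notin> A"
        have yV: "y \<in> verts G" using that(1) F.E_V' by blast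
        have xA: "x \<notin> A" using that(3) by (simp add: K_def)
        show False
        proof (cases "y \<in> C")
          case yC: True
          then show False using X(3)[of x y] that True xA yA by (auto simp: K_def)
        next
          case False
          then have "x \<in> A" using A(3) that(1) F.E_sym yV by (auto simp: F.nb_def)
          then show False using xA by simp
        qed
      qed
    qed
    have "u \<in> K \<and> v \<in> K \<or> u \<in> A \<and> v \<notin> K \<or> v \<in> A \<and> u \<notin> K"
      using half[OF uv(1,2)] half[OF F.E_sym[OF uv(1)] uv(3)] by blast
    then show "{f u, f v} \<in> edges (W_graph n t c)"
      using W_edge_iff[OF le cK fV[OF uv(2)] fV[OF uv(3)]] ne fA fK uv(2,3) by (auto simp: not_less[symmetric])
  qed
qed

text \<open>The closure stays inside \<open>F\<close> because \<open>F[C]\<close> admits no closure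
  step. Conversely, edges with an end off \<open>K\<close> are already in \<open>G\<close> because
  degrees there are tight, and \<open>K\<close> is a clique of the closure as soon as
  \<open>L = K\<close>.\<close>

lemma clique_core_closure:
  assumes clique_core: "clique_core V F c K k" and G: "simple_graph G" "verts G = V" and GF: "\<And>u v. adj G u v \<Longrightarrow> F u v"
    and dG: "\<And>v. v \<in> V \<Longrightarrow> k \<le> degree G v" and L: "clique_core.layered V F K k S q"
    and xs: "gcyc (adj G) xs" "length xs = c" and t: "t = c div 2"
    and e1: "\<And>d. k < d \<Longrightarrow> d < t \<Longrightarrow> f_num (card V) d c < card (edges G)"
    and e2: "h_num (c + 1) (t - 1) < card (edges (induced G (set xs)))" and cn: "c < card V"
  shows "{u, v} \<in> edges (C_closure G xs) \<longleftrightarrow> F u v"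
proof -
  interpret F: clique_core V F c K k by fact
  interpret E: sgraph V "adj G" using sgraph_adj[OF G(1)] G(2) by simp
  note LD = F.layeredD[OF L]
  have c6: "6 \<le> c" using F.kc F.k2 by linarith
  define C where "C = set xs"
  have dx: "distinct xs" using xs(1) by (simp add: gcyc_def gpath_def)
  have "hd xs \<in> V" using xs(1) E.E_V' by (auto simp: gcyc_def)
  then have CV: "C \<subseteq> V" using E.gpath_set_V xs(1) by (auto simp: gcyc_def C_def)
  have cC: "card C = c" using dx xs(2) by (simp add: C_def distinct_card)
  have finC: "finite C" by (simp add: C_def)
  have gF: "gcyc F xs" using xs(1) GF gpath_mono[of "adj G" xs F] by (auto simp: gcyc_def)
  have KC: "K \<subseteq> C" using F.K_on_cycle[OF L gF xs(2)] by (simp add: C_def)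
  have nbR: "E.nb v = F.nb v" if v: "v \<in> V - K" for v
  proof (rule card_subset_eq)
    show "E.nb v \<subseteq> F.nb v" using GF by (auto simp: E.nb_def F.nb_def)
    have "card (E.nb v) \<le> card (F.nb v)"
      by (rule card_mono[OF F.finite_nb]) (use GF in \<open>auto simp: E.nb_def F.nb_def\<close>)
    moreover have "k \<le> card (E.nb v)" using dG[of v] v degree_adj[OF G(1)] by simp
    ultimately show "card (E.nb v) = card (F.nb v)" using LD(6)[OF v] by linarith
  qed simp
  define GI where "GI = induced G C"
  note GI = induced_facts[OF G(1), of C, unfolded G(2), OF CV, folded GI_def]
  define H where "H = m_closure (c + 1) GI"
  have H: "is_m_closure (c + 1) GI H" unfolding H_def by (rule is_m_closure_m_closure[OF GI(1)])
  have gI: "gcyc (adj GI) xs"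
  proof -
    have "successively (adj GI) xs" using xs(1) unfolding gcyc_def gpath_def
      by (auto intro!: successively_mono[of "adj G" xs "adj GI"] simp: GI(3) C_def)
    moreover have "adj GI (last xs) (hd xs)" using xs(1) unfolding gcyc_def gpath_def by (auto simp: GI(3) C_def)
    ultimately show ?thesis using xs(1) by (auto simp: gcyc_def gpath_def)
  qed
  have sxs: "set xs = verts GI" using GI(2) by (simp add: C_def)
  note cl = cycle_closure[OF GI(1) gI sxs xs(2) c6 H, unfolded GI(2)]
  interpret h: closed_graph C "adj H" c t using cl(4) t by simp
  define FC where "FC = rel_graph C F"
  note FC = rel_graph[OF F.sgraph_axioms CV, folded FC_def]
  interpret fc: sgraph C "adj FC" using sgraph_adj[OF FC(1)] FC(2) by simp
  have fcnb: "fc.nb v = F.nb v \<inter> C" if "v \<in> C" for v using that FC(3) by (auto simp: fc.nb_def F.nb_def)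
  have fcR: "card (fc.nb v) \<le> k" if v: "v \<in> C - K" for v
  proof -
    have "card (fc.nb v) \<le> card (F.nb v)" using fcnb v by (intro card_mono) auto
    then show ?thesis using LD(6)[of v] v CV by auto
  qed
  have fcK: "card (fc.nb v) + k \<le> c" if v: "v \<in> K" "v \<notin> S" for v
  proof -
    have "fc.nb v \<subseteq> K - {v}"
    proof
      fix w assume w: "w \<in> fc.nb v"
      then have vw: "F v w" "w \<in> C" using FC(3) by (auto simp: fc.nb_def)
      have "w \<in> K"
      proof (rule ccontr)
        assume "w \<notin> K"
        then have wR: "w \<in> V - K" using vw CV by blast
        have "v \<in> F.nb w" using vw F.E_sym by (simp add: F.nb_def)
        then have "v \<in> (F.layer w - {w}) \<union> S" "F.layer w \<subseteq> V - K" using LD(6)[OF wR] by auto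
        then show False using v by auto
      qed
      then show "w \<in> K - {v}" using vw F.E_irr by auto
    qed
    then have "card (fc.nb v) \<le> card (K - {v})" using F.finK by (intro card_mono) auto
    moreover have "card (K - {v}) + 1 = card K" using v(1) F.finK by (metis Suc_eq_plus1 card_Suc_Diff1)
    ultimately show ?thesis using F.cK by linarith
  qed
  \<comment> \<open>A nonadjacent pair of \<open>F[C]\<close> contains a vertex off
    \<open>K\<close>, of degree at most \<open>k\<close>. The other vertex is off \<open>K\<close>
    as well, or lies in \<open>K - S\<close> and has degree at most \<open>c - k\<close>.\<close>
  have noFC: "\<nexists>K'. closure_step (c + 1) FC K'"
  proof
    assume "\<exists>K'. closure_step (c + 1) FC K'"
    then obtain u v where uv: "u \<in> C" "v \<in> C" "u \<noteq> v" "\<not> F u v" "c + 1 \<le> card (fc.nb u) + card (fc.nb v)"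
      unfolding closure_step_def using FC degree_adj[OF FC(1)] by (auto simp: adj_def)
    have key: "card (fc.nb p) + card (fc.nb r) \<le> c" if p: "p \<in> C - K" "r \<in> C" "\<not> F p r" for p r
    proof (cases "r \<in> K")
      case True
      have "r \<notin> S" using LD(6)[of p] p CV by (auto simp: F.nb_def)
      then show ?thesis using fcK[OF True] fcR[OF p(1)] by linarith
    next
      case False
      then show ?thesis using fcR[of p] fcR[of r] p F.kc by fastforce
    qed
    have "u \<notin> K \<or> v \<notin> K" using F.cl uv by blast
    then have "card (fc.nb u) + card (fc.nb v) \<le> c"
      using key[of u v] key[of v u] uv F.E_sym by (auto simp: add.commute)
    then show False using uv(5) by simp
  qed
  have "edges GI \<subseteq> edges FC" by (rule edges_mono_adj[OF GI(1)]) (use GI(3) FC(3) GF in auto)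
  then have HFC: "edges H \<subseteq> edges FC"
    using closure_mono[OF _ GI(1) FC(1) _ _ noFC] H GI(2) FC(2) by (auto simp: is_m_closure_def)
  have HF: "F u v" if "adj H u v" for u v using that HFC FC(3)[of u v] by (auto simp: adj_def)
  have hle: "card (h.nb v) \<le> card (fc.nb v)" for v
    by (rule card_mono[OF fc.finite_nb]) (use HFC in \<open>auto simp: h.nb_def fc.nb_def adj_def\<close>)
  have kt: "k + 2 \<le> t" using F.kc t by linarith
  have LK: "h.L \<subseteq> K"
  proof
    fix v assume v: "v \<in> h.L"
    show "v \<in> K"
    proof (rule ccontr)
      assume "v \<notin> K"
      then have "v \<in> C - K" using v h.L_V by blast
      then have "card (h.nb v) \<le> k" using fcR hle le_trans by blast
      then show False using v kt by (auto simp: h.L_def)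
    qed
  qed
  have eI: "card (edges GI) \<le> h.esz C"
  proof -
    have "card (edges GI) \<le> card (edges H)" using cl(3) simple_graph_finite_edges[OF cl(1)] by (rule card_mono[rotated])
    then show ?thesis using card_edges_esz[OF cl(1)] cl(2) by simp
  qed
  have cLK: "card h.L \<le> card K" using LK F.finK by (rule card_mono[rotated])
  \<comment> \<open>If \<open>L\<close> is large but not \<open>K\<close>, then
    \<open>e(G) \<le> f(n,d,c)\<close> for some \<open>d\<close> with \<open>k < d < t\<close>,
    against the bound on \<open>e(G)\<close>. If \<open>L\<close> is small, too few edges are left
    for \<open>G[V(C)]\<close>.\<close>
  have KL: "h.L = K"
  proof (cases "c + 2 \<le> card h.L + t")
    case True
    show ?thesis
    proof (rule ccontr)
      assume n: "h.L \<noteq> K"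
      then have lt: "card h.L < card K" using LK F.finK by (metis psubsetI psubset_card_mono)
      define d where "d = c + 1 - card h.L"
      have d: "k < d" "d < t" "d \<le> c" using lt True F.cK t c6 unfolding d_def by linarith+
      have "card (edges G) = E.esz V" using card_edges_esz[OF G(1)] G(2) by simp
      also have "\<dots> \<le> E.esz C + (\<Sum>v\<in>V - C. card (E.nb v))"
      proof -
        have "C \<union> (V - C) = V" using CV by blast
        then show ?thesis using E.esz_Un_le[of "V - C" C] E.finV finC by simp
      qed
      also have "E.esz C = card (edges GI)"
      proof -
        interpret gi: sgraph C "adj GI" using sgraph_adj[OF GI(1)] GI(2) by simp
        have "E.esz C = gi.esz C" unfolding E.esz_def gi.esz_def
          by (rule arg_cong[of _ _ card]) (use GI(3) in auto)
        then show ?thesis using card_edges_esz[OF GI(1)] GI(2) by simp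
      qed
      also have "(\<Sum>v\<in>V - C. card (E.nb v)) = (\<Sum>v\<in>V - C. k)"
      proof (rule sum.cong)
        fix v assume "v \<in> V - C"
        then have v: "v \<in> V - K" using KC by blast
        show "card (E.nb v) = k" unfolding nbR[OF v] using LD(6)[OF v] by blast
      qed simp
      also have "\<dots> = k * (card V - c)" using CV cC finC by (simp add: card_Diff_subset)
      also have "card (edges GI) \<le> h_num (c + 1) d" using eI h.esz_big[OF True] by (simp add: d_def)
      also have "k * (card V - c) \<le> d * (card V - c)" using d(1) by simp
      finally have "card (edges G) \<le> f_num (card V) d c" using f_num_h_num[of d c "card V"] d cn by simp
      then show False using e1[OF d(1,2)] by simp
    qed
  next
    case False
    then have "card h.L \<le> c + 1 - t" by simp
    moreover have "c + 1 - t \<le> card K" using F.cK kt by linarith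
    ultimately obtain L' where L': "h.L \<subseteq> L'" "L' \<subseteq> K" "card L' = c + 1 - t"
      using exists_subset_between[OF _ _ LK F.finK] by blast
    have "h.esz C \<le> (card L' choose 2) + (\<Sum>v\<in>C - L'. card (h.nb v))"
      using L'(2) KC by (intro h.esz_le_sum) auto
    also have "(\<Sum>v\<in>C - L'. card (h.nb v)) = (\<Sum>v\<in>K - L'. card (h.nb v)) + (\<Sum>v\<in>C - K. card (h.nb v))"
    proof -
      have "C - L' = (K - L') \<union> (C - K)" using L'(2) KC by auto
      then show ?thesis using F.finK finC sum.union_disjoint[of "K - L'" "C - K"] by fastforce
    qed
    also have "(\<Sum>v\<in>K - L'. card (h.nb v)) \<le> (\<Sum>v\<in>K - L'. t)"
    proof (rule sum_mono)
      fix v assume "v \<in> K - L'"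
      then show "card (h.nb v) \<le> t" using L'(1) KC by (auto simp: h.L_def)
    qed
    also have "(\<Sum>v\<in>K - L'. t) = (t - k) * t"
    proof -
      have "card (K - L') = card K - (c + 1 - t)" using L'(2,3) F.finK by (simp add: card_Diff_subset finite_subset)
      moreover have "card K - (c + 1 - t) = t - k" using F.cK kt t by linarith
      ultimately show ?thesis by simp
    qed
    also have "(\<Sum>v\<in>C - K. card (h.nb v)) \<le> (\<Sum>v\<in>C - K. k)" using fcR hle by (intro sum_mono) (meson le_trans)
    also have "(\<Sum>v\<in>C - K. k) = (k - 1) * k"
    proof -
      have "card (C - K) = k - 1" using KC F.finK cC F.cK by (simp add: card_Diff_subset)
      then show ?thesis by simp
    qed
    finally have "card (edges GI) \<le> ((c + 1 - t) choose 2) + t * (t - k) + k * (k - 1)"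
      using eI L'(3) by (simp add: mult.commute)
    moreover have "h_num (c + 1) (t - 1) < card (edges GI)" using e2 by (simp add: GI_def C_def)
    moreover have "k + 1 \<le> t" using kt by simp
    ultimately show ?thesis using size_contradiction[OF h.ct(1) F.k2] by blast
  qed
  have "edges (C_closure G xs) = (edges G - edges GI) \<union> edges H"
    by (simp add: C_closure_def H_def GI_def C_def xs(2))
  then have iff: "{u, v} \<in> edges (C_closure G xs) \<longleftrightarrow> adj G u v \<and> \<not> (u \<in> C \<and> v \<in> C) \<or> adj H u v"
    using GI(3)[of u v] by (auto simp: adj_def)
  show ?thesis
  proof
    assume "{u, v} \<in> edges (C_closure G xs)"
    then show "F u v" using iff GF HF by blast
  next
    assume uv: "F u v"
    have V: "u \<in> V" "v \<in> V" "u \<noteq> v" using uv F.E_V F.E_V' F.E_irr by blast+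
    show "{u, v} \<in> edges (C_closure G xs)"
    proof (cases "u \<in> K \<and> v \<in> K")
      case True
      then have "adj H u v" using h.L_clique KL V(3) by blast
      then show ?thesis using iff by blast
    next
      case False
      have "adj G u v"
      proof (cases "u \<in> K")
        case True
        then have "v \<in> V - K" using False V by blast
        then have "u \<in> E.nb v" using nbR uv F.E_sym by (auto simp: F.nb_def)
        then show ?thesis using E.E_sym by (simp add: E.nb_def)
      next
        case False
        then have "v \<in> E.nb u" using nbR[of u] V uv by (auto simp: F.nb_def)
        then show ?thesis by (simp add: E.nb_def)
      qed
      moreover have "adj H u v" if "u \<in> C \<and> v \<in> C"
      proof -
        have "adj GI u v" using calculation that GI(3) by blast
        then show ?thesis using cl(3) by (auto simp: adj_def)
      qed
      ultimately show ?thesis using iff by blast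
    qed
  qed
qed

theorem theorem1p12:
  fixes G :: "'a graph" and C :: "'a list" and n k c :: nat
  assumes "simple_graph G" and "two_connected G" and "card (verts G) = n"
    and "min_degree G \<ge> k"
    and "longest_cycle G C" and "length C = c" and "c \<in> {6..n - 1}"
    and "card (edges G) > max (f_num n (k + 1) c) (f_num n (c div 2 - 1) c)"
    and "card (edges (induced G (set C))) > h_num (c + 1) (c div 2 - 1)"
  shows "(\<exists>H. subgraph H (W_graph n (c div 2) c) \<and> graph_iso G H) \<or>
    graph_iso (C_closure G C) (W_graph n k c) \<or> graph_iso (C_closure G C) (Z_graph n k c)"
proof -
  define V where "V = verts G"
  define t where "t = c div 2"
  have c: "6 \<le> c" "c < card V" using assms(3,7) by (auto simp: V_def)
  have ct: "c = 2 * t \<or> c = 2 * t + 1" "3 \<le> t" using c(1) unfolding t_def by presburger+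
  interpret E: two_conn_graph V "adj G" using two_conn_graph_adj[OF assms(1,2)] by (simp add: V_def)
  have cyc: "gcyc (adj G) C" "\<And>ys. gcyc (adj G) ys \<Longrightarrow> length ys \<le> c"
    using assms(5,6) is_cycle_gcyc[OF assms(1)] by (auto simp: longest_cycle_def)
  obtain F where F: "sgraph V F" "\<And>u v. adj G u v \<Longrightarrow> F u v" "circ_maximal V F c"
    using ex_circ_maximal[OF E.sgraph_axioms cyc(2)] by blast
  have tF: "two_conn_graph V F" using two_conn_graph_mono[OF E.two_conn_graph_axioms F(1,2)] .
  interpret F: maximal_graph V F c
  proof -
    interpret two_conn_graph V F by (rule tF)
    show "maximal_graph V F c" by unfold_locales (use F(3) c in \<open>auto simp: circ_maximal_def\<close>)
  qed
  have gF: "gcyc F C" using cyc(1) F(2) gpath_mono[of "adj G" C F] by (auto simp: gcyc_def)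
  have dG: "k \<le> degree G v" if "v \<in> V" for v
  proof -
    have "min_degree G \<le> degree G v" unfolding min_degree_def using that E.finV by (intro Min_le) (auto simp: V_def)
    then show ?thesis using assms(4) by simp
  qed
  have dF: "k \<le> card (F.nb v)" if "v \<in> V" for v
  proof -
    have "card (E.nb v) \<le> card (F.nb v)" 
      by (rule card_mono[OF F.finite_nb]) (use F(2) in \<open>auto simp: E.nb_def F.nb_def\<close>)
    then show ?thesis using dG[OF that] degree_adj[OF assms(1)] by simp
  qed
  have eG: "card (edges G) \<le> F.esz V"
  proof -
    have "card (edges G) = E.esz V" using card_edges_esz[OF assms(1)] by (simp add: V_def)
    also have "\<dots> \<le> F.esz V" unfolding E.esz_def F.esz_def
    proof (rule card_mono)
      show "finite {e. \<exists>u v. e = {u, v} \<and> u \<in> V \<and> v \<in> V \<and> F u v}"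
        by (rule finite_subset[of _ "Pow V"]) (use F.finV in auto)
    qed (use F(2) in auto)
    finally show ?thesis .
  qed
  \<comment> \<open>At \<open>d = k + 1\<close> and \<open>d = t - 1\<close> this is the hypothesis
    on \<open>e(G)\<close>; convexity covers the values between.\<close>
  have e1: "f_num n d c < card (edges G)" if "k < d" "d < t" for d
  proof -
    have "f_num n d c \<le> max (f_num n (k + 1) c) (f_num n (t - 1) c)"
      using that ct c assms(3) by (intro f_num_convex) (auto simp: V_def)
    also have "\<dots> < card (edges G)" using assms(8) by (simp add: t_def)
    finally show ?thesis .
  qed
  have et: "f_num n (t - 1) c < card (edges G)" using assms(8) by (simp add: t_def)
  have CV: "set C \<subseteq> V"
  proof -
    have "hd C \<in> V" using gF F.E_V' by (auto simp: gcyc_def)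
    then show ?thesis using F.gpath_set_V gF by (auto simp: gcyc_def)
  qed
  show ?thesis
  proof (cases "card (F.core t) + t \<le> c + 1")
    case True
    have "card (edges (induced G (set C))) \<le> card (edges (rel_graph (set C) F))"
    proof (rule card_mono)
      show "finite (edges (rel_graph (set C) F))"
        using simple_graph_finite_edges[OF rel_graph(1)[OF F.sgraph_axioms CV]] .
      note I = induced_facts[OF assms(1), of "set C", folded V_def, OF CV]
      show "edges (induced G (set C)) \<subseteq> edges (rel_graph (set C) F)"
        by (rule edges_mono_adj[OF I(1)]) (use I(3) rel_graph(3)[OF F.sgraph_axioms CV] F(2) in auto)
    qed
    then have "h_num (c + 1) (t - 1) < card (edges (rel_graph (set C) F))" using assms(9) by (simp add: t_def)
    from sparse_core_case[OF F.maximal_graph_axioms c t_def True gF assms(6) this]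
    obtain A where A: "A \<subseteq> set C" "card A = t" "\<forall>v\<in>V - set C. sgraph.nb F v \<subseteq> A"
      "c = 2 * t \<longrightarrow> (\<forall>u\<in>set C - A. \<forall>v\<in>set C - A. \<not> F u v)"
      "c = 2 * t + 1 \<longrightarrow> (\<exists>p\<in>set C - A. \<exists>q\<in>set C - A. p \<noteq> q \<and>
        (\<forall>u\<in>set C - A. \<forall>v\<in>set C - A. F u v \<longrightarrow> {u, v} = {p, q}))" by blast
    have cC: "card (set C) = c" using gF assms(6) by (simp add: gcyc_def gpath_def distinct_card)
    show ?thesis
      using sparse_core_embed[OF assms(1,3) _ F(2) _ cC t_def c(1) A(1,2) _ A(4,5)] F(1) CV A(3)
      unfolding V_def t_def by blast
  next
    case False
    define K where "K = F.core t"
    define d where "d = c + 1 - card K"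
    have c2t: "c \<le> 2 * t + 1" using ct by linarith
    have Kne: "F.core t \<noteq> {}"
    proof
      assume e: "F.core t = {}"
      have "card (F.core t) = 0" unfolding e by simp
      then show False using False ct by linarith
    qed
    have KV: "K \<subseteq> V" using F.dense_core[of t] by (auto simp: F.dense_def K_def)
    have cl: "F u v" if "u \<in> K" "v \<in> K" "u \<noteq> v" for u v using F.core_clique[OF c2t] that by (auto simp: K_def)
    have cK: "card K \<le> c" using F.clique_card_le[OF cl KV] .
    have d: "d < t" "card K + d = c + 1" using False cK by (auto simp: d_def K_def)
    have dens: "X \<subseteq> K" if "F.dense d X" for X
      using F.dense_le_clique_core[OF c2t Kne _ that] by (simp add: d_def K_def)
    \<comment> \<open>Sets with all inner degrees above \<open>d\<close> lie in \<open>K\<close>, so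
      every set of more than \<open>|K|\<close> vertices has a vertex to delete.\<close>
    have "F.esz V \<le> (card K choose 2) + d * (card V - card K)"
    proof (rule F.esz_degenerate[OF F.finV])
      show "card K \<le> card V" using KV F.finV by (rule card_mono[rotated])
      fix Y assume Y: "Y \<subseteq> V" "card K < card Y"
      show "\<exists>v\<in>Y. card (F.nb v \<inter> Y) \<le> d"
      proof (rule ccontr)
        assume "\<not> ?thesis"
        then have "F.dense d Y" using Y(1) by (auto simp: F.dense_def not_le)
        then have "card Y \<le> card K" using dens F.finV KV by (meson card_mono finite_subset)
        then show False using Y(2) by simp
      qed
    qed
    moreover have "(card K choose 2) + d * (card V - card K) = f_num n d c"
    proof -
      have "c - d + 1 = card K" "n - c + d - 1 = card V - card K" using d ct cK c(2) assms(3) unfolding V_def by linarith+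
      then show ?thesis by (simp add: f_num_def)
    qed
    ultimately have ef: "card (edges G) \<le> f_num n d c" using eG by simp
    have "\<not> k < d" using e1[OF _ d(1)] ef by fastforce
    \<comment> \<open>Otherwise \<open>V\<close> itself would be dense and contained in
      \<open>K\<close>, although \<open>|K| \<le> c < n\<close>.\<close>
    moreover have ddeg: "\<exists>v\<in>V. card (F.nb v) \<le> d"
    proof (rule ccontr)
      assume "\<not> ?thesis"
      then have "F.dense d V" by (auto simp: F.dense_def F.nb_V not_le)
      then have "K = V" using dens KV by blast
      then have "card V \<le> card K" by simp
      then show False using cK c(2) by simp
    qed
    then have "k \<le> d" using dF le_trans by blast
    ultimately have dk: "d = k" by simp
    have k2: "2 \<le> k" using ddeg two_conn_graph_degree_ge_2[OF tF] dk le_trans by blast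
    \<comment> \<open>The value \<open>t - 1\<close> is bounded by a hypothesis of its own, so it is
      also excluded when \<open>d = k = t - 1\<close>, which \<open>e1\<close> leaves open.\<close>
    have "k \<noteq> t - 1" using et ef dk by auto
    then have kt: "k + 2 \<le> t" using d(1) dk by linarith
    have clqF: "clique_core V F c K k"
    proof
      show "card K + k = c + 1" using d(2) dk by simp
      show "2 * k + 4 \<le> c" using kt ct by linarith
      show "\<exists>y\<in>K. \<not> F v y" if "v \<in> V - K" for v
        using F.core_not_joined[OF c2t Kne] that by (simp add: K_def)
    qed (use KV cl k2 dF in auto)
    interpret Q: clique_core V F c K k by (rule clqF)
    have iff: "{u, v} \<in> edges (C_closure G C) \<longleftrightarrow> F u v" if "Q.layered S q" for S q u v
      by (rule clique_core_closure[OF clqF assms(1) _ F(2) dG that cyc(1) assms(6) t_def])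
        (use e1 assms(3,9) c in \<open>auto simp: V_def t_def\<close>)
    have vC: "verts (C_closure G C) = V" by (simp add: C_closure_def V_def)
    have ck: "card K = c - k + 1" using d dk ct by linarith
    have nV: "card V = n" using assms(3) by (simp add: V_def)
    consider S where "Q.layered S 1" "card S = k" | S where "Q.layered S (k - 1)" "card S = 2"
      using Q.ex_layered by blast
    then show ?thesis
    proof cases
      case 1
      note LD = Q.layeredD[OF 1(1)]
      have one: "Q.layer v = {v}" if "v \<in> V - K" for v
      proof -
        have "card (Q.layer v) = 1" using LD(6)[OF that] by simp
        then show ?thesis by (metis card_1_singletonE insertI1 Q.layer_def singletonD)
      qed
      have nbS: "F.nb v = S" if "v \<in> V - K" for v using LD(6)[OF that] one[OF that] by simp
      have "graph_iso (C_closure G C) (W_graph (card V) k c)"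
      proof (rule graph_iso_W[OF F.finV LD(1) KV 1(2) ck vC])
        fix u v assume uv: "u \<in> V" "v \<in> V"
        have R: "F x y \<longleftrightarrow> y \<in> S" if "x \<in> V" "x \<notin> K" for x y using nbS[of x] that by (auto simp: F.nb_def)
        show "({u, v} \<in> edges (C_closure G C)) = (u \<in> K \<and> v \<in> K \<and> u \<noteq> v \<or> u \<in> S \<and> v \<notin> K \<or> v \<in> S \<and> u \<notin> K)"
        proof (cases "u \<in> K \<and> v \<in> K")
          case True
          then show ?thesis using iff[OF 1(1)] cl F.E_irr by auto
        next
          case False
          then show ?thesis using iff[OF 1(1)] R[OF uv(1), of v] R[OF uv(2), of u] F.E_sym LD(1) by blast
        qed
      qed
      then show ?thesis using nV by simp
    next
      case 2
      note LD = Q.layeredD[OF 2(1)]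
      have "graph_iso (C_closure G C) (Z_graph (card V) k c)"
      proof (rule graph_iso_Z[OF F.finV LD(1) 2(2) KV ck k2 _ LD(7) vC])
        show "v \<in> Q.layer v \<and> Q.layer v \<subseteq> V - K \<and> card (Q.layer v) = k - 1" if "v \<in> V - K" for v
          using LD(6)[OF that] by (simp add: Q.layer_def)
        fix u v assume uv: "u \<in> V" "v \<in> V"
        have R: "F x y \<longleftrightarrow> y \<in> Q.layer x - {x} \<or> y \<in> S" if "x \<in> V" "x \<notin> K" for x y
          using LD(6)[of x] that by (auto simp: F.nb_def)
        show "({u, v} \<in> edges (C_closure G C)) = (u \<noteq> v \<and>
          (u \<in> K \<and> v \<in> K \<or> u \<in> S \<and> v \<notin> K \<or> v \<in> S \<and> u \<notin> K \<or> u \<notin> K \<and> v \<in> Q.layer u))"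
        proof (cases "u \<in> K \<and> v \<in> K")
          case True
          then show ?thesis using iff[OF 2(1)] cl F.E_irr by auto
        next
          case False
          have "F u v \<longrightarrow> u \<noteq> v" using F.E_irr by auto
          moreover have "Q.layer u \<subseteq> V - K" if "u \<notin> K" using LD(6)[of u] that uv by blast
          moreover have "Q.layer v \<subseteq> V - K" if "v \<notin> K" using LD(6)[of v] that uv by blast
          moreover have "F u v \<longleftrightarrow> F v u" using F.E_sym by blast
          ultimately show ?thesis
            using False iff[OF 2(1)] R[OF uv(1), of v] R[OF uv(2), of u] LD(1) by blast
        qed
      qed
      then show ?thesis using nV by simp
    qed
  qed
qed

end
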